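(* Let $F:\mathbb{R}^d\times\mathbb{R}^d\to\mathbb{R}^d$ be continuous and satisfy the hypotheses $(\mathbf{H_1})$ and $(\mathbf{H_2})$ stated in the context, and let $(\Delta_n)_{n\in\mathbb{Z}}$ be the Gaussian noise with coefficients $(a_k)_{k\ge 0}$, with associated sequence $(b_k)_{k\ge0}$, described in the context. Consider the dynamics $X_{n+1}=F(X_n,\Delta_{n+1})$, $n\ge 0$. Then: (i) There exists an invariant distribution $\mu_\star$ associated to these dynamics. (ii) Assume that $(\mathbf{H_{poly}})$ (stated in the context) holds with $\rho,\beta>1/2$ and $\rho+\beta>3/2$. Then uniqueness holds for the invariant distribution $\mu_\star$ (in the sense of the context). Furthermore, for every initial distribution $\mu_0$ for which $\int_{\mathcal{X}} V(x)\,\Pi_{\mathcal{X}}^*\mu_0(dx)<+\infty$ and for all $\varepsilon>0$, there exists $C_\varepsilon>0$ such that for all $n\geq 1$ $$\|\mathcal{L}((X^{\mu_0}_{n+k})_{k\geqslant0})-\mathcal{S}\mu_\star\|_{TV}\leqslant C_\varepsilon\, n^{-(v(\beta,\rho)-\varepsilon)},$$ where $$v(\beta,\rho)=\sup_{\alpha\in\left(\frac12\vee\left(\frac32-\beta\right),\,\rho\right)}\min\{1,2(\rho-\alpha)\}\left(\min\{\alpha,\beta,\alpha+\beta-1\}-\tfrac12\right).$$ (iii) Assume that $(\mathbf{H_{exp}})$ (stated in the context) holds. Then uniqueness holds for the invariant distribution $\mu_\star$. Furthermore, for every initial distribution $\mu_0$ for which $\int_{\mathcal{X}} V(x)\,\Pi_{\mathcal{X}}^*\mu_0(dx)<+\infty$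 and for all $p>0$, there exists $C_p>0$ such that for all $n\ge 1$ $$\|\mathcal{L}((X^{\mu_0}_{n+k})_{k\geqslant0})-\mathcal{S}\mu_\star\|_{TV}\leqslant C_p\, n^{-p}.$$
   Context: Notation. $d\ge1$ is fixed, $\mathcal{X}:=\mathbb{R}^d$, $\mathbb{Z}^-:=\{0,-1,-2,\dots\}$, $\mathcal{W}:=(\mathbb{R}^d)^{\mathbb{Z}^-}$; $|\cdot|$ is the Euclidean norm; $B(0,K)$ is the closed ball of $\mathbb{R}^d$ of radius $K$ centered at $0$; $\mathcal{M}_1(E)$ is the set of probability measures on $E$; $f^*\mu$ is the pushforward of $\mu$ by $f$; $\Pi_{\mathcal{X}},\Pi_{\mathcal{W}}$ are the projections of $\mathcal{X}\times\mathcal{W}$ onto $\mathcal{X}$ and $\mathcal{W}$; $J_f(x)$ is the Jacobian matrix of $f$ at $x$; $\mathcal{L}$ denotes the law; $\|\mu-\nu\|_{TV}:=\sup_A|\mu(A)-\nu(A)|$ over measurable sets $A$; $s\vee t=\max(s,t)$. Noise. $(\Delta_n)_{n\in\mathbb{Z}}$ is an $\mathbb{R}^d$-valued stationary, purely non-deterministic Gaussian sequence with $d$ independent components, with (Wold) moving average representation $\Delta_n=\sum_{k=0}^{+\infty}a_k\xi_{n-k}$, where $(a_k)_{k\ge0}$ is a real sequence with $\sum_k a_k^2<\infty$, normalized so that $a_0=1$, and $(\xi_k)_{k\in\mathbb{Z}}$ is i.i.d. with law $\mathcal{N}(0,I_d)$. The sequence $(b_k)_{k\ge0}$ is defined by $b_0=1/a_0$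 and $b_k=-\frac1{a_0}\sum_{l=1}^{k}a_lb_{k-l}$ for $k\ge1$. $\mathbb{P}_w$ denotes the law of $(\Delta_k)_{k\le0}$ on $\mathcal{W}$. Markovian structure. For $w\in\mathcal{W}$, $w'\in\mathbb{R}^d$, let $w\sqcup w'\in\mathcal{W}$ be given by $(w\sqcup w')_0=w'$ and $(w\sqcup w')_k=w_{k+1}$ for $k<0$, and let $\varphi((x,w),w'):=(F(x,w'),w\sqcup w')$. The process $(X_n,(\Delta_{n+k})_{k\le0})_{n\ge0}$ is realized through the (Feller) Markov transition kernel $\mathcal{Q}$ on $\mathcal{X}\times\mathcal{W}$ given by $\int g(x',w')\,\mathcal{Q}((x,w),(dx',dw'))=\int_{\mathbb{R}^d}g(\varphi((x,w),\delta))\,\mathcal{P}(w,d\delta)$, with $\mathcal{P}(w,d\delta):=\mathcal{L}(\Delta_{n+1}\mid(\Delta_{n+k})_{k\le0}=w)$ (independent of $n$ by stationarity). An initial distribution is the law on $\mathcal{X}\times\mathcal{W}$ of a couple $(X_0,(\Delta_k)_{k\le0})$; in particular its $\mathcal{W}$-marginal is $\mathbb{P}_w$. An invariant distribution is such a distribution $\mu$ with $\mathcal{Q}\mu=\mu$. For an initial distribution $\mu$, $(X^\mu_n)_{n\ge0}$ denotes the first component of the process realized through $\mathcal{Q}$ with initial distribution $\mu$, and $\mathcal{S}\mu$ denotes the law of $(X_n^\mu)_{n\ge0}$. Uniqueness of the invariant distribution is up to the equivalence relation $\mu\sim\nu\iff\mathcal{S}\mu=\mathcal{S}\nu$. Hypothesis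 $(\mathbf{H_{poly}})$: there exist $\rho,\beta>1/2$ and $C_\rho,C_\beta>0$ such that $|a_k|\le C_\rho(k+1)^{-\rho}$ and $|b_k|\le C_\beta(k+1)^{-\beta}$ for all $k\ge0$; and there exist $\kappa\ge\rho+1$ and $C_\kappa>0$ such that $|a_k-a_{k+1}|\le C_\kappa(k+1)^{-\kappa}$ for all $k\ge0$. Hypothesis $(\mathbf{H_{exp}})$: there exist $\lambda,\zeta>0$ and $C_\lambda,C_\zeta>0$ such that $|a_k|\le C_\lambda e^{-\lambda k}$ and $|b_k|\le C_\zeta e^{-\zeta k}$ for all $k\ge0$. Hypothesis $(\mathbf{H_1})$: there exist a continuous function $V:\mathcal{X}\to(0,+\infty)$ with $\lim_{|x|\to+\infty}V(x)=+\infty$, $\gamma\in(0,1)$ and $C>0$ such that $V(F(x,w))\le\gamma V(x)+C(1+|w|)$ for all $(x,w)\in\mathcal{X}\times\mathbb{R}^d$. The $V$ in the theorem is this function. Hypothesis $(\mathbf{H_2})$: put $\tilde F(x,u,y):=F(x,u+y)$. For every $K>0$ there exist $\tilde K>0$, $C_{\tilde K}>0$ and $M_K>0$ such that for every $\mathbf{x}=(x,x',y,y')\in B(0,K)^4$ there exists $\Lambda_{\mathbf{x}}:\mathbb{R}^d\to\mathbb{R}^d$ such that: (a) $\Lambda_{\mathbf{x}}$ is a bijection of $\mathbb{R}^d$ onto $\mathbb{R}^d$, and is a $\mathcal{C}^1$-diffeomorphism between two open sets $U$ and $D$ such that $\mathbb{R}^d\setminus U$ and $\mathbb{R}^d\setminus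 D$ are negligible; (b) for all $u\in B(0,\tilde K)$, $\tilde F(x,u,y)=\tilde F(x',\Lambda_{\mathbf{x}}(u),y')$ and $|\det(J_{\Lambda_{\mathbf{x}}}(u))|\ge C_{\tilde K}$; (c) for all $u\in\mathbb{R}^d$, $|\Lambda_{\mathbf{x}}(u)-u|\le M_K$. *)

theory Defs
  imports "HOL-Probability.Probability"
begin

text \<open>
  \<open>\<real>\<^sup>d\<close> is \<open>real ^ 'd\<close>. A past trajectory \<open>w\<close>, indexed in the paper by \<open>0, -1, -2, \<dots>\<close>, is a function
  on \<open>nat\<close>: \<open>w j\<close> is the coordinate at time \<open>-j\<close>. In particular \<open>w \<squnion> w'\<close>, which puts \<open>w'\<close> at time \<open>0\<close>
  and moves the coordinate at time \<open>k + 1\<close> to time \<open>k\<close>, is \<open>case_nat w' w\<close>.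
\<close>

abbreviation traj_space :: "(nat \<Rightarrow> real ^ 'd) measure" where
  "traj_space \<equiv> PiM UNIV (\<lambda>_. borel)"

abbreviation state_space :: "((real ^ 'd) \<times> (nat \<Rightarrow> real ^ 'd)) measure" where
  "state_space \<equiv> borel \<Otimes>\<^sub>M traj_space"

definition tv_dist :: "'a measure \<Rightarrow> 'a measure \<Rightarrow> real" where
  "tv_dist \<mu> \<nu> = (SUP A\<in>sets \<mu>. \<bar>measure \<mu> A - measure \<nu> A\<bar>)"

text \<open>\<open>\<kappa>\<close> is a regular version of the conditional law of \<open>X\<close> given \<open>Y\<close>.\<close>

definition cond_law ::
  "'w measure \<Rightarrow> ('w \<Rightarrow> 'c) \<Rightarrow> 'c measure \<Rightarrow> ('w \<Rightarrow> 'b) \<Rightarrow> 'b measure \<Rightarrow> ('b \<Rightarrow> 'c measure) \<Rightarrow> bool" where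
  "cond_law \<Omega> X L Y N \<kappa> \<longleftrightarrow>
     \<kappa> \<in> measurable N (prob_algebra L) \<and>
     (\<forall>A\<in>sets N. \<forall>B\<in>sets L.
        emeasure \<Omega> {\<omega>\<in>space \<Omega>. Y \<omega> \<in> A \<and> X \<omega> \<in> B}
          = (\<integral>\<^sup>+ y\<in>A. emeasure (\<kappa> y) B \<partial>distr \<Omega> N Y))"

definition std_gaussian_density :: "real ^ 'd \<Rightarrow> real" where
  "std_gaussian_density x = (\<Prod>i\<in>UNIV. std_normal_density (x $ i))"

text \<open>
  The Wold representation of the noise. The series converges in \<open>L\<^sup>2\<close>. A square-summable moving
  average over i.i.d. variables is the Wold representation exactly when \<open>\<xi>\<close> is the innovation
  sequence of \<open>\<Delta>\<close>; this is \<open>innovation\<close>: each component of \<open>\<xi> n\<close> lies in the \<open>L\<^sup>2\<close>-closed linear span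
  of the same component of \<open>\<Delta> k\<close>, \<open>k \<le> n\<close>. That \<open>\<Delta>\<close> is Gaussian, stationary, purely
  non-deterministic and has independent components are consequences of these assumptions.
\<close>

locale gaussian_noise = prob_space \<Omega> for \<Omega> :: "'w measure" +
  fixes a :: "nat \<Rightarrow> real" and \<xi> \<Delta> :: "int \<Rightarrow> 'w \<Rightarrow> real ^ 'd"
  assumes a_0: "a 0 = 1"
    and a_square_summable: "summable (\<lambda>k. (a k)\<^sup>2)"
    and \<xi>_indep: "indep_vars (\<lambda>_. borel) \<xi> UNIV"
    and \<xi>_normal: "\<And>k. distributed \<Omega> lborel (\<xi> k) (\<lambda>x. ennreal (std_gaussian_density x))"
    and \<Delta>_measurable: "\<And>n. random_variable borel (\<Delta> n)"
    and moving_average: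
      "\<And>n. (\<lambda>N. \<integral>\<^sup>+ \<omega>. ennreal ((norm (\<Delta> n \<omega> - (\<Sum>k\<le>N. a k *\<^sub>R \<xi> (n - int k) \<omega>)))\<^sup>2) \<partial>\<Omega>)
             \<longlonglongrightarrow> 0"
    and innovation:
      "\<And>n i \<epsilon>. \<epsilon> > 0 \<Longrightarrow> \<exists>N c.
         (\<integral>\<^sup>+ \<omega>. ennreal ((\<xi> n \<omega> $ i - (\<Sum>k\<le>(N::nat). c k * \<Delta> (n - int k) \<omega> $ i))\<^sup>2) \<partial>\<Omega>) < ennreal \<epsilon>"

fun inverse_coeffs :: "(nat \<Rightarrow> real) \<Rightarrow> nat \<Rightarrow> real" where
  "inverse_coeffs a 0 = 1 / a 0"
| "inverse_coeffs a (Suc k) =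
     - (1 / a 0) * (\<Sum>l\<in>{1..Suc k}. a l * inverse_coeffs a (Suc k - l))"

definition past :: "(int \<Rightarrow> 'w \<Rightarrow> real ^ 'd) \<Rightarrow> int \<Rightarrow> 'w \<Rightarrow> (nat \<Rightarrow> real ^ 'd)" where
  "past \<Delta> n \<omega> = (\<lambda>j. \<Delta> (n - int j) \<omega>)"

definition past_law :: "'w measure \<Rightarrow> (int \<Rightarrow> 'w \<Rightarrow> real ^ 'd) \<Rightarrow> (nat \<Rightarrow> real ^ 'd) measure" where
  "past_law \<Omega> \<Delta> = distr \<Omega> traj_space (past \<Delta> 0)"

text \<open>
  The conditional law of the next noise variable given the past is determined only up to a
  null set of pasts, so it is specified by a predicate on kernels.
\<close>

definition noise_kernel ::
  "'w measure \<Rightarrow> (int \<Rightarrow> 'w \<Rightarrow> real ^ 'd) \<Rightarrow> ((nat \<Rightarrow> real ^ 'd) \<Rightarrow> (real ^ 'd) measure) \<Rightarrow> bool" where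
  "noise_kernel \<Omega> \<Delta> P \<longleftrightarrow> (\<forall>n. cond_law \<Omega> (\<Delta> (n + 1)) borel (past \<Delta> n) traj_space P)"

definition transition_kernel ::
  "((real ^ 'd) \<times> (real ^ 'd) \<Rightarrow> real ^ 'd) \<Rightarrow> ((nat \<Rightarrow> real ^ 'd) \<Rightarrow> (real ^ 'd) measure) \<Rightarrow>
   (real ^ 'd) \<times> (nat \<Rightarrow> real ^ 'd) \<Rightarrow> ((real ^ 'd) \<times> (nat \<Rightarrow> real ^ 'd)) measure" where
  "transition_kernel F P = (\<lambda>(x, w). distr (P w) state_space (\<lambda>\<delta>. (F (x, \<delta>), case_nat \<delta> w)))"

lemma transition_kernel_measurable:
  fixes F :: "(real ^ 'd) \<times> (real ^ 'd) \<Rightarrow> real ^ 'd"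
  assumes "continuous_on UNIV F" and P: "P \<in> measurable traj_space (prob_algebra borel)"
  shows "transition_kernel F P \<in> measurable state_space (prob_algebra state_space)"
proof -
  have [measurable]: "F \<in> borel_measurable (borel \<Otimes>\<^sub>M borel)"
    using assms(1) by (metis borel_measurable_continuous_onI borel_prod)
  note [measurable] = P
  show ?thesis
    unfolding transition_kernel_def split_beta'
  proof (rule measurable_distr_prob_space2[where M=borel])
    show "(\<lambda>x. P (snd x)) \<in> measurable state_space (prob_algebra borel)" by measurable
    have [measurable]: "(\<lambda>x::((real ^ 'd) \<times> (nat \<Rightarrow> real ^ 'd)) \<times> (real ^ 'd). case_nat (snd x) (snd (fst x)))
        \<in> measurable (state_space \<Otimes>\<^sub>M borel) traj_space"
    proof (rule measurable_PiM_single')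
      fix i :: nat
      show "(\<lambda>x::((real ^ 'd) \<times> (nat \<Rightarrow> real ^ 'd)) \<times> (real ^ 'd). case_nat (snd x) (snd (fst x)) i)
          \<in> measurable (state_space \<Otimes>\<^sub>M borel) borel"
        by (cases i) auto
    qed auto
    show "(\<lambda>(x, y). (F (fst x, y), case_nat y (snd x))) \<in> measurable (state_space \<Otimes>\<^sub>M borel) state_space"
      unfolding split_beta' by measurable
  qed
qed

definition initial_distribution ::
  "(nat \<Rightarrow> real ^ 'd) measure \<Rightarrow> ((real ^ 'd) \<times> (nat \<Rightarrow> real ^ 'd)) measure \<Rightarrow> bool" where
  "initial_distribution Pw \<mu> \<longleftrightarrow>
     prob_space \<mu> \<and> sets \<mu> = sets state_space \<and> distr \<mu> traj_space snd = Pw"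

definition invariant_distribution ::
  "(nat \<Rightarrow> real ^ 'd) measure \<Rightarrow>
   ((real ^ 'd) \<times> (nat \<Rightarrow> real ^ 'd) \<Rightarrow> ((real ^ 'd) \<times> (nat \<Rightarrow> real ^ 'd)) measure) \<Rightarrow>
   ((real ^ 'd) \<times> (nat \<Rightarrow> real ^ 'd)) measure \<Rightarrow> bool" where
  "invariant_distribution Pw Q \<mu> \<longleftrightarrow> initial_distribution Pw \<mu> \<and> \<mu> \<bind> Q = \<mu>"

text \<open>
  The law of the Markov chain with initial distribution \<open>\<mu>\<close> and transition kernel \<open>Q\<close>: the Ionescu
  Tulcea measure for the kernels giving the next state from the history \<open>\<omega> 0, \<dots>, \<omega> (i - 1)\<close>.
\<close>

definition chain_step :: "'s measure \<Rightarrow> ('s \<Rightarrow> 's measure) \<Rightarrow> nat \<Rightarrow> (nat \<Rightarrow> 's) \<Rightarrow> 's measure" where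
  "chain_step \<mu> Q i \<omega> = (case i of 0 \<Rightarrow> \<mu> | Suc j \<Rightarrow> Q (\<omega> j))"

lemma chain_step_Ionescu_Tulcea:
  assumes \<mu>: "prob_space \<mu>" "sets \<mu> = sets S" and Q: "Q \<in> measurable S (prob_algebra S)"
  shows "Ionescu_Tulcea (chain_step \<mu> Q) (\<lambda>_. S)"
proof (rule Ionescu_Tulcea.intro)
  fix i
  show "chain_step \<mu> Q i \<in> measurable (PiM {0..<i} (\<lambda>_. S)) (subprob_algebra S)"
  proof (cases i)
    case 0
    then show ?thesis using \<mu>
      by (auto simp: chain_step_def[abs_def] space_subprob_algebra
          intro!: measurable_const prob_space_imp_subprob_space)
  next
    case (Suc j)
    have [measurable]: "Q \<in> measurable S (subprob_algebra S)" using Q by (rule measurable_prob_algebraD)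
    show ?thesis unfolding chain_step_def[abs_def] Suc by simp measurable
  qed
next
  fix i :: nat and x assume x: "x \<in> space (PiM {0..<i} (\<lambda>_. S))"
  show "prob_space (chain_step \<mu> Q i x)"
  proof (cases i)
    case 0 then show ?thesis using \<mu> by (simp add: chain_step_def)
  next
    case (Suc j)
    then have "x j \<in> space S" using x by (auto simp: space_PiM)
    from measurable_space[OF Q this] show ?thesis by (simp add: chain_step_def Suc space_prob_algebra)
  qed
qed

definition chain_law :: "'s measure \<Rightarrow> 's measure \<Rightarrow> ('s \<Rightarrow> 's measure) \<Rightarrow> (nat \<Rightarrow> 's) measure" where
  "chain_law S \<mu> Q =
     projective_family.lim UNIV (Ionescu_Tulcea.CI (chain_step \<mu> Q) (\<lambda>_. S)) (\<lambda>_. S)"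

text \<open>\<open>path_law Q \<mu>\<close> is \<open>\<S> \<mu>\<close>, the law of the first component of the chain.\<close>

definition path_law ::
  "((real ^ 'd) \<times> (nat \<Rightarrow> real ^ 'd) \<Rightarrow> ((real ^ 'd) \<times> (nat \<Rightarrow> real ^ 'd)) measure) \<Rightarrow>
   ((real ^ 'd) \<times> (nat \<Rightarrow> real ^ 'd)) measure \<Rightarrow> (nat \<Rightarrow> real ^ 'd) measure" where
  "path_law Q \<mu> = distr (chain_law state_space \<mu> Q) traj_space (\<lambda>\<omega> n. fst (\<omega> n))"

definition shifted_path_law ::
  "((real ^ 'd) \<times> (nat \<Rightarrow> real ^ 'd) \<Rightarrow> ((real ^ 'd) \<times> (nat \<Rightarrow> real ^ 'd)) measure) \<Rightarrow>
   ((real ^ 'd) \<times> (nat \<Rightarrow> real ^ 'd)) measure \<Rightarrow> nat \<Rightarrow> (nat \<Rightarrow> real ^ 'd) measure" where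
  "shifted_path_law Q \<mu> n = distr (path_law Q \<mu>) traj_space (\<lambda>x k. x (n + k))"

definition unique_invariant ::
  "(nat \<Rightarrow> real ^ 'd) measure \<Rightarrow>
   ((real ^ 'd) \<times> (nat \<Rightarrow> real ^ 'd) \<Rightarrow> ((real ^ 'd) \<times> (nat \<Rightarrow> real ^ 'd)) measure) \<Rightarrow> bool" where
  "unique_invariant Pw Q \<longleftrightarrow>
     (\<forall>\<mu> \<nu>. invariant_distribution Pw Q \<mu> \<longrightarrow> invariant_distribution Pw Q \<nu> \<longrightarrow>
        path_law Q \<mu> = path_law Q \<nu>)"

definition H_poly :: "(nat \<Rightarrow> real) \<Rightarrow> real \<Rightarrow> real \<Rightarrow> bool" where
  "H_poly a \<rho> \<beta> \<longleftrightarrow>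
     \<rho> > 1/2 \<and> \<beta> > 1/2 \<and>
     (\<exists>C>0. \<forall>k. \<bar>a k\<bar> \<le> C * (real k + 1) powr (-\<rho>)) \<and>
     (\<exists>C>0. \<forall>k. \<bar>inverse_coeffs a k\<bar> \<le> C * (real k + 1) powr (-\<beta>)) \<and>
     (\<exists>\<kappa>\<ge>\<rho> + 1. \<exists>C>0. \<forall>k. \<bar>a k - a (k + 1)\<bar> \<le> C * (real k + 1) powr (-\<kappa>))"

definition H_exp :: "(nat \<Rightarrow> real) \<Rightarrow> bool" where
  "H_exp a \<longleftrightarrow>
     (\<exists>l>0. \<exists>C>0. \<forall>k. \<bar>a k\<bar> \<le> C * exp (- l * real k)) \<and>
     (\<exists>z>0. \<exists>C>0. \<forall>k. \<bar>inverse_coeffs a k\<bar> \<le> C * exp (- z * real k))"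

definition H1 :: "((real ^ 'd) \<times> (real ^ 'd) \<Rightarrow> real ^ 'd) \<Rightarrow> (real ^ 'd \<Rightarrow> real) \<Rightarrow> bool" where
  "H1 F V \<longleftrightarrow>
     continuous_on UNIV V \<and> (\<forall>x. V x > 0) \<and> filterlim V at_top at_infinity \<and>
     (\<exists>\<gamma>\<in>{0<..<1}. \<exists>C>0. \<forall>x w. V (F (x, w)) \<le> \<gamma> * V x + C * (1 + norm w))"

definition C1_on :: "(real ^ 'd) set \<Rightarrow> (real ^ 'd \<Rightarrow> real ^ 'd) \<Rightarrow> bool" where
  "C1_on U f \<longleftrightarrow>
     (\<forall>x\<in>U. f differentiable at x) \<and> continuous_on U (\<lambda>x. jacobian f (at x))"

definition C1_diffeo :: "(real ^ 'd) set \<Rightarrow> (real ^ 'd) set \<Rightarrow> (real ^ 'd \<Rightarrow> real ^ 'd) \<Rightarrow> bool" where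
  "C1_diffeo U D f \<longleftrightarrow> bij_betw f U D \<and> C1_on U f \<and> C1_on D (inv_into U f)"

text \<open>
  The Jacobian of \<open>\<Lambda>\<close> is only guaranteed to exist on \<open>U\<close>, so the lower bound on its determinant is
  required at the points of the ball that lie in \<open>U\<close>, that is almost everywhere on the ball.
\<close>

definition H2 :: "((real ^ 'd) \<times> (real ^ 'd) \<Rightarrow> real ^ 'd) \<Rightarrow> bool" where
  "H2 F \<longleftrightarrow>
     (\<forall>K>0. \<exists>Kt>0. \<exists>C>0. \<exists>M>0.
        \<forall>x\<in>cball 0 K. \<forall>x'\<in>cball 0 K. \<forall>y\<in>cball 0 K. \<forall>y'\<in>cball 0 K.
          \<exists>\<Lambda>. bij \<Lambda> \<and>
            (\<exists>U D. open U \<and> open D \<and> negligible (- U) \<and> negligible (- D) \<and> C1_diffeo U D \<Lambda> \<and>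
               (\<forall>u\<in>cball 0 Kt.
                  F (x, u + y) = F (x', \<Lambda> u + y') \<and>
                  (u \<in> U \<longrightarrow> \<bar>det (jacobian \<Lambda> (at u))\<bar> \<ge> C))) \<and>
            (\<forall>u. norm (\<Lambda> u - u) \<le> M))"

definition rate :: "real \<Rightarrow> real \<Rightarrow> real" where
  "rate \<beta> \<rho> =
     (SUP \<alpha>\<in>{max (1/2) (3/2 - \<beta>)<..<\<rho>}.
        min 1 (2 * (\<rho> - \<alpha>)) * (min (min \<alpha> \<beta>) (\<alpha> + \<beta> - 1) - 1/2))"

end

theory Submission imports Defs "HOL-Real_Asymp.Real_Asymp"
begin

text \<open>
The pair of \<open>X\<^sub>n\<close> and the memory, whose entry \<open>m\<close> is the conditional mean of \<open>\<Delta>\<close> at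
time \<open>n + m + 1\<close> given the past, is a Markov chain driven by i.i.d. Gaussian innovations.
Two copies first run for \<open>T\<close> steps on the same innovations, so that their memories become close
and both states return to a compact set. By (H2) a change of one innovation then makes
the \<open>X\<close>-components meet with probability bounded below, and later innovations, shifted
deterministically by means of \<open>a\<close> and its convolution inverse \<open>b\<close>, cancel the remaining difference
of memories: \<open>L\<close> of these shifts enter the change of variables, the others cost at most their
\<open>l\<^sup>2\<close>-norm in total variation. No coupling has to be constructed: a backward induction over \<open>k\<close>
such trials bounds the difference of the path probabilities, the Lyapunov function controlling
the escape from compact sets. For the rates \<open>T\<close>, \<open>L\<close>, \<open>k\<close> are powers of \<open>n\<close>, and the
exponential case is the polynomial one with arbitrarily large exponents. Existence is
Krylov-Bogoliubov along a filter; as the marginal on the noise is fixed, only the \<open>X\<close>-component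
needs compactness.
\<close>

text \<open>The rate comes from a trade-off in \<alpha>, the decay
  \<open>m powr (- \<alpha>)\<close> required of the difference of the memories. Compensating such a
  difference after L steps costs the square-summable tail of its convolution with b, nearly
  L^(-\<theta>) with \<theta> just below min(\<alpha>, \<beta>, \<alpha> + \<beta> - 1) - 1/2. A
  failed trial has changed L + 1 innovations; after T further steps it still adds about sqrt(L)
  T^(-(\<rho> - \<alpha>)) m^(-\<alpha>), and k such contributions must stay below m^(-\<alpha>).
  With T nearly n and k a small power of n, L can nearly reach n^min(1, 2(\<rho> - \<alpha>)): this
  is the product in \<open>rate\<close>. The law of the noise given that a trial failed is
  intractable; \<open>jump_inequality\<close> never conditions, it integrates a nonnegative slack
  over the noise and over its perturbation and needs only that one law dominates the other. Two
  initial laws have unrelated memories. So each initial point is compared with the point of the same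
  memory and X = 0, whose law depends on the noise alone, and the memories start with difference
  zero.\<close>

type_synonym 'd traj = "nat \<Rightarrow> real ^ 'd"
type_synonym 'd state = "(real ^ 'd) \<times> (nat \<Rightarrow> real ^ 'd)"

section \<open>Gaussian noise sequences and their translations\<close>

definition gauss :: "(real ^ 'd) measure" where
 "gauss = density lborel (\<lambda>x. ennreal (std_gaussian_density x))"

abbreviation noise :: "(nat \<Rightarrow> real ^ 'd) measure" where
 "noise \<equiv> PiM UNIV (\<lambda>_. gauss)"

abbreviation nn_mean (binder "\<E>" 10) where "nn_mean f \<equiv> nn_integral noise f"
abbreviation mean (binder "\<EE>" 10) where "mean f \<equiv> integral\<^sup>L noise f"

lemma std_gaussian_density_eq:
 "std_gaussian_density (x::real^'d) = (1 / sqrt (2 * pi)) ^ CARD('d) * exp (- (x \<bullet> x) / 2)"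
 by (simp add: std_gaussian_density_def std_normal_density_def prod.distrib exp_sum[symmetric]
   inner_vec_def power2_eq_square sum_negf[symmetric] sum_divide_distrib prod_dividef power_divide)

lemma std_gaussian_density_pos: "std_gaussian_density x > 0"
 by (simp add: std_gaussian_density_eq)

lemma measurable_std_gaussian_density [measurable]: "std_gaussian_density \<in> borel_measurable borel"
 unfolding std_gaussian_density_def by measurable

lemma sets_gauss [simp, measurable_cong]: "sets gauss = sets borel"
 and space_gauss [simp]: "space gauss = UNIV"
 by (simp_all add: gauss_def)

lemma nn_integral_gauss:
 "f \<in> borel_measurable borel \<Longrightarrow>
  (\<integral>\<^sup>+x. f x \<partial>gauss) = (\<integral>\<^sup>+x. ennreal (std_gaussian_density x) * f x \<partial>lborel)"
 unfolding gauss_def by (subst nn_integral_density) auto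

text \<open>The density is a product over the coordinates, so its integral factors into
  one-dimensional normal integrals; \<open>B\<close> passes from products over the index type to
  products over \<open>Basis\<close>.\<close>

lemma prob_space_gauss: "prob_space (gauss :: (real^'d) measure)"
proof
 have B: "(\<Prod>i\<in>UNIV. f (axis i 1)) = (\<Prod>b\<in>Basis. f b)" for f :: "real^'d \<Rightarrow> ennreal"
  by (auto simp: Basis_vec_def axis_eq_axis inj_on_def UNION_singleton_eq_range
     intro!: prod.reindex_cong[of "\<lambda>i. axis i 1", symmetric])
 have "emeasure (gauss :: (real^'d) measure) UNIV = (\<integral>\<^sup>+x. 1 \<partial>(gauss :: (real^'d) measure))"
  by simp
 also have "... = (\<integral>\<^sup>+x. ennreal (std_gaussian_density (x :: real^'d)) \<partial>lborel)"
  by (subst nn_integral_gauss) auto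
 also have "... = (\<integral>\<^sup>+x. (\<Prod>b\<in>Basis. ennreal (std_normal_density ((x :: real^'d) \<bullet> b))) \<partial>lborel)"
  by (simp add: std_gaussian_density_def prod_ennreal[symmetric] B[symmetric] inner_axis)
 also have "... = (\<Prod>b\<in>(Basis :: (real^'d) set). (\<integral>\<^sup>+x. ennreal (std_normal_density x) \<partial>lborel))"
  by (intro nn_integral_lborel_prod) auto
 also have "(\<integral>\<^sup>+x. ennreal (std_normal_density x) \<partial>lborel) = 1"
  by (subst nn_integral_eq_integral) (auto simp: integrable_normal_density integral_normal_density)
 finally show "emeasure (gauss :: (real^'d) measure) (space gauss) = 1" by simp
qed

text \<open>One-dimensional step of the Cameron-Martin formula: translation invariance of Lebesgue
  measure leaves the ratio of the Gaussian densities at \<open>x - h\<close> and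
  \<open>x\<close>.\<close>

lemma nn_integral_gauss_shift:
 fixes h :: "real^'d"
 assumes [measurable]: "f \<in> borel_measurable borel"
 shows "(\<integral>\<^sup>+x. f (x + h) \<partial>gauss) = (\<integral>\<^sup>+x. f x * ennreal (exp (h \<bullet> x - h \<bullet> h / 2)) \<partial>gauss)"
proof -
 have *: "std_gaussian_density (x - h) = std_gaussian_density x * exp (h \<bullet> x - h \<bullet> h / 2)" for x
  by (simp add: std_gaussian_density_eq inner_diff_left inner_diff_right inner_commute
    field_simps exp_add[symmetric] exp_diff[symmetric])
 have "(\<integral>\<^sup>+x. f (x + h) \<partial>gauss) = (\<integral>\<^sup>+x. ennreal (std_gaussian_density ((h + x) - h)) * f (h + x) \<partial>lborel)"
  by (subst nn_integral_gauss) (auto simp: add.commute)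
 also have "... = (\<integral>\<^sup>+x. ennreal (std_gaussian_density (x - h)) * f x \<partial>distr lborel borel ((+) h))"
  by (subst nn_integral_distr) auto
 also have "... = (\<integral>\<^sup>+x. ennreal (std_gaussian_density x) * (f x * ennreal (exp (h \<bullet> x - h \<bullet> h / 2))) \<partial>lborel)"
  unfolding lborel_distr_plus
  by (auto simp: * ennreal_mult std_gaussian_density_pos less_imp_le ac_simps intro!: nn_integral_cong)
 finally show ?thesis by (subst nn_integral_gauss) auto
qed

interpretation gauss: prob_space "gauss :: (real^'d) measure" by (rule prob_space_gauss)
interpretation noise: sequence_space "gauss :: (real^'d) measure"
 by unfold_locales

lemma sets_noise [measurable_cong]: "sets noise = sets traj_space"
 by (intro sets_PiM_cong) auto

lemma space_noise [simp]: "space noise = UNIV"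
 by (simp add: space_PiM)

lemma case_nat_measurable_traj [measurable (raw)]:
 assumes [measurable]: "f \<in> measurable M borel" "g \<in> measurable M traj_space"
 shows "(\<lambda>x. case_nat (f x) (g x)) \<in> measurable M traj_space"
proof (rule measurable_PiM_single')
 fix i :: nat
 show "(\<lambda>x. case_nat (f x) (g x) i) \<in> measurable M borel"
  by (cases i) auto
qed auto

lemma comb_seq_measurable_traj [measurable (raw)]:
 assumes "f \<in> measurable M traj_space" "g \<in> measurable M traj_space"
 shows "(\<lambda>x. comb_seq n (f x) (g x)) \<in> measurable M traj_space"
 using assms by (rule measurable_comb_seq')

lemma nn_integral_case_nat_noise:
 assumes [measurable]: "f \<in> borel_measurable traj_space"
 shows "(\<E> w. f w) = (\<integral>\<^sup>+u. (\<E> w. f (case_nat u w)) \<partial>gauss)"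
proof -
 have "(\<E> w. f w)
  = (\<integral>\<^sup>+w. f w \<partial>distr (gauss \<Otimes>\<^sub>M noise) noise (\<lambda>(s, w). case_nat s w))"
  by (simp add: noise.PiM_iter)
 also have "... = (\<integral>\<^sup>+x. f (case_nat (fst x) (snd x)) \<partial>(gauss \<Otimes>\<^sub>M noise))"
  by (subst nn_integral_distr) (simp_all add: split_beta')
 also have "... = (\<integral>\<^sup>+u. (\<E> w. f (case_nat u w)) \<partial>gauss)"
  by (subst noise.P.nn_integral_fst[symmetric]) auto
 finally show ?thesis .
qed

text \<open>The coordinates below \<open>n\<close> and those from \<open>n\<close> on are
  independent, so each block can be drawn from its own copy of the noise. The Markov property of
  every chain below is derived from this.\<close>

lemma nn_integral_comb_seq_noise:
 assumes [measurable]: "f \<in> borel_measurable traj_space"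
 shows "(\<E> w. f w) = (\<E> w. (\<E> w'. f (comb_seq n w w')))"
proof -
 have "(\<E> w. f w)
  = (\<integral>\<^sup>+w. f w \<partial>distr (noise \<Otimes>\<^sub>M noise) noise (\<lambda>(s, w). comb_seq n s w))"
  by (simp add: noise.PiM_comb_seq)
 also have "... = (\<integral>\<^sup>+x. f (comb_seq n (fst x) (snd x)) \<partial>(noise \<Otimes>\<^sub>M noise))"
  by (subst nn_integral_distr) (simp_all add: split_beta')
 also have "... = (\<E> w. (\<E> w'. f (comb_seq n w w')))"
  by (subst noise.P.nn_integral_fst[symmetric]) auto
 finally show ?thesis .
qed

text \<open>The Cameron-Martin density of the law of \<open>w + h\<close> with respect to the noise,
  when \<open>h\<close> vanishes from \<open>N\<close> on. Infinite shifts are reached later by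
  approximation, so the exponent is always a finite sum.\<close>

definition shift_weight :: "nat \<Rightarrow> (nat \<Rightarrow> real ^ 'd) \<Rightarrow> (nat \<Rightarrow> real ^ 'd) \<Rightarrow> real" where
 "shift_weight N h w = exp ((\<Sum>i<N. h i \<bullet> w i) - (\<Sum>i<N. h i \<bullet> h i) / 2)"

lemma shift_weight_measurable [measurable]:
 "shift_weight N h \<in> borel_measurable traj_space"
 unfolding shift_weight_def by measurable

lemma shift_weight_pos: "shift_weight N h w > 0"
 by (simp add: shift_weight_def)

lemma shift_weight_Suc:
 "shift_weight (Suc N) h (case_nat u w)
  = exp (h 0 \<bullet> u - h 0 \<bullet> h 0 / 2) * shift_weight N (\<lambda>i. h (Suc i)) w"
 unfolding shift_weight_def sum.lessThan_Suc_shift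
 by (simp add: exp_add[symmetric] add_divide_distrib algebra_simps)

lemma case_nat_add: "(\<lambda>i. case_nat u w i + h i) = case_nat (u + h 0) (\<lambda>i. w i + h (Suc i))"
 by (auto split: nat.split)

lemma add_measurable_traj [measurable (raw)]:
 assumes [measurable]: "f \<in> measurable M traj_space"
 shows "(\<lambda>x i. f x i + h i) \<in> measurable M traj_space"
 by (rule measurable_PiM_single') auto

text \<open>Coordinate 0 is split off and the formula for one Gaussian vector is applied to the
  integral over the others; hence \<open>f\<close> and \<open>h\<close> must vary in the
  induction.\<close>

lemma nn_integral_noise_shift:
 fixes h :: "nat \<Rightarrow> real ^ 'd"
 assumes "f \<in> borel_measurable traj_space" "\<And>i. i \<ge> N \<Longrightarrow> h i = 0"
 shows "(\<E> w. f (\<lambda>i. w i + h i)) = (\<E> w. f w * ennreal (shift_weight N h w))"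
 using assms
proof (induction N arbitrary: f h)
 case 0
 then show ?case by (simp add: shift_weight_def)
next
 case (Suc N)
 note [measurable] = Suc.prems(1)
 have IH: "(\<E> w. f (case_nat u (\<lambda>i. w i + h (Suc i))))
   = (\<E> w. f (case_nat u w) * ennreal (shift_weight N (\<lambda>i. h (Suc i)) w))" for u
  by (rule Suc.IH[where f="\<lambda>w. f (case_nat u w)"]) (auto intro: Suc.prems)
 have "(\<E> w. f (\<lambda>i. w i + h i))
  = (\<integral>\<^sup>+u. (\<E> w. f (case_nat (u + h 0) (\<lambda>i. w i + h (Suc i)))) \<partial>gauss)"
  by (subst nn_integral_case_nat_noise) (simp_all add: case_nat_add)
 also have "... = (\<integral>\<^sup>+u. (\<lambda>u. (\<E> w. f (case_nat u w) * ennreal (shift_weight N (\<lambda>i. h (Suc i)) w))) (u + h 0) \<partial>gauss)"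
  by (simp only: IH)
 also have "... = (\<integral>\<^sup>+u. (\<E> w. f (case_nat u w) * ennreal (shift_weight N (\<lambda>i. h (Suc i)) w))
   * ennreal (exp (h 0 \<bullet> u - h 0 \<bullet> h 0 / 2)) \<partial>gauss)"
  by (subst nn_integral_gauss_shift) auto
 also have "... = (\<integral>\<^sup>+u. (\<E> w. f (case_nat u w) * ennreal (shift_weight (Suc N) h (case_nat u w))) \<partial>gauss)"
  by (subst nn_integral_multc[symmetric])
    (auto simp: shift_weight_Suc ennreal_mult shift_weight_pos less_imp_le ac_simps)
 also have "... = (\<E> w. f w * ennreal (shift_weight (Suc N) h w))"
  by (subst nn_integral_case_nat_noise) simp_all
 finally show ?case .
qed

text \<open>On the event that the linear functional is at most \<open>B\<close> the density is
  bounded: seen from the shifted noise the functional has grown by H, the squared norm of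
  \<open>h\<close>, so the exponent there is at most B + H - H / 2. The resulting domination of laws
  does not deteriorate with the number of coordinates.\<close>

lemma nn_integral_noise_shift_le:
 fixes h :: "nat \<Rightarrow> real ^ 'd"
 assumes [measurable]: "f \<in> borel_measurable traj_space" and h: "\<And>i. i \<ge> N \<Longrightarrow> h i = 0"
 shows "(\<E> w. f (\<lambda>i. w i + h i) * indicator {w. (\<Sum>i<N. h i \<bullet> w i) \<le> B} w)
  \<le> ennreal (exp (B + (\<Sum>i<N. h i \<bullet> h i) / 2)) * (\<E> w. f w)"
proof -
 define H where "H = (\<Sum>i<N. h i \<bullet> h i)"
 define g where "g w = f w * indicator {w. (\<Sum>i<N. h i \<bullet> w i) \<le> B + H} w" for w
 have [measurable]: "g \<in> borel_measurable traj_space"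
  unfolding g_def by measurable
 have "(\<E> w. f (\<lambda>i. w i + h i) * indicator {w. (\<Sum>i<N. h i \<bullet> w i) \<le> B} w)
   = (\<E> w. g (\<lambda>i. w i + h i))"
  by (intro nn_integral_cong)
   (auto simp: g_def H_def inner_add_right sum.distrib split: split_indicator)
 also have "... = (\<E> w. g w * ennreal (shift_weight N h w))"
  by (rule nn_integral_noise_shift) (auto intro: h)
 also have "... \<le> (\<E> w. ennreal (exp (B + H / 2)) * f w)"
 proof (intro nn_integral_mono)
  fix w
  show "g w * ennreal (shift_weight N h w) \<le> ennreal (exp (B + H / 2)) * f w"
  proof (cases "(\<Sum>i<N. h i \<bullet> w i) \<le> B + H")
   case True
   then have "shift_weight N h w \<le> exp (B + H / 2)"
    by (simp add: shift_weight_def H_def[symmetric])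
   then have "f w * ennreal (shift_weight N h w) \<le> f w * ennreal (exp (B + H / 2))"
    by (intro mult_left_mono ennreal_leI) auto
   then show ?thesis using True by (simp add: g_def mult.commute)
  qed (simp add: g_def)
 qed
 also have "... = ennreal (exp (B + H / 2)) * (\<E> w. f w)"
  by (rule nn_integral_cmult) measurable
 finally show ?thesis by (simp add: H_def)
qed

lemma nn_integral_shift_weight:
 fixes h :: "nat \<Rightarrow> real ^ 'd"
 assumes h: "\<And>i. i \<ge> N \<Longrightarrow> h i = 0"
 shows "(\<E> w. ennreal (shift_weight N h w)) = 1"
 using nn_integral_noise_shift[of "\<lambda>_. 1" N h] h by (simp add: noise.P.emeasure_space_1[simplified])

text \<open>One of the two factors serves as the density of the shift by \<open>h\<close>, and
  shifting the other one multiplies it by the exponential of the squared norm.\<close>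

lemma nn_integral_shift_weight_sq:
 fixes h :: "nat \<Rightarrow> real ^ 'd"
 assumes h: "\<And>i. i \<ge> N \<Longrightarrow> h i = 0"
 shows "(\<E> w. ennreal ((shift_weight N h w)\<^sup>2)) = ennreal (exp (\<Sum>i<N. h i \<bullet> h i))"
proof -
 have "(\<E> w. ennreal ((shift_weight N h w)\<^sup>2))
   = (\<E> w. ennreal (shift_weight N h w) * ennreal (shift_weight N h w))"
  by (simp add: power2_eq_square ennreal_mult shift_weight_pos less_imp_le)
 also have "... = (\<E> w. ennreal (shift_weight N h (\<lambda>i. w i + h i)))"
  by (rule nn_integral_noise_shift[symmetric]) (auto intro: h)
 also have "... = (\<E> w. ennreal (exp (\<Sum>i<N. h i \<bullet> h i)) * ennreal (shift_weight N h w))"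
  by (intro nn_integral_cong)
    (simp add: shift_weight_def inner_add_right sum.distrib ennreal_mult[symmetric] exp_add[symmetric])
 also have "... = ennreal (exp (\<Sum>i<N. h i \<bullet> h i))"
  by (subst nn_integral_cmult) (auto simp: nn_integral_shift_weight[OF h])
 finally show ?thesis .
qed

text \<open>The difference is the integral of 1 - Z over B, where Z is the density of the shift, and
  the first absolute moment of Z - 1 is at most the square root of its variance exp s - 1. For s
  \<le> 1 this is at most 2 sqrt s; for larger s the bound exceeds 1 and is trivial.\<close>

lemma noise_shift_finite_tv:
 fixes h :: "nat \<Rightarrow> real ^ 'd"
 assumes B [measurable]: "B \<in> sets traj_space" and h: "\<And>i. i \<ge> N \<Longrightarrow> h i = 0"
 shows "\<bar>measure noise B - measure noise {w. (\<lambda>i. w i + h i) \<in> B}\<bar>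
  \<le> 2 * sqrt (\<Sum>i<N. h i \<bullet> h i)"
proof -
 define s where "s = (\<Sum>i<N. h i \<bullet> h i)"
 have s0: "s \<ge> 0" unfolding s_def by (intro sum_nonneg) simp
 let ?M = "noise :: 'd traj measure"
 let ?Z = "shift_weight N h"
 show ?thesis
 proof (cases "s \<le> 1")
  case False
  have "\<bar>measure ?M B - measure ?M {w. (\<lambda>i. w i + h i) \<in> B}\<bar> \<le> 1"
   using noise.P.prob_le_1[of B] noise.P.prob_le_1[of "{w. (\<lambda>i. w i + h i) \<in> B}"]
    measure_nonneg[of ?M B] measure_nonneg[of ?M "{w. (\<lambda>i. w i + h i) \<in> B}"] by linarith
  also have "... \<le> 2 * sqrt s" using False real_sqrt_ge_one[of s] by linarith
  finally show ?thesis by (simp add: s_def)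
 next
  case True
  have iZ: "integrable ?M ?Z"
   by (rule integrableI_nonneg) (auto simp: nn_integral_shift_weight[OF h] less_imp_le[OF shift_weight_pos])
  have iZ2: "integrable ?M (\<lambda>w. (?Z w)\<^sup>2)"
   by (rule integrableI_nonneg) (auto simp: nn_integral_shift_weight_sq[OF h])
  have EZ: "integral\<^sup>L ?M ?Z = 1"
   by (subst integral_eq_nn_integral)
    (auto simp: nn_integral_shift_weight[OF h] less_imp_le[OF shift_weight_pos])
  have EZ2: "(\<integral>w. (?Z w)\<^sup>2 \<partial>?M) = exp s"
   by (subst integral_eq_nn_integral) (auto simp: nn_integral_shift_weight_sq[OF h] s_def)
  have i2: "integrable ?M (\<lambda>w. (?Z w - 1)\<^sup>2)"
   unfolding power2_diff using iZ iZ2 by auto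
  have E2: "(\<integral>w. (?Z w - 1)\<^sup>2 \<partial>?M) = exp s - 1"
   unfolding power2_diff using iZ iZ2 EZ EZ2 by (simp add: noise.P.prob_space[simplified])
  have iA: "integrable ?M (\<lambda>w. \<bar>?Z w - 1\<bar>)" using iZ by auto
  \<comment> \<open>Cauchy-Schwarz, read off from the nonnegative variance of the absolute value of
    Z - 1.\<close>
  have V: "(\<integral>w. \<bar>?Z w - 1\<bar> \<partial>?M)\<^sup>2 \<le> exp s - 1"
   using noise.P.variance_eq[OF iA] noise.P.variance_positive[of "\<lambda>w. \<bar>?Z w - 1\<bar>"] i2 E2 by simp
  have "measure ?M {w. (\<lambda>i. w i + h i) \<in> B} = (\<integral>w. indicator B w * ?Z w \<partial>?M)"
  proof -
   have *: "emeasure ?M {w. (\<lambda>i. w i + h i) \<in> B} = (\<integral>\<^sup>+w. indicator B (\<lambda>i. w i + h i) \<partial>?M)"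
   proof -
    have "{w. (\<lambda>i. w i + h i) \<in> B} = (\<lambda>w i. w i + h i) -` B \<inter> space ?M" by auto
    also have "... \<in> sets ?M" by measurable
    finally have "(\<integral>\<^sup>+w. indicator {w. (\<lambda>i. w i + h i) \<in> B} w \<partial>?M) = emeasure ?M {w. (\<lambda>i. w i + h i) \<in> B}"
     by (rule nn_integral_indicator)
    then show ?thesis by (simp add: indicator_def)
   qed
   also have "... = (\<integral>\<^sup>+w. indicator B w * ennreal (?Z w) \<partial>?M)"
    by (rule nn_integral_noise_shift) (auto intro: h)
   also have "... = (\<integral>\<^sup>+w. ennreal (indicator B w * ?Z w) \<partial>?M)"
    by (intro nn_integral_cong) (auto split: split_indicator)
   finally show ?thesis
    by (subst integral_eq_nn_integral)
     (auto simp: measure_def * less_imp_le[OF shift_weight_pos])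
  qed
  moreover have "measure ?M B = (\<integral>w. indicator B w \<partial>?M)" by simp
  ultimately have "measure ?M B - measure ?M {w. (\<lambda>i. w i + h i) \<in> B}
    = (\<integral>w. indicator B w - indicator B w * ?Z w \<partial>?M)"
   by (subst Bochner_Integration.integral_diff)
     (auto intro!: integrable_mult_indicator[of B ?M ?Z, simplified] iZ noise.P.integrable_const_bound[where B=1] )
  also have "\<bar>\<dots>\<bar> \<le> (\<integral>w. \<bar>?Z w - 1\<bar> \<partial>?M)"
  proof (rule order.trans[OF integral_abs_bound integral_mono'])
   show "integrable ?M (\<lambda>w. \<bar>?Z w - 1\<bar>)" by fact
  qed (auto split: split_indicator)
  also have "... \<le> sqrt (exp s - 1)"
   using V by (intro real_le_rsqrt)
  also have "... \<le> sqrt (4 * s)"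
  proof -
   have "exp s \<le> 1 + s + s\<^sup>2" using True s0 by (intro exp_bound) auto
   also have "s\<^sup>2 \<le> s" using True s0 by (simp add: power2_eq_square mult_left_le)
   finally show ?thesis using s0 by simp
  qed
  also have "... = 2 * sqrt s" by (simp add: real_sqrt_mult)
  finally show ?thesis by (simp add: s_def)
 qed
qed

text \<open>A crude Gaussian variance bound. Exponential moments follow from the normalisation of
  \<open>shift_weight\<close>; with t^2 s = 1 the estimate x^2 \<le> 2 (e^x + e^(-x)) gives 4 s
  e^(1/2), and 8 s is a round upper value.\<close>

lemma nn_integral_noise_sq_le:
 fixes h :: "nat \<Rightarrow> real ^ 'd"
 shows "(\<E> w. ennreal ((\<Sum>i<N. h i \<bullet> w i)\<^sup>2)) \<le> ennreal (8 * (\<Sum>i<N. h i \<bullet> h i))"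
proof -
 define s where "s = (\<Sum>i<N. h i \<bullet> h i)"
 have s0: "s \<ge> 0" unfolding s_def by (intro sum_nonneg) simp
 have ex: "(\<E> w. ennreal (exp (\<Sum>i<N. t * (h i \<bullet> w i)))) = ennreal (exp (t\<^sup>2 * s / 2))" for t
 proof -
  \<comment> \<open>For the shift by t h on the first N coordinates, the fact that the weight
    integrates to 1 is exactly the formula for the exponential moment.\<close>
  define g where "g i = (if i < N then t *\<^sub>R h i else 0)" for i
  have g: "shift_weight N g w = exp (- (t\<^sup>2 * s / 2)) * exp (\<Sum>i<N. t * (h i \<bullet> w i))" for w
   by (simp add: shift_weight_def g_def s_def exp_add[symmetric] power2_eq_square sum_distrib_left ac_simps)
  have "1 = (\<E> w. ennreal (shift_weight N g w))"
   by (rule nn_integral_shift_weight[symmetric]) (auto simp: g_def)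
  also have "... = ennreal (exp (- (t\<^sup>2 * s / 2))) * (\<E> w. ennreal (exp (\<Sum>i<N. t * (h i \<bullet> w i))))"
   unfolding g by (subst nn_integral_cmult[symmetric]) (auto simp: ennreal_mult)
  finally have "ennreal (exp (t\<^sup>2 * s / 2)) = ennreal (exp (t\<^sup>2 * s / 2)) * (ennreal (exp (- (t\<^sup>2 * s / 2))) * (\<E> w. ennreal (exp (\<Sum>i<N. t * (h i \<bullet> w i)))))"
   by simp
  also have "... = (\<E> w. ennreal (exp (\<Sum>i<N. t * (h i \<bullet> w i))))"
   by (simp add: mult.assoc[symmetric] ennreal_mult[symmetric] exp_add[symmetric] ac_simps
     flip: ennreal_mult)
  finally show ?thesis ..
 qed
 show ?thesis
 proof (cases "s = 0")
  case True
  then have "h i \<bullet> h i = 0" if "i < N" for i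
   using that sum_nonneg_eq_0_iff[of "{..<N}" "\<lambda>i. h i \<bullet> h i"] by (auto simp: s_def)
  then have "(\<Sum>i<N. h i \<bullet> w i) = 0" for w by simp
  then show ?thesis by simp
 next
  case False
  then have s: "s > 0" using s0 by simp
  define t where "t = 1 / sqrt s"
  have t: "t > 0" "t\<^sup>2 * s = 1" using s by (auto simp: t_def power_divide)
  have cosh: "x\<^sup>2 \<le> 2 * (exp x + exp (- x))" for x :: real
  proof -
   have "y\<^sup>2 \<le> 2 * (exp y + exp (-y))" if "y \<ge> 0" for y :: real
    using exp_lower_Taylor_quadratic[OF that] exp_ge_add_one_self[of "-y"] by simp
   from this[of "\<bar>x\<bar>"] show ?thesis by (cases "x \<ge> 0") (auto simp: abs_if add.commute)
  qed
  have "(\<E> w. ennreal ((\<Sum>i<N. h i \<bullet> w i)\<^sup>2))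
   \<le> (\<E> w. ennreal (2 * s) * (ennreal (exp (\<Sum>i<N. t * (h i \<bullet> w i))) + ennreal (exp (\<Sum>i<N. (- t) * (h i \<bullet> w i)))))"
  proof (intro nn_integral_mono)
   fix w :: "nat \<Rightarrow> real^'d"
   define x where "x = (\<Sum>i<N. h i \<bullet> w i)"
   have "x\<^sup>2 = s * (t * x)\<^sup>2" using t by (simp add: power_mult_distrib algebra_simps)
   also have "... \<le> s * (2 * (exp (t * x) + exp (- (t * x))))"
    using s0 by (intro mult_left_mono cosh)
   finally show "ennreal ((\<Sum>i<N. h i \<bullet> w i)\<^sup>2) \<le>
    ennreal (2 * s) * (ennreal (exp (\<Sum>i<N. t * (h i \<bullet> w i))) + ennreal (exp (\<Sum>i<N. (- t) * (h i \<bullet> w i))))"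
    unfolding sum_distrib_left[symmetric] x_def[symmetric]
    using s0 by (simp add: ennreal_plus[symmetric] ennreal_mult[symmetric] ac_simps ennreal_leI
      del: ennreal_plus)
  qed
  also have "... = ennreal (2 * s) * (ennreal (exp (1/2)) + ennreal (exp (1/2)))"
  proof -
   have "(\<E> w. ennreal (2 * s) * (ennreal (exp (\<Sum>i<N. t * (h i \<bullet> w i))) + ennreal (exp (\<Sum>i<N. (- t) * (h i \<bullet> w i)))))
    = ennreal (2 * s) * ((\<E> w. ennreal (exp (\<Sum>i<N. t * (h i \<bullet> w i)))) + (\<E> w. ennreal (exp (\<Sum>i<N. (- t) * (h i \<bullet> w i)))))"
    by (subst nn_integral_cmult, measurable) (subst nn_integral_add, measurable)
   also have "... = ennreal (2 * s) * (ennreal (exp (1/2)) + ennreal (exp (1/2)))"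
    unfolding ex using t by simp
   finally show ?thesis .
  qed
  also have "... = ennreal (4 * s * exp (1/2))"
   using s0 by (simp add: ennreal_plus[symmetric] ennreal_mult[symmetric] del: ennreal_plus)
  also have "... \<le> ennreal (8 * s)"
  proof -
   have "exp (1/2::real) \<le> 2" using exp_bound_half[of "1/2::real"] by simp
   then have "4 * s * exp (1/2) \<le> 4 * s * 2" using s0 by (intro mult_left_mono) auto
   then show ?thesis by (intro ennreal_leI) simp
  qed
  finally show ?thesis by (simp add: s_def)
 qed
qed

text \<open>The sets that can be approximated by finite-dimensional ones form a sigma-algebra,
  whence the induction over the generation of the product sigma-algebra. Two measures are treated at
  once because the noise and its translate must be approximated on the same cylinder.\<close>

lemma cylinder_approx:
 fixes M1 M2 :: "(nat \<Rightarrow> 'a :: topological_space) measure"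
 assumes "finite_measure M1" "finite_measure M2"
  and s1: "sets M1 = sets (PiM UNIV (\<lambda>_. borel))" and s2: "sets M2 = sets (PiM UNIV (\<lambda>_. borel))"
  and A: "A \<in> sets (PiM UNIV (\<lambda>_. borel))" and e: "e > 0"
 shows "\<exists>N B. B \<in> sets (PiM UNIV (\<lambda>_. borel)) \<and> (\<forall>w w'. (\<forall>i<N. w i = w' i) \<longrightarrow> w \<in> B \<longrightarrow> w' \<in> B)
  \<and> measure M1 (sym_diff A B) < e \<and> measure M2 (sym_diff A B) < e"
proof -
 interpret M1: finite_measure M1 by fact
 interpret M2: finite_measure M2 by fact
 note [measurable_cong] = s1 s2
 from A have "A \<in> sigma_sets UNIV {{f. f i \<in> A} |i A. A \<in> sets (borel :: 'a measure)}"
  unfolding sets_PiM_single by (simp add: PiE_def)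
 then show ?thesis using e
 proof (induction arbitrary: e rule: sigma_sets.induct)
  case (Basic a)
  then obtain i B where a: "a = {f. f i \<in> B}" and B: "B \<in> sets borel" by auto
  have "a = (\<lambda>f. f i) -` B \<inter> space (PiM UNIV (\<lambda>_. borel))" by (auto simp: a space_PiM)
  also have "... \<in> sets (PiM UNIV (\<lambda>_. borel))"
   using B by (intro measurable_sets[of _ _ borel]) auto
  finally have "a \<in> sets (PiM UNIV (\<lambda>_. borel))" .
  with Basic.prems show ?case
   by (intro exI[of _ "Suc i"] exI[of _ a]) (auto simp: a)
 next
  case Empty
  then show ?case by (intro exI[of _ 0] exI[of _ "{}"]) auto
 next
  case (Compl a)
  from Compl.IH[OF Compl.prems] obtain N B where B: "B \<in> sets (PiM UNIV (\<lambda>_. borel))"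
   "\<forall>w w'. (\<forall>i<N. w i = w' i) \<longrightarrow> w \<in> B \<longrightarrow> w' \<in> B"
   "measure M1 (sym_diff a B) < e" "measure M2 (sym_diff a B) < e" by blast
  have "UNIV - B = space (PiM UNIV (\<lambda>_. borel)) - B" by (simp add: space_PiM)
  also have "... \<in> sets (PiM UNIV (\<lambda>_. borel))" using B by blast
  finally have "UNIV - B \<in> sets (PiM UNIV (\<lambda>_. borel))" .
  moreover have "sym_diff (UNIV - a) (UNIV - B) = sym_diff a B" by auto
  moreover have "\<forall>w w'. (\<forall>i<N. w i = w' i) \<longrightarrow> w \<in> UNIV - B \<longrightarrow> w' \<in> UNIV - B"
  proof (intro allI impI)
   fix w w' :: "nat \<Rightarrow> 'a" assume *: "\<forall>i<N. w i = w' i" "w \<in> UNIV - B"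
   then have "\<forall>i<N. w' i = w i" by simp
   with B(2) * show "w' \<in> UNIV - B" by blast
  qed
  ultimately show ?case using B(3,4) by (intro exI[of _ N] exI[of _ "UNIV - B"]) simp
 next
  case (Union a)
  have aS [measurable]: "a i \<in> sets (PiM UNIV (\<lambda>_. borel))" for i
   using Union.hyps[of i] unfolding sets_PiM_single by (simp add: PiE_def)
  have lim: "\<exists>n. \<forall>m\<ge>n. measure M ((\<Union>i. a i) - (\<Union>i<m. a i)) < e / 2" if M: "finite_measure M" "sets M = sets (PiM UNIV (\<lambda>_. borel))" for M
  proof -
   interpret finite_measure M by fact
   have "(\<lambda>m. measure M ((\<Union>i. a i) - (\<Union>i<m. a i))) \<longlonglongrightarrow> measure M (\<Inter>m. (\<Union>i. a i) - (\<Union>i<m. a i))"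
   proof (rule finite_Lim_measure_decseq)
    show "range (\<lambda>m. (\<Union>i. a i) - (\<Union>i<m. a i)) \<subseteq> sets M"
     unfolding M(2) by auto
    show "decseq (\<lambda>m. (\<Union>i. a i) - (\<Union>i<m. a i))"
     unfolding decseq_def by (intro allI impI Diff_mono UN_mono) auto
   qed
   also have "(\<Inter>m. (\<Union>i. a i) - (\<Union>i<m. a i)) = {}" by auto
   finally have "(\<lambda>m. measure M ((\<Union>i. a i) - (\<Union>i<m. a i))) \<longlonglongrightarrow> 0" by simp
   from order_tendstoD(2)[OF this, of "e/2"] Union.prems show ?thesis
    by (simp add: eventually_sequentially)
  qed
  obtain n1 n2 where n: "\<And>m. m \<ge> n1 \<Longrightarrow> measure M1 ((\<Union>i. a i) - (\<Union>i<m. a i)) < e / 2"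
    "\<And>m. m \<ge> n2 \<Longrightarrow> measure M2 ((\<Union>i. a i) - (\<Union>i<m. a i)) < e / 2"
   using lim[of M1] lim[of M2] assms(1-4) by blast
  \<comment> \<open>The successor makes m positive, so that half of e can be distributed over m
    sets.\<close>
  define m where "m = Suc (max n1 n2)"
  have m: "measure M1 ((\<Union>i. a i) - (\<Union>i<m. a i)) < e / 2" "measure M2 ((\<Union>i. a i) - (\<Union>i<m. a i)) < e / 2"
   using n by (auto simp: m_def)
  have "e / (2 * real m) > 0" using Union.prems by (simp add: m_def)
  then have "\<forall>i. \<exists>N B. B \<in> sets (PiM UNIV (\<lambda>_. borel)) \<and> (\<forall>w w'. (\<forall>i<N. w i = w' i) \<longrightarrow> w \<in> B \<longrightarrow> w' \<in> B)
   \<and> measure M1 (sym_diff (a i) B) < e / (2 * real m) \<and> measure M2 (sym_diff (a i) B) < e / (2 * real m)"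
   using Union.IH by blast
  then obtain N B where B: "\<And>i. B i \<in> sets (PiM UNIV (\<lambda>_. borel))"
   "\<And>i w w'. (\<forall>j<N i. w j = w' j) \<Longrightarrow> w \<in> B i \<Longrightarrow> w' \<in> B i"
   "\<And>i. measure M1 (sym_diff (a i) (B i)) < e / (2 * real m)"
   "\<And>i. measure M2 (sym_diff (a i) (B i)) < e / (2 * real m)" by metis
  define N' where "N' = Max (N ` {..<m})"
  have N': "N i \<le> N'" if "i < m" for i using that by (simp add: N'_def)
  have bound: "measure M (sym_diff (\<Union>i. a i) (\<Union>i<m. B i)) < e"
   if M: "finite_measure M" "sets M = sets (PiM UNIV (\<lambda>_. borel))"
    and 1: "measure M ((\<Union>i. a i) - (\<Union>i<m. a i)) < e / 2"
    and 2: "\<And>i. measure M (sym_diff (a i) (B i)) < e / (2 * real m)" for M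
  proof -
   interpret finite_measure M by fact
   note [measurable] = B(1)
   have "measure M (sym_diff (\<Union>i. a i) (\<Union>i<m. B i))
    \<le> measure M (((\<Union>i. a i) - (\<Union>i<m. a i)) \<union> (\<Union>i<m. sym_diff (a i) (B i)))"
   proof (rule finite_measure_mono)
    show "sym_diff (\<Union>i. a i) (\<Union>i<m. B i) \<subseteq> ((\<Union>i. a i) - (\<Union>i<m. a i)) \<union> (\<Union>i<m. sym_diff (a i) (B i))"
     by blast
   qed (unfold M(2), measurable)
   also have "... \<le> measure M ((\<Union>i. a i) - (\<Union>i<m. a i)) + measure M (\<Union>i<m. sym_diff (a i) (B i))"
    by (rule measure_Un_le) (unfold M(2), measurable)
   also have "measure M (\<Union>i<m. sym_diff (a i) (B i)) \<le> (\<Sum>i<m. measure M (sym_diff (a i) (B i)))"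
    by (rule measure_UNION_le) (auto simp: M(2) intro!: aS B(1))
   also have "... \<le> (\<Sum>i<m. e / (2 * real m))"
    by (intro sum_mono less_imp_le 2)
   also have "... = e / 2"
   proof -
    have "m > 0" by (simp add: m_def)
    then show ?thesis by simp
   qed
   finally show ?thesis using 1 by linarith
  qed
  have "(\<Union>i<m. B i) \<in> sets (PiM UNIV (\<lambda>_. borel))" using B(1) by auto
  moreover have "\<forall>w w'. (\<forall>i<N'. w i = w' i) \<longrightarrow> w \<in> (\<Union>i<m. B i) \<longrightarrow> w' \<in> (\<Union>i<m. B i)"
  proof (intro allI impI)
   fix w w' :: "nat \<Rightarrow> 'a" assume *: "\<forall>i<N'. w i = w' i" "w \<in> (\<Union>i<m. B i)"
   then obtain i where i: "i < m" "w \<in> B i" by auto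
   have "\<forall>j<N i. w j = w' j" using *(1) N'[OF i(1)] by auto
   with B(2) i show "w' \<in> (\<Union>i<m. B i)" by blast
  qed
  ultimately show ?case
   using bound[OF assms(1) s1 m(1) B(3)] bound[OF assms(2) s2 m(2) B(4)]
   by (intro exI[of _ N'] exI[of _ "\<Union>i<m. B i"]) auto
 qed
qed

text \<open>Passage to infinitely many coordinates: on a cylinder the shift by \<open>h\<close> acts
  like the shift by its truncation \<open>g\<close>, for which the bound holds with a constant
  independent of N.\<close>

lemma noise_shift_tv:
 fixes h :: "nat \<Rightarrow> real ^ 'd"
 assumes B [measurable]: "B \<in> sets traj_space" and h: "\<And>N. (\<Sum>i<N. h i \<bullet> h i) \<le> s\<^sup>2" and s: "s \<ge> 0"
 shows "\<bar>measure noise B - measure noise {w. (\<lambda>i. w i + h i) \<in> B}\<bar> \<le> 2 * s"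
proof (rule field_le_epsilon)
 fix e :: real assume e: "e > 0"
 let ?M = "noise :: 'd traj measure"
 define M2 where "M2 = distr ?M traj_space (\<lambda>w i. w i + h i)"
 have f2: "prob_space M2" unfolding M2_def by (rule noise.P.prob_space_distr) measurable
 interpret M2: prob_space M2 by fact
 have s2: "sets M2 = sets traj_space" by (simp add: M2_def)
 have M2: "measure M2 C = measure ?M {w. (\<lambda>i. w i + h i) \<in> C}" if "C \<in> sets traj_space" for C
  unfolding M2_def using that by (subst measure_distr) (auto simp: vimage_def)
 obtain N C where C: "C \<in> sets traj_space" "\<And>w w'. (\<forall>i<N. w i = w' i) \<Longrightarrow> w \<in> C \<Longrightarrow> w' \<in> C"
  "measure ?M (sym_diff B C) < e / 2" "measure M2 (sym_diff B C) < e / 2"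
  using cylinder_approx[OF noise.P.finite_measure_axioms M2.finite_measure_axioms
    sets_noise s2 B, of "e/2"] e by auto
 have diff: "\<bar>measure M B - measure M C\<bar> \<le> measure M (sym_diff B C)" if "prob_space M" "sets M = sets traj_space" for M
 proof -
  interpret prob_space M by fact
  have sB: "B \<in> sets M" "C \<in> sets M" using B C(1) that(2) by auto
  have "measure M B \<le> measure M (C \<union> sym_diff B C)"
   using sB by (intro finite_measure_mono) auto
  also have "... \<le> measure M C + measure M (sym_diff B C)" using sB by (intro measure_Un_le) auto
  finally have 1: "measure M B \<le> measure M C + measure M (sym_diff B C)" .
  have "measure M C \<le> measure M (B \<union> sym_diff B C)"
   using sB by (intro finite_measure_mono) auto
  also have "... \<le> measure M B + measure M (sym_diff B C)" using sB by (intro measure_Un_le) auto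
  finally show ?thesis using 1 by linarith
 qed
 define g where "g i = (if i < N then h i else 0)" for i
 have "{w. (\<lambda>i. w i + h i) \<in> C} = {w. (\<lambda>i. w i + g i) \<in> C}"
 proof (rule Collect_cong)
  fix w :: "nat \<Rightarrow> real^'d"
  have "\<forall>i<N. w i + h i = w i + g i" by (simp add: g_def)
  with C(2)[of "\<lambda>i. w i + h i" "\<lambda>i. w i + g i"] C(2)[of "\<lambda>i. w i + g i" "\<lambda>i. w i + h i"]
  show "((\<lambda>i. w i + h i) \<in> C) = ((\<lambda>i. w i + g i) \<in> C)" by auto
 qed
 then have "measure M2 C = measure ?M {w. (\<lambda>i. w i + g i) \<in> C}" using M2[OF C(1)] by simp
 moreover have "\<bar>measure ?M C - measure ?M {w. (\<lambda>i. w i + g i) \<in> C}\<bar> \<le> 2 * sqrt (\<Sum>i<N. g i \<bullet> g i)"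
  by (rule noise_shift_finite_tv[OF C(1)]) (auto simp: g_def)
 moreover have "sqrt (\<Sum>i<N. g i \<bullet> g i) \<le> s"
  using h[of N] s by (intro real_le_lsqrt) (auto simp: g_def intro!: sum_nonneg)
 ultimately have "\<bar>measure ?M C - measure M2 C\<bar> \<le> 2 * s" by linarith
 with diff[OF noise.P.prob_space_axioms sets_noise] diff[OF f2 s2] C(3,4) M2[OF B]
 show "\<bar>measure ?M B - measure ?M {w. (\<lambda>i. w i + h i) \<in> B}\<bar> \<le> 2 * s + e" by linarith
qed

section \<open>Change of variables by an almost everywhere diffeomorphism\<close>

text \<open>The image measure is bounded set by set. Over the part T of W that is mapped into E, the
  integral of the absolute Jacobian determinant is the measure of the image, hence at most that of
  E; it is also at least c times the measure of T.\<close>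

lemma nn_integral_change_of_variables_le_wellorder:
 fixes f :: "real ^ 'm::{finite,wellorder} \<Rightarrow> real ^ 'm::_"
 assumes f [measurable]: "f \<in> borel_measurable borel" and W [measurable]: "W \<in> sets borel"
  and W': "emeasure lborel W < \<infinity>"
  and der: "\<And>u. u \<in> W \<Longrightarrow> (f has_derivative f' u) (at u within W)"
  and inj: "inj_on f W" and c: "c > 0" "\<And>u. u \<in> W \<Longrightarrow> \<bar>det (matrix (f' u))\<bar> \<ge> c"
  and q [measurable]: "q \<in> borel_measurable borel"
 shows "(\<integral>\<^sup>+u. q (f u) * indicator W u \<partial>lborel) \<le> ennreal (1 / c) * (\<integral>\<^sup>+u. q u \<partial>lborel)"
proof -
 define N where "N = distr (density lborel (indicator W)) borel f"
 have "N \<le> scale_measure (ennreal (1 / c)) lborel"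
 proof (subst le_measure)
  show "\<forall>E\<in>sets N. emeasure N E \<le> emeasure (scale_measure (ennreal (1 / c)) lborel) E"
  proof
   fix E assume "E \<in> sets N"
   then have E [measurable]: "E \<in> sets borel" by (simp add: N_def)
   define T where "T = {u\<in>W. f u \<in> E}"
   have T [measurable]: "T \<in> sets borel" unfolding T_def by measurable
   have "emeasure N E = emeasure (density lborel (indicator W)) (f -` E)"
    unfolding N_def by (subst emeasure_distr) auto
   also have "... = emeasure lborel T"
   proof (subst emeasure_density)
    have "(\<integral>\<^sup>+u. indicator W u * indicator (f -` E) u \<partial>lborel) = (\<integral>\<^sup>+u. indicator T u \<partial>lborel)"
     by (intro nn_integral_cong) (auto simp: T_def split: split_indicator)
    then show "(\<integral>\<^sup>+u. indicator W u * indicator (f -` E) u \<partial>lborel) = emeasure lborel T" by simp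
   qed (use measurable_sets_borel[OF f E] in auto)
   finally have N: "emeasure N E = emeasure lborel T" .
   show "emeasure N E \<le> emeasure (scale_measure (ennreal (1 / c)) lborel) E"
   \<comment> \<open>The comparison of real-valued integrals needs finite measures; otherwise the
     right-hand side is infinite.\<close>
   proof (cases "emeasure lborel E = \<infinity>")
    case True
    then show ?thesis using c(1) by (simp add: ennreal_mult_top)
   next
    case False
    then have Em: "E \<in> lmeasurable" using E
     by (simp add: fmeasurable_def top.not_eq_extremum)
    have "emeasure lborel T \<le> emeasure lborel W"
     by (rule emeasure_mono) (auto simp: T_def)
    then have Tm: "T \<in> lmeasurable" using T W'
     by (simp add: fmeasurable_def)
    have derT: "(f has_derivative f' u) (at u within T)" if "u \<in> T" for u
     using der[of u] that by (auto simp: T_def intro: has_derivative_subset)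
    have injT: "inj_on f T" using inj by (rule inj_on_subset) (auto simp: T_def)
    have TL: "T \<in> sets lebesgue" using T by auto
    have sub: "f ` T \<subseteq> E" by (auto simp: T_def)
    have fT: "f ` T \<in> lmeasurable"
    proof (rule fmeasurableI2[OF Em sub])
     show "f ` T \<in> sets lebesgue"
      by (rule differentiable_image_in_sets_lebesgue[OF TL])
       (use derT in \<open>auto simp: differentiable_on_def differentiable_def\<close>)
    qed
    have I1: "((\<lambda>u. \<bar>det (matrix (f' u))\<bar>) has_integral measure lebesgue (f ` T)) T"
     using has_measure_differentiable_image[OF TL derT injT, of "measure lebesgue (f ` T)"] fT by blast
    have I2: "((\<lambda>u. c) has_integral (c * measure lebesgue T)) T"
     proof -
     have "((\<lambda>u. 1::real) has_integral measure lebesgue T) T"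
      using Tm by (metis has_integral_integral lmeasurable_iff_integrable_on lmeasure_integral)
     from has_integral_mult_right[OF this, of c] show ?thesis by simp
    qed
    have "c * measure lebesgue T \<le> measure lebesgue (f ` T)"
     by (rule has_integral_le[OF I2 I1]) (use c(2) in \<open>auto simp: T_def\<close>)
    also have "... \<le> measure lebesgue E"
     by (rule measure_mono_fmeasurable[OF sub _ Em]) (use fT in auto)
    finally have "measure lebesgue T \<le> 1 / c * measure lebesgue E"
     using c(1) by (simp add: field_simps)
    then have "ennreal (measure lebesgue T) \<le> ennreal (1 / c) * ennreal (measure lebesgue E)"
     using c(1) by (subst ennreal_mult[symmetric]) (auto intro: ennreal_leI)
    moreover have eq: "emeasure lborel X = ennreal (measure lebesgue X)" if "X \<in> lmeasurable" "X \<in> sets borel" for X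
     using emeasure_eq_measure2[OF that(1)] that(2) by simp
    ultimately show ?thesis
     unfolding N eq[OF Tm T] eq[OF Em E] by (simp add: eq[OF Em E])
   qed
  qed
 qed (simp add: N_def)
 then have "nn_integral N q \<le> nn_integral (scale_measure (ennreal (1 / c)) lborel) q"
  by (rule nn_integral_mono_measure[rotated]) (simp add: N_def)
 also have "nn_integral N q = (\<integral>\<^sup>+u. q (f u) * indicator W u \<partial>lborel)"
  unfolding N_def by (subst nn_integral_distr, measurable)
   (subst nn_integral_density, auto simp: mult.commute)
 finally show ?thesis by (subst (asm) nn_integral_scale_measure) auto
qed

text \<open>
 The change of variables theorems of the library ask for a well-ordered index type; a copy of
 \<open>{..<CARD('d)}\<close> provides one for every finite index type.
\<close>

typedef ('d :: finite) ordered_index = "{..<CARD('d)}"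
 by (auto intro!: exI[of _ 0])

instantiation ordered_index :: (finite) linorder
begin

definition less_eq_ordered_index where
 "i \<le> j \<longleftrightarrow> Rep_ordered_index i \<le> Rep_ordered_index j"

definition less_ordered_index where
 "i < j \<longleftrightarrow> Rep_ordered_index i < Rep_ordered_index j"

instance
 by standard (auto simp: less_eq_ordered_index_def less_ordered_index_def Rep_ordered_index_inject)

end

instance ordered_index :: (finite) wellorder
proof
 fix P :: "'a ordered_index \<Rightarrow> bool" and i
 assume step: "\<And>i. (\<And>j. j < i \<Longrightarrow> P j) \<Longrightarrow> P i"
 show "P i"
 proof (induction "Rep_ordered_index i" arbitrary: i rule: less_induct)
  case less
  show ?case by (rule step) (rule less, simp add: less_ordered_index_def)
 qed
qed

lemma bij_betw_Rep_ordered_index: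
 "bij_betw Rep_ordered_index (UNIV :: 'd::finite ordered_index set) {..<CARD('d)}"
 using type_definition.Rep_range[OF type_definition_ordered_index]
 by (auto simp: bij_betw_def inj_on_def Rep_ordered_index_inject)

instance ordered_index :: (finite) finite
 by standard (simp add: bij_betw_finite[OF bij_betw_Rep_ordered_index])

lemma ex_bij_ordered_index: "\<exists>f :: 'd::finite ordered_index \<Rightarrow> 'd. bij f"
proof -
 have "CARD('d ordered_index) = CARD('d)"
  using bij_betw_same_card[OF bij_betw_Rep_ordered_index] by simp
 from finite_same_card_bij[OF _ _ this] show ?thesis by auto
qed

text \<open>In the Leibniz formula the same relabelling of rows and columns acts on the permutations
  by conjugation with \<open>f\<close>, a bijection that preserves signs.\<close>

lemma det_reindex:
 fixes A :: "real ^ 'd ^ 'd" and f :: "'m::finite \<Rightarrow> 'd"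
 assumes f: "bij f"
 shows "det (\<chi> i j. A $ f i $ f j) = det A"
proof -
 have inj: "inj f" using f by (rule bij_is_inj)
 have bij: "bij_betw (map_permutation UNIV f) {p. p permutes UNIV} {p. p permutes UNIV}"
 proof -
  have "map_permutation UNIV f = (\<lambda>p x. if x \<in> UNIV then f (p (inv_into UNIV f x)) else x)"
   using bij_is_surj[OF f] by (simp add: map_permutation_def fun_eq_iff restrict_id_def)
  then show ?thesis using bij_betw_permutations[OF f] by simp
 qed
 have "det A = (\<Sum>p | p permutes UNIV. of_int (sign p) * (\<Prod>i\<in>UNIV. A $ i $ p i))"
  by (simp add: det_def)
 also have "... = (\<Sum>p | p permutes UNIV. of_int (sign (map_permutation UNIV f p)) * (\<Prod>i\<in>UNIV. A $ i $ map_permutation UNIV f p i))"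
  by (rule sum.reindex_bij_betw[OF bij, symmetric])
 also have "... = (\<Sum>p | p permutes UNIV. of_int (sign p) * (\<Prod>i\<in>UNIV. A $ f i $ f (p i)))"
 proof (intro sum.cong refl)
  fix p :: "'m \<Rightarrow> 'm" assume "p \<in> {p. p permutes UNIV}"
  then have "sign (map_permutation UNIV f p) = sign p"
   using inj by (intro sign_map_permutation) auto
  moreover have "(\<Prod>i\<in>UNIV. A $ i $ map_permutation UNIV f p i) = (\<Prod>i\<in>UNIV. A $ f i $ map_permutation UNIV f p (f i))"
   by (rule prod.reindex_bij_betw[OF f, symmetric])
  ultimately show "of_int (sign (map_permutation UNIV f p)) * (\<Prod>i\<in>UNIV. A $ i $ map_permutation UNIV f p i)
   = of_int (sign p) * (\<Prod>i\<in>UNIV. A $ f i $ f (p i))"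
   using inj by (simp add: map_permutation_apply)
 qed
 finally show ?thesis by (simp add: det_def)
qed

lemma prod_Basis_vec: "(\<Prod>b\<in>Basis. g b) = (\<Prod>i\<in>UNIV. g (axis i 1))" for g :: "real^'d \<Rightarrow> 'b::comm_monoid_mult"
 by (auto simp: Basis_vec_def axis_eq_axis inj_on_def UNION_singleton_eq_range
   intro!: prod.reindex_cong[of "\<lambda>i. axis i 1"])

lemma reindex_measurable [measurable]:
 "(\<lambda>x :: real ^ 'd. \<chi> i. x $ f i) \<in> borel_measurable borel"
 by (intro borel_measurable_continuous_onI continuous_intros continuous_on_component)

text \<open>Lebesgue measure is determined by the volumes of boxes, which are products over the
  coordinates in any order.\<close>

lemma lborel_reindex:
 fixes f :: "'m::finite \<Rightarrow> 'd::finite"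
 assumes f: "bij f"
 shows "distr lborel borel (\<lambda>x. \<chi> i. x $ f i) = (lborel :: (real ^ 'm) measure)"
proof (rule lborel_eqI[symmetric])
 define g where "g = inv f"
 have g [simp]: "f (g i) = i" "g (f j) = j" for i j
  using f by (auto simp: g_def bij_def surj_f_inv_f)
 fix l u :: "real ^ 'm" assume le: "\<And>b. b \<in> Basis \<Longrightarrow> l \<bullet> b \<le> u \<bullet> b"
 then have le': "l $ i \<le> u $ i" for i using le[of "axis i 1"] by (simp add: inner_axis)
 have "(\<lambda>x :: real^'d. \<chi> i. x $ f i) -` box l u = box (\<chi> i. l $ g i) (\<chi> i. u $ g i)"
  by (auto simp: mem_box_cart) (metis g)+
 then have "emeasure (distr lborel borel (\<lambda>x :: real^'d. \<chi> i. x $ f i)) (box l u)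
  = emeasure lborel (box (\<chi> i. l $ g i) (\<chi> i. u $ g i) :: (real^'d) set)"
  by (subst emeasure_distr) auto
 also have "... = (\<Prod>i\<in>UNIV. (u $ g i - l $ g i))"
 proof (subst emeasure_lborel_box)
  show "(\<chi> i. l $ g i) \<bullet> b \<le> (\<chi> i. u $ g i) \<bullet> b" if "b \<in> Basis" for b :: "real^'d"
   using that le' by (auto simp: Basis_vec_def inner_axis)
 qed (simp add: prod_Basis_vec inner_axis)
 also have "(\<Prod>i\<in>UNIV. (u $ g i - l $ g i)) = (\<Prod>i\<in>UNIV. (u $ i - l $ i))"
  by (rule prod.reindex_bij_betw) (use f in \<open>simp add: g_def bij_imp_bij_inv\<close>)
 finally show "emeasure (distr lborel borel (\<lambda>x :: real^'d. \<chi> i. x $ f i)) (box l u) = ennreal (\<Prod>b\<in>Basis. (u - l) \<bullet> b)"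
  by (simp add: prod_Basis_vec inner_axis)
qed simp

text \<open>The relabelling of coordinates \<open>to\<close> and its inverse \<open>fro\<close>
  preserve Lebesgue measure, and conjugating \<open>f\<close> by them does not change its Jacobian
  determinant, so the well-ordered version applies to the conjugate.\<close>

lemma nn_integral_change_of_variables_le:
 fixes f :: "real ^ 'd \<Rightarrow> real ^ 'd"
 assumes f [measurable]: "f \<in> borel_measurable borel" and W [measurable]: "W \<in> sets borel"
  and W': "emeasure lborel W < \<infinity>"
  and der: "\<And>u. u \<in> W \<Longrightarrow> (f has_derivative f' u) (at u within W)"
  and inj: "inj_on f W" and c: "c > 0" "\<And>u. u \<in> W \<Longrightarrow> \<bar>det (matrix (f' u))\<bar> \<ge> c"
  and q [measurable]: "q \<in> borel_measurable borel"
 shows "(\<integral>\<^sup>+u. q (f u) * indicator W u \<partial>lborel) \<le> ennreal (1 / c) * (\<integral>\<^sup>+u. q u \<partial>lborel)"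
proof -
 obtain r :: "'d ordered_index \<Rightarrow> 'd" where r: "bij r" using ex_bij_ordered_index by blast
 define s where "s = inv r"
 have rs [simp]: "r (s i) = i" "s (r j) = j" for i j
  using r by (auto simp: s_def bij_def surj_f_inv_f)
 have s: "bij s" using r by (simp add: s_def bij_imp_bij_inv)
 define to :: "real ^ 'd \<Rightarrow> real ^ 'd ordered_index" where "to x = (\<chi> i. x $ r i)" for x
 define fro :: "real ^ 'd ordered_index \<Rightarrow> real ^ 'd" where "fro x = (\<chi> i. x $ s i)" for x
 have tf [simp]: "to (fro x) = x" "fro (to y) = y" for x y
  by (simp_all add: to_def fro_def)
 have [measurable]: "to \<in> borel_measurable borel" "fro \<in> borel_measurable borel"
  unfolding to_def fro_def by measurable
 have lin: "bounded_linear to" "bounded_linear fro"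
  by (intro linear_conv_bounded_linear[THEN iffD1] linearI; simp add: to_def fro_def vec_eq_iff)+
 have L: "lborel = distr lborel borel fro"
  unfolding fro_def[abs_def] by (rule lborel_reindex[OF s, symmetric])
 have fW: "fro -` W = to ` W" by (auto simp: image_iff) (metis tf(1))
 have [measurable]: "fro -` W \<in> sets borel" using measurable_sets_borel[of fro borel W] by simp
 have "(\<integral>\<^sup>+u. q (f u) * indicator W u \<partial>lborel) = (\<integral>\<^sup>+u. q (f (fro u)) * indicator W (fro u) \<partial>lborel)"
  by (subst L, subst nn_integral_distr) auto
 also have "... = (\<integral>\<^sup>+u. (\<lambda>v. q (fro v)) ((\<lambda>v. to (f (fro v))) u) * indicator (fro -` W) u \<partial>lborel)"
  by (intro nn_integral_cong) (auto split: split_indicator)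
 also have "... \<le> ennreal (1 / c) * (\<integral>\<^sup>+u. q (fro u) \<partial>lborel)"
 proof (rule nn_integral_change_of_variables_le_wellorder[where f'="\<lambda>u v. to (f' (fro u) (fro v))"])
  show "emeasure lborel (fro -` W) < \<infinity>"
   using W' by (subst (asm) L, subst (asm) emeasure_distr) auto
  show "((\<lambda>v. to (f (fro v))) has_derivative (\<lambda>v. to (f' (fro u) (fro v)))) (at u within fro -` W)"
   if u: "u \<in> fro -` W" for u
  proof -
   have 1: "(fro has_derivative fro) (at u within fro -` W)"
    using lin(2) by (rule bounded_linear_imp_has_derivative)
   have 2: "(f has_derivative f' (fro u)) (at (fro u) within fro ` (fro -` W))"
    by (rule has_derivative_subset[OF der]) (use u in auto)
   have 3: "((f \<circ> fro) has_derivative (f' (fro u) \<circ> fro)) (at u within fro -` W)"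
    by (rule diff_chain_within[OF 1 2])
   from bounded_linear.has_derivative[OF lin(1) 3] show ?thesis by (simp add: o_def)
  qed
  show "inj_on (\<lambda>v. to (f (fro v))) (fro -` W)"
  proof (rule inj_onI)
   fix x y assume *: "x \<in> fro -` W" "y \<in> fro -` W" "to (f (fro x)) = to (f (fro y))"
   have "fro (to (f (fro x))) = fro (to (f (fro y)))" by (simp only: *)
   then have "f (fro x) = f (fro y)" by simp
   then have "fro x = fro y" using inj * by (auto dest: inj_onD)
   then have "to (fro x) = to (fro y)" by (simp only:)
   then show "x = y" by simp
  qed
  show "c \<le> \<bar>det (matrix (\<lambda>v. to (f' (fro u) (fro v))))\<bar>" if u: "u \<in> fro -` W" for u
  proof -
   have "fro (axis j 1) = axis (r j) 1" for j
    by (auto simp: fro_def axis_def vec_eq_iff)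
   then have "matrix (\<lambda>v. to (f' (fro u) (fro v))) = (\<chi> i j. matrix (f' (fro u)) $ r i $ r j)"
    by (simp add: matrix_def to_def)
   then show ?thesis using c(2)[of "fro u"] u by (simp add: det_reindex[OF r])
  qed
 qed (use c in auto)
 also have "(\<integral>\<^sup>+u. q (fro u) \<partial>lborel) = (\<integral>\<^sup>+u. q u \<partial>lborel)"
  by (subst L, subst nn_integral_distr) auto
 finally show ?thesis .
qed

text \<open>On a ball of radius R a map that moves points by at most M increases the squared norm by
  at most 2 R M + M^2, so the Gaussian density at u is at most exp (R M + M^2 / 2) times the density
  at \<open>f u\<close>. Clause (c) of (H2) enters here.\<close>

lemma nn_integral_gauss_change_of_variables_le:
 fixes f :: "real ^ 'd \<Rightarrow> real ^ 'd"
 assumes f [measurable]: "f \<in> borel_measurable borel" and W [measurable]: "W \<in> sets borel"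
  and W': "W \<subseteq> cball 0 R"
  and der: "\<And>u. u \<in> W \<Longrightarrow> (f has_derivative f' u) (at u within W)"
  and inj: "inj_on f W" and c: "c > 0" "\<And>u. u \<in> W \<Longrightarrow> \<bar>det (matrix (f' u))\<bar> \<ge> c"
  and M: "\<And>u. u \<in> W \<Longrightarrow> norm (f u - u) \<le> M"
  and q [measurable]: "q \<in> borel_measurable borel"
 shows "(\<integral>\<^sup>+u. q (f u) * indicator W u \<partial>gauss)
  \<le> ennreal (exp (R * M + M\<^sup>2 / 2) / c) * (\<integral>\<^sup>+u. q u \<partial>gauss)"
proof -
 let ?e = "exp (R * M + M\<^sup>2 / 2)"
 have dens: "std_gaussian_density u \<le> ?e * std_gaussian_density (f u)" if "u \<in> W" for u
 proof -
  have "(f u \<bullet> f u) - u \<bullet> u = 2 * (u \<bullet> (f u - u)) + (f u - u) \<bullet> (f u - u)"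
   by (simp add: algebra_simps inner_commute)
  also have "u \<bullet> (f u - u) \<le> norm u * norm (f u - u)" by (rule norm_cauchy_schwarz)
  also have "norm u * norm (f u - u) \<le> R * M"
  proof (intro mult_mono)
   show "norm u \<le> R" using W' that by auto
   then show "0 \<le> R" using norm_ge_zero[of u] by linarith
  qed (use M[OF that] in auto)
  also have "(f u - u) \<bullet> (f u - u) \<le> M\<^sup>2"
   using M[OF that] by (simp add: power2_norm_eq_inner[symmetric] power_mono)
  finally have "- (u \<bullet> u) / 2 \<le> (R * M + M\<^sup>2 / 2) + - (f u \<bullet> f u) / 2" by simp
  then have "exp (- (u \<bullet> u) / 2) \<le> ?e * exp (- (f u \<bullet> f u) / 2)"
   by (simp add: exp_add[symmetric])
  then show ?thesis
   unfolding std_gaussian_density_eq mult.left_commute[of ?e] by (intro mult_left_mono) auto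
 qed
 have "(\<integral>\<^sup>+u. q (f u) * indicator W u \<partial>gauss)
  = (\<integral>\<^sup>+u. ennreal (std_gaussian_density u) * (q (f u) * indicator W u) \<partial>lborel)"
  by (subst nn_integral_gauss) auto
 also have "... \<le> (\<integral>\<^sup>+u. ennreal ?e * (ennreal (std_gaussian_density (f u)) * q (f u) * indicator W u) \<partial>lborel)"
 proof (intro nn_integral_mono)
  fix u
  show "ennreal (std_gaussian_density u) * (q (f u) * indicator W u)
   \<le> ennreal ?e * (ennreal (std_gaussian_density (f u)) * q (f u) * indicator W u)"
  proof (cases "u \<in> W")
   case True
   have "ennreal (std_gaussian_density u) * q (f u) \<le> ennreal (?e * std_gaussian_density (f u)) * q (f u)"
    using dens[OF True] by (intro mult_right_mono ennreal_leI) auto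
   then show ?thesis using True
    by (simp add: ennreal_mult less_imp_le[OF std_gaussian_density_pos] mult.assoc)
  qed simp
 qed
 also have "... = ennreal ?e * (\<integral>\<^sup>+u. (\<lambda>v. ennreal (std_gaussian_density v) * q v) (f u) * indicator W u \<partial>lborel)"
  by (subst nn_integral_cmult) auto
 also have "... \<le> ennreal ?e * (ennreal (1 / c) * (\<integral>\<^sup>+u. ennreal (std_gaussian_density u) * q u \<partial>lborel))"
 proof (intro mult_left_mono nn_integral_change_of_variables_le)
  have "emeasure lborel W \<le> emeasure lborel (cball 0 R :: (real^'d) set)"
   by (rule emeasure_mono) (use W' in auto)
  also have "... < \<infinity>" by (rule emeasure_lborel_cball_finite)
  finally show "emeasure lborel W < \<infinity>" .
 qed (use der inj c in auto)
 also have "... = ennreal (?e / c) * (\<integral>\<^sup>+u. q u \<partial>gauss)"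
  using c(1) by (subst nn_integral_gauss)
   (auto simp: mult.assoc[symmetric] ennreal_mult[symmetric])
 finally show ?thesis .
qed

section \<open>Perturbing the innovations of one trial\<close>

lemma measurable_trajI:
 fixes f :: "'a \<Rightarrow> nat \<Rightarrow> real ^ 'd"
 assumes "\<And>i. (\<lambda>x. f x i) \<in> borel_measurable M"
 shows "f \<in> measurable M traj_space"
 by (rule measurable_PiM_single') (use assms in auto)

text \<open>Given the first innovation u, the later ones undergo a deterministic shift, which the
  exponential bound controls uniformly in u \<in> W. Integrating over u leaves the domination
  assumed for \<Lambda> alone, and the two constants multiply.\<close>

lemma jump_dominated:
 fixes \<Lambda> :: "real ^ 'd \<Rightarrow> real ^ 'd" and g :: "real ^ 'd \<Rightarrow> nat \<Rightarrow> real ^ 'd"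
 assumes \<Lambda> [measurable]: "\<Lambda> \<in> borel_measurable borel" and W [measurable]: "W \<in> sets borel"
  and dom: "\<And>q. q \<in> borel_measurable borel \<Longrightarrow>
   (\<integral>\<^sup>+u. q (\<Lambda> u) * indicator W u \<partial>gauss) \<le> C * (\<integral>\<^sup>+u. q u \<partial>gauss)"
  and g [measurable]: "\<And>i. (\<lambda>u. g u i) \<in> borel_measurable borel"
  and gL: "\<And>u i. i \<ge> L \<Longrightarrow> g u i = 0"
  and H: "\<And>u. u \<in> W \<Longrightarrow> (\<Sum>i<L. g u i \<bullet> g u i) \<le> H"
  and f [measurable]: "f \<in> borel_measurable traj_space"
 shows "(\<E> w. f (case_nat (\<Lambda> (w 0)) (\<lambda>i. w (Suc i) + g (w 0) i))
   * indicator {w. w 0 \<in> W \<and> (\<Sum>i<L. g (w 0) i \<bullet> w (Suc i)) \<le> B} w)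
  \<le> ennreal (exp (B + H / 2)) * C * (\<E> w. f w)"
proof -
 let ?A = "{w. w 0 \<in> W \<and> (\<Sum>i<L. g (w 0) i \<bullet> w (Suc i)) \<le> B}"
 have [measurable]: "(\<lambda>w. g (w 0) i) \<in> borel_measurable traj_space" for i
  by (rule measurable_compose[OF _ g]) measurable
 have [measurable]: "(\<lambda>w. case_nat (\<Lambda> (w 0)) (\<lambda>i. w (Suc i) + g (w 0) i)) \<in> measurable traj_space traj_space"
  by (intro case_nat_measurable_traj measurable_trajI) measurable
 define \<phi> where "\<phi> v = (\<E> w. f (case_nat v w))" for v
 have [measurable]: "\<phi> \<in> borel_measurable borel" unfolding \<phi>_def by measurable
 have "(\<E> w. f (case_nat (\<Lambda> (w 0)) (\<lambda>i. w (Suc i) + g (w 0) i)) * indicator ?A w)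
  = (\<integral>\<^sup>+u. (\<E> w. f (case_nat (\<Lambda> u) (\<lambda>i. w i + g u i)) * indicator {w. (\<Sum>i<L. g u i \<bullet> w i) \<le> B} w * indicator W u) \<partial>gauss)"
  by (subst nn_integral_case_nat_noise, measurable)
    (auto intro!: nn_integral_cong split: split_indicator)
 also have "... \<le> (\<integral>\<^sup>+u. ennreal (exp (B + H / 2)) * (\<phi> (\<Lambda> u) * indicator W u) \<partial>gauss)"
 proof (intro nn_integral_mono)
  fix u :: "real ^ 'd"
  show "(\<E> w. f (case_nat (\<Lambda> u) (\<lambda>i. w i + g u i)) * indicator {w. (\<Sum>i<L. g u i \<bullet> w i) \<le> B} w * indicator W u)
   \<le> ennreal (exp (B + H / 2)) * (\<phi> (\<Lambda> u) * indicator W u)"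
  proof (cases "u \<in> W")
   case True
   have "(\<E> w. f (case_nat (\<Lambda> u) (\<lambda>i. w i + g u i)) * indicator {w. (\<Sum>i<L. g u i \<bullet> w i) \<le> B} w)
    \<le> ennreal (exp (B + (\<Sum>i<L. g u i \<bullet> g u i) / 2)) * \<phi> (\<Lambda> u)"
    unfolding \<phi>_def
    by (rule nn_integral_noise_shift_le[where f="\<lambda>w. f (case_nat (\<Lambda> u) w)"]) (auto intro: gL)
   also have "... \<le> ennreal (exp (B + H / 2)) * \<phi> (\<Lambda> u)"
    using H[OF True] by (intro mult_right_mono ennreal_leI) auto
   finally show ?thesis using True by simp
  qed simp
 qed
 also have "... = ennreal (exp (B + H / 2)) * (\<integral>\<^sup>+u. \<phi> (\<Lambda> u) * indicator W u \<partial>gauss)"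
  by (rule nn_integral_cmult) measurable
 also have "... \<le> ennreal (exp (B + H / 2)) * (C * (\<integral>\<^sup>+u. \<phi> u \<partial>gauss))"
  by (intro mult_left_mono dom) auto
 also have "(\<integral>\<^sup>+u. \<phi> u \<partial>gauss) = (\<E> w. f w)"
  unfolding \<phi>_def by (rule nn_integral_case_nat_noise[symmetric]) measurable
 finally show ?thesis by (simp add: mult.assoc)
qed

text \<open>For each u the linear functional has second moment at most 8 H. By Chebyshev and 16 H
  \<le> B^2 it exceeds B with probability at most 1/2, and this is integrated over u \<in>
  W.\<close>

lemma jump_set_prob:
 fixes g :: "real ^ 'd \<Rightarrow> nat \<Rightarrow> real ^ 'd"
 assumes W [measurable]: "W \<in> sets borel"
  and g [measurable]: "\<And>i. (\<lambda>u. g u i) \<in> borel_measurable borel"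
  and H: "\<And>u. u \<in> W \<Longrightarrow> (\<Sum>i<L. g u i \<bullet> g u i) \<le> H" and B: "B > 0" "16 * H \<le> B\<^sup>2"
 shows "measure gauss W / 2
  \<le> measure noise {w. w 0 \<in> W \<and> (\<Sum>i<L. g (w 0) i \<bullet> w (Suc i)) \<le> B}"
proof -
 let ?A = "{w. w 0 \<in> W \<and> (\<Sum>i<L. g (w 0) i \<bullet> w (Suc i)) \<le> B}"
 let ?M = "noise :: 'd traj measure"
 have [measurable]: "(\<lambda>w. g (w 0) i) \<in> borel_measurable traj_space" for i
  by (rule measurable_compose[OF _ g]) measurable
 have AS [measurable]: "?A \<in> sets traj_space"
 proof -
  have "?A = {w \<in> space traj_space. w 0 \<in> W \<and> (\<Sum>i<L. g (w 0) i \<bullet> w (Suc i)) \<le> B}"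
   by (simp add: space_PiM)
  also have "... \<in> sets traj_space" by measurable
  finally show ?thesis .
 qed
 have half: "ennreal (1/2) \<le> emeasure ?M {w. (\<Sum>i<L. g u i \<bullet> w i) \<le> B}" if u: "u \<in> W" for u
 proof -
  let ?Y = "\<lambda>w. \<Sum>i<L. g u i \<bullet> w i"
  have mS: "{w. P (?Y w)} \<in> sets ?M" if "Measurable.pred borel P" for P
  proof -
   have "{w. P (?Y w)} = {w \<in> space traj_space. P (?Y w)}" by (simp add: space_PiM)
   also have "... \<in> sets traj_space" using that by measurable
   finally show ?thesis by (simp add: sets_noise)
  qed
  have "emeasure ?M {w. B < ?Y w} \<le> emeasure ?M {w \<in> space ?M. 1 \<le> ennreal (1 / B\<^sup>2) * ennreal ((?Y w)\<^sup>2)}"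
  proof (rule emeasure_mono)
   show "{w. B < ?Y w} \<subseteq> {w \<in> space ?M. 1 \<le> ennreal (1 / B\<^sup>2) * ennreal ((?Y w)\<^sup>2)}"
   proof safe
    fix w assume "B < ?Y w"
    then have "B\<^sup>2 \<le> (?Y w)\<^sup>2" using B by (intro power_mono) auto
    then have "1 \<le> 1 / B\<^sup>2 * (?Y w)\<^sup>2" using B by (simp add: field_simps)
    then have "ennreal 1 \<le> ennreal (1 / B\<^sup>2 * (?Y w)\<^sup>2)" by (rule ennreal_leI)
    also have "... = ennreal (1 / B\<^sup>2) * ennreal ((?Y w)\<^sup>2)" by (rule ennreal_mult) auto
    finally show "1 \<le> ennreal (1 / B\<^sup>2) * ennreal ((?Y w)\<^sup>2)" by simp
   qed simp
  qed measurable
  also have "... \<le> ennreal (1 / B\<^sup>2) * (\<integral>\<^sup>+w. ennreal ((?Y w)\<^sup>2) * indicator UNIV w \<partial>?M)"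
   using nn_integral_Markov_inequality[of "\<lambda>w. ennreal ((?Y w)\<^sup>2)" UNIV ?M "ennreal (1 / B\<^sup>2)"]
   using sets.top[of ?M] by simp
  also have "... \<le> ennreal (1 / B\<^sup>2) * ennreal (8 * (\<Sum>i<L. g u i \<bullet> g u i))"
   using nn_integral_noise_sq_le[of "g u" L] by (intro mult_left_mono) auto
  also have "... \<le> ennreal (1 / B\<^sup>2) * ennreal (8 * H)"
   using H[OF u] by (intro mult_left_mono ennreal_leI) auto
  also have "... = ennreal (8 * H / B\<^sup>2)" by (subst ennreal_mult'[symmetric]) auto
  also have "... \<le> ennreal (1/2)"
   using B by (intro ennreal_leI) (simp add: field_simps)
  finally have le: "measure ?M {w. B < ?Y w} \<le> 1/2"
   unfolding noise.P.emeasure_eq_measure by (subst (asm) ennreal_le_iff) auto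
  have "{w. ?Y w \<le> B} = space ?M - {w. B < ?Y w}" by auto
  then have "measure ?M {w. ?Y w \<le> B} = 1 - measure ?M {w. B < ?Y w}"
   using mS[of "\<lambda>y. B < y"] by (simp add: noise.P.prob_compl[simplified])
  with le show ?thesis unfolding noise.P.emeasure_eq_measure by (intro ennreal_leI) simp
 qed
 have "ennreal (1/2) * emeasure gauss W = (\<integral>\<^sup>+u. ennreal (1/2) * indicator W u \<partial>gauss)"
  by (subst nn_integral_cmult) auto
 also have "... \<le> (\<integral>\<^sup>+u. emeasure ?M {w. (\<Sum>i<L. g u i \<bullet> w i) \<le> B} * indicator W u \<partial>gauss)"
  using half by (intro nn_integral_mono) (auto split: split_indicator)
 also have "... = (\<integral>\<^sup>+u. (\<integral>\<^sup>+w. indicator ?A (case_nat u w) \<partial>?M) \<partial>gauss)"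
 proof (intro nn_integral_cong)
  fix u :: "real^'d"
  have "{w. (\<Sum>i<L. g u i \<bullet> w i) \<le> B} \<in> sets ?M"
  proof -
   have "{w. (\<Sum>i<L. g u i \<bullet> w i) \<le> B} = {w \<in> space traj_space. (\<Sum>i<L. g u i \<bullet> w i) \<le> B}"
    by (simp add: space_PiM)
   also have "... \<in> sets traj_space" by measurable
   finally show ?thesis by (simp add: sets_noise)
  qed
  then have "emeasure ?M {w. (\<Sum>i<L. g u i \<bullet> w i) \<le> B} * indicator W u
   = (\<integral>\<^sup>+w. indicator {w. (\<Sum>i<L. g u i \<bullet> w i) \<le> B} w * indicator W u \<partial>?M)"
   by (subst nn_integral_multc) auto
  also have "... = (\<integral>\<^sup>+w. indicator ?A (case_nat u w) \<partial>?M)"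
   by (intro nn_integral_cong) (auto split: split_indicator)
  finally show "emeasure ?M {w. (\<Sum>i<L. g u i \<bullet> w i) \<le> B} * indicator W u
   = (\<integral>\<^sup>+w. indicator ?A (case_nat u w) \<partial>?M)" .
 qed
 also have "... = (\<integral>\<^sup>+w. indicator ?A w \<partial>?M)"
  by (rule nn_integral_case_nat_noise[symmetric]) measurable
 also have "... = emeasure ?M ?A" by (rule nn_integral_indicator) (simp add: sets_noise)
 finally show ?thesis
  by (simp add: noise.P.emeasure_eq_measure gauss.emeasure_eq_measure ennreal_mult[symmetric]
    measure_nonneg del: ennreal_half)
qed

text \<open>This replaces a coupling. \<open>Q1\<close> and \<open>Q2\<close> stand for the
  probabilities of a future event for two chains, given the innovations w of a trial, and \<Psi>
  perturbs these innovations. The slack P, which is b + R1 + R2 minus or plus Q1 - Q2, is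
  nonnegative. On A the sum P w + P (\<Psi> w) is at least b - \<eta>: the pair (w, \<Psi> w)
  succeeds, and the crossed pair (\<Psi> w, w) is not worse than a failure. Domination bounds c
  times the integral of P (\<Psi> w) over A by the expectation of P, so twice that expectation is at
  least c prob A (b - \<eta>), a definite gain over b.\<close>

lemma (in prob_space) jump_inequality:
 fixes Q1 Q2 R1 R2 :: "'a \<Rightarrow> real"
 assumes [measurable]: "Q1 \<in> borel_measurable M" "Q2 \<in> borel_measurable M"
   "R1 \<in> borel_measurable M" "R2 \<in> borel_measurable M" "\<Psi> \<in> measurable M M" and A [measurable]: "A \<in> sets M"
  and Q: "\<And>w. \<bar>Q1 w\<bar> \<le> K" "\<And>w. \<bar>Q2 w\<bar> \<le> K" and R: "\<And>w. \<bar>R1 w\<bar> \<le> K" "\<And>w. \<bar>R2 w\<bar> \<le> K"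
  and c: "0 \<le> c" "c \<le> 1"
  and dom: "\<And>f. f \<in> borel_measurable M \<Longrightarrow>
   ennreal c * (\<integral>\<^sup>+w. f (\<Psi> w) * indicator A w \<partial>M) \<le> (\<integral>\<^sup>+w. f w \<partial>M)"
  and fail: "\<And>w. w \<in> space M \<Longrightarrow> \<bar>Q1 w - Q2 w\<bar> \<le> b + R1 w + R2 w"
  and inverse: "\<And>w. w \<in> A \<Longrightarrow> \<bar>Q1 (\<Psi> w) - Q2 w\<bar> \<le> b + R1 (\<Psi> w) + R2 w"
  and success: "\<And>w. w \<in> A \<Longrightarrow> \<bar>Q1 w - Q2 (\<Psi> w)\<bar> \<le> \<eta>"
  and R0: "\<And>w. R1 w \<ge> 0" "\<And>w. R2 w \<ge> 0"
 shows "\<bar>expectation Q1 - expectation Q2\<bar>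
  \<le> b - c / 2 * prob A * (b - \<eta>) + expectation R1 + expectation R2"
proof -
 have int [simp]: "integrable M Q1" "integrable M Q2" "integrable M R1" "integrable M R2"
  by (rule integrable_const_bound[where B=K]; use Q R in simp)+
 have key: "c / 2 * prob A * (b - \<eta>) \<le> expectation P"
  if P [measurable]: "P \<in> borel_measurable M" and P0: "\<And>w. w \<in> space M \<Longrightarrow> P w \<ge> 0" and iP: "integrable M P"
   and PA: "\<And>w. w \<in> A \<Longrightarrow> P w + P (\<Psi> w) \<ge> b - \<eta>" for P
 proof -
  have sp: "w \<in> A \<Longrightarrow> w \<in> space M" "w \<in> space M \<Longrightarrow> \<Psi> w \<in> space M" for w
   using sets.sets_into_space[OF A] measurable_space[OF assms(5)] by auto
  have "ennreal (c * prob A * (b - \<eta>)) = ennreal c * (\<integral>\<^sup>+w. ennreal (b - \<eta>) * indicator A w \<partial>M)"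
   using c by (subst nn_integral_cmult) (auto simp: emeasure_eq_measure ennreal_mult''[symmetric]
     ennreal_mult'[symmetric] ac_simps)
  also have "... \<le> ennreal c * (\<integral>\<^sup>+w. ennreal (P w) * indicator A w + ennreal (P (\<Psi> w)) * indicator A w \<partial>M)"
  proof (intro mult_left_mono nn_integral_mono)
   fix w show "ennreal (b - \<eta>) * indicator A w \<le> ennreal (P w) * indicator A w + ennreal (P (\<Psi> w)) * indicator A w"
   proof (cases "w \<in> A")
    case True
    then have "ennreal (b - \<eta>) \<le> ennreal (P w + P (\<Psi> w))" using PA by (intro ennreal_leI)
    also have "... = ennreal (P w) + ennreal (P (\<Psi> w))" using True sp P0 by (intro ennreal_plus) auto
    finally show ?thesis using True by simp
   qed simp
  qed simp
  also have "... = ennreal c * (\<integral>\<^sup>+w. ennreal (P w) * indicator A w \<partial>M) + ennreal c * (\<integral>\<^sup>+w. ennreal (P (\<Psi> w)) * indicator A w \<partial>M)"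
   by (subst nn_integral_add) (auto simp: distrib_left)
  also have "... \<le> (\<integral>\<^sup>+w. ennreal (P w) \<partial>M) + (\<integral>\<^sup>+w. ennreal (P w) \<partial>M)"
  proof (rule add_mono)
   have "ennreal c * (\<integral>\<^sup>+w. ennreal (P w) * indicator A w \<partial>M) \<le> 1 * (\<integral>\<^sup>+w. ennreal (P w) \<partial>M)"
    using c by (intro mult_mono nn_integral_mono) (auto split: split_indicator)
   then show "ennreal c * (\<integral>\<^sup>+w. ennreal (P w) * indicator A w \<partial>M) \<le> (\<integral>\<^sup>+w. ennreal (P w) \<partial>M)" by simp
  qed (rule dom, measurable)
  also have "(\<integral>\<^sup>+w. ennreal (P w) \<partial>M) = ennreal (expectation P)"
   using iP P0 by (intro nn_integral_eq_integral) auto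
  finally have "ennreal (c * prob A * (b - \<eta>)) \<le> ennreal (2 * expectation P)"
   using P0 by (subst (asm) ennreal_plus[symmetric]) (auto intro: integral_nonneg_AE)
  moreover have "expectation P \<ge> 0" using P0 by (auto intro: integral_nonneg_AE)
  ultimately show ?thesis by (simp add: ennreal_le_iff2 field_simps) linarith
 qed
 have "c / 2 * prob A * (b - \<eta>) \<le> expectation (\<lambda>w. Q2 w + b + R1 w + R2 w - Q1 w)"
 proof (rule key)
  show "Q2 w + b + R1 w + R2 w - Q1 w \<ge> 0" if "w \<in> space M" for w using fail[OF that] by linarith
  \<comment> \<open>\<open>success\<close> pairs Q1 at w with Q2 at \<Psi> w and
    \<open>inverse\<close> the other two values; the terms R1 w and R2 (\<Psi> w) left over are
    nonnegative.\<close>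
  show "Q2 w + b + R1 w + R2 w - Q1 w + (Q2 (\<Psi> w) + b + R1 (\<Psi> w) + R2 (\<Psi> w) - Q1 (\<Psi> w)) \<ge> b - \<eta>"
   if "w \<in> A" for w
   using inverse[OF that] success[OF that] R0(1)[of w] R0(2)[of "\<Psi> w"] by linarith
 qed auto
 moreover have "c / 2 * prob A * (b - \<eta>) \<le> expectation (\<lambda>w. Q1 w + b + R1 w + R2 w - Q2 w)"
 proof (rule key)
  show "Q1 w + b + R1 w + R2 w - Q2 w \<ge> 0" if "w \<in> space M" for w using fail[OF that] by linarith
  show "Q1 w + b + R1 w + R2 w - Q2 w + (Q1 (\<Psi> w) + b + R1 (\<Psi> w) + R2 (\<Psi> w) - Q2 (\<Psi> w)) \<ge> b - \<eta>"
   if "w \<in> A" for w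
   using inverse[OF that] success[OF that] R0(1)[of w] R0(2)[of "\<Psi> w"] by linarith
 qed auto
 ultimately show ?thesis by (simp add: prob_space)
qed

section \<open>Coupling through a shift of the innovations\<close>

text \<open>Entry m predicts the noise m + 1 steps ahead. One step later every horizon has shrunk by
  one and the new innovation u adds its coefficient times u. The noise acting on X is entry 0 plus
  u, since the leading coefficient is 1.\<close>

definition memory_step ::
 "((real ^ 'd) \<times> (real ^ 'd) \<Rightarrow> real ^ 'd) \<Rightarrow> (nat \<Rightarrow> real) \<Rightarrow>
  (real ^ 'd) \<times> (nat \<Rightarrow> real ^ 'd) \<Rightarrow> real ^ 'd \<Rightarrow> (real ^ 'd) \<times> (nat \<Rightarrow> real ^ 'd)" where
 "memory_step F a z u = (F (fst z, snd z 0 + u), \<lambda>m. snd z (Suc m) + a (Suc m) *\<^sub>R u)"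

primrec memory_chain ::
 "((real ^ 'd) \<times> (real ^ 'd) \<Rightarrow> real ^ 'd) \<Rightarrow> (nat \<Rightarrow> real) \<Rightarrow>
  (real ^ 'd) \<times> (nat \<Rightarrow> real ^ 'd) \<Rightarrow> (nat \<Rightarrow> real ^ 'd) \<Rightarrow> nat \<Rightarrow> (real ^ 'd) \<times> (nat \<Rightarrow> real ^ 'd)" where
 "memory_chain F a z w 0 = z"
| "memory_chain F a z w (Suc n) = memory_step F a (memory_chain F a z w n) (w n)"

lemma space_traj_space [simp]: "space traj_space = UNIV"
 by (simp add: space_PiM)

lemma space_state_space [simp]: "space state_space = UNIV"
 by (simp add: space_pair_measure)

locale memory_dynamics =
 fixes F :: "(real ^ 'd) \<times> (real ^ 'd) \<Rightarrow> real ^ 'd" and a :: "nat \<Rightarrow> real"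
 assumes F_continuous: "continuous_on UNIV F" and a_0: "a 0 = 1"
begin

abbreviation chain where "chain \<equiv> memory_chain F a"

lemma F_measurable [measurable]: "F \<in> borel_measurable (borel \<Otimes>\<^sub>M borel)"
 using F_continuous by (metis borel_measurable_continuous_onI borel_prod)

text \<open>The memory evolves without regard to X and is affine in the innovations. Hence under a
  common noise the difference of two memories is only read n entries further, without any new
  contribution.\<close>

lemma snd_chain: "snd (chain z w n) m = snd z (m + n) + (\<Sum>j<n. a (m + n - j) *\<^sub>R w j)"
proof (induction n arbitrary: m)
 case (Suc n)
 have "snd (chain z w (Suc n)) m = snd z (m + Suc n) + (\<Sum>j<n. a (m + Suc n - j) *\<^sub>R w j) + a (Suc m) *\<^sub>R w n"
  by (simp add: memory_step_def Suc.IH)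
 also have "a (Suc m) = a (m + Suc n - n)" by simp
 finally show ?case by (simp add: add.assoc)
qed simp

lemma fst_chain_Suc:
 "fst (chain z w (Suc n)) = F (fst (chain z w n), snd z n + (\<Sum>j\<le>n. a (n - j) *\<^sub>R w j))"
 by (simp add: memory_step_def snd_chain lessThan_Suc_atMost[symmetric] a_0 add.assoc)

lemma chain_cong: "(\<And>i. i < n \<Longrightarrow> w i = w' i) \<Longrightarrow> chain z w n = chain z w' n"
 by (induction n) auto

lemma chain_comb_seq_le: "n \<le> i \<Longrightarrow> chain z (comb_seq i w w') n = chain z w n"
 by (rule chain_cong) (simp add: comb_seq_less)

lemma chain_comb_seq_add: "chain z (comb_seq i w w') (i + n) = chain (chain z w i) w' n"
proof (induction n)
 case 0 then show ?case by (simp add: chain_comb_seq_le)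
next
 case (Suc n)
 then show ?case using comb_seq_add[of i w w' n] by (simp add: add.commute)
qed

lemma memory_step_measurable [measurable (raw)]:
 assumes [measurable]: "f \<in> measurable M state_space" "g \<in> measurable M borel"
 shows "(\<lambda>x. memory_step F a (f x) (g x)) \<in> measurable M state_space"
proof -
 have [measurable]: "(\<lambda>x m. snd (f x) (Suc m) + a (Suc m) *\<^sub>R g x) \<in> measurable M traj_space"
  by (rule measurable_trajI) measurable
 show ?thesis unfolding memory_step_def by measurable
qed

lemma chain_measurable [measurable (raw)]:
 assumes [measurable]: "f \<in> measurable M state_space" "g \<in> measurable M traj_space"
 shows "(\<lambda>x. chain (f x) (g x) n) \<in> measurable M state_space"
 by (induction n) auto

definition path_prob where
 "path_prob A m z = measure noise {w. (\<lambda>k. fst (chain z w (m + k))) \<in> A}"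

lemma path_measurable [measurable (raw)]:
 assumes [measurable]: "f \<in> measurable M state_space" "g \<in> measurable M traj_space"
 shows "(\<lambda>x k. fst (chain (f x) (g x) (m + k))) \<in> measurable M traj_space"
 by (rule measurable_trajI) measurable

lemma path_event_sets:
 assumes [measurable]: "A \<in> sets traj_space"
 shows "{w. (\<lambda>k. fst (chain z w (m + k))) \<in> A} \<in> sets traj_space"
proof -
 have "{w. (\<lambda>k. fst (chain z w (m + k))) \<in> A} = {w \<in> space traj_space. (\<lambda>k. fst (chain z w (m + k))) \<in> A}"
  by (simp add: space_PiM)
 also have "... \<in> sets traj_space"
  by measurable
 finally show ?thesis .
qed

lemma emeasure_path_event:
 assumes [measurable]: "A \<in> sets traj_space"
 shows "emeasure noise {w. (\<lambda>k. fst (chain z w (m + k))) \<in> A}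
  = (\<E> w. indicator A (\<lambda>k. fst (chain z w (m + k))))"
proof -
 have "(\<E> w. indicator A (\<lambda>k. fst (chain z w (m + k))))
  = (\<E> w. indicator {w. (\<lambda>k. fst (chain z w (m + k))) \<in> A} w)"
  by (intro nn_integral_cong) (auto split: split_indicator)
 also have "... = emeasure noise {w. (\<lambda>k. fst (chain z w (m + k))) \<in> A}"
  using path_event_sets[OF assms] by (intro nn_integral_indicator) (simp add: sets_noise)
 finally show ?thesis ..
qed

lemma path_prob_bounds: "0 \<le> path_prob A m z" "path_prob A m z \<le> 1"
 by (auto simp: path_prob_def)

lemma path_prob_measurable [measurable]:
 assumes [measurable]: "A \<in> sets traj_space"
 shows "path_prob A m \<in> borel_measurable state_space"
proof -
 have "path_prob A m z = enn2real (\<E> w. indicator A (\<lambda>k. fst (chain z w (m + k))))" for z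
  by (simp add: path_prob_def measure_def emeasure_path_event)
 then have "path_prob A m = (\<lambda>z. enn2real (\<E> w. indicator A (\<lambda>k. fst (chain z w (m + k)))))" ..
 also have "... \<in> borel_measurable state_space" by measurable
 finally show ?thesis .
qed

text \<open>Markov property: the noise is split at time i into two independent blocks.\<close>

lemma path_prob_add:
 assumes [measurable]: "A \<in> sets traj_space"
 shows "path_prob A (i + m) z = (\<EE> w. path_prob A m (chain z w i))"
proof -
 have "ennreal (path_prob A (i + m) z) = (\<E> w. indicator A (\<lambda>k. fst (chain z w (i + m + k))))"
  by (simp add: path_prob_def emeasure_path_event[symmetric] noise.P.emeasure_eq_measure)
 also have "... = (\<E> w. (\<E> w'. indicator A (\<lambda>k. fst (chain z (comb_seq i w w') (i + m + k)))))"
  by (subst nn_integral_comb_seq_noise[where n=i]) auto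
 also have "... = (\<E> w. ennreal (path_prob A m (chain z w i)))"
  by (simp add: add.assoc chain_comb_seq_add emeasure_path_event[symmetric] path_prob_def
    noise.P.emeasure_eq_measure)
 also have "... = ennreal (\<EE> w. path_prob A m (chain z w i))"
  by (intro nn_integral_eq_integral noise.P.integrable_const_bound[where B=1])
    (auto simp: path_prob_bounds)
 finally show ?thesis
  by (subst (asm) ennreal_inj) (auto simp: path_prob_bounds intro: integral_nonneg_AE)
qed

text \<open>A deterministic shift \<open>h\<close> of the innovations absorbs the difference of the memories.\<close>

lemma path_prob_compensated:
 assumes A [measurable]: "A \<in> sets traj_space" and "fst z1 = fst z2"
  and h: "\<And>n. snd z1 n = snd z2 n + (\<Sum>j\<le>n. a (n - j) *\<^sub>R h j)"
  and s: "\<And>N. (\<Sum>i<N. h i \<bullet> h i) \<le> s\<^sup>2" "s \<ge> 0"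
 shows "\<bar>path_prob A m z1 - path_prob A m z2\<bar> \<le> 2 * s"
proof -
 have "fst (chain z1 w n) = fst (chain z2 (\<lambda>i. w i + h i) n)" for w n
 proof (induction n)
  case (Suc n)
  then show ?case unfolding fst_chain_Suc h
   by (simp add: scaleR_add_right sum.distrib algebra_simps)
 qed (use assms in simp)
 then have "path_prob A m z1
   = measure noise {w. (\<lambda>i. w i + h i) \<in> {w. (\<lambda>k. fst (chain z2 w (m + k))) \<in> A}}"
  by (simp add: path_prob_def)
 then show ?thesis
  using noise_shift_tv[OF path_event_sets[OF A, of z2 m] s] by (simp add: path_prob_def abs_minus_commute)
qed

end

section \<open>Compensation by the convolution inverse, and the jump\<close>

lemma convolution_inverse_coeffs:
 assumes "a 0 = 1"
 shows "(\<Sum>l\<le>n. a l * inverse_coeffs a (n - l)) = (if n = 0 then 1 else 0)"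
proof (cases n)
 case (Suc k)
 have "(\<Sum>l\<le>Suc k. a l * inverse_coeffs a (Suc k - l))
  = a 0 * inverse_coeffs a (Suc k) + (\<Sum>l\<in>{1..Suc k}. a l * inverse_coeffs a (Suc k - l))"
  by (simp add: atMost_atLeast0 sum.atLeast_Suc_atMost[of 0 "Suc k"] del: inverse_coeffs.simps sum.cl_ivl_Suc)
 also have "... = 0" using assms by simp
 finally show ?thesis using Suc by simp
qed (use assms in simp)

text \<open>Convolution with b, that is, division of formal power series by the one with
  coefficients a. It turns a prescribed difference \<open>s\<close> of the noises into the shift of
  the innovations that produces it.\<close>

definition compensation :: "(nat \<Rightarrow> real) \<Rightarrow> (nat \<Rightarrow> 'v::real_vector) \<Rightarrow> nat \<Rightarrow> 'v" where
 "compensation a s i = (\<Sum>j\<le>i. inverse_coeffs a (i - j) *\<^sub>R s j)"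

text \<open>Associativity of convolution: after exchanging the sums, the inner one is the
  convolution of a with its inverse.\<close>

lemma sum_compensation:
 assumes "a 0 = 1"
 shows "(\<Sum>j\<le>n. a (n - j) *\<^sub>R compensation a s j) = s n"
proof -
 have "(\<Sum>j\<le>n. a (n - j) *\<^sub>R compensation a s j)
  = (\<Sum>j\<le>n. \<Sum>k\<le>j. (a (n - j) * inverse_coeffs a (j - k)) *\<^sub>R s k)"
  by (simp add: compensation_def scaleR_sum_right)
 also have "... = (\<Sum>k\<le>n. \<Sum>j\<in>{k..n}. (a (n - j) * inverse_coeffs a (j - k)) *\<^sub>R s k)"
  unfolding sum.Sigma[OF finite_atMost ballI[OF finite_atMost]] sum.Sigma[OF finite_atMost ballI[OF finite_atLeastAtMost]]
  by (rule sum.reindex_bij_witness[of _ "\<lambda>(k, j). (j, k)" "\<lambda>(j, k). (k, j)"]) auto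
 also have "... = (\<Sum>k\<le>n. (if k = n then s k else 0))"
 proof (intro sum.cong refl)
  fix k assume k: "k \<in> {..n}"
  have "(\<Sum>j\<in>{k..n}. a (n - j) * inverse_coeffs a (j - k)) = (\<Sum>l\<le>n - k. a l * inverse_coeffs a (n - k - l))"
   using k by (intro sum.reindex_bij_witness[of _ "\<lambda>l. n - l" "\<lambda>j. n - j"]) auto
  also have "... = (if k = n then 1 else 0)"
   using convolution_inverse_coeffs[of a "n - k"] assms k by auto
  finally show "(\<Sum>j\<in>{k..n}. (a (n - j) * inverse_coeffs a (j - k)) *\<^sub>R s k) = (if k = n then s k else 0)"
   by (simp add: scaleR_sum_left[symmetric])
 qed
 also have "... = s n" by simp
 finally show ?thesis .
qed

lemma compensation_0: "a 0 = 1 \<Longrightarrow> compensation a s 0 = s 0"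
 by (simp add: compensation_def)

context memory_dynamics
begin

text \<open>\<open>G 0\<close> is a free displacement, used to make the states meet after one step
  although the first noises differ; hence \<open>conv\<close> only speaks of n > 0. From time 1 on
  the convolution of a with G cancels the difference of the memories, so both chains see the same
  noise and stay together. The part of G beyond L remains as a shift of fresh innovations and costs
  2 s.\<close>

lemma path_prob_success:
 assumes A: "A \<in> sets traj_space"
  and conv: "\<And>n. n > 0 \<Longrightarrow> (\<Sum>j\<le>n. a (n - j) *\<^sub>R G j) = snd z1 n - snd z2 n"
  and w': "\<And>i. i \<le> L \<Longrightarrow> w' i = w i + G i"
  and meet: "F (fst z1, w 0 + snd z1 0) = F (fst z2, w' 0 + snd z2 0)"
  and tail: "\<And>N. (\<Sum>i<N. G (Suc L + i) \<bullet> G (Suc L + i)) \<le> s\<^sup>2" "s \<ge> 0"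
 shows "\<bar>path_prob A m (chain z1 w (Suc L)) - path_prob A m (chain z2 w' (Suc L))\<bar> \<le> 2 * s"
proof (rule path_prob_compensated[OF A _ _ tail])
 have "fst (chain z1 w (Suc n)) = fst (chain z2 w' (Suc n))" if "n \<le> L" for n
  using that
 proof (induction n)
  case 0
  then show ?case using meet by (simp add: memory_step_def add.commute)
 next
  case (Suc n)
  have "(\<Sum>j\<le>Suc n. a (Suc n - j) *\<^sub>R w' j)
   = (\<Sum>j\<le>Suc n. a (Suc n - j) *\<^sub>R w j) + (\<Sum>j\<le>Suc n. a (Suc n - j) *\<^sub>R G j)"
   using Suc.prems w' by (simp add: scaleR_add_right sum.distrib[symmetric])
  moreover have "(\<Sum>j\<le>Suc n. a (Suc n - j) *\<^sub>R G j) = snd z1 (Suc n) - snd z2 (Suc n)" by (rule conv) simp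
  ultimately have "snd z1 (Suc n) + (\<Sum>j\<le>Suc n. a (Suc n - j) *\<^sub>R w j) = snd z2 (Suc n) + (\<Sum>j\<le>Suc n. a (Suc n - j) *\<^sub>R w' j)"
   by simp
  moreover have "fst (chain z1 w (Suc n)) = fst (chain z2 w' (Suc n))" using Suc by simp
  ultimately show ?case unfolding fst_chain_Suc[of _ _ "Suc n"] by (simp only:)
 qed
 then show "fst (chain z1 w (Suc L)) = fst (chain z2 w' (Suc L))" by simp
 fix n
 have *: "(\<Sum>j<Suc L. a (n + Suc L - j) *\<^sub>R w' j)
  = (\<Sum>j<Suc L. a (n + Suc L - j) *\<^sub>R w j) + (\<Sum>j<Suc L. a (n + Suc L - j) *\<^sub>R G j)"
  using w' by (simp add: scaleR_add_right sum.distrib[symmetric] del: sum.lessThan_Suc)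
 have "{..n + Suc L} = {..<Suc L} \<union> (\<lambda>j. Suc L + j) ` {..n}"
 proof (intro set_eqI iffI)
  fix x assume "x \<in> {..n + Suc L}"
  then show "x \<in> {..<Suc L} \<union> (\<lambda>j. Suc L + j) ` {..n}"
   by (cases "x < Suc L") (auto intro!: image_eqI[of _ _ "x - Suc L"])
 qed auto
 then have "(\<Sum>j\<le>n + Suc L. a (n + Suc L - j) *\<^sub>R G j)
  = (\<Sum>j<Suc L. a (n + Suc L - j) *\<^sub>R G j) + (\<Sum>j\<in>(\<lambda>j. Suc L + j) ` {..n}. a (n + Suc L - j) *\<^sub>R G j)"
  by (simp only:) (rule sum.union_disjoint, auto)
 also have "(\<Sum>j\<in>(\<lambda>j. Suc L + j) ` {..n}. a (n + Suc L - j) *\<^sub>R G j) = (\<Sum>j\<le>n. a (n - j) *\<^sub>R G (Suc L + j))"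
  by (subst sum.reindex) (auto simp: inj_on_def add.commute)
 finally show "snd (chain z1 w (Suc L)) n = snd (chain z2 w' (Suc L)) n + (\<Sum>j\<le>n. a (n - j) *\<^sub>R G (Suc L + j))"
  unfolding snd_chain * using conv[of "n + Suc L"] by (simp del: sum.lessThan_Suc add: algebra_simps)
qed

text \<open>The reciprocal of the domination constant: exp (B + H / 2) with B = 4 (H + 1) for the
  shifted innovations, times exp (r M + M^2 / 2) / c for the first one. It is capped at 1 as
  \<open>jump_inequality\<close> requires.\<close>

definition jump_const where
 "jump_const r M c H = min 1 (c / exp (4 * (H + 1) + H / 2 + r * M + M\<^sup>2 / 2))"

text \<open>The gain depends on r, M, c and H but not on the two states, so it is uniform over the
  compact set on which (H2) is used. The hypothesis \<open>fail\<close> concerns all pairs of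
  innovations at bounded squared distance, because it is applied both to equal innovations and to
  the crossed pair (\<Psi> w, w).\<close>

lemma jump_step:
 fixes z1 z2 :: "(real ^ 'd) \<times> (nat \<Rightarrow> real ^ 'd)"
 defines "G \<equiv> \<lambda>v. compensation a (\<lambda>j. if j = 0 then v else snd z1 j - snd z2 j)"
 assumes A [measurable]: "A \<in> sets traj_space"
  and inj: "inj \<Lambda>" and U: "open U" "negligible (- U)" "\<And>u. u \<in> U \<Longrightarrow> \<Lambda> differentiable at u"
  and meet: "\<And>u. u \<in> cball 0 r \<Longrightarrow> F (fst z1, u + snd z1 0) = F (fst z2, \<Lambda> u + snd z2 0)"
  and det: "c > 0" "\<And>u. u \<in> cball 0 r \<Longrightarrow> u \<in> U \<Longrightarrow> \<bar>det (jacobian \<Lambda> (at u))\<bar> \<ge> c"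
  and M: "\<And>u. norm (\<Lambda> u - u) \<le> M"
  and H: "\<And>v N. norm v \<le> M \<Longrightarrow> (\<Sum>i<N. G v (Suc i) \<bullet> G v (Suc i)) \<le> H"
  and tail: "\<And>v N. norm v \<le> M \<Longrightarrow> (\<Sum>i<N. G v (Suc L + i) \<bullet> G v (Suc L + i)) \<le> s\<^sup>2" "s \<ge> 0"
  and R [measurable]: "R \<in> borel_measurable state_space" and R_bounds: "\<And>z. 0 \<le> R z" "\<And>z. R z \<le> K"
  and fail: "\<And>w w'. (\<Sum>i<Suc L. (w' i - w i) \<bullet> (w' i - w i)) \<le> M\<^sup>2 + H \<Longrightarrow>
   \<bar>path_prob A m (chain z1 w (Suc L)) - path_prob A m (chain z2 w' (Suc L))\<bar>
    \<le> b + R (chain z1 w (Suc L)) + R (chain z2 w' (Suc L))"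
  and b: "2 * s \<le> b"
 shows "\<bar>path_prob A (Suc L + m) z1 - path_prob A (Suc L + m) z2\<bar>
  \<le> b - jump_const r M c H * measure gauss (cball 0 r :: (real ^ 'd) set) / 4 * (b - 2 * s)
   + (\<EE> w. R (chain z1 w (Suc L))) + (\<EE> w. R (chain z2 w (Suc L)))"
proof -
 have M0: "M \<ge> 0" using norm_ge_zero M by (rule order_trans)
 have H0: "H \<ge> 0" using H[of 0 0] M0 by simp
 have G0: "G v 0 = v" for v by (simp add: G_def compensation_0 a_0)
 \<comment> \<open>Regularity of \<Lambda> is known on U only; cutting it off outside gives a Borel
   map that agrees with \<Lambda> almost everywhere.\<close>
 define \<Lambda>0 where "\<Lambda>0 u = indicator U u *\<^sub>R \<Lambda> u" for u
 have U_borel [measurable]: "U \<in> sets borel" using U by simp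
 have \<Lambda>0 [measurable]: "\<Lambda>0 \<in> borel_measurable borel"
  unfolding \<Lambda>0_def
  using U by (intro borel_measurable_continuous_on_indicator U_borel differentiable_imp_continuous_on)
   (auto simp: differentiable_on_def intro: differentiable_at_withinI)
 have \<Lambda>0_eq: "\<Lambda>0 u = \<Lambda> u" if "u \<in> U" for u using that by (simp add: \<Lambda>0_def)
 define W where "W = cball 0 r \<inter> U"
 have W [measurable]: "W \<in> sets borel" unfolding W_def by measurable
 \<comment> \<open>The shift of innovation i + 1. It depends on the first innovation through the
   displacement, and it stops after L entries so that only a finite-dimensional density is
   involved.\<close>
 define g where "g u i = (if i < L then G (\<Lambda>0 u - u) (Suc i) else 0)" for u i
 have g [measurable]: "(\<lambda>u. g u i) \<in> borel_measurable borel" for i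
 proof -
  have *: "(\<lambda>u. (if j = 0 then \<Lambda>0 u - u else snd z1 j - snd z2 j)) \<in> borel_measurable borel" for j
   by (cases "j = 0") auto
  show ?thesis unfolding g_def G_def compensation_def using * by (cases "i < L") auto
 qed
 have WM: "norm (\<Lambda>0 u - u) \<le> M" if "u \<in> W" for u
  using M[of u] that by (simp add: W_def \<Lambda>0_eq)
 have gH: "(\<Sum>i<L. g u i \<bullet> g u i) \<le> H" if "u \<in> W" for u
  using H[OF WM[OF that], of L] by (simp add: g_def)
 let ?E = "exp (r * M + M\<^sup>2 / 2)"
 have dom1: "(\<integral>\<^sup>+u. q (\<Lambda>0 u) * indicator W u \<partial>gauss) \<le> ennreal (?E / c) * (\<integral>\<^sup>+u. q u \<partial>gauss)"
  if [measurable]: "q \<in> borel_measurable borel" for q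
 proof (rule nn_integral_gauss_change_of_variables_le[where f' = "\<lambda>u. frechet_derivative \<Lambda> (at u)"])
  show "W \<subseteq> cball 0 r" by (simp add: W_def)
  show "(\<Lambda>0 has_derivative frechet_derivative \<Lambda> (at u)) (at u within W)" if "u \<in> W" for u
  proof -
   have "(\<Lambda> has_derivative frechet_derivative \<Lambda> (at u)) (at u)"
    using U(3) that by (simp add: W_def frechet_derivative_works)
   then have "(\<Lambda> has_derivative frechet_derivative \<Lambda> (at u)) (at u within W)"
    by (rule has_derivative_at_withinI)
   then show ?thesis
    by (rule has_derivative_transform[rotated 2]) (use that in \<open>auto simp: W_def \<Lambda>0_eq\<close>)
  qed
  show "inj_on \<Lambda>0 W" using inj by (auto simp: inj_on_def W_def \<Lambda>0_eq)
  show "c \<le> \<bar>det (matrix (frechet_derivative \<Lambda> (at u)))\<bar>" if "u \<in> W" for u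
   using det(2)[of u] that by (simp add: W_def jacobian_def)
 qed (use det(1) WM that in auto)
 \<comment> \<open>Large enough for 16 H \<le> B^2, and positive even if H = 0.\<close>
 define B where "B = 4 * (H + 1)"
 define \<Psi> where "\<Psi> w = case_nat (\<Lambda>0 (w 0)) (\<lambda>i. w (Suc i) + g (w 0) i)" for w
 define S where "S = {w. w 0 \<in> W \<and> (\<Sum>i<L. g (w 0) i \<bullet> w (Suc i)) \<le> B}"
 have [measurable]: "(\<lambda>w. g (w 0) i) \<in> borel_measurable traj_space" for i
  by (rule measurable_compose[OF _ g]) measurable
 have S [measurable]: "S \<in> sets traj_space"
 proof -
  have "S = {w \<in> space traj_space. w 0 \<in> W \<and> (\<Sum>i<L. g (w 0) i \<bullet> w (Suc i)) \<le> B}"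
   by (simp add: S_def)
  also have "... \<in> sets traj_space" by measurable
  finally show ?thesis .
 qed
 have \<Psi> [measurable]: "\<Psi> \<in> measurable traj_space traj_space"
  unfolding \<Psi>_def by (intro case_nat_measurable_traj measurable_trajI) measurable
 have probS: "measure gauss (cball 0 r :: (real ^ 'd) set) / 2 \<le> measure noise S"
 proof -
  have "measure gauss (cball 0 r :: (real ^ 'd) set) = measure gauss W"
  proof (rule measure_eq_AE)
   \<comment> \<open>U has full Lebesgue measure, hence full Gaussian measure, so nothing is lost by
     intersecting the ball with U.\<close>
   have "AE u in lebesgue. u \<in> U"
    using AE_not_in[of "- U" lebesgue] U(2) by (simp add: negligible_iff_null_sets)
   then have "AE u in lborel. u \<in> U" by (simp add: AE_completion_iff)
   then show "AE x in gauss. (x \<in> cball 0 r) = (x \<in> W)"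
    unfolding gauss_def by (subst AE_density) (auto simp: W_def)
  qed (auto simp: gauss_def)
  moreover have "measure gauss W / 2 \<le> measure noise S"
   unfolding S_def
  proof (rule jump_set_prob[where H=H])
   have "16 * H \<le> 16 * (H + 1) * (H + 1)" using H0 by (simp add: algebra_simps)
   then show "16 * H \<le> B\<^sup>2" by (simp add: B_def power2_eq_square algebra_simps)
  qed (use H0 gH in \<open>auto simp: B_def\<close>)
  ultimately show ?thesis by simp
 qed
 define \<gamma> where "\<gamma> = jump_const r M c H"
 have \<gamma>: "0 \<le> \<gamma>" "\<gamma> \<le> 1" "\<gamma> \<le> c / exp (B + H / 2 + r * M + M\<^sup>2 / 2)"
  using det(1) by (auto simp: \<gamma>_def jump_const_def B_def)
 have \<Psi>_shift: "\<Psi> w i = w i + G (\<Lambda> (w 0) - w 0) i" if "w \<in> S" "i \<le> L" for w i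
  using that by (cases i) (auto simp: \<Psi>_def g_def S_def W_def \<Lambda>0_eq G0)
 \<comment> \<open>The perturbation has bounded squared norm, the first displacement contributing
   M^2 and the shifts H; this admits the crossed pair in \<open>fail\<close>.\<close>
 have \<Psi>_norm: "(\<Sum>i<Suc L. (\<Psi> w i - w i) \<bullet> (\<Psi> w i - w i)) \<le> M\<^sup>2 + H" if "w \<in> S" for w
 proof -
  let ?v = "\<Lambda> (w 0) - w 0"
  have "(\<Sum>i<Suc L. (\<Psi> w i - w i) \<bullet> (\<Psi> w i - w i)) = (\<Sum>i<Suc L. G ?v i \<bullet> G ?v i)"
   using \<Psi>_shift[OF that] by (intro sum.cong) auto
  also have "... = ?v \<bullet> ?v + (\<Sum>i<L. G ?v (Suc i) \<bullet> G ?v (Suc i))"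
   by (simp add: sum.lessThan_Suc_shift G0 del: sum.lessThan_Suc)
  also have "?v \<bullet> ?v \<le> M\<^sup>2" using M[of "w 0"] by (simp add: power2_norm_eq_inner[symmetric] power_mono)
  also have "(\<Sum>i<L. G ?v (Suc i) \<bullet> G ?v (Suc i)) \<le> H" using M by (rule H)
  finally show ?thesis by simp
 qed
 define e where "e = path_prob A m"
 have [measurable]: "e \<in> borel_measurable state_space" unfolding e_def by measurable
 have "\<bar>(\<EE> w. e (chain z1 w (Suc L))) - (\<EE> w. e (chain z2 w (Suc L)))\<bar>
  \<le> b - \<gamma> / 2 * measure noise S * (b - 2 * s)
   + (\<EE> w. R (chain z1 w (Suc L))) + (\<EE> w. R (chain z2 w (Suc L)))"
 proof (rule noise.P.jump_inequality[where \<Psi>=\<Psi> and K="max 1 K"])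
  show "\<bar>e (chain z1 w (Suc L))\<bar> \<le> max 1 K" "\<bar>e (chain z2 w (Suc L))\<bar> \<le> max 1 K" for w
   using path_prob_bounds[of A m] by (auto simp: e_def le_max_iff_disj)
  show "\<bar>R (chain z1 w (Suc L))\<bar> \<le> max 1 K" "\<bar>R (chain z2 w (Suc L))\<bar> \<le> max 1 K" for w
   using R_bounds by (auto simp: le_max_iff_disj)
  show "\<bar>e (chain z1 w (Suc L)) - e (chain z2 w (Suc L))\<bar> \<le> b + R (chain z1 w (Suc L)) + R (chain z2 w (Suc L))" for w
   unfolding e_def by (rule fail) (use H0 in simp)
  show "\<bar>e (chain z1 (\<Psi> w) (Suc L)) - e (chain z2 w (Suc L))\<bar> \<le> b + R (chain z1 (\<Psi> w) (Suc L)) + R (chain z2 w (Suc L))"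
   if "w \<in> S" for w
  proof -
   have "(\<Sum>i<Suc L. (w i - \<Psi> w i) \<bullet> (w i - \<Psi> w i)) = (\<Sum>i<Suc L. (\<Psi> w i - w i) \<bullet> (\<Psi> w i - w i))"
    by (intro sum.cong) (auto simp: algebra_simps)
   then show ?thesis unfolding e_def using \<Psi>_norm[OF that] by (intro fail) simp
  qed
  show "\<bar>e (chain z1 w (Suc L)) - e (chain z2 (\<Psi> w) (Suc L))\<bar> \<le> 2 * s" if "w \<in> S" for w
   unfolding e_def
  proof (rule path_prob_success[where G="G (\<Lambda> (w 0) - w 0)", OF A])
   show "F (fst z1, w 0 + snd z1 0) = F (fst z2, \<Psi> w 0 + snd z2 0)"
    using meet[of "w 0"] that by (simp add: \<Psi>_def S_def W_def \<Lambda>0_eq)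
   show "(\<Sum>i<N. G (\<Lambda> (w 0) - w 0) (Suc L + i) \<bullet> G (\<Lambda> (w 0) - w 0) (Suc L + i)) \<le> s\<^sup>2" for N
    using M by (rule tail)
   show "(\<Sum>j\<le>n. a (n - j) *\<^sub>R G (\<Lambda> (w 0) - w 0) j) = snd z1 n - snd z2 n" if "n > 0" for n
    unfolding G_def sum_compensation[of a, OF a_0] using that by simp
  qed (use \<Psi>_shift[OF that] tail in auto)
  show "ennreal \<gamma> * (\<E> w. f (\<Psi> w) * indicator S w) \<le> (\<E> w. f w)"
   if "f \<in> borel_measurable noise" for f
  proof -
   have [measurable]: "f \<in> borel_measurable traj_space" using that by (simp cong: measurable_cong_sets[OF sets_noise refl])
   have "(\<E> w. f (\<Psi> w) * indicator S w)
    \<le> ennreal (exp (B + H / 2)) * ennreal (?E / c) * (\<E> w. f w)"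
    unfolding \<Psi>_def S_def by (rule jump_dominated[OF \<Lambda>0 W dom1 g _ gH]) (auto simp: g_def)
   then have "ennreal \<gamma> * (\<E> w. f (\<Psi> w) * indicator S w)
    \<le> ennreal \<gamma> * (ennreal (exp (B + H / 2)) * ennreal (?E / c) * (\<E> w. f w))"
    by (rule mult_left_mono) simp
   also have "... = ennreal (\<gamma> * (exp (B + H / 2) * (?E / c))) * (\<E> w. f w)"
   proof -
    have "ennreal (\<gamma> * (x * y)) = ennreal \<gamma> * (ennreal x * ennreal y)" if "x \<ge> 0" "y \<ge> 0" for x y
     using that \<gamma>(1) by (simp add: ennreal_mult)
    from this[of "exp (B + H / 2)" "?E / c"] det(1) show ?thesis by (simp add: mult.assoc)
   qed
   also have "... \<le> ennreal 1 * (\<E> w. f w)"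
   proof (intro mult_right_mono ennreal_leI)
    have "\<gamma> * (exp (B + H / 2) * (?E / c)) \<le> c / exp (B + H / 2 + r * M + M\<^sup>2 / 2) * (exp (B + H / 2) * (?E / c))"
     using \<gamma>(3) det(1) by (intro mult_right_mono) auto
    also have "... = 1" using det(1) by (simp add: exp_add[symmetric] field_simps)
    finally show "\<gamma> * (exp (B + H / 2) * (?E / c)) \<le> 1" .
   qed simp
   finally show ?thesis by simp
  qed
 qed (use \<gamma> R_bounds in \<open>auto cong: measurable_cong_sets[OF sets_noise sets_noise]\<close>)
 also have "b - \<gamma> / 2 * measure noise S * (b - 2 * s)
  \<le> b - \<gamma> * measure gauss (cball 0 r :: (real ^ 'd) set) / 4 * (b - 2 * s)"
 proof -
  have "\<gamma> / 2 * (measure gauss (cball 0 r :: (real ^ 'd) set) / 2) * (b - 2 * s) \<le> \<gamma> / 2 * measure noise S * (b - 2 * s)"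
   using probS \<gamma> b by (intro mult_right_mono mult_left_mono) auto
  then show ?thesis by (simp add: algebra_simps)
 qed
 finally show ?thesis unfolding path_prob_add[OF A] e_def \<gamma>_def by simp
qed

end

lemma (in prob_space) bounded_expectation:
 fixes f :: "'a \<Rightarrow> real"
 assumes "f \<in> borel_measurable M" "\<And>x. 0 \<le> f x" "\<And>x. f x \<le> K"
 shows "integrable M f" "0 \<le> expectation f" "expectation f \<le> K"
proof -
 show "integrable M f" using assms by (intro integrable_const_bound[where B=K]) auto
 then show "0 \<le> expectation f" "expectation f \<le> K"
  using assms by (auto intro!: integral_nonneg_AE integral_le_const)
qed

section \<open>Backward induction over the trials\<close>

context memory_dynamics
begin

lemma integral_chain_add:
 fixes f :: "_ \<Rightarrow> real"
 assumes [measurable]: "f \<in> borel_measurable state_space" and f: "\<And>z. 0 \<le> f z" "\<And>z. f z \<le> K"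
 shows "(\<EE> w. (\<EE> w'. f (chain (chain z w i) w' j))) = (\<EE> w. f (chain z w (i + j)))"
proof -
 have eq: "(\<E> w. ennreal (f (chain z w n))) = ennreal (\<EE> w. f (chain z w n))" for z n
  by (intro nn_integral_eq_integral noise.P.bounded_expectation(1)[where K=K] AE_I2 f) measurable
 have bnd: "0 \<le> (\<EE> w'. f (chain z w' j))" "(\<EE> w'. f (chain z w' j)) \<le> K" for z
  by (rule noise.P.bounded_expectation(2)[where K="K"] noise.P.bounded_expectation(3); (rule f | measurable))+
 have "ennreal (\<EE> w. f (chain z w (i + j))) = (\<E> w. ennreal (f (chain z w (i + j))))"
  by (simp add: eq)
 also have "... = (\<E> w. (\<E> w'. ennreal (f (chain (chain z w i) w' j))))"
  by (subst nn_integral_comb_seq_noise[where n=i]) (auto simp: chain_comb_seq_add)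
 also have "... = (\<E> w. ennreal (\<EE> w'. f (chain (chain z w i) w' j)))"
  by (simp add: eq)
 also have "... = ennreal (\<EE> w. (\<EE> w'. f (chain (chain z w i) w' j)))"
  by (intro nn_integral_eq_integral noise.P.bounded_expectation(1)[where K=K] AE_I2 bnd) measurable
 finally show ?thesis
  by (subst (asm) ennreal_inj) (auto intro!: integral_nonneg_AE AE_I2 bnd f)
qed

text \<open>The expected number of trials, among those started at times 0, \<tau>, 2 \<tau>, ..., at
  whose start \<open>Y\<close> exceeds 1. For such a trial only the trivial bound 1 is available,
  and these costs are collected here.\<close>

primrec escape :: "((real ^ 'd) \<times> (nat \<Rightarrow> real ^ 'd) \<Rightarrow> real) \<Rightarrow> nat \<Rightarrow> nat \<Rightarrow> (real ^ 'd) \<times> (nat \<Rightarrow> real ^ 'd) \<Rightarrow> real" where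
 "escape Y \<tau> 0 z = 0"
| "escape Y \<tau> (Suc k) z = indicator {z. 1 < Y z} z + (\<EE> w. escape Y \<tau> k (chain z w \<tau>))"

lemma escape_measurable [measurable]:
 assumes [measurable]: "Y \<in> borel_measurable state_space"
 shows "escape Y \<tau> k \<in> borel_measurable state_space"
proof (induction k)
 case (Suc k)
 note [measurable] = Suc
 have [measurable]: "{z. 1 < Y z} \<in> sets state_space"
 proof -
  have "{z. 1 < Y z} = {z \<in> space state_space. 1 < Y z}" by simp
  also have "... \<in> sets state_space" by measurable
  finally show ?thesis .
 qed
 show ?case by simp
qed simp

lemma escape_bounds:
 assumes [measurable]: "Y \<in> borel_measurable state_space"
 shows "0 \<le> escape Y \<tau> k z" "escape Y \<tau> k z \<le> real k"
proof (induction k arbitrary: z)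
 case (Suc k)
 have I: "0 \<le> (\<EE> w. escape Y \<tau> k (chain z w \<tau>))"
  "(\<EE> w. escape Y \<tau> k (chain z w \<tau>)) \<le> real k" for z
  by (rule noise.P.bounded_expectation(2)[where K="real k"] noise.P.bounded_expectation(3); (rule Suc | measurable))+
 have *: "0 \<le> escape Y \<tau> (Suc k) z" "escape Y \<tau> (Suc k) z \<le> real (Suc k)" for z
  using I[of z] by (auto split: split_indicator)
 { case 1 show ?case by (rule *) }
 { case 2 show ?case by (rule *) }
qed auto

text \<open>A trial may enlarge the difference of the memories by \<kappa> m^(-\<alpha>), whether it
  succeeds or not. With k trials ahead the difference must therefore leave a margin of k \<kappa>,
  and after one of them the margin for the others is intact. If \<open>Y\<close> is small at both
  points, both chains are in \<open>G1\<close> after T steps with probability at least 1/2; there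
  the jump gains \<delta> (b - 2 s), elsewhere nothing is lost.\<close>

lemma trial_bound:
 fixes K r M c H :: real and G1 :: "((real ^ 'd) \<times> (nat \<Rightarrow> real ^ 'd)) set"
 defines "G1 \<equiv> {z. fst z \<in> cball 0 K \<and> snd z 0 \<in> cball 0 K}"
 defines "\<delta> \<equiv> jump_const r M c H * measure gauss (cball 0 r :: (real ^ 'd) set) / 4"
 assumes H2: "\<And>x x' y y'. x \<in> cball 0 K \<Longrightarrow> x' \<in> cball 0 K \<Longrightarrow> y \<in> cball 0 K \<Longrightarrow> y' \<in> cball 0 K \<Longrightarrow>
     \<exists>\<Lambda>. bij \<Lambda> \<and>
      (\<exists>U D. open U \<and> open D \<and> negligible (- U) \<and> negligible (- D) \<and> C1_diffeo U D \<Lambda> \<and>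
        (\<forall>u\<in>cball 0 r.
         F (x, u + y) = F (x', \<Lambda> u + y') \<and>
         (u \<in> U \<longrightarrow> \<bar>det (jacobian \<Lambda> (at u))\<bar> \<ge> c))) \<and>
      (\<forall>u. norm (\<Lambda> u - u) \<le> M)"
  and c: "c > 0" and A [measurable]: "A \<in> sets traj_space" and Y [measurable]: "Y \<in> borel_measurable state_space"
  and \<alpha>: "\<alpha> \<ge> 0" and \<kappa>: "\<kappa> \<ge> 0" and H0: "H \<ge> 0" and s: "s \<ge> 0"
  and comp: "\<And>q v N. (\<And>m. m \<ge> 1 \<Longrightarrow> norm (q m) \<le> real m powr (- \<alpha>)) \<Longrightarrow> norm v \<le> M \<Longrightarrow>
    (\<Sum>i<N. (norm (compensation a (\<lambda>j. if j = 0 then v else q j :: real ^ 'd) (Suc i)))\<^sup>2) \<le> H"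
  and comp_tail: "\<And>q v N. (\<And>m. m \<ge> 1 \<Longrightarrow> norm (q m) \<le> real m powr (- \<alpha>)) \<Longrightarrow> norm v \<le> M \<Longrightarrow>
    (\<Sum>i<N. (norm (compensation a (\<lambda>j. if j = 0 then v else q j :: real ^ 'd) (Suc L + i)))\<^sup>2) \<le> s\<^sup>2"
  and influence: "\<And>m g. m \<ge> 1 \<Longrightarrow> (\<Sum>j<Suc L. (norm (g j :: real ^ 'd))\<^sup>2) \<le> M\<^sup>2 + H \<Longrightarrow>
    norm (\<Sum>j<Suc L. a (m + T + Suc L - j) *\<^sub>R g j) \<le> \<kappa> * real m powr (- \<alpha>)"
  and return: "\<And>z1 z2. Y z1 \<le> 1 \<Longrightarrow> Y z2 \<le> 1 \<Longrightarrow>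
    1 / 2 \<le> measure noise {w. chain z1 w T \<in> G1 \<and> chain z2 w T \<in> G1}"
  and k: "real k * \<kappa> \<le> 1"
  and z: "\<And>m. m \<ge> 1 \<Longrightarrow> norm (snd z1 (m + T) - snd z2 (m + T)) \<le> (1 - real k * \<kappa>) * real m powr (- \<alpha>)"
 shows "\<bar>path_prob A (k * (T + Suc L) + m) z1 - path_prob A (k * (T + Suc L) + m) z2\<bar>
  \<le> 2 * s + (1 - \<delta> / 2) ^ k + escape Y (T + Suc L) k z1 + escape Y (T + Suc L) k z2"
 using k z
proof (induction k arbitrary: z1 z2)
 case 0
 then show ?case using path_prob_bounds[of A m z1] path_prob_bounds[of A m z2] s by simp
next
 case (Suc k)
 define \<tau> where "\<tau> = T + Suc L"
 have \<delta>: "0 \<le> \<delta>" "\<delta> \<le> 1"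
 proof -
  have j: "0 \<le> jump_const r M c H" "jump_const r M c H \<le> 1" using c by (auto simp: jump_const_def)
  then show "0 \<le> \<delta>" by (simp add: \<delta>_def)
  have "jump_const r M c H * measure gauss (cball 0 r :: (real ^ 'd) set) \<le> 1 * 1"
   using j by (intro mult_mono) auto
  then show "\<delta> \<le> 1" by (simp add: \<delta>_def)
 qed
 \<comment> \<open>The bound for the remaining k trials without the escape terms. It stays above 2
   s, the price of a success, so the gain of a jump is never negative.\<close>
 define b where "b = 2 * s + (1 - \<delta> / 2) ^ k"
 have b: "2 * s \<le> b" using \<delta> by (simp add: b_def)
 have b_Suc: "b - \<delta> / 2 * (b - 2 * s) = 2 * s + (1 - \<delta> / 2) ^ Suc k"
  by (simp add: b_def algebra_simps)
 let ?R = "escape Y \<tau> k"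
 show ?case
 proof (cases "Y z1 \<le> 1 \<and> Y z2 \<le> 1")
  \<comment> \<open>The indicators in \<open>escape\<close> already exceed the trivial bound
    1.\<close>
  case False
  have "0 \<le> (\<EE> w. ?R (chain z1 w \<tau>))" "0 \<le> (\<EE> w. ?R (chain z2 w \<tau>))"
   by (intro integral_nonneg_AE AE_I2 escape_bounds[OF Y])+
  moreover have "0 \<le> (1 - \<delta> / 2) ^ Suc k" using \<delta> by (intro zero_le_power) auto
  moreover have "1 \<le> indicator {z. 1 < Y z} z1 + (indicator {z. 1 < Y z} z2 :: real)"
   using False by (auto split: split_indicator)
  moreover have "\<bar>path_prob A (Suc k * (T + Suc L) + m) z1 - path_prob A (Suc k * (T + Suc L) + m) z2\<bar> \<le> 1"
   using path_prob_bounds[of A _ z1] path_prob_bounds[of A _ z2] by (smt (verit))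
  ultimately show ?thesis using s unfolding escape.simps \<tau>_def[symmetric] by linarith
 next
  case True
  define e where "e = path_prob A (Suc L + (k * \<tau> + m))"
  have e_bounds: "0 \<le> e z" "e z \<le> 1" for z by (auto simp: e_def path_prob_bounds)
  have [measurable]: "e \<in> borel_measurable state_space" unfolding e_def by measurable
  define J where "J z = (\<EE> w. ?R (chain z w (Suc L)))" for z
  have J_bounds: "0 \<le> J z" "J z \<le> real k" for z
   unfolding J_def by (rule noise.P.bounded_expectation(2)[where K="real k"] noise.P.bounded_expectation(3); (rule escape_bounds[OF Y] | measurable))+
  have [measurable]: "J \<in> borel_measurable state_space" unfolding J_def by measurable
  define S where "S = {w. chain z1 w T \<in> G1 \<and> chain z2 w T \<in> G1}"
  have G1 [measurable]: "G1 \<in> sets state_space"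
  proof -
   have "G1 = {z \<in> space state_space. norm (fst z) \<le> K \<and> norm (snd z 0) \<le> K}" by (simp add: G1_def)
   also have "... \<in> sets state_space" by measurable
   finally show ?thesis .
  qed
  have S [measurable]: "S \<in> sets traj_space"
  proof -
   have "S = {w \<in> space traj_space. chain z1 w T \<in> G1 \<and> chain z2 w T \<in> G1}" by (simp add: S_def)
   also have "... \<in> sets traj_space" by measurable
   finally show ?thesis .
  qed
  have wait: "\<bar>e (chain z1 w T) - e (chain z2 w T)\<bar>
   \<le> b - \<delta> * (b - 2 * s) * indicator S w + J (chain z1 w T) + J (chain z2 w T)" for w
  proof -
   let ?z1 = "chain z1 w T" and ?z2 = "chain z2 w T"
   have diff: "snd ?z1 n - snd ?z2 n = snd z1 (n + T) - snd z2 (n + T)" for n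
    by (simp add: snd_chain)
   \<comment> \<open>The induction hypothesis after the trial. The memories are compared from entry
     T on only, because the next trial begins with T steps of common noise; so the moved innovations
     are felt from a distance of at least T.\<close>
   have fail: "\<bar>path_prob A (k * \<tau> + m) (chain ?z1 w1 (Suc L)) - path_prob A (k * \<tau> + m) (chain ?z2 w2 (Suc L))\<bar>
     \<le> b + ?R (chain ?z1 w1 (Suc L)) + ?R (chain ?z2 w2 (Suc L))"
    if "(\<Sum>i<Suc L. (w2 i - w1 i) \<bullet> (w2 i - w1 i)) \<le> M\<^sup>2 + H" for w1 w2
    unfolding b_def \<tau>_def
   proof (rule Suc.IH)
    show "real k * \<kappa> \<le> 1" using Suc.prems(1) \<kappa> by (simp add: algebra_simps)
    fix n :: nat assume n: "n \<ge> 1"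
    have eq: "snd (chain ?z1 w1 (Suc L)) (n + T) - snd (chain ?z2 w2 (Suc L)) (n + T)
     = (snd z1 (n + T + Suc L + T) - snd z2 (n + T + Suc L + T))
      - (\<Sum>j<Suc L. a (n + T + Suc L - j) *\<^sub>R (w2 j - w1 j))"
     using diff[of "n + T + Suc L"]
     by (simp add: snd_chain[of _ _ "Suc L"] scaleR_diff_right sum_subtractf del: sum.lessThan_Suc memory_chain.simps)
    have "norm (snd z1 (n + T + Suc L + T) - snd z2 (n + T + Suc L + T))
     \<le> (1 - real (Suc k) * \<kappa>) * real (n + T + Suc L) powr (- \<alpha>)"
     by (rule Suc.prems) (use n in simp)
    also have "... \<le> (1 - real (Suc k) * \<kappa>) * real n powr (- \<alpha>)"
     using Suc.prems(1) n \<alpha> by (intro mult_left_mono powr_mono2') auto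
    finally have 1: "norm (snd z1 (n + T + Suc L + T) - snd z2 (n + T + Suc L + T)) \<le> (1 - real (Suc k) * \<kappa>) * real n powr (- \<alpha>)" .
    have 2: "norm (\<Sum>j<Suc L. a (n + T + Suc L - j) *\<^sub>R (w2 j - w1 j)) \<le> \<kappa> * real n powr (- \<alpha>)"
     by (rule influence[OF n]) (use that in \<open>simp only: power2_norm_eq_inner\<close>)
    show "norm (snd (chain ?z1 w1 (Suc L)) (n + T) - snd (chain ?z2 w2 (Suc L)) (n + T)) \<le> (1 - real k * \<kappa>) * real n powr (- \<alpha>)"
     unfolding eq using norm_triangle_ineq4[of "snd z1 (n + T + Suc L + T) - snd z2 (n + T + Suc L + T)" "\<Sum>j<Suc L. a (n + T + Suc L - j) *\<^sub>R (w2 j - w1 j)"] 1 2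
     by (simp add: algebra_simps)
   qed
   show ?thesis
   proof (cases "w \<in> S")
    case True
    then have G: "fst ?z1 \<in> cball 0 K" "fst ?z2 \<in> cball 0 K" "snd ?z1 0 \<in> cball 0 K" "snd ?z2 0 \<in> cball 0 K"
     by (auto simp: S_def G1_def)
    obtain \<Lambda> U D where \<Lambda>: "bij \<Lambda>" "open U" "negligible (- U)" "C1_diffeo U D \<Lambda>"
     "\<And>u. u \<in> cball 0 r \<Longrightarrow> F (fst ?z1, u + snd ?z1 0) = F (fst ?z2, \<Lambda> u + snd ?z2 0)"
     "\<And>u. u \<in> cball 0 r \<Longrightarrow> u \<in> U \<Longrightarrow> \<bar>det (jacobian \<Lambda> (at u))\<bar> \<ge> c"
     "\<And>u. norm (\<Lambda> u - u) \<le> M"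
     using H2[OF G] by blast
    have small: "norm (snd ?z1 n - snd ?z2 n) \<le> real n powr (- \<alpha>)" if "n \<ge> 1" for n
    proof -
     have "norm (snd ?z1 n - snd ?z2 n) \<le> (1 - real (Suc k) * \<kappa>) * real n powr (- \<alpha>)"
      unfolding diff by (rule Suc.prems) fact
     also have "... \<le> 1 * real n powr (- \<alpha>)"
      using \<kappa> by (intro mult_right_mono) auto
     finally show ?thesis by simp
    qed
    have "\<bar>path_prob A (Suc L + (k * \<tau> + m)) ?z1 - path_prob A (Suc L + (k * \<tau> + m)) ?z2\<bar>
     \<le> b - jump_const r M c H * measure gauss (cball 0 r :: (real ^ 'd) set) / 4 * (b - 2 * s)
      + (\<EE> w'. ?R (chain ?z1 w' (Suc L))) + (\<EE> w'. ?R (chain ?z2 w' (Suc L)))"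
    proof (rule jump_step[OF A, where \<Lambda>=\<Lambda> and U=U and K="real k"])
     show "inj \<Lambda>" using \<Lambda>(1) by (rule bij_is_inj)
     show "\<Lambda> differentiable at u" if "u \<in> U" for u
      using \<Lambda>(4) that by (auto simp: C1_diffeo_def C1_on_def)
     fix v :: "real ^ 'd" and N assume v: "norm v \<le> M"
     show "(\<Sum>i<N. compensation a (\<lambda>j. if j = 0 then v else snd ?z1 j - snd ?z2 j) (Suc i) \<bullet>
       compensation a (\<lambda>j. if j = 0 then v else snd ?z1 j - snd ?z2 j) (Suc i)) \<le> H"
      unfolding power2_norm_eq_inner[symmetric] by (rule comp) (use small v in auto)
     show "(\<Sum>i<N. compensation a (\<lambda>j. if j = 0 then v else snd ?z1 j - snd ?z2 j) (Suc L + i) \<bullet>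
       compensation a (\<lambda>j. if j = 0 then v else snd ?z1 j - snd ?z2 j) (Suc L + i)) \<le> s\<^sup>2"
      unfolding power2_norm_eq_inner[symmetric] by (rule comp_tail) (use small v in auto)
    qed (use \<Lambda> c s b fail escape_bounds[OF Y] in auto)
    then show ?thesis using True by (simp add: e_def J_def \<delta>_def)
   next
    case False
    have Re: "e z = (\<EE> w'. path_prob A (k * \<tau> + m) (chain z w' (Suc L)))" for z
     unfolding e_def by (rule path_prob_add[OF A])
    have int: "integrable noise (\<lambda>w'. path_prob A (k * \<tau> + m) (chain z w' (Suc L)))"
     "integrable noise (\<lambda>w'. ?R (chain z w' (Suc L)))" for z
     by (rule noise.P.bounded_expectation(1)[OF _ path_prob_bounds], measurable)
       (rule noise.P.bounded_expectation(1)[OF _ escape_bounds[OF Y]], measurable)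
    have "\<bar>e ?z1 - e ?z2\<bar> = \<bar>(\<EE> w'. path_prob A (k * \<tau> + m) (chain ?z1 w' (Suc L)) - path_prob A (k * \<tau> + m) (chain ?z2 w' (Suc L)))\<bar>"
     unfolding Re using int by (subst Bochner_Integration.integral_diff) auto
    also have "... \<le> (\<EE> w'. \<bar>path_prob A (k * \<tau> + m) (chain ?z1 w' (Suc L)) - path_prob A (k * \<tau> + m) (chain ?z2 w' (Suc L))\<bar>)"
     by (rule integral_abs_bound)
    \<comment> \<open>Outside S no jump is attempted: \<open>fail\<close> is used with equal
      innovations, at squared distance 0.\<close>
    also have "... \<le> (\<EE> w'. b + ?R (chain ?z1 w' (Suc L)) + ?R (chain ?z2 w' (Suc L)))"
    proof (intro integral_mono fail)
     show "integrable noise (\<lambda>w'. \<bar>path_prob A (k * \<tau> + m) (chain ?z1 w' (Suc L)) - path_prob A (k * \<tau> + m) (chain ?z2 w' (Suc L))\<bar>)"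
      by (intro integrable_abs Bochner_Integration.integrable_diff int)
     show "integrable noise (\<lambda>w'. b + ?R (chain ?z1 w' (Suc L)) + ?R (chain ?z2 w' (Suc L)))"
      by (intro Bochner_Integration.integrable_add int) simp
    qed (use H0 in simp)
    also have "... = b + J ?z1 + J ?z2"
     using int(2)[of ?z1] int(2)[of ?z2] by (simp add: J_def noise.P.prob_space[simplified] del: memory_chain.simps)
    finally show ?thesis using False by simp
   qed
  qed
  have Pe: "path_prob A (Suc k * (T + Suc L) + m) z = (\<EE> w. e (chain z w T))" for z
  proof -
   have "Suc k * (T + Suc L) + m = T + (Suc L + (k * \<tau> + m))" by (simp add: \<tau>_def)
   then show ?thesis unfolding e_def by (simp only: path_prob_add[OF A, of T])
  qed
  have int: "integrable noise (\<lambda>w. e (chain z w T))" "integrable noise (\<lambda>w. J (chain z w T))"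
    "integrable noise (indicator S :: _ \<Rightarrow> real)" for z
   by (rule noise.P.bounded_expectation(1)[OF _ e_bounds]
     noise.P.bounded_expectation(1)[OF _ J_bounds]
     noise.P.bounded_expectation(1)[OF _ indicator_pos_le indicator_le_1]; measurable)+
  have "\<bar>path_prob A (Suc k * (T + Suc L) + m) z1 - path_prob A (Suc k * (T + Suc L) + m) z2\<bar>
   = \<bar>(\<EE> w. e (chain z1 w T) - e (chain z2 w T))\<bar>"
   unfolding Pe using int by (subst Bochner_Integration.integral_diff) auto
  also have "... \<le> (\<EE> w. \<bar>e (chain z1 w T) - e (chain z2 w T)\<bar>)"
   by (rule integral_abs_bound)
  also have "... \<le> (\<EE> w. b - \<delta> * (b - 2 * s) * indicator S w + J (chain z1 w T) + J (chain z2 w T))"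
   by (intro integral_mono wait) (use int in auto)
  also have "... = b - \<delta> * (b - 2 * s) * measure noise S
    + (\<EE> w. J (chain z1 w T)) + (\<EE> w. J (chain z2 w T))"
   using int by (simp add: noise.P.prob_space[simplified])
  \<comment> \<open>The return probability 1/2 is what turns \<delta> into \<delta> / 2 in the
    recursion.\<close>
  also have "... \<le> b - \<delta> * (b - 2 * s) * (1 / 2)
    + (\<EE> w. J (chain z1 w T)) + (\<EE> w. J (chain z2 w T))"
  proof -
   have "1 / 2 \<le> measure noise S" using return[of z1 z2] True by (simp add: S_def)
   then have "\<delta> * (b - 2 * s) * (1 / 2) \<le> \<delta> * (b - 2 * s) * measure noise S"
    using \<delta> b by (intro mult_left_mono) auto
   then show ?thesis by linarith
  qed
  also have "... = 2 * s + (1 - \<delta> / 2) ^ Suc k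
    + (\<EE> w. J (chain z1 w T)) + (\<EE> w. J (chain z2 w T))"
   using b_Suc by simp
  finally have final: "\<bar>path_prob A (Suc k * (T + Suc L) + m) z1 - path_prob A (Suc k * (T + Suc L) + m) z2\<bar>
   \<le> 2 * s + (1 - \<delta> / 2) ^ Suc k
    + (\<EE> w. J (chain z1 w T)) + (\<EE> w. J (chain z2 w T))" .
  have JT: "(\<EE> w. J (chain z w T)) = (\<EE> w. ?R (chain z w \<tau>))" for z
   unfolding J_def \<tau>_def
   using integral_chain_add[OF escape_measurable[OF Y] escape_bounds[OF Y], where i=T and j="Suc L"] by simp
  show ?thesis using final True unfolding JT escape.simps \<tau>_def[symmetric]
   by (simp del: memory_chain.simps)
 qed
qed

end

section \<open>Power estimates for compensation and influence\<close>

lemma sum_powr_bound: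
 fixes p :: real
 assumes "p > 1"
 obtains Z where "Z > 0" "\<And>J. finite J \<Longrightarrow> (\<Sum>n\<in>J. real (Suc n) powr (- p)) \<le> Z"
proof -
 have "summable (\<lambda>n. real n powr (- p))" using assms by (simp add: summable_real_powr_iff)
 then have s: "summable (\<lambda>n. real (Suc n) powr (- p))" by (rule summable_Suc_iff[THEN iffD2])
 show ?thesis
 proof (rule that[of "(\<Sum>n. real (Suc n) powr (- p)) + 1"])
  show "(\<Sum>n. real (Suc n) powr (- p)) + 1 > 0"
   using suminf_nonneg[OF s] by (simp add: add_nonneg_pos)
  fix J :: "nat set" assume "finite J"
  then have "(\<Sum>n\<in>J. real (Suc n) powr (- p)) \<le> (\<Sum>n. real (Suc n) powr (- p))"
   by (intro sum_le_suminf s) auto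
  then show "(\<Sum>n\<in>J. real (Suc n) powr (- p)) \<le> (\<Sum>n. real (Suc n) powr (- p)) + 1" by simp
 qed
qed

text \<open>The larger of x and y is at least n / 2. A part \<sigma> of its exponent is converted
  into n^(-\<sigma>) and the rest is moved to the smaller variable. What remains is a power of one
  variable, summable as soon as \<alpha> + \<beta> - \<sigma> > 1.\<close>

lemma powr_convolution_term:
 fixes x y n \<alpha> \<beta> \<sigma> :: real
 assumes "x > 0" "y > 0" "n \<le> x + y" "n > 0" "\<sigma> \<ge> 0" "\<sigma> \<le> \<alpha>" "\<sigma> \<le> \<beta>"
 shows "x powr (- \<beta>) * y powr (- \<alpha>) \<le> 2 powr \<sigma> * n powr (- \<sigma>) * (x powr (- (\<alpha> + \<beta> - \<sigma>)) + y powr (- (\<alpha> + \<beta> - \<sigma>)))"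
proof -
 have *: "u powr (- \<beta>') * v powr (- \<alpha>') \<le> 2 powr \<sigma> * n powr (- \<sigma>) * v powr (- (\<alpha>' + \<beta>' - \<sigma>))"
  if "v \<le> u" "u > 0" "v > 0" "n \<le> u + v" "\<sigma> \<le> \<beta>'" for u v \<alpha>' \<beta>' :: real
 proof -
  have "u powr (- \<beta>') = u powr (- \<sigma>) * u powr (- (\<beta>' - \<sigma>))" by (simp add: powr_add[symmetric])
  also have "... \<le> (n / 2) powr (- \<sigma>) * v powr (- (\<beta>' - \<sigma>))"
   using that assms by (intro mult_mono powr_mono2') auto
  also have "(n / 2) powr (- \<sigma>) = 2 powr \<sigma> * n powr (- \<sigma>)"
   using assms by (simp add: powr_divide powr_minus field_simps)
  finally have "u powr (- \<beta>') * v powr (- \<alpha>') \<le> 2 powr \<sigma> * n powr (- \<sigma>) * v powr (- (\<beta>' - \<sigma>)) * v powr (- \<alpha>')"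
   by (intro mult_right_mono) auto
  also have "... = 2 powr \<sigma> * n powr (- \<sigma>) * v powr (- (\<alpha>' + \<beta>' - \<sigma>))"
   by (simp add: powr_add[symmetric] algebra_simps)
  finally show ?thesis .
 qed
 show ?thesis
 proof (cases "y \<le> x")
  case True
  have "x powr (- \<beta>) * y powr (- \<alpha>) \<le> 2 powr \<sigma> * n powr (- \<sigma>) * y powr (- (\<alpha> + \<beta> - \<sigma>))"
   using True assms by (intro *) auto
  also have "... \<le> 2 powr \<sigma> * n powr (- \<sigma>) * (x powr (- (\<alpha> + \<beta> - \<sigma>)) + y powr (- (\<alpha> + \<beta> - \<sigma>)))"
   by (intro mult_left_mono) auto
  finally show ?thesis .
 next
  case False
  have "y powr (- \<alpha>) * x powr (- \<beta>) \<le> 2 powr \<sigma> * n powr (- \<sigma>) * x powr (- (\<beta> + \<alpha> - \<sigma>))"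
   using False assms by (intro *) auto
  also have "... \<le> 2 powr \<sigma> * n powr (- \<sigma>) * (x powr (- (\<alpha> + \<beta> - \<sigma>)) + y powr (- (\<alpha> + \<beta> - \<sigma>)))"
   by (intro mult_left_mono) (auto simp: add.commute)
  finally show ?thesis by (simp add: mult.commute)
 qed
qed

text \<open>The term j = 0 carries the free displacement and decays like b; the others form a
  convolution of the decays \<beta> and \<alpha>. The constant is uniform in q and v, as it must be
  for random memories and displacements.\<close>

lemma compensation_decay:
 fixes a :: "nat \<Rightarrow> real" and \<alpha> \<beta> \<sigma> C M :: real
 assumes b: "\<And>k. \<bar>inverse_coeffs a k\<bar> \<le> C * (real k + 1) powr (- \<beta>)" and C: "C \<ge> 0"
  and \<sigma>: "\<sigma> \<ge> 0" "\<sigma> \<le> \<alpha>" "\<sigma> \<le> \<beta>" "\<sigma> < \<alpha> + \<beta> - 1" and M: "M \<ge> 0"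
 obtains C' where "C' > 0"
  "\<And>(q :: nat \<Rightarrow> 'v :: real_normed_vector) (v :: 'v) n. (\<And>m. m \<ge> 1 \<Longrightarrow> norm (q m) \<le> real m powr (- \<alpha>)) \<Longrightarrow> norm v \<le> M \<Longrightarrow>
    n \<ge> 1 \<Longrightarrow> norm (compensation a (\<lambda>j. if j = 0 then v else q j) n) \<le> C' * real n powr (- \<sigma>)"
proof -
 define p where "p = \<alpha> + \<beta> - \<sigma>"
 have "p > 1" using \<sigma> by (simp add: p_def)
 then obtain Z where Z: "Z > 0" "\<And>J. finite J \<Longrightarrow> (\<Sum>n\<in>J. real (Suc n) powr (- p)) \<le> Z"
  by (rule sum_powr_bound) blast
 define C' where "C' = C * M + C * (2 powr \<sigma> * (2 * Z)) + 1"
 show ?thesis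
 proof (rule that)
  show "C' > 0" using C M Z(1) by (auto simp: C'_def intro!: add_nonneg_pos add_nonneg_nonneg mult_nonneg_nonneg)
  fix q :: "nat \<Rightarrow> 'v" and v :: 'v and n
  assume q: "\<And>m. m \<ge> 1 \<Longrightarrow> norm (q m) \<le> real m powr (- \<alpha>)" and v: "norm v \<le> M" and n: "n \<ge> (1::nat)"
  have term_le: "norm (inverse_coeffs a (n - Suc j) *\<^sub>R q (Suc j))
    \<le> C * (2 powr \<sigma> * real n powr (- \<sigma>)) * (real (Suc (n - Suc j)) powr (- p) + real (Suc j) powr (- p))"
   if "j < n" for j
  proof -
   have "norm (inverse_coeffs a (n - Suc j) *\<^sub>R q (Suc j))
     \<le> (C * (real (n - Suc j) + 1) powr (- \<beta>)) * real (Suc j) powr (- \<alpha>)"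
    unfolding norm_scaleR using C by (intro mult_mono b q) auto
   also have "... = C * (real (Suc (n - Suc j)) powr (- \<beta>) * real (Suc j) powr (- \<alpha>))"
    by (simp add: add.commute)
   also have "... \<le> C * (2 powr \<sigma> * real n powr (- \<sigma>) * (real (Suc (n - Suc j)) powr (- p) + real (Suc j) powr (- p)))"
    unfolding p_def using that n \<sigma> C by (intro mult_left_mono powr_convolution_term) auto
   finally show ?thesis by (simp add: mult.assoc)
  qed
  have "compensation a (\<lambda>j. if j = 0 then v else q j) n
    = inverse_coeffs a n *\<^sub>R v + (\<Sum>j<n. inverse_coeffs a (n - Suc j) *\<^sub>R q (Suc j))"
   unfolding compensation_def lessThan_Suc_atMost[symmetric] sum.lessThan_Suc_shift by simp
  also have "norm \<dots> \<le> norm (inverse_coeffs a n *\<^sub>R v) + (\<Sum>j<n. norm (inverse_coeffs a (n - Suc j) *\<^sub>R q (Suc j)))"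
   by (intro order.trans[OF norm_triangle_ineq] add_left_mono norm_sum)
  also have "... \<le> C * M * real n powr (- \<sigma>)
    + (\<Sum>j<n. C * (2 powr \<sigma> * real n powr (- \<sigma>)) * (real (Suc (n - Suc j)) powr (- p) + real (Suc j) powr (- p)))"
  proof (intro add_mono sum_mono term_le)
   have "norm (inverse_coeffs a n *\<^sub>R v) \<le> (C * (real n + 1) powr (- \<beta>)) * M"
    unfolding norm_scaleR using C by (intro mult_mono b v) auto
   also have "(real n + 1) powr (- \<beta>) \<le> real n powr (- \<beta>)" using n \<sigma> by (intro powr_mono2') auto
   also have "real n powr (- \<beta>) \<le> real n powr (- \<sigma>)" using n \<sigma> by (intro powr_mono) auto
   finally show "norm (inverse_coeffs a n *\<^sub>R v) \<le> C * M * real n powr (- \<sigma>)"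
    using C M by (simp add: mult_left_mono mult_right_mono algebra_simps)
  qed auto
  also have "(\<Sum>j<n. C * (2 powr \<sigma> * real n powr (- \<sigma>)) * (real (Suc (n - Suc j)) powr (- p) + real (Suc j) powr (- p)))
    = C * (2 powr \<sigma> * real n powr (- \<sigma>)) * ((\<Sum>j<n. real (Suc (n - Suc j)) powr (- p)) + (\<Sum>j<n. real (Suc j) powr (- p)))"
   by (simp add: sum_distrib_left sum.distrib algebra_simps)
  also have "(\<Sum>j<n. real (Suc (n - Suc j)) powr (- p)) = (\<Sum>j<n. real (Suc j) powr (- p))"
   by (rule sum.nat_diff_reindex)
  also have "C * (2 powr \<sigma> * real n powr (- \<sigma>)) * ((\<Sum>j<n. real (Suc j) powr (- p)) + (\<Sum>j<n. real (Suc j) powr (- p)))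
    \<le> C * (2 powr \<sigma> * real n powr (- \<sigma>)) * (Z + Z)"
   using C Z(2)[of "{..<n}"] by (intro mult_left_mono add_mono) auto
  finally show "norm (compensation a (\<lambda>j. if j = 0 then v else q j) n) \<le> C' * real n powr (- \<sigma>)"
   by (simp add: C'_def algebra_simps) (smt (verit) powr_ge_zero)
 qed
qed

text \<open>Square summability requires \<sigma> > 1/2, and the excess \<sigma> - 1/2 becomes the
  decay \<theta> of the tail in L. This is the origin of min{\<alpha>, \<beta>, \<alpha> + \<beta> -
  1} - 1/2 in the rate; the supremum is approached but not attained, which strict inequalities on
  the exponents absorb.\<close>

lemma compensation_square_sums:
 fixes a :: "nat \<Rightarrow> real" and \<alpha> \<beta> \<sigma> \<theta> C M :: real
 assumes b: "\<And>k. \<bar>inverse_coeffs a k\<bar> \<le> C * (real k + 1) powr (- \<beta>)" and C: "C \<ge> 0"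
  and \<sigma>: "\<sigma> \<le> \<alpha>" "\<sigma> \<le> \<beta>" "\<sigma> < \<alpha> + \<beta> - 1" and M: "M \<ge> 0" and \<theta>: "0 \<le> \<theta>" "\<theta> < \<sigma> - 1/2"
 obtains C' where "C' > 0"
  "\<And>(q :: nat \<Rightarrow> 'v :: real_normed_vector) (v :: 'v) L N. (\<And>m. m \<ge> 1 \<Longrightarrow> norm (q m) \<le> real m powr (- \<alpha>)) \<Longrightarrow> norm v \<le> M \<Longrightarrow>
    (\<Sum>i<N. (norm (compensation a (\<lambda>j. if j = 0 then v else q j) (Suc L + i)))\<^sup>2) \<le> (C' * real (Suc L) powr (- \<theta>))\<^sup>2"
proof -
 have "\<sigma> \<ge> 0" using \<theta> by simp
 then obtain C1 where C1: "C1 > 0"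
  "\<And>(q :: nat \<Rightarrow> 'v :: real_normed_vector) (v :: 'v) n. (\<And>m. m \<ge> 1 \<Longrightarrow> norm (q m) \<le> real m powr (- \<alpha>)) \<Longrightarrow> norm v \<le> M \<Longrightarrow>
    n \<ge> 1 \<Longrightarrow> norm (compensation a (\<lambda>j. if j = 0 then v else q j) n) \<le> C1 * real n powr (- \<sigma>)"
  using compensation_decay[OF b C _ \<sigma> M] by blast
 have "2 * (\<sigma> - \<theta>) > 1" using \<theta> by simp
 then obtain Z where Z: "Z > 0" "\<And>J. finite J \<Longrightarrow> (\<Sum>n\<in>J. real (Suc n) powr (- (2 * (\<sigma> - \<theta>)))) \<le> Z"
  by (rule sum_powr_bound) blast
 show ?thesis
 proof (rule that[of "C1 * sqrt Z"])
  show "C1 * sqrt Z > 0" using C1 Z by simp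
  fix q :: "nat \<Rightarrow> 'v" and v :: 'v and L N
  assume q: "\<And>m. m \<ge> 1 \<Longrightarrow> norm (q m) \<le> real m powr (- \<alpha>)" and v: "norm v \<le> M"
  have "(\<Sum>i<N. (norm (compensation a (\<lambda>j. if j = 0 then v else q j) (Suc L + i)))\<^sup>2)
   \<le> (\<Sum>i<N. (C1 * real (Suc L) powr (- \<theta>))\<^sup>2 * real (Suc (L + i)) powr (- (2 * (\<sigma> - \<theta>))))"
  proof (rule sum_mono)
   fix i
   have "norm (compensation a (\<lambda>j. if j = 0 then v else q j) (Suc L + i)) \<le> C1 * real (Suc L + i) powr (- \<sigma>)"
    by (rule C1(2)[OF q v]) auto
   also have "real (Suc L + i) powr (- \<sigma>) = real (Suc L + i) powr (- \<theta>) * real (Suc L + i) powr (- (\<sigma> - \<theta>))"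
    by (simp add: powr_add[symmetric])
   also have "C1 * \<dots> \<le> C1 * (real (Suc L) powr (- \<theta>) * real (Suc L + i) powr (- (\<sigma> - \<theta>)))"
    using C1 \<theta> by (intro mult_left_mono mult_right_mono powr_mono2') auto
   finally have "(norm (compensation a (\<lambda>j. if j = 0 then v else q j) (Suc L + i)))\<^sup>2
     \<le> (C1 * real (Suc L) powr (- \<theta>) * real (Suc (L + i)) powr (- (\<sigma> - \<theta>)))\<^sup>2"
    by (intro power_mono) (auto simp: mult.assoc)
   also have "... = (C1 * real (Suc L) powr (- \<theta>))\<^sup>2 * (real (Suc (L + i)) powr (- (\<sigma> - \<theta>)))\<^sup>2"
    by (simp add: power_mult_distrib)
   also have "(real (Suc (L + i)) powr (- (\<sigma> - \<theta>)))\<^sup>2 = real (Suc (L + i)) powr (- (2 * (\<sigma> - \<theta>)))"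
    by (subst powr_numeral[symmetric]) (auto simp: powr_powr algebra_simps)
   finally show "(norm (compensation a (\<lambda>j. if j = 0 then v else q j) (Suc L + i)))\<^sup>2
     \<le> (C1 * real (Suc L) powr (- \<theta>))\<^sup>2 * real (Suc (L + i)) powr (- (2 * (\<sigma> - \<theta>)))" .
  qed
  also have "... = (C1 * real (Suc L) powr (- \<theta>))\<^sup>2 * (\<Sum>n\<in>(\<lambda>i. L + i) ` {..<N}. real (Suc n) powr (- (2 * (\<sigma> - \<theta>))))"
   by (simp add: sum_distrib_left sum.reindex inj_on_def)
  also have "... \<le> (C1 * real (Suc L) powr (- \<theta>))\<^sup>2 * Z"
   by (intro mult_left_mono Z) auto
  also have "... = (C1 * sqrt Z * real (Suc L) powr (- \<theta>))\<^sup>2"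
   using Z by (simp add: power_mult_distrib)
  finally show "(\<Sum>i<N. (norm (compensation a (\<lambda>j. if j = 0 then v else q j) (Suc L + i)))\<^sup>2)
   \<le> (C1 * sqrt Z * real (Suc L) powr (- \<theta>))\<^sup>2" .
 qed
qed

text \<open>The moved innovations are seen at distance beyond m + T. Of the decay \<rho> of a, the
  part \<alpha> is spent on m and the part \<rho> - \<alpha> on the wait T; Cauchy-Schwarz over the
  L terms contributes the factor sqrt L.\<close>

lemma influence_bound:
 fixes g :: "nat \<Rightarrow> 'v :: real_normed_vector" and \<alpha> \<rho> C :: real
 assumes a: "\<And>k. \<bar>a k\<bar> \<le> C * (real k + 1) powr (- \<rho>)" and C: "C \<ge> 0"
  and \<alpha>: "0 \<le> \<alpha>" "\<alpha> \<le> \<rho>" and m: "m \<ge> 1" and T: "T \<ge> 1"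
  and g: "(\<Sum>j<L. (norm (g j))\<^sup>2) \<le> G"
 shows "norm (\<Sum>j<L. a (m + T + L - j) *\<^sub>R g j) \<le> (C * sqrt (real L * G) * real T powr (- (\<rho> - \<alpha>))) * real m powr (- \<alpha>)"
proof -
 have "norm (\<Sum>j<L. a (m + T + L - j) *\<^sub>R g j) \<le> (\<Sum>j<L. C * (real m powr (- \<alpha>) * real T powr (- (\<rho> - \<alpha>))) * norm (g j))"
 proof (rule order.trans[OF norm_sum sum_mono])
  fix j assume j: "j \<in> {..<L}"
  have "\<bar>a (m + T + L - j)\<bar> \<le> C * (real (m + T + L - j) + 1) powr (- \<rho>)" by (rule a)
  also have "... \<le> C * real (m + T) powr (- \<rho>)"
   using C j m \<alpha> by (intro mult_left_mono powr_mono2') (auto simp: of_nat_diff)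
  also have "real (m + T) powr (- \<rho>) = real (m + T) powr (- \<alpha>) * real (m + T) powr (- (\<rho> - \<alpha>))"
   by (simp add: powr_add[symmetric])
  also have "C * \<dots> \<le> C * (real m powr (- \<alpha>) * real T powr (- (\<rho> - \<alpha>)))"
   using C m T \<alpha> by (intro mult_left_mono mult_mono powr_mono2') auto
  finally show "norm (a (m + T + L - j) *\<^sub>R g j) \<le> C * (real m powr (- \<alpha>) * real T powr (- (\<rho> - \<alpha>))) * norm (g j)"
   by (simp add: mult_right_mono)
 qed
 also have "... = C * (real m powr (- \<alpha>) * real T powr (- (\<rho> - \<alpha>))) * (\<Sum>j<L. 1 * norm (g j))"
  by (simp add: sum_distrib_left)
 also have "... \<le> C * (real m powr (- \<alpha>) * real T powr (- (\<rho> - \<alpha>))) * sqrt (real L * G)"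
 proof (intro mult_left_mono real_le_rsqrt)
  have "(\<Sum>j<L. 1 * norm (g j))\<^sup>2 \<le> (\<Sum>j<L. 1\<^sup>2) * (\<Sum>j<L. (norm (g j))\<^sup>2)"
   by (rule Cauchy_Schwarz_ineq_sum)
  also have "... \<le> real L * G" using g by (simp add: mult_left_mono)
  finally show "(\<Sum>j<L. 1 * norm (g j))\<^sup>2 \<le> real L * G" .
 qed (use C in auto)
 finally show ?thesis by (simp add: ac_simps)
qed

section \<open>Lyapunov control and return to compact sets\<close>

lemma nn_integral_noise_norm_sq_le:
 fixes c :: "nat \<Rightarrow> real"
 shows "(\<E> w. ennreal ((norm (\<Sum>j<n. c j *\<^sub>R w j :: real ^ 'd))\<^sup>2))
  \<le> ennreal (8 * real CARD('d) * (\<Sum>j<n. (c j)\<^sup>2))"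
proof -
 have "(\<E> w. ennreal ((norm (\<Sum>j<n. c j *\<^sub>R w j :: real ^ 'd))\<^sup>2))
  = (\<E> w. (\<Sum>k\<in>(UNIV :: 'd set). ennreal ((\<Sum>j<n. (c j *\<^sub>R axis k 1) \<bullet> (w j :: real ^ 'd))\<^sup>2)))"
 proof (intro nn_integral_cong)
  fix w :: "'d traj"
  let ?x = "\<Sum>j<n. c j *\<^sub>R w j"
  have "(norm ?x)\<^sup>2 = (\<Sum>k\<in>UNIV. (?x $ k)\<^sup>2)"
   unfolding power2_norm_eq_inner inner_vec_def by (simp add: power2_eq_square)
  also have "... = (\<Sum>k\<in>UNIV. (\<Sum>j<n. (c j *\<^sub>R axis k 1) \<bullet> w j)\<^sup>2)"
   by (simp add: inner_axis' )
  finally show "ennreal ((norm ?x)\<^sup>2) = (\<Sum>k\<in>UNIV. ennreal ((\<Sum>j<n. (c j *\<^sub>R axis k 1) \<bullet> w j)\<^sup>2))"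
   by simp
 qed
 also have "... = (\<Sum>k\<in>(UNIV :: 'd set). (\<E> w. ennreal ((\<Sum>j<n. (c j *\<^sub>R axis k 1) \<bullet> (w j :: real ^ 'd))\<^sup>2)))"
  by (rule nn_integral_sum) measurable
 also have "... \<le> (\<Sum>k\<in>(UNIV :: 'd set). ennreal (8 * (\<Sum>j<n. (c j *\<^sub>R axis k 1 :: real ^ 'd) \<bullet> (c j *\<^sub>R axis k 1))))"
  by (intro sum_mono nn_integral_noise_sq_le)
 also have "... = ennreal (8 * real CARD('d) * (\<Sum>j<n. (c j)\<^sup>2))"
  by (simp add: inner_axis_axis power2_eq_square ennreal_of_nat_eq_real_of_nat ennreal_mult'[symmetric] algebra_simps)
 finally show ?thesis .
qed

lemma noise_norm_moment:
 fixes c :: "nat \<Rightarrow> real"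
 assumes s: "(\<Sum>j<n. (c j)\<^sup>2) \<le> s"
 shows "integrable noise (\<lambda>w. norm (\<Sum>j<n. c j *\<^sub>R w j :: real ^ 'd))" (is "integrable _ ?f")
  and "(\<EE> w. norm (\<Sum>j<n. c j *\<^sub>R w j :: real ^ 'd)) \<le> 1 + 8 * real CARD('d) * s"
proof -
 have s0: "s \<ge> 0" using s sum_nonneg[of "{..<n}" "\<lambda>j. (c j)\<^sup>2"] by simp
 have "(\<E> w. ennreal (?f w)) \<le> (\<E> w. 1 + ennreal ((?f w)\<^sup>2))"
 proof (intro nn_integral_mono)
  fix w :: "'d traj"
  have "?f w \<le> 1 + (?f w)\<^sup>2" using sum_squares_bound[of "?f w" 1] norm_ge_zero[of "\<Sum>j<n. c j *\<^sub>R w j"] unfolding one_power2 mult_1_right by linarith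
  then have "ennreal (?f w) \<le> ennreal (1 + (?f w)\<^sup>2)" by (rule ennreal_leI)
  then show "ennreal (?f w) \<le> 1 + ennreal ((?f w)\<^sup>2)" by simp
 qed
 also have "... = 1 + (\<E> w. ennreal ((?f w)\<^sup>2))"
  by (subst nn_integral_add) (auto simp: noise.P.emeasure_space_1[simplified])
 also have "... \<le> 1 + ennreal (8 * real CARD('d) * (\<Sum>j<n. (c j)\<^sup>2))"
  by (intro add_left_mono nn_integral_noise_norm_sq_le)
 also have "... \<le> 1 + ennreal (8 * real CARD('d) * s)"
  using s by (intro add_left_mono ennreal_leI mult_left_mono) auto
 also have "... = ennreal (1 + 8 * real CARD('d) * s)"
  using s0 by simp
 finally have le: "(\<E> w. ennreal (?f w)) \<le> ennreal (1 + 8 * real CARD('d) * s)" .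
 show int: "integrable noise ?f"
  using le by (intro integrableI_nonneg) (auto simp: top_unique less_top[symmetric])
 show "(\<EE> w. ?f w) \<le> 1 + 8 * real CARD('d) * s"
  using le s0 unfolding nn_integral_eq_integral[OF int AE_I2[OF norm_ge_zero]]
  by (subst (asm) ennreal_le_iff) auto
qed

context memory_dynamics
begin

text \<open>What the starting point contributes to the bound on V at time T: the initial value and
  the predicted noises, discounted by \<gamma>. Entry T, which has weight 1, is included because it
  is entry 0 of the memory at time T, up to later innovations.\<close>

definition potential :: "(real ^ 'd \<Rightarrow> real) \<Rightarrow> real \<Rightarrow> real \<Rightarrow> nat \<Rightarrow> (real ^ 'd) \<times> (nat \<Rightarrow> real ^ 'd) \<Rightarrow> real" where
 "potential V \<gamma> C T z = \<gamma> ^ T * V (fst z) + C * (\<Sum>i\<le>T. \<gamma> ^ (T - i) * norm (snd z i))"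

lemma potential_measurable [measurable]:
 assumes [measurable]: "V \<in> borel_measurable borel"
 shows "potential V \<gamma> C T \<in> borel_measurable state_space"
 unfolding potential_def[abs_def] by measurable

lemma V_chain_le:
 assumes V: "\<And>x w. V (F (x, w)) \<le> \<gamma> * V x + C * (1 + norm w)" and \<gamma>: "\<gamma> \<ge> 0"
 shows "V (fst (chain z w n))
  \<le> \<gamma> ^ n * V (fst z) + C * (\<Sum>i<n. \<gamma> ^ (n - Suc i) * (1 + norm (snd z i + (\<Sum>j\<le>i. a (i - j) *\<^sub>R w j))))"
proof (induction n)
 case (Suc n)
 let ?d = "\<lambda>i. 1 + norm (snd z i + (\<Sum>j\<le>i. a (i - j) *\<^sub>R w j))"
 have "V (fst (chain z w (Suc n))) \<le> \<gamma> * V (fst (chain z w n)) + C * ?d n"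
  unfolding fst_chain_Suc by (rule V)
 also have "... \<le> \<gamma> * (\<gamma> ^ n * V (fst z) + C * (\<Sum>i<n. \<gamma> ^ (n - Suc i) * ?d i)) + C * ?d n"
  using Suc.IH \<gamma> by (intro add_right_mono mult_left_mono)
 also have "... = \<gamma> ^ Suc n * V (fst z) + C * ((\<Sum>i<n. \<gamma> * \<gamma> ^ (n - Suc i) * ?d i) + ?d n)"
  by (simp add: algebra_simps sum_distrib_left)
 also have "(\<Sum>i<n. \<gamma> * \<gamma> ^ (n - Suc i) * ?d i) = (\<Sum>i<n. \<gamma> ^ (Suc n - Suc i) * ?d i)"
  by (intro sum.cong) (auto simp: power_Suc[symmetric] Suc_diff_Suc simp del: power_Suc)
 finally show ?case by simp
qed simp

lemma sum_power_diff_le: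
 assumes "0 \<le> \<gamma>" "\<gamma> < (1::real)"
 shows "(\<Sum>i<n. \<gamma> ^ (n - Suc i)) \<le> 1 / (1 - \<gamma>)"
proof -
 have "(\<Sum>i<n. \<gamma> ^ (n - Suc i)) = (\<Sum>i<n. \<gamma> ^ i)" by (rule sum.nat_diff_reindex)
 also have "... \<le> (\<Sum>i. \<gamma> ^ i)" using assms by (intro sum_le_suminf summable_geometric) auto
 also have "... = 1 / (1 - \<gamma>)" using assms by (intro suminf_geometric) auto
 finally show ?thesis .
qed

text \<open>K must not depend on T. If the potential is at most 1, V at time T is bounded by
  \<open>W\<close>, whose mean is at most \<open>v\<close> by a geometric series, and the first
  memory entry by 1 plus the norm of a Gaussian vector of bounded variance. Markov's inequality
  gives failure probability 1/4 for each chain, and the union bound leaves 1/2.\<close>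

lemma return_prob:
 assumes V: "\<And>x w. V (F (x, w)) \<le> \<gamma> * V x + C * (1 + norm w)" and \<gamma>: "0 < \<gamma>" "\<gamma> < 1" and C: "C > 0"
  and coercive: "filterlim V at_top at_infinity"
  and a2: "\<And>n. (\<Sum>i<n. (a i)\<^sup>2) \<le> s"
 obtains K where "K > 0"
  "\<And>T z1 z2. potential V \<gamma> (C / \<gamma> + 1) T z1 \<le> 1 \<Longrightarrow> potential V \<gamma> (C / \<gamma> + 1) T z2 \<le> 1 \<Longrightarrow> V (fst z1) \<ge> 0 \<Longrightarrow> V (fst z2) \<ge> 0 \<Longrightarrow>
   1 / 2 \<le> measure noise {w. chain z1 w T \<in> {z. fst z \<in> cball 0 K \<and> snd z 0 \<in> cball 0 K}
     \<and> chain z2 w T \<in> {z. fst z \<in> cball 0 K \<and> snd z 0 \<in> cball 0 K}}"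
proof -
 have s0: "s \<ge> 0" using a2[of 0] by simp
 define m where "m = 1 + 8 * real CARD('d) * s"
 have m: "m \<ge> 1" using s0 by (simp add: m_def)
 define v where "v = 1 + C * ((1 + m) * (1 / (1 - \<gamma>)))"
 have v: "v > 0" using C \<gamma> m by (auto simp: v_def intro!: add_pos_nonneg)
 obtain K0 where K0: "\<And>x. K0 \<le> norm x \<Longrightarrow> 8 * v < V x"
  using coercive[unfolded filterlim_at_top_dense, rule_format, of "8 * v"] by (auto simp: eventually_at_infinity)
 \<comment> \<open>Leaving the ball forces V above 8 v, or the memory entry above 8 (1 + m) in
   norm.\<close>
 define K where "K = max 1 (max K0 (8 * (1 + m)))"
 have single: "measure noise {w. \<not> (fst (chain z w T) \<in> cball 0 K \<and> snd (chain z w T) 0 \<in> cball 0 K)} \<le> 1 / 4"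
  if pot: "potential V \<gamma> (C / \<gamma> + 1) T z \<le> 1" and V0: "V (fst z) \<ge> 0" for T z
 proof -
  define N where "N i w = norm (\<Sum>j<Suc i. a (i - j) *\<^sub>R (w j :: real ^ 'd))" for i w
  define N' where "N' w = norm (\<Sum>j<T. a (T - j) *\<^sub>R (w j :: real ^ 'd))" for w
  have N: "integrable noise (N i)" "(\<EE> w. N i w) \<le> m" for i
  proof -
   have "(\<Sum>j<Suc i. (a (i - j))\<^sup>2) = (\<Sum>j<Suc i. (a j)\<^sup>2)"
    using sum.nat_diff_reindex[of "\<lambda>j. (a j)\<^sup>2" "Suc i"] by simp
   also have "... \<le> s" by (rule a2)
   finally show "integrable noise (N i)" "(\<EE> w. N i w) \<le> m"
    unfolding N_def[abs_def] m_def by (rule noise_norm_moment)+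
  qed
  have N': "integrable noise N'" "(\<EE> w. N' w) \<le> m"
  proof -
   have "(\<Sum>j<T. (a (T - j))\<^sup>2) = (\<Sum>j<T. (a (Suc j))\<^sup>2)"
    using sum.nat_diff_reindex[of "\<lambda>j. (a (Suc j))\<^sup>2" T]
    by (simp add: Suc_diff_Suc cong: sum.cong_simp)
   also have "... \<le> (\<Sum>j<Suc T. (a j)\<^sup>2)" unfolding sum.lessThan_Suc_shift by simp
   also have "... \<le> s" by (rule a2)
   finally show "integrable noise N'" "(\<EE> w. N' w) \<le> m"
    unfolding N'_def[abs_def] m_def by (rule noise_norm_moment)+
  qed
  define W where "W w = 1 + C * (\<Sum>i<T. \<gamma> ^ (T - Suc i) * (1 + N i w))" for w
  have W: "integrable noise W" "(\<EE> w. W w) \<le> v"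
  proof -
   show "integrable noise W" unfolding W_def[abs_def] using N by simp
   have "(\<EE> w. W w) = 1 + C * (\<Sum>i<T. \<gamma> ^ (T - Suc i) * (1 + (\<EE> w. N i w)))"
    unfolding W_def using N by (simp add: noise.P.prob_space[simplified])
   also have "... \<le> 1 + C * (\<Sum>i<T. \<gamma> ^ (T - Suc i) * (1 + m))"
    using C \<gamma> N by (intro add_left_mono mult_left_mono sum_mono) auto
   also have "... = 1 + C * ((1 + m) * (\<Sum>i<T. \<gamma> ^ (T - Suc i)))"
    by (simp add: sum_distrib_left mult.commute)
   also have "... \<le> v"
    unfolding v_def using C m \<gamma> by (intro add_left_mono mult_left_mono sum_power_diff_le) auto
   finally show "(\<EE> w. W w) \<le> v" .
  qed
  \<comment> \<open>The origin of C / \<gamma> + 1: the factor 1 / \<gamma> corrects the exponent T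
    - i against T - i - 1 in the unrolled drift, and the summand 1 pays for entry T by
    itself.\<close>
  have sumD: "C / \<gamma> * (\<Sum>i<T. \<gamma> ^ (T - i) * norm (snd z i)) + norm (snd z T) \<le> (C / \<gamma> + 1) * (\<Sum>i\<le>T. \<gamma> ^ (T - i) * norm (snd z i))"
  proof -
   have *: "(\<Sum>i\<le>T. \<gamma> ^ (T - i) * norm (snd z i)) = (\<Sum>i<T. \<gamma> ^ (T - i) * norm (snd z i)) + norm (snd z T)"
    by (simp add: lessThan_Suc_atMost[symmetric])
   have "0 \<le> (\<Sum>i<T. \<gamma> ^ (T - i) * norm (snd z i))" using \<gamma> by (intro sum_nonneg) auto
   moreover have "0 \<le> C / \<gamma> * norm (snd z T)" using C \<gamma> by simp
   ultimately show ?thesis unfolding * by (simp add: algebra_simps)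
  qed
  have VW: "V (fst (chain z w T)) \<le> W w" for w
  proof -
   have "V (fst (chain z w T)) \<le> \<gamma> ^ T * V (fst z) + C * (\<Sum>i<T. \<gamma> ^ (T - Suc i) * (1 + norm (snd z i + (\<Sum>j\<le>i. a (i - j) *\<^sub>R w j))))"
    by (rule V_chain_le[OF V]) (use \<gamma> in simp)
   also have "... \<le> \<gamma> ^ T * V (fst z) + C * (\<Sum>i<T. \<gamma> ^ (T - Suc i) * (norm (snd z i) + (1 + N i w)))"
   proof (intro add_left_mono mult_left_mono sum_mono)
    fix i show "1 + norm (snd z i + (\<Sum>j\<le>i. a (i - j) *\<^sub>R w j)) \<le> norm (snd z i) + (1 + N i w)"
     using norm_triangle_ineq[of "snd z i" "\<Sum>j\<le>i. a (i - j) *\<^sub>R w j"]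
     by (simp add: N_def lessThan_Suc_atMost)
   qed (use C \<gamma> in auto)
   also have "... = (\<gamma> ^ T * V (fst z) + C * (\<Sum>i<T. \<gamma> ^ (T - Suc i) * norm (snd z i))) + C * (\<Sum>i<T. \<gamma> ^ (T - Suc i) * (1 + N i w))"
    by (simp add: distrib_left sum.distrib)
   also have "C * (\<Sum>i<T. \<gamma> ^ (T - Suc i) * norm (snd z i)) = C / \<gamma> * (\<Sum>i<T. \<gamma> ^ (T - i) * norm (snd z i))"
   proof -
    have "(\<Sum>i<T. \<gamma> ^ (T - i) * norm (snd z i)) = \<gamma> * (\<Sum>i<T. \<gamma> ^ (T - Suc i) * norm (snd z i))"
     unfolding sum_distrib_left mult.assoc[symmetric] power_Suc[symmetric] by (intro sum.cong) (auto simp: Suc_diff_Suc)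
    then show ?thesis using \<gamma> by simp
   qed
   finally show ?thesis using pot sumD unfolding potential_def W_def by (smt (verit) norm_ge_zero)
  qed
  have zT: "norm (snd z T) \<le> 1"
  proof -
   have "0 \<le> C / \<gamma> * (\<Sum>i<T. \<gamma> ^ (T - i) * norm (snd z i))" using C \<gamma> by (intro mult_nonneg_nonneg sum_nonneg) auto
   moreover have "0 \<le> \<gamma> ^ T * V (fst z)" using V0 \<gamma> by simp
   ultimately show ?thesis using pot sumD unfolding potential_def by linarith
  qed
  have DN: "norm (snd (chain z w T) 0) \<le> 1 + N' w" for w
   using zT norm_triangle_ineq[of "snd z T" "\<Sum>j<T. a (T - j) *\<^sub>R w j"] by (simp add: snd_chain N'_def)
  \<comment> \<open>One variable of mean at most 2 is at least 8 on both bad events, so a single use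
    of Markov's inequality suffices.\<close>
  define X where "X w = W w / v + (1 + N' w) / (1 + m)" for w
  have W0: "W w \<ge> 0" "N' w \<ge> 0" for w
   using C \<gamma> by (auto simp: W_def N'_def N_def intro!: add_nonneg_nonneg mult_nonneg_nonneg sum_nonneg)
  have X: "integrable noise X" "(\<EE> w. X w) \<le> 2"
  proof -
   show "integrable noise X" unfolding X_def[abs_def] using W N' by simp
   have "(\<EE> w. X w) = (\<EE> w. W w) / v + (1 + (\<EE> w. N' w)) / (1 + m)"
    unfolding X_def using W N' by (simp add: noise.P.prob_space[simplified])
   also have "... \<le> v / v + (1 + m) / (1 + m)"
    using W N' v m by (intro add_mono divide_right_mono) auto
   also have "... = 2" using v m by simp
   finally show "(\<EE> w. X w) \<le> 2" .
  qed
  have "{w. \<not> (fst (chain z w T) \<in> cball 0 K \<and> snd (chain z w T) 0 \<in> cball 0 K)} \<subseteq> {w \<in> space noise. 8 \<le> X w}"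
  proof safe
   fix w
   assume "fst (chain z w T) \<notin> cball 0 K"
   then have "8 * v < V (fst (chain z w T))" by (intro K0) (simp add: K_def)
   then have "8 * v < W w" using VW[of w] by simp
   then have "8 \<le> W w / v" using v by (simp add: field_simps)
   moreover have "0 \<le> (1 + N' w) / (1 + m)" using W0(2)[of w] m by simp
   ultimately show "8 \<le> X w" by (simp add: X_def)
  next
   fix w
   assume "snd (chain z w T) 0 \<notin> cball 0 K"
   then have "8 * (1 + m) < 1 + N' w" using DN[of w] by (simp add: K_def)
   then have "8 \<le> (1 + N' w) / (1 + m)" using m by (simp add: field_simps)
   moreover have "0 \<le> W w / v" using W0(1)[of w] v by simp
   ultimately show "8 \<le> X w" by (simp add: X_def)
  qed simp_all
  moreover have "{w \<in> space noise. 8 \<le> X w} \<in> sets noise"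
  proof -
   have [measurable]: "X \<in> borel_measurable noise" using X(1) by simp
   show ?thesis by measurable
  qed
  ultimately have "measure noise {w. \<not> (fst (chain z w T) \<in> cball 0 K \<and> snd (chain z w T) 0 \<in> cball 0 K)}
   \<le> measure noise {w \<in> space noise. 8 \<le> X w}"
   by (intro noise.P.finite_measure_mono) auto
  also have "... \<le> (\<EE> w. X w) / 8"
   using W0 v m by (intro integral_Markov_inequality_measure[where A="{}", OF X(1)])
    (auto simp: X_def intro!: AE_I2 add_nonneg_nonneg divide_nonneg_nonneg)
  also have "... \<le> 1 / 4" using X(2) by simp
  finally show ?thesis .
 qed
 show ?thesis
 proof (rule that[of K])
  show "K > 0" by (simp add: K_def)
  fix T z1 z2
  assume z: "potential V \<gamma> (C / \<gamma> + 1) T z1 \<le> 1" "potential V \<gamma> (C / \<gamma> + 1) T z2 \<le> 1" "V (fst z1) \<ge> 0" "V (fst z2) \<ge> 0"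
  let ?G = "{z. fst z \<in> cball 0 K \<and> snd z 0 \<in> cball 0 K} :: 'd state set"
  let ?B = "\<lambda>z. {w. \<not> (fst (chain z w T) \<in> cball 0 K \<and> snd (chain z w T) 0 \<in> cball 0 K)}"
  have B [measurable]: "?B z \<in> sets noise" for z
  proof -
   have "?B z = {w \<in> space traj_space. \<not> (norm (fst (chain z w T)) \<le> K \<and> norm (snd (chain z w T) 0) \<le> K)}" by simp
   also have "... \<in> sets traj_space" by measurable
   finally show ?thesis by (simp add: sets_noise)
  qed
  have "measure noise (?B z1 \<union> ?B z2) \<le> 1 / 4 + 1 / 4"
   using single[OF z(1,3)] single[OF z(2,4)] measure_Un_le[OF B[of z1] B[of z2]] by linarith
  moreover have eq: "{w. chain z1 w T \<in> ?G \<and> chain z2 w T \<in> ?G} = space noise - (?B z1 \<union> ?B z2)" by auto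
  moreover have "measure noise (space noise - (?B z1 \<union> ?B z2)) = 1 - measure noise (?B z1 \<union> ?B z2)"
   by (intro noise.P.prob_compl sets.Un B)
  ultimately show "1 / 2 \<le> measure noise {w. chain z1 w T \<in> ?G \<and> chain z2 w T \<in> ?G}"
   unfolding eq by linarith
 qed
qed

end

section \<open>Moments under the stationary law of the memory\<close>

lemma nn_integral_gauss_norm_le:
 "(\<integral>\<^sup>+u. ennreal (norm (u :: real ^ 'd)) \<partial>gauss) \<le> ennreal (1 + 8 * real CARD('d))"
proof -
 have "(\<integral>\<^sup>+u. ennreal (norm (u :: real ^ 'd)) \<partial>gauss) = (\<integral>\<^sup>+u. ennreal (norm u) \<partial>distr noise gauss (\<lambda>w :: 'd traj. w 0))"
  by (simp add: noise.PiM_component)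
 also have "... = (\<E> w. ennreal (norm (\<Sum>j<1. 1 *\<^sub>R w j :: real ^ 'd)))"
  by (subst nn_integral_distr) auto
 also have "... = ennreal (\<EE> w. norm (\<Sum>j<1. 1 *\<^sub>R w j :: real ^ 'd))"
  by (intro nn_integral_eq_integral noise_norm_moment(1)[OF order.refl]) auto
 also have "... \<le> ennreal (1 + 8 * real CARD('d))"
  using noise_norm_moment(2)[where n=1 and c="\<lambda>_. 1" and s=1 and 'd='d] by (intro ennreal_leI) simp
 finally show ?thesis .
qed

lemma min_add_le_ennreal: "min (a + b) c \<le> min a c + (b :: ennreal)"
proof (cases "a \<le> c")
 case True
 then show ?thesis by (simp add: min_absorb1 min.coboundedI1)
next
 case False
 have "min (a + b) c \<le> c + b" by (rule order_trans[OF min.cobounded2]) simp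
 with False show ?thesis by (simp add: min_absorb2)
qed

text \<open>\<open>\<D>\<close> is a stationary law of the memory, that is of the conditional means of the future noise.\<close>

locale stationary_memory = memory_dynamics F a
 for F :: "(real ^ 'd) \<times> (real ^ 'd) \<Rightarrow> real ^ 'd" and a :: "nat \<Rightarrow> real" +
 fixes \<D> :: "(nat \<Rightarrow> real ^ 'd) measure"
 assumes prob_D: "prob_space \<D>" and sets_D [measurable_cong]: "sets \<D> = sets traj_space"
  and invariant_D: "distr (\<D> \<Otimes>\<^sub>M gauss) traj_space (\<lambda>(D, u) m. D (Suc m) + a (Suc m) *\<^sub>R u) = \<D>"
begin

interpretation D: prob_space \<D> by (rule prob_D)

lemma nn_integral_chain_Suc:
 assumes [measurable]: "f \<in> borel_measurable state_space"
 shows "(\<E> w. f (chain z w (Suc t)))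
  = (\<E> w. \<integral>\<^sup>+u. f (memory_step F a (chain z w t) u) \<partial>gauss)"
proof -
 have "(\<E> w. f (chain z w (Suc t)))
  = (\<E> w. (\<E> w'. f (chain z (comb_seq t w w') (Suc t))))"
  by (rule nn_integral_comb_seq_noise) measurable
 also have "... = (\<E> w. (\<E> w'. f (memory_step F a (chain z w t) (w' 0))))"
  by (simp add: chain_comb_seq_le comb_seq_add[of t _ _ 0, simplified])
 also have "(\<lambda>w. (\<E> w'. f (memory_step F a (chain z w t) (w' 0))))
  = (\<lambda>w. \<integral>\<^sup>+u. f (memory_step F a (chain z w t) u) \<partial>distr noise gauss (\<lambda>w'. w' 0))"
  by (subst nn_integral_distr) auto
 finally show ?thesis by (simp add: noise.PiM_component)
qed

lemma nn_integral_chain_add: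
 assumes [measurable]: "f \<in> borel_measurable state_space"
 shows "(\<E> w. f (chain z w (s + t)))
  = (\<E> w. (\<E> w'. f (chain (chain z w s) w' t)))"
 by (subst nn_integral_comb_seq_noise[where n=s]) (auto simp: chain_comb_seq_add)

definition initial where
 "initial \<nu> \<longleftrightarrow> prob_space \<nu> \<and> sets \<nu> = sets state_space \<and> distr \<nu> traj_space snd = \<D>"

text \<open>The memory evolves autonomously and \<D> is invariant for its evolution, so its law is
  \<D> at all times, however it depends on X at the start.\<close>

lemma nn_integral_memory:
 assumes \<nu>: "initial \<nu>" and g: "g \<in> borel_measurable traj_space"
 shows "(\<integral>\<^sup>+z. (\<E> w. g (snd (chain z w t))) \<partial>\<nu>) = (\<integral>\<^sup>+D. g D \<partial>\<D>)"
 using g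
proof (induction t arbitrary: g)
 case 0
 note [measurable] = 0
 have [measurable_cong]: "sets \<nu> = sets state_space" using \<nu> by (simp add: initial_def)
 have "(\<integral>\<^sup>+D. g D \<partial>\<D>) = (\<integral>\<^sup>+D. g D \<partial>distr \<nu> traj_space snd)"
  using \<nu> by (simp add: initial_def)
 also have "... = (\<integral>\<^sup>+z. g (snd z) \<partial>\<nu>)" by (rule nn_integral_distr) auto
 finally show ?case by (simp add: noise.P.emeasure_space_1[simplified])
next
 case (Suc t)
 note [measurable] = Suc.prems
 have [measurable_cong]: "sets \<nu> = sets state_space" using \<nu> by (simp add: initial_def)
 have m [measurable]: "(\<lambda>(D, u) m. D (Suc m) + a (Suc m) *\<^sub>R u) \<in> measurable (\<D> \<Otimes>\<^sub>M gauss) traj_space"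
  unfolding split_beta' by (rule measurable_trajI) measurable
 have m' [measurable]: "(\<lambda>x m. fst x (Suc m) + a (Suc m) *\<^sub>R snd x) \<in> measurable (traj_space \<Otimes>\<^sub>M gauss) traj_space"
  by (rule measurable_trajI) measurable
 have [measurable]: "(\<lambda>D. \<integral>\<^sup>+u. g (\<lambda>m. D (Suc m) + a (Suc m) *\<^sub>R u) \<partial>gauss) \<in> borel_measurable traj_space"
 proof -
  have "(\<lambda>x. g (\<lambda>m. fst x (Suc m) + a (Suc m) *\<^sub>R snd x)) \<in> borel_measurable (traj_space \<Otimes>\<^sub>M gauss)"
   by (rule measurable_compose[OF m' Suc.prems])
  from gauss.borel_measurable_nn_integral_fst[OF this] show ?thesis by simp
 qed
 have "(\<integral>\<^sup>+z. (\<E> w. g (snd (chain z w (Suc t)))) \<partial>\<nu>)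
  = (\<integral>\<^sup>+z. (\<E> w. (\<lambda>D. \<integral>\<^sup>+u. g (\<lambda>m. D (Suc m) + a (Suc m) *\<^sub>R u) \<partial>gauss) (snd (chain z w t))) \<partial>\<nu>)"
  by (subst nn_integral_chain_Suc) (auto simp: memory_step_def)
 also have "... = (\<integral>\<^sup>+D. \<integral>\<^sup>+u. g (\<lambda>m. D (Suc m) + a (Suc m) *\<^sub>R u) \<partial>gauss \<partial>\<D>)"
  by (rule Suc.IH) measurable
 also have "... = (\<integral>\<^sup>+x. g (\<lambda>m. fst x (Suc m) + a (Suc m) *\<^sub>R snd x) \<partial>(\<D> \<Otimes>\<^sub>M gauss))"
 proof -
  have "(\<lambda>x. g (\<lambda>m. fst x (Suc m) + a (Suc m) *\<^sub>R snd x)) \<in> borel_measurable (\<D> \<Otimes>\<^sub>M gauss)"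
   using measurable_compose[OF m Suc.prems] by (simp add: split_beta')
  from gauss.nn_integral_fst[OF this] show ?thesis by simp
 qed
 also have "... = (\<integral>\<^sup>+D. g D \<partial>distr (\<D> \<Otimes>\<^sub>M gauss) traj_space (\<lambda>(D, u) m. D (Suc m) + a (Suc m) *\<^sub>R u))"
  by (subst nn_integral_distr[OF m]) (simp_all add: split_beta')
 also have "... = (\<integral>\<^sup>+D. g D \<partial>\<D>)" by (simp add: invariant_D)
 finally show ?case .
qed

context
 fixes V :: "real ^ 'd \<Rightarrow> real" and \<gamma> C m1 :: real
 assumes V_measurable [measurable]: "V \<in> borel_measurable borel" and V_nonneg: "\<And>x. V x \<ge> 0"
  and V_step: "\<And>x w. V (F (x, w)) \<le> \<gamma> * V x + C * (1 + norm w)" and \<gamma>: "0 < \<gamma>" "\<gamma> < 1" and C: "C > 0"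
  and m1: "(\<integral>\<^sup>+D. ennreal (norm (D 0)) \<partial>\<D>) \<le> ennreal m1" "m1 \<ge> 0"
begin

text \<open>C times an upper bound for the mean of 1 plus the norm of the noise: \<open>m1\<close>
  bounds the conditional mean, the last summand the innovation.\<close>

definition drift where "drift = C * (1 + m1 + (1 + 8 * real CARD('d)))"

lemma drift_nonneg: "drift \<ge> 0"
 using C m1 by (simp add: drift_def)

text \<open>The truncation at \<open>R\<close> serves invariant laws, under which V is not known to
  be integrable beforehand. The factor s inside the truncation lets the inequality be iterated with
  powers of \<gamma>.\<close>

lemma nn_integral_V_Suc:
 assumes \<nu>: "initial \<nu>" and s: "s \<ge> 0"
 shows "(\<integral>\<^sup>+z. (\<E> w. min (ennreal (s * V (fst (chain z w (Suc t))))) R) \<partial>\<nu>)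
  \<le> (\<integral>\<^sup>+z. (\<E> w. min (ennreal (s * \<gamma> * V (fst (chain z w t)))) R) \<partial>\<nu>) + ennreal (s * drift)"
proof -
 interpret \<nu>: prob_space \<nu> using \<nu> by (simp add: initial_def)
 have [measurable_cong]: "sets \<nu> = sets state_space" using \<nu> by (simp add: initial_def)
 let ?g = "\<lambda>z. min (ennreal (s * \<gamma> * V (fst z))) R"
 define mu where "mu = (\<integral>\<^sup>+u. ennreal (norm (u :: real ^ 'd)) \<partial>gauss)"
 have "(\<integral>\<^sup>+z. (\<E> w. min (ennreal (s * V (fst (chain z w (Suc t))))) R) \<partial>\<nu>)
  = (\<integral>\<^sup>+z. (\<E> w. \<integral>\<^sup>+u. min (ennreal (s * V (fst (memory_step F a (chain z w t) u)))) R \<partial>gauss) \<partial>\<nu>)"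
  by (subst nn_integral_chain_Suc) auto
 also have "... \<le> (\<integral>\<^sup>+z. (\<E> w. ?g (chain z w t) + ennreal (s * C) * (1 + ennreal (norm (snd (chain z w t) 0)) + mu)) \<partial>\<nu>)"
 proof (intro nn_integral_mono)
  fix z and w :: "'d traj"
  define y where "y = chain z w t"
  have "min (ennreal (s * V (fst (memory_step F a y u)))) R
    \<le> ?g y + ennreal (s * C) * (1 + ennreal (norm (snd y 0)) + ennreal (norm u))" for u
  proof -
   have "V (F (fst y, snd y 0 + u)) \<le> \<gamma> * V (fst y) + C * (1 + norm (snd y 0 + u))" by (rule V_step)
   also have "... \<le> \<gamma> * V (fst y) + C * (1 + norm (snd y 0) + norm u)"
    using C norm_triangle_ineq[of "snd y 0" u] by (intro add_left_mono mult_left_mono) auto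
   finally have "s * V (F (fst y, snd y 0 + u)) \<le> s * (\<gamma> * V (fst y) + C * (1 + norm (snd y 0) + norm u))"
    using s by (rule mult_left_mono)
   then have "ennreal (s * V (F (fst y, snd y 0 + u))) \<le> ennreal (s * \<gamma> * V (fst y) + s * C * (1 + norm (snd y 0) + norm u))"
    by (intro ennreal_leI) (simp add: algebra_simps)
   also have "... = ennreal (s * \<gamma> * V (fst y)) + ennreal (s * C) * (1 + ennreal (norm (snd y 0)) + ennreal (norm u))"
    using s C \<gamma> V_nonneg by (subst ennreal_plus) (auto simp: ennreal_mult ennreal_plus)
   finally have "min (ennreal (s * V (F (fst y, snd y 0 + u)))) R
    \<le> min (ennreal (s * \<gamma> * V (fst y)) + ennreal (s * C) * (1 + ennreal (norm (snd y 0)) + ennreal (norm u))) R"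
    by (rule min.mono) simp
   from order_trans[OF this min_add_le_ennreal] show ?thesis by (simp add: memory_step_def)
  qed
  then have "(\<integral>\<^sup>+u. min (ennreal (s * V (fst (memory_step F a y u)))) R \<partial>gauss)
   \<le> (\<integral>\<^sup>+u. ?g y + ennreal (s * C) * (1 + ennreal (norm (snd y 0)) + ennreal (norm (u :: real ^ 'd))) \<partial>gauss)"
   by (intro nn_integral_mono)
  also have "... = ?g y + ennreal (s * C) * (1 + ennreal (norm (snd y 0)) + mu)"
   by (simp add: nn_integral_add nn_integral_cmult gauss.emeasure_space_1[simplified] mu_def)
  finally show "(\<integral>\<^sup>+u. min (ennreal (s * V (fst (memory_step F a (chain z w t) u)))) R \<partial>gauss)
   \<le> ?g (chain z w t) + ennreal (s * C) * (1 + ennreal (norm (snd (chain z w t) 0)) + mu)" unfolding y_def .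
 qed
 also have "... = (\<integral>\<^sup>+z. (\<E> w. ?g (chain z w t)) \<partial>\<nu>)
   + ennreal (s * C) * (1 + (\<integral>\<^sup>+z. (\<E> w. ennreal (norm (snd (chain z w t) 0))) \<partial>\<nu>) + mu)"
  by (simp add: nn_integral_add nn_integral_cmult noise.P.emeasure_space_1[simplified] \<nu>.emeasure_space_1)
 also have "(\<integral>\<^sup>+z. (\<E> w. ennreal (norm (snd (chain z w t) 0))) \<partial>\<nu>) = (\<integral>\<^sup>+D. ennreal (norm (D 0)) \<partial>\<D>)"
  by (rule nn_integral_memory[OF \<nu>]) measurable
 also have "(\<integral>\<^sup>+z. (\<E> w. ?g (chain z w t)) \<partial>\<nu>) + ennreal (s * C) * (1 + (\<integral>\<^sup>+D. ennreal (norm (D 0)) \<partial>\<D>) + mu)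
  \<le> (\<integral>\<^sup>+z. (\<E> w. ?g (chain z w t)) \<partial>\<nu>) + ennreal (s * C) * (1 + ennreal m1 + ennreal (1 + 8 * real CARD('d)))"
  unfolding mu_def by (intro add_left_mono mult_left_mono add_mono m1 nn_integral_gauss_norm_le order.refl) auto
 also have "ennreal (s * C) * (1 + ennreal m1 + ennreal (1 + 8 * real CARD('d))) = ennreal (s * drift)"
 proof -
  define m2 where "m2 = 1 + 8 * real CARD('d)"
  have "m2 \<ge> 0" by (simp add: m2_def)
  then have "1 + ennreal m1 + ennreal m2 = ennreal (1 + m1 + m2)" using m1(2) by simp
  then have "ennreal (s * C) * (1 + ennreal m1 + ennreal m2) = ennreal (s * C) * ennreal (1 + m1 + m2)" by (simp only:)
  also have "... = ennreal ((s * C) * (1 + m1 + m2))"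
   using s C m1(2) \<open>m2 \<ge> 0\<close> by (intro ennreal_mult[symmetric]) auto
  finally show ?thesis unfolding drift_def m2_def mult.assoc .
 qed
 finally show ?thesis .
qed

lemma nn_integral_V_le:
 assumes \<nu>: "initial \<nu>" and v: "(\<integral>\<^sup>+z. ennreal (V (fst z)) \<partial>\<nu>) \<le> ennreal v" "v \<ge> 0"
 shows "(\<integral>\<^sup>+z. (\<E> w. ennreal (V (fst (chain z w t)))) \<partial>\<nu>) \<le> ennreal (v + drift / (1 - \<gamma>))"
proof (induction t)
 case 0
 have "v \<le> v + drift / (1 - \<gamma>)" using drift_nonneg \<gamma> by simp
 from order_trans[OF v(1) ennreal_leI[OF this]] show ?case by (simp add: noise.P.emeasure_space_1[simplified])
next
 case (Suc t)
 have [measurable_cong]: "sets \<nu> = sets state_space" using \<nu> by (simp add: initial_def)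
 let ?I = "\<integral>\<^sup>+z. (\<E> w. ennreal (V (fst (chain z w t)))) \<partial>\<nu>"
 have "(\<integral>\<^sup>+z. (\<E> w. ennreal (V (fst (chain z w (Suc t))))) \<partial>\<nu>)
  \<le> (\<integral>\<^sup>+z. (\<E> w. ennreal (\<gamma> * V (fst (chain z w t)))) \<partial>\<nu>) + ennreal drift"
  using nn_integral_V_Suc[OF \<nu>, where s=1 and R=top and t=t] by simp
 also have "(\<integral>\<^sup>+z. (\<E> w. ennreal (\<gamma> * V (fst (chain z w t)))) \<partial>\<nu>) = ennreal \<gamma> * ?I"
  using \<gamma> V_nonneg by (simp add: ennreal_mult nn_integral_cmult)
 also have "... + ennreal drift \<le> ennreal \<gamma> * ennreal (v + drift / (1 - \<gamma>)) + ennreal drift"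
  by (intro add_right_mono mult_left_mono Suc.IH) auto
 also have "... = ennreal (\<gamma> * (v + drift / (1 - \<gamma>)) + drift)"
  using \<gamma> v(2) drift_nonneg by (simp add: ennreal_mult ennreal_plus)
 also have "... \<le> ennreal (v + drift / (1 - \<gamma>))"
 proof (rule ennreal_leI)
  have "\<gamma> * v \<le> 1 * v" using \<gamma> v(2) by (intro mult_right_mono) auto
  moreover have "\<gamma> * (drift / (1 - \<gamma>)) + drift = drift / (1 - \<gamma>)" using \<gamma> by (simp add: field_simps)
  ultimately show "\<gamma> * (v + drift / (1 - \<gamma>)) + drift \<le> v + drift / (1 - \<gamma>)" unfolding distrib_left by linarith
 qed
 finally show ?case .
qed

end

text \<open>Markov's inequality at level 1, once for each of the k starting times.\<close>

lemma nn_integral_escape_le: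
 assumes \<nu>: "initial \<nu>" and Y [measurable]: "Y \<in> borel_measurable state_space"
  and e: "\<And>t. (\<integral>\<^sup>+z. (\<E> w. ennreal (Y (chain z w t))) \<partial>\<nu>) \<le> ennreal e" "e \<ge> 0"
 shows "(\<integral>\<^sup>+z. (\<E> w. ennreal (escape Y \<tau> k (chain z w t))) \<partial>\<nu>) \<le> ennreal (real k * e)"
proof (induction k arbitrary: t)
 case (Suc k)
 have [measurable_cong]: "sets \<nu> = sets state_space" using \<nu> by (simp add: initial_def)
 have "(\<integral>\<^sup>+z. (\<E> w. ennreal (escape Y \<tau> (Suc k) (chain z w t))) \<partial>\<nu>)
  \<le> (\<integral>\<^sup>+z. (\<E> w. ennreal (Y (chain z w t)) + (\<E> w'. ennreal (escape Y \<tau> k (chain (chain z w t) w' \<tau>)))) \<partial>\<nu>)"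
 proof (intro nn_integral_mono)
  fix z w
  let ?z = "chain z w t"
  have "(\<E> w'. ennreal (escape Y \<tau> k (chain ?z w' \<tau>))) = ennreal (\<EE> w'. escape Y \<tau> k (chain ?z w' \<tau>))"
   by (intro nn_integral_eq_integral noise.P.bounded_expectation(1)[where K="real k"] AE_I2 escape_bounds[OF Y]) measurable
  moreover have "ennreal (indicator {z. 1 < Y z} ?z) \<le> ennreal (Y ?z)"
   by (auto split: split_indicator simp: ennreal_ge_1)
  moreover have "0 \<le> (\<EE> w'. escape Y \<tau> k (chain ?z w' \<tau>))"
   by (intro integral_nonneg_AE AE_I2 escape_bounds[OF Y])
  ultimately show "ennreal (escape Y \<tau> (Suc k) ?z) \<le> ennreal (Y ?z) + (\<E> w'. ennreal (escape Y \<tau> k (chain ?z w' \<tau>)))"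
   by (simp add: ennreal_plus add_right_mono)
 qed
 also have "... = (\<integral>\<^sup>+z. (\<E> w. ennreal (Y (chain z w t))) \<partial>\<nu>)
   + (\<integral>\<^sup>+z. (\<E> w. ennreal (escape Y \<tau> k (chain z w (t + \<tau>)))) \<partial>\<nu>)"
  by (subst nn_integral_chain_add, measurable) (simp add: nn_integral_add)
 also have "... \<le> ennreal e + ennreal (real k * e)"
  by (intro add_mono e Suc.IH)
 also have "... = ennreal (real (Suc k) * e)"
  using e(2) by (subst ennreal_plus[symmetric]) (auto simp: algebra_simps)
 finally show ?case .
qed simp

end

section \<open>Polynomial rates\<close>

text \<open>From ln x \<le> x - 1 at x = e (j + 1), with e chosen so that (j + 1)^s costs a constant
  times \<gamma>^(-j/2), half of the available geometric decay.\<close>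

lemma geometric_powr_bound:
 fixes \<gamma> s :: real
 assumes \<gamma>: "0 < \<gamma>" "\<gamma> < 1" and s: "s > 0"
 obtains Z where "Z > 0" "\<And>T. (\<Sum>j\<le>T. \<gamma> ^ j * real (Suc j) powr s) \<le> Z" "\<And>T. \<gamma> ^ T * real (Suc T) powr s \<le> Z"
proof -
 define e where "e = - ln \<gamma> / (2 * s)"
 have e: "e > 0" using assms by (simp add: e_def divide_neg_pos)
 define c where "c = exp (s * (e - 1 - ln e))"
 have le: "\<gamma> ^ j * real (Suc j) powr s \<le> c * sqrt \<gamma> ^ j" for j
 proof -
  have "ln (e * real (Suc j)) \<le> e * real (Suc j) - 1" using e by (intro ln_le_minus_one) auto
  moreover have "ln (e * real (Suc j)) = ln e + ln (real (Suc j))" using e by (intro ln_mult_pos) auto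
  ultimately have "ln (real (Suc j)) \<le> e * real j + (e - 1 - ln e)"
   by (simp only: of_nat_Suc ring_distribs)
  then have "s * ln (real (Suc j)) \<le> s * (e * real j + (e - 1 - ln e))" using s by simp
  also have "... = real j * (- ln \<gamma> / 2) + s * (e - 1 - ln e)"
   using s by (simp add: e_def field_simps)
  finally have "real (Suc j) powr s \<le> exp (real j * (- ln \<gamma> / 2)) * c"
   by (simp add: powr_def c_def exp_add[symmetric])
  then have "\<gamma> ^ j * real (Suc j) powr s \<le> \<gamma> ^ j * (exp (real j * (- ln \<gamma> / 2)) * c)"
   using \<gamma> by (intro mult_left_mono) auto
  also have "\<gamma> ^ j * exp (real j * (- ln \<gamma> / 2)) = sqrt \<gamma> ^ j"
  proof -
   have "\<gamma> ^ j = exp (real j * ln \<gamma>)" using \<gamma> by (simp add: exp_of_nat_mult)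
   moreover have "sqrt \<gamma> ^ j = exp (real j * (ln \<gamma> / 2))"
    using \<gamma> by (simp add: exp_of_nat_mult ln_sqrt[symmetric])
   ultimately show ?thesis by (simp add: exp_add[symmetric] field_simps)
  qed
  then have "\<gamma> ^ j * (exp (real j * (- ln \<gamma> / 2)) * c) = c * sqrt \<gamma> ^ j" by (simp add: algebra_simps)
  finally show ?thesis .
 qed
 have g: "summable (\<lambda>j. c * sqrt \<gamma> ^ j)" using \<gamma> by (intro summable_mult summable_geometric) auto
 have c: "c > 0" by (simp add: c_def)
 show ?thesis
 proof (rule that[of "(\<Sum>j. c * sqrt \<gamma> ^ j) + 1"])
  show "(\<Sum>j. c * sqrt \<gamma> ^ j) + 1 > 0" using suminf_nonneg[OF g] c \<gamma> by (simp add: add_nonneg_pos)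
  fix T
  have "(\<Sum>j\<le>T. \<gamma> ^ j * real (Suc j) powr s) \<le> (\<Sum>j\<le>T. c * sqrt \<gamma> ^ j)" by (intro sum_mono le)
  also have "... \<le> (\<Sum>j. c * sqrt \<gamma> ^ j)" using c \<gamma> by (intro sum_le_suminf g) auto
  finally show 1: "(\<Sum>j\<le>T. \<gamma> ^ j * real (Suc j) powr s) \<le> (\<Sum>j. c * sqrt \<gamma> ^ j) + 1" by simp
  have "\<gamma> ^ T * real (Suc T) powr s \<le> (\<Sum>j\<le>T. \<gamma> ^ j * real (Suc j) powr s)"
   using \<gamma> by (intro member_le_sum) auto
  with 1 show "\<gamma> ^ T * real (Suc T) powr s \<le> (\<Sum>j. c * sqrt \<gamma> ^ j) + 1" by simp
 qed
qed

text \<open>Since Suc T is at most the product of Suc i and Suc (T - i), the power at i is the power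
  at T times a polynomial factor in T - i, which the geometric weight absorbs. Discounting therefore
  preserves the order of decay.\<close>

lemma discounted_powr_sum:
 fixes \<gamma> s :: real
 assumes \<gamma>: "0 < \<gamma>" "\<gamma> < 1" and s: "s > 0"
 obtains Z where "Z > 0" "\<And>T. (\<Sum>i\<le>T. \<gamma> ^ (T - i) * real (Suc i) powr (- s)) \<le> Z * real (Suc T) powr (- s)"
  "\<And>T. \<gamma> ^ T \<le> Z * real (Suc T) powr (- s)"
proof -
 obtain Z where Z: "Z > 0" "\<And>T. (\<Sum>j\<le>T. \<gamma> ^ j * real (Suc j) powr s) \<le> Z" "\<And>T. \<gamma> ^ T * real (Suc T) powr s \<le> Z"
  using geometric_powr_bound[OF assms] by blast
 show ?thesis
 proof (rule that[OF Z(1)])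
  fix T
  have "(\<Sum>i\<le>T. \<gamma> ^ (T - i) * real (Suc i) powr (- s)) \<le> (\<Sum>i\<le>T. real (Suc T) powr (- s) * (\<gamma> ^ (T - i) * real (Suc (T - i)) powr s))"
  proof (intro sum_mono)
   fix i assume i: "i \<in> {..T}"
   then obtain j where "T = i + j" by (auto simp: le_iff_add)
   then have "Suc T \<le> Suc i * Suc (T - i)" by simp
   then have "real (Suc T) \<le> real (Suc i) * real (Suc (T - i))" by (metis of_nat_le_iff of_nat_mult)
   then have "(real (Suc i) * real (Suc (T - i))) powr (- s) \<le> real (Suc T) powr (- s)"
    using s by (intro powr_mono2') auto
   then have "real (Suc i) powr (- s) * real (Suc (T - i)) powr (- s) * real (Suc (T - i)) powr s \<le> real (Suc T) powr (- s) * real (Suc (T - i)) powr s"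
    by (simp add: powr_mult mult_right_mono)
   then have "real (Suc i) powr (- s) \<le> real (Suc T) powr (- s) * real (Suc (T - i)) powr s"
    by (simp add: mult.assoc powr_add[symmetric])
   then have "\<gamma> ^ (T - i) * real (Suc i) powr (- s) \<le> \<gamma> ^ (T - i) * (real (Suc T) powr (- s) * real (Suc (T - i)) powr s)"
    using \<gamma> by (intro mult_left_mono) auto
   then show "\<gamma> ^ (T - i) * real (Suc i) powr (- s) \<le> real (Suc T) powr (- s) * (\<gamma> ^ (T - i) * real (Suc (T - i)) powr s)"
    by (simp add: mult.left_commute)
  qed
  also have "... = real (Suc T) powr (- s) * (\<Sum>i\<le>T. \<gamma> ^ (T - i) * real (Suc (T - i)) powr s)"
   by (simp add: sum_distrib_left)
  also have "(\<Sum>i\<le>T. \<gamma> ^ (T - i) * real (Suc (T - i)) powr s) = (\<Sum>j\<le>T. \<gamma> ^ j * real (Suc j) powr s)"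
   by (rule sum.reindex_bij_witness[of _ "\<lambda>j. T - j" "\<lambda>j. T - j"]) auto
  also have "real (Suc T) powr (- s) * \<dots> \<le> real (Suc T) powr (- s) * Z"
   by (intro mult_left_mono Z) auto
  finally show "(\<Sum>i\<le>T. \<gamma> ^ (T - i) * real (Suc i) powr (- s)) \<le> Z * real (Suc T) powr (- s)"
   by (simp add: mult.commute)
  have "\<gamma> ^ T = \<gamma> ^ T * real (Suc T) powr s * real (Suc T) powr (- s)"
   by (simp add: mult.assoc powr_add[symmetric])
  also have "... \<le> Z * real (Suc T) powr (- s)" by (intro mult_right_mono Z) auto
  finally show "\<gamma> ^ T \<le> Z * real (Suc T) powr (- s)" .
 qed
qed

context stationary_memory
begin

text \<open>The V part decays geometrically in T and the discounted memory part like the moment of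
  entry T. So a trial starting with potential above 1 becomes rare as the waiting time grows, which
  is how \<open>escape\<close> is paid for.\<close>

lemma potential_moment:
 assumes \<nu>: "initial \<nu>"
  and [measurable]: "V \<in> borel_measurable borel" and V0: "\<And>x. V x \<ge> 0" and \<gamma>: "0 < \<gamma>" "\<gamma> < 1" and C: "C \<ge> 0"
  and V: "\<And>t. (\<integral>\<^sup>+z. (\<E> w. ennreal (V (fst (chain z w t)))) \<partial>\<nu>) \<le> ennreal B" "B \<ge> 0"
  and D: "\<And>m. (\<integral>\<^sup>+D. ennreal (norm (D m)) \<partial>\<D>) \<le> ennreal (M * real (Suc m) powr (- s))" "M \<ge> 0"
  and Z: "\<And>T. (\<Sum>i\<le>T. \<gamma> ^ (T - i) * real (Suc i) powr (- s)) \<le> Z * real (Suc T) powr (- s)"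
   "\<And>T. \<gamma> ^ T \<le> Z * real (Suc T) powr (- s)"
 shows "(\<integral>\<^sup>+z. (\<E> w. ennreal (potential V \<gamma> C T (chain z w t))) \<partial>\<nu>)
  \<le> ennreal ((B + C * M) * Z * real (Suc T) powr (- s))"
proof -
 have [measurable_cong]: "sets \<nu> = sets state_space" using \<nu> by (simp add: initial_def)
 have "(\<integral>\<^sup>+z. (\<E> w. ennreal (potential V \<gamma> C T (chain z w t))) \<partial>\<nu>)
  = (\<integral>\<^sup>+z. (\<E> w. ennreal (\<gamma> ^ T) * ennreal (V (fst (chain z w t)))
    + ennreal C * (\<Sum>i\<le>T. ennreal (\<gamma> ^ (T - i)) * ennreal (norm (snd (chain z w t) i)))) \<partial>\<nu>)"
 proof (intro nn_integral_cong)
  fix z w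
  have "ennreal (\<Sum>i\<le>T. \<gamma> ^ (T - i) * norm (snd (chain z w t) i)) = (\<Sum>i\<le>T. ennreal (\<gamma> ^ (T - i)) * ennreal (norm (snd (chain z w t) i)))"
   using \<gamma> by (subst sum_ennreal[symmetric]) (auto simp: ennreal_mult)
  moreover have "0 \<le> (\<Sum>i\<le>T. \<gamma> ^ (T - i) * norm (snd (chain z w t) i))" using \<gamma> by (intro sum_nonneg) auto
  ultimately show "ennreal (potential V \<gamma> C T (chain z w t)) = ennreal (\<gamma> ^ T) * ennreal (V (fst (chain z w t)))
    + ennreal C * (\<Sum>i\<le>T. ennreal (\<gamma> ^ (T - i)) * ennreal (norm (snd (chain z w t) i)))"
   using V0 \<gamma> C by (simp add: potential_def ennreal_plus ennreal_mult)
 qed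
 also have "... = ennreal (\<gamma> ^ T) * (\<integral>\<^sup>+z. (\<E> w. ennreal (V (fst (chain z w t)))) \<partial>\<nu>)
   + ennreal C * (\<Sum>i\<le>T. ennreal (\<gamma> ^ (T - i)) * (\<integral>\<^sup>+z. (\<E> w. ennreal (norm (snd (chain z w t) i))) \<partial>\<nu>))"
  by (simp add: nn_integral_add nn_integral_cmult nn_integral_sum)
 also have "... = ennreal (\<gamma> ^ T) * (\<integral>\<^sup>+z. (\<E> w. ennreal (V (fst (chain z w t)))) \<partial>\<nu>)
   + ennreal C * (\<Sum>i\<le>T. ennreal (\<gamma> ^ (T - i)) * (\<integral>\<^sup>+D. ennreal (norm (D i)) \<partial>\<D>))"
  by (subst nn_integral_memory[OF \<nu>, where g="\<lambda>D. ennreal (norm (D _))"]) auto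
 also have "... \<le> ennreal (\<gamma> ^ T) * ennreal B
   + ennreal C * (\<Sum>i\<le>T. ennreal (\<gamma> ^ (T - i)) * ennreal (M * real (Suc i) powr (- s)))"
  by (intro add_mono mult_left_mono sum_mono V D) auto
 also have "... = ennreal (\<gamma> ^ T * B + C * (\<Sum>i\<le>T. \<gamma> ^ (T - i) * (M * real (Suc i) powr (- s))))"
 proof -
  have "(\<Sum>i\<le>T. ennreal (\<gamma> ^ (T - i)) * ennreal (M * real (Suc i) powr (- s))) = ennreal (\<Sum>i\<le>T. \<gamma> ^ (T - i) * (M * real (Suc i) powr (- s)))"
   using \<gamma> D(2) by (subst sum_ennreal[symmetric]) (auto simp: ennreal_mult simp del: powr_gt_zero)
  moreover have "0 \<le> (\<Sum>i\<le>T. \<gamma> ^ (T - i) * (M * real (Suc i) powr (- s)))" using \<gamma> D(2) by (intro sum_nonneg) auto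
  ultimately show ?thesis using \<gamma> V(2) C by (simp add: ennreal_plus ennreal_mult)
 qed
 also have "... \<le> ennreal ((B + C * M) * Z * real (Suc T) powr (- s))"
 proof (rule ennreal_leI)
  have "(\<Sum>i\<le>T. \<gamma> ^ (T - i) * (M * real (Suc i) powr (- s))) = M * (\<Sum>i\<le>T. \<gamma> ^ (T - i) * real (Suc i) powr (- s))"
   by (simp add: sum_distrib_left mult.left_commute)
  also have "... \<le> M * (Z * real (Suc T) powr (- s))" by (intro mult_left_mono Z D)
  finally have "C * (\<Sum>i\<le>T. \<gamma> ^ (T - i) * (M * real (Suc i) powr (- s))) \<le> C * (M * (Z * real (Suc T) powr (- s)))"
   using C by (rule mult_left_mono)
  moreover have "\<gamma> ^ T * B \<le> (Z * real (Suc T) powr (- s)) * B" by (intro mult_right_mono Z V)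
  ultimately show "\<gamma> ^ T * B + C * (\<Sum>i\<le>T. \<gamma> ^ (T - i) * (M * real (Suc i) powr (- s))) \<le> (B + C * M) * Z * real (Suc T) powr (- s)"
   by (simp add: algebra_simps)
 qed
 finally show ?thesis .
qed

text \<open>The same memory with X reset to 0. Integrating over the reset points gives a quantity
  that depends on \<D> alone, a reference common to all initial laws; and since a point and its
  reset share the memory, the smallness assumption of \<open>trial_bound\<close> is met with
  difference 0.\<close>

definition origin where "origin \<nu> = distr \<nu> state_space (\<lambda>z. (0, snd z))"

lemma initial_origin: "initial \<nu> \<Longrightarrow> initial (origin \<nu>)"
proof -
 assume \<nu>: "initial \<nu>"
 then interpret \<nu>: prob_space \<nu> by (simp add: initial_def)
 have [measurable_cong]: "sets \<nu> = sets state_space" using \<nu> by (simp add: initial_def)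
 have "distr (origin \<nu>) traj_space snd = distr \<nu> traj_space snd"
  unfolding origin_def by (subst distr_distr) (auto simp: o_def)
 with \<nu> show "initial (origin \<nu>)"
  by (auto simp: initial_def origin_def intro!: \<nu>.prob_space_distr)
qed

lemma integral_origin:
 assumes \<nu>: "initial \<nu>" and [measurable]: "f \<in> borel_measurable state_space"
 shows "(\<integral>z. f (0, snd z) \<partial>\<nu>) = (\<integral>D. f (0, D) \<partial>\<D> :: real)"
proof -
 have [measurable_cong]: "sets \<nu> = sets state_space" using \<nu> by (simp add: initial_def)
 have "(\<integral>D. f (0, D) \<partial>\<D>) = (\<integral>D. f (0, D) \<partial>distr \<nu> traj_space snd)"
  using \<nu> by (simp add: initial_def)
 also have "... = (\<integral>z. f (0, snd z) \<partial>\<nu>)" by (subst integral_distr) auto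
 finally show ?thesis ..
qed

lemma comparison_with_origin:
 assumes \<nu>: "initial \<nu>" and A [measurable]: "A \<in> sets traj_space" and Y [measurable]: "Y \<in> borel_measurable state_space"
  and bound: "\<And>z. \<bar>path_prob A n z - path_prob A n (0, snd z)\<bar> \<le> b + escape Y \<tau> k z + escape Y \<tau> k (0, snd z)"
  and e: "\<And>t. (\<integral>\<^sup>+z. (\<E> w. ennreal (Y (chain z w t))) \<partial>\<nu>) \<le> ennreal e"
   "\<And>t. (\<integral>\<^sup>+z. (\<E> w. ennreal (Y (chain z w t))) \<partial>origin \<nu>) \<le> ennreal e" "e \<ge> 0"
 shows "\<bar>(\<integral>z. path_prob A n z \<partial>\<nu>) - (\<integral>D. path_prob A n (0, D) \<partial>\<D>)\<bar> \<le> b + 2 * real k * e"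
proof -
 interpret \<nu>: prob_space \<nu> using \<nu> by (simp add: initial_def)
 have [measurable_cong]: "sets \<nu> = sets state_space" using \<nu> by (simp add: initial_def)
 have sp: "space \<nu> = UNIV" using sets_eq_imp_space_eq[of \<nu> state_space] \<nu> by (simp add: initial_def)
 have esc: "(\<integral>z. escape Y \<tau> k z \<partial>\<mu>) \<le> real k * e" if \<mu>: "initial \<mu>"
  "\<And>t. (\<integral>\<^sup>+z. (\<E> w. ennreal (Y (chain z w t))) \<partial>\<mu>) \<le> ennreal e" for \<mu>
 proof -
  interpret \<mu>: prob_space \<mu> using \<mu> by (simp add: initial_def)
  have [measurable_cong]: "sets \<mu> = sets state_space" using \<mu> by (simp add: initial_def)
  have i: "integrable \<mu> (escape Y \<tau> k)"
   by (rule \<mu>.bounded_expectation(1)[OF _ escape_bounds[OF Y]]) measurable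
  have "ennreal (\<integral>z. escape Y \<tau> k z \<partial>\<mu>) = (\<integral>\<^sup>+z. (\<E> w. ennreal (escape Y \<tau> k (chain z w 0))) \<partial>\<mu>)"
   using nn_integral_eq_integral[OF i] escape_bounds[OF Y] by (simp add: noise.P.emeasure_space_1[simplified])
  also have "... \<le> ennreal (real k * e)" by (rule nn_integral_escape_le[OF \<mu>(1) Y \<mu>(2) e(3)])
  finally show ?thesis using e(3) by (simp add: ennreal_le_iff)
 qed
 have esc0: "(\<integral>z. escape Y \<tau> k (0, snd z) \<partial>\<nu>) \<le> real k * e"
 proof -
  have "(\<integral>z. escape Y \<tau> k (0, snd z) \<partial>\<nu>) = (\<integral>z. escape Y \<tau> k z \<partial>origin \<nu>)"
   unfolding origin_def by (subst integral_distr) auto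
  also have "... \<le> real k * e" by (rule esc[OF initial_origin[OF \<nu>] e(2)])
  finally show ?thesis .
 qed
 have int: "integrable \<nu> (\<lambda>z. path_prob A n z)" "integrable \<nu> (\<lambda>z. path_prob A n (0, snd z))"
  "integrable \<nu> (\<lambda>z. escape Y \<tau> k z)" "integrable \<nu> (\<lambda>z. escape Y \<tau> k (0, snd z))"
  by (rule \<nu>.bounded_expectation(1)[OF _ path_prob_bounds] \<nu>.bounded_expectation(1)[OF _ escape_bounds[OF Y]]; measurable)+
 have "\<bar>(\<integral>z. path_prob A n z \<partial>\<nu>) - (\<integral>D. path_prob A n (0, D) \<partial>\<D>)\<bar>
  = \<bar>\<integral>z. path_prob A n z - path_prob A n (0, snd z) \<partial>\<nu>\<bar>"
  using int by (simp add: integral_origin[OF \<nu>, symmetric])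
 also have "... \<le> (\<integral>z. \<bar>path_prob A n z - path_prob A n (0, snd z)\<bar> \<partial>\<nu>)" by (rule integral_abs_bound)
 also have "... \<le> (\<integral>z. b + escape Y \<tau> k z + escape Y \<tau> k (0, snd z) \<partial>\<nu>)"
 proof (intro integral_mono bound)
  show "integrable \<nu> (\<lambda>z. \<bar>path_prob A n z - path_prob A n (0, snd z)\<bar>)"
   by (intro integrable_abs Bochner_Integration.integrable_diff int)
  show "integrable \<nu> (\<lambda>z. b + escape Y \<tau> k z + escape Y \<tau> k (0, snd z))"
   by (intro Bochner_Integration.integrable_add int) simp
 qed
 also have "... = b + (\<integral>z. escape Y \<tau> k z \<partial>\<nu>) + (\<integral>z. escape Y \<tau> k (0, snd z) \<partial>\<nu>)"
  using int by (simp add: \<nu>.prob_space)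
 also have "... \<le> b + 2 * real k * e" using esc[OF \<nu> e(1)] esc0 by simp
 finally show ?thesis .
qed

end

section \<open>Choice of the exponents and the resulting rate\<close>

lemma eventually_powr_le:
 fixes x y c :: real
 assumes "x < y"
 shows "\<forall>\<^sub>F n in sequentially. c * real n powr x \<le> real n powr y"
proof -
 have "((\<lambda>n. c * real n powr (x - y)) \<longlongrightarrow> c * 0) sequentially"
  using assms by (intro tendsto_mult_left tendsto_neg_powr filterlim_real_sequentially) auto
 then have "\<forall>\<^sub>F n in sequentially. c * real n powr (x - y) < 1"
  by (rule order_tendstoD) simp
 moreover have "\<forall>\<^sub>F n in sequentially. n \<ge> (1::nat)" by (rule eventually_ge_at_top)
 ultimately show ?thesis
 proof eventually_elim
  case (elim n)
  have "c * real n powr x = (c * real n powr (x - y)) * real n powr y"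
   by (simp add: mult.assoc powr_add[symmetric])
  also have "... \<le> 1 * real n powr y" using elim by (intro mult_right_mono) auto
  finally show ?case by simp
 qed
qed

lemma eventually_exp_powr_le:
 fixes c \<theta> p :: real
 assumes "c > 0" "\<theta> > 0"
 shows "\<forall>\<^sub>F n in sequentially. exp (- c * real n powr \<theta>) \<le> real n powr (- p)"
 using assms by real_asymp

lemma nat_floor_powr:
 fixes \<theta> :: real
 assumes n: "n \<ge> (1::nat)" and \<theta>: "\<theta> \<ge> 0"
 defines "T \<equiv> nat \<lfloor>real n powr \<theta>\<rfloor>"
 shows "T \<ge> 1" "real T \<le> real n powr \<theta>" "real n powr \<theta> \<le> real (Suc T)" "real n powr \<theta> / 2 \<le> real T"
  "real (Suc T) \<le> 2 * real n powr \<theta>"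
proof -
 have 1: "1 \<le> real n powr \<theta>" using n \<theta> by (intro ge_one_powr_ge_zero) auto
 then show "T \<ge> 1" unfolding T_def by linarith
 show 2: "real T \<le> real n powr \<theta>" unfolding T_def using 1 by linarith
 show 3: "real n powr \<theta> \<le> real (Suc T)" unfolding T_def using 1 by linarith
 show "real n powr \<theta> / 2 \<le> real T" using 3 \<open>T \<ge> 1\<close> by simp
 show "real (Suc T) \<le> 2 * real n powr \<theta>" using 1 2 by simp
qed

text \<open>\<theta>1, \<theta>2, \<theta>3 are the exponents of T, L and k. The conditions ensure
  that the compensation tail L^(-\<theta>) is at most n^(-p), that k trials of length T + L + 1 fit
  into n steps, that k \<kappa> \<le> 1, and that k times the potential moment is of order
  n^(-p).\<close>

lemma rate_parameters:
 fixes \<alpha> \<beta> \<rho> p :: real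
 assumes \<beta>: "\<beta> > 1/2" and \<alpha>: "max (1/2) (3/2 - \<beta>) < \<alpha>" "\<alpha> < \<rho>" and p: "0 < p"
  "p < min 1 (2 * (\<rho> - \<alpha>)) * (min (min \<alpha> \<beta>) (\<alpha> + \<beta> - 1) - 1/2)"
 obtains \<sigma> \<theta> \<theta>1 \<theta>2 \<theta>3 where
  "\<sigma> \<le> \<alpha>" "\<sigma> \<le> \<beta>" "\<sigma> < \<alpha> + \<beta> - 1" "0 \<le> \<theta>" "\<theta> < \<sigma> - 1/2" "p \<le> \<theta>2 * \<theta>"
  "\<theta>1 > 0" "\<theta>2 > 0" "\<theta>3 > 0" "\<theta>1 + \<theta>3 < 1" "\<theta>2 + \<theta>3 < 1" "\<theta>3 + \<theta>2 / 2 < \<theta>1 * (\<rho> - \<alpha>)" "p + \<theta>3 < \<theta>1 * (\<rho> - 1/2)"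
proof -
 define m0 where "m0 = min 1 (2 * (\<rho> - \<alpha>))"
 define c0 where "c0 = min (min \<alpha> \<beta>) (\<alpha> + \<beta> - 1) - 1/2"
 have m0: "0 < m0" "m0 \<le> 1" "m0 \<le> 2 * (\<rho> - \<alpha>)" using \<alpha> by (auto simp: m0_def)
 have c0: "0 < c0" "c0 + 1/2 \<le> \<alpha>" "c0 + 1/2 \<le> \<beta>" "c0 + 1/2 \<le> \<alpha> + \<beta> - 1" using \<alpha> \<beta> by (auto simp: c0_def)
 have pP: "p < m0 * c0" using p by (simp add: m0_def c0_def)
 \<comment> \<open>p is m0 c0 t with t < 1. Both factors are shrunk by x, where x^2 \<ge> t because
   (1 + t)^2 \<ge> 4 t; the product of the shrunk factors still reaches p.\<close>
 define t where "t = p / (m0 * c0)"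
 have t: "0 < t" "t < 1" using p pP m0 c0 by (auto simp: t_def)
 define x where "x = (1 + t) / 2"
 have x: "0 < x" "x < 1" using t by (auto simp: x_def)
 have "0 < (1 - t)\<^sup>2" using t by simp
 then have xt: "t \<le> x * x" by (simp add: x_def power2_eq_square field_simps)
 define \<theta>2 where "\<theta>2 = m0 * x"
 define \<theta> where "\<theta> = c0 * x"
 define \<sigma> where "\<sigma> = 1/2 + c0 * ((1 + x) / 2)"
 have \<theta>2: "0 < \<theta>2" "\<theta>2 < 1" "\<theta>2 < 2 * (\<rho> - \<alpha>)"
 proof -
  have "m0 * x < m0 * 1" using m0 x by (intro mult_strict_left_mono) auto
  then show "\<theta>2 < 1" "\<theta>2 < 2 * (\<rho> - \<alpha>)" using m0 unfolding \<theta>2_def mult_1_right by linarith+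
 qed (use m0 x in \<open>simp add: \<theta>2_def\<close>)
 have \<sigma>: "\<sigma> < c0 + 1/2"
 proof -
  have "c0 * ((1 + x) / 2) < c0 * 1" using c0 x by (intro mult_strict_left_mono) auto
  then show ?thesis unfolding \<sigma>_def mult_1_right by linarith
 qed
 have \<theta>: "0 \<le> \<theta>" "\<theta> < \<sigma> - 1/2"
 proof -
  have "c0 * x < c0 * ((1 + x) / 2)" using c0 x by (intro mult_strict_left_mono) auto
  then show "\<theta> < \<sigma> - 1/2" unfolding \<theta>_def \<sigma>_def by linarith
 qed (use c0 x in \<open>simp add: \<theta>_def\<close>)
 have p\<theta>: "p \<le> \<theta>2 * \<theta>"
 proof -
  have "p = m0 * c0 * t" using m0 c0 by (simp add: t_def)
  also have "... \<le> m0 * c0 * (x * x)" using m0 c0 xt by (intro mult_left_mono) auto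
  finally show ?thesis by (simp add: \<theta>2_def \<theta>_def ac_simps)
 qed
 define s where "s = \<rho> - 1/2"
 define r where "r = \<rho> - \<alpha>"
 have "m0 * c0 \<le> 1 * c0" using m0 c0 by (intro mult_right_mono) auto
 then have s: "p < s" "s > 0" using pP c0(2) \<alpha>(2) p(1) unfolding s_def mult_1_left by linarith+
 have r: "r > 0" "\<theta>2 / 2 < r" using \<alpha> \<theta>2 by (auto simp: r_def)
 \<comment> \<open>Small enough for the three conditions that remain once \<theta>1 is set to 1 - 2
   \<theta>3.\<close>
 define \<theta>3 where "\<theta>3 = min ((1 - \<theta>2) / 2) (min ((r - \<theta>2 / 2) / (2 * (1 + 2 * r))) ((s - p) / (2 * (1 + 2 * s))))"
 have \<theta>3: "\<theta>3 > 0" using \<theta>2 r s by (auto simp: \<theta>3_def)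
 have l1: "\<theta>3 \<le> (1 - \<theta>2) / 2" unfolding \<theta>3_def by (rule min.cobounded1)
 have "\<theta>3 \<le> (r - \<theta>2 / 2) / (2 * (1 + 2 * r))" unfolding \<theta>3_def by (rule min.coboundedI2, rule min.cobounded1)
 then have l2: "\<theta>3 * (2 * (1 + 2 * r)) \<le> r - \<theta>2 / 2" using r by (subst (asm) pos_le_divide_eq) auto
 have "\<theta>3 \<le> (s - p) / (2 * (1 + 2 * s))" unfolding \<theta>3_def by (rule min.coboundedI2, rule min.cobounded2)
 then have l3: "\<theta>3 * (2 * (1 + 2 * s)) \<le> s - p" using s by (subst (asm) pos_le_divide_eq) auto
 have q: "\<theta>3 * r > 0" "\<theta>3 * s > 0" using \<theta>3 r s by auto
 show ?thesis
 proof (rule that[of \<sigma> \<theta> \<theta>2 "1 - 2 * \<theta>3" \<theta>3])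
  show "\<theta>3 + \<theta>2 / 2 < (1 - 2 * \<theta>3) * (\<rho> - \<alpha>)" using l2 q \<theta>3 by (simp add: r_def[symmetric] algebra_simps)
  show "p + \<theta>3 < (1 - 2 * \<theta>3) * (\<rho> - 1/2)" unfolding s_def[symmetric] using l3 q \<theta>3 by (simp add: algebra_simps)
 qed (use \<sigma> \<theta> c0 p\<theta> \<theta>2 \<theta>3 l1 in auto)
qed

context stationary_memory
begin

text \<open>K, r, c, M, H and \<delta> are fixed before n enters, so afterwards only powers of n
  have to be compared. The error consists of the tail cost 2 s, the factor (1 - \<delta> / 2)^k for
  repeated failure, and the escape terms of a point and of its reset.\<close>

theorem memory_convergence:
 assumes H1: "H1 F V" and H2: "H2 F"
  and Ca: "Ca > 0" "\<And>k. \<bar>a k\<bar> \<le> Ca * (real k + 1) powr (- \<rho>)"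
  and Cb: "Cb > 0" "\<And>k. \<bar>inverse_coeffs a k\<bar> \<le> Cb * (real k + 1) powr (- \<beta>)"
  and \<beta>: "\<beta> > 1/2" and \<alpha>: "max (1/2) (3/2 - \<beta>) < \<alpha>" "\<alpha> < \<rho>" and p: "0 < p"
   "p < min 1 (2 * (\<rho> - \<alpha>)) * (min (min \<alpha> \<beta>) (\<alpha> + \<beta> - 1) - 1/2)"
  and D: "\<And>m. (\<integral>\<^sup>+D. ennreal (norm (D m)) \<partial>\<D>) \<le> ennreal (MD * real (Suc m) powr (- (\<rho> - 1/2)))" and MD: "MD \<ge> 0"
  and \<nu>: "initial \<nu>" and V\<nu>: "(\<integral>\<^sup>+z. ennreal (V (fst z)) \<partial>\<nu>) < \<infinity>"
 shows "\<exists>C>0. \<forall>n\<ge>1. \<forall>A\<in>sets traj_space.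
  \<bar>(\<integral>z. path_prob A n z \<partial>\<nu>) - (\<integral>D. path_prob A n (0, D) \<partial>\<D>)\<bar> \<le> C * real n powr (- p)"
proof -
 interpret \<nu>: prob_space \<nu> using \<nu> by (simp add: initial_def)
 have [measurable_cong]: "sets \<nu> = sets state_space" using \<nu> by (simp add: initial_def)
 obtain \<gamma> C where V_cont: "continuous_on UNIV V" and V_pos: "\<And>x. V x > 0" and coercive: "filterlim V at_top at_infinity"
  and \<gamma>: "0 < \<gamma>" "\<gamma> < 1" and C: "C > 0" and VF: "\<And>x w. V (F (x, w)) \<le> \<gamma> * V x + C * (1 + norm w)"
  using H1 unfolding H1_def by auto
 have V_meas [measurable]: "V \<in> borel_measurable borel" using V_cont by (rule borel_measurable_continuous_onI)
 obtain \<sigma> \<theta> \<theta>1 \<theta>2 \<theta>3 where par: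
  "\<sigma> \<le> \<alpha>" "\<sigma> \<le> \<beta>" "\<sigma> < \<alpha> + \<beta> - 1" "0 \<le> \<theta>" "\<theta> < \<sigma> - 1/2" "p \<le> \<theta>2 * \<theta>"
  "\<theta>1 > 0" "\<theta>2 > 0" "\<theta>3 > 0" "\<theta>1 + \<theta>3 < 1" "\<theta>2 + \<theta>3 < 1" "\<theta>3 + \<theta>2 / 2 < \<theta>1 * (\<rho> - \<alpha>)" "p + \<theta>3 < \<theta>1 * (\<rho> - 1/2)"
  using rate_parameters[OF \<beta> \<alpha> p] by metis
 have \<rho>: "\<rho> > 1/2" using \<alpha> by simp
 obtain s2 where s2: "\<And>n. (\<Sum>i<n. (a i)\<^sup>2) \<le> s2"
 proof -
  obtain Z where Z: "Z > 0" "\<And>J. finite J \<Longrightarrow> (\<Sum>n\<in>J. real (Suc n) powr (- (2 * \<rho>))) \<le> Z"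
   using sum_powr_bound[of "2 * \<rho>"] \<rho> by auto
  show ?thesis
  proof (rule that)
   fix n
   have "(\<Sum>i<n. (a i)\<^sup>2) \<le> (\<Sum>i<n. Ca\<^sup>2 * real (Suc i) powr (- (2 * \<rho>)))"
   proof (rule sum_mono)
    fix i
    have "(a i)\<^sup>2 \<le> (Ca * (real i + 1) powr (- \<rho>))\<^sup>2"
     using Ca(2)[of i] by (subst power2_abs[symmetric], intro power_mono) auto
    also have "... = Ca\<^sup>2 * real (Suc i) powr (- (2 * \<rho>))"
     by (simp add: power_mult_distrib powr_numeral[symmetric] powr_powr add.commute mult.commute)
    finally show "(a i)\<^sup>2 \<le> Ca\<^sup>2 * real (Suc i) powr (- (2 * \<rho>))" .
   qed
   also have "... \<le> Ca\<^sup>2 * Z" unfolding sum_distrib_left[symmetric] by (intro mult_left_mono Z) auto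
   finally show "(\<Sum>i<n. (a i)\<^sup>2) \<le> Ca\<^sup>2 * Z" .
  qed
 qed
 define C1 where "C1 = C / \<gamma> + 1"
 have C1: "C1 > 0" using C \<gamma> by (simp add: C1_def add_pos_pos)
 obtain K where K: "K > 0"
  "\<And>T z1 z2. potential V \<gamma> C1 T z1 \<le> 1 \<Longrightarrow> potential V \<gamma> C1 T z2 \<le> 1 \<Longrightarrow>
   1 / 2 \<le> measure noise {w. chain z1 w T \<in> {z. fst z \<in> cball 0 K \<and> snd z 0 \<in> cball 0 K}
     \<and> chain z2 w T \<in> {z. fst z \<in> cball 0 K \<and> snd z 0 \<in> cball 0 K}}"
 proof (rule return_prob[OF VF \<gamma> C coercive s2, folded C1_def], goal_cases)
  case (1 K)
  show ?case
   by (rule 1(1)[OF 1(2)]) (rule 1(3); (assumption | rule less_imp_le[OF V_pos]))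
 qed
 have "\<exists>r>0. \<exists>c>0. \<exists>M>0. \<forall>x\<in>cball 0 K. \<forall>x'\<in>cball 0 K. \<forall>y\<in>cball 0 K. \<forall>y'\<in>cball 0 K.
     \<exists>\<Lambda>. bij \<Lambda> \<and>
      (\<exists>U D. open U \<and> open D \<and> negligible (- U) \<and> negligible (- D) \<and> C1_diffeo U D \<Lambda> \<and>
        (\<forall>u\<in>cball 0 r.
         F (x, u + y) = F (x', \<Lambda> u + y') \<and>
         (u \<in> U \<longrightarrow> \<bar>det (jacobian \<Lambda> (at u))\<bar> \<ge> c))) \<and>
      (\<forall>u. norm (\<Lambda> u - u) \<le> M)"
  using H2 K(1) unfolding H2_def by (elim allE impE)
 then obtain r c M where r: "r > 0" and c: "c > 0" and M: "M > 0" and \<Lambda>: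
  "\<forall>x\<in>cball 0 K. \<forall>x'\<in>cball 0 K. \<forall>y\<in>cball 0 K. \<forall>y'\<in>cball 0 K.
     \<exists>\<Lambda>. bij \<Lambda> \<and>
      (\<exists>U D. open U \<and> open D \<and> negligible (- U) \<and> negligible (- D) \<and> C1_diffeo U D \<Lambda> \<and>
        (\<forall>u\<in>cball 0 r.
         F (x, u + y) = F (x', \<Lambda> u + y') \<and>
         (u \<in> U \<longrightarrow> \<bar>det (jacobian \<Lambda> (at u))\<bar> \<ge> c))) \<and>
      (\<forall>u. norm (\<Lambda> u - u) \<le> M)"
  by (elim exE conjE)
 obtain Cc where Cc: "Cc > 0"
  "\<And>(q :: 'd traj) v L N. (\<And>m. m \<ge> 1 \<Longrightarrow> norm (q m) \<le> real m powr (- \<alpha>)) \<Longrightarrow> norm v \<le> M \<Longrightarrow>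
    (\<Sum>i<N. (norm (compensation a (\<lambda>j. if j = 0 then v else q j) (Suc L + i)))\<^sup>2) \<le> (Cc * real (Suc L) powr (- \<theta>))\<^sup>2"
  using compensation_square_sums[OF Cb(2) less_imp_le[OF Cb(1)] par(1,2,3) less_imp_le[OF M] par(4,5), where 'v="real ^ 'd"] by blast
 \<comment> \<open>The tail bound at L = 0, where the power of \<open>Suc L\<close> is 1.\<close>
 define H where "H = Cc\<^sup>2"
 have H: "(\<Sum>i<N. (norm (compensation a (\<lambda>j. if j = 0 then v else q j) (Suc i)))\<^sup>2) \<le> H"
  if "\<And>m. m \<ge> 1 \<Longrightarrow> norm (q m) \<le> real m powr (- \<alpha>)" "norm v \<le> M" for q :: "'d traj" and v N
 proof -
  have "(\<Sum>i<N. (norm (compensation a (\<lambda>j. if j = 0 then v else q j) (Suc 0 + i)))\<^sup>2) \<le> (Cc * real (Suc 0) powr (- \<theta>))\<^sup>2"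
   by (rule Cc(2)[OF that])
  then show ?thesis by (simp add: H_def)
 qed
 define \<delta> where "\<delta> = jump_const r M c H * measure gauss (cball 0 r :: (real ^ 'd) set) / 4"
 have \<delta>: "0 < \<delta>" "\<delta> \<le> 1"
 proof -
  have j: "0 < jump_const r M c H" "jump_const r M c H \<le> 1" using c by (auto simp: jump_const_def)
  \<comment> \<open>A ball of positive radius has positive volume and the density is positive
    everywhere.\<close>
  have "emeasure gauss (cball 0 r :: (real ^ 'd) set) \<noteq> 0"
  proof
   assume "emeasure gauss (cball 0 r :: (real ^ 'd) set) = 0"
   then have "cball 0 r \<in> null_sets (gauss :: (real ^ 'd) measure)" by (auto intro: null_setsI)
   then have "AE x in lborel. x \<notin> (cball 0 r :: (real ^ 'd) set)"
    unfolding gauss_def by (subst (asm) null_sets_density_iff) (auto simp: ennreal_eq_0_iff not_le[THEN iffD2, OF std_gaussian_density_pos] not_le)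
   then have "cball 0 r \<in> null_sets (lborel :: (real ^ 'd) measure)"
    by (rule AE_iff_null_sets[THEN iffD2, rotated]) simp
   then have "measure lborel (cball 0 r :: (real ^ 'd) set) = 0" by (simp add: measure_def null_setsD1)
   then show False using content_cball_pos[OF r, of "0 :: real ^ 'd"] by simp
  qed
  then have g: "0 < measure gauss (cball 0 r :: (real ^ 'd) set)"
   by (simp add: gauss.emeasure_eq_measure zero_less_measure_iff)
  then show "0 < \<delta>" using j by (simp add: \<delta>_def)
  have "jump_const r M c H * measure gauss (cball 0 r :: (real ^ 'd) set) \<le> 1 * 1"
   using j by (intro mult_mono) auto
  then show "\<delta> \<le> 1" by (simp add: \<delta>_def)
 qed
 obtain Z where Z: "Z > 0" "\<And>T. (\<Sum>i\<le>T. \<gamma> ^ (T - i) * real (Suc i) powr (- (\<rho> - 1/2))) \<le> Z * real (Suc T) powr (- (\<rho> - 1/2))"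
  "\<And>T. \<gamma> ^ T \<le> Z * real (Suc T) powr (- (\<rho> - 1/2))"
  using discounted_powr_sum[OF \<gamma>, of "\<rho> - 1/2"] \<rho> by auto
 have moment: "\<exists>B\<ge>0. \<forall>t T. (\<integral>\<^sup>+z. (\<E> w. ennreal (potential V \<gamma> C1 T (chain z w t))) \<partial>\<mu>)
   \<le> ennreal (B * real (Suc T) powr (- (\<rho> - 1/2)))"
  if \<mu>: "initial \<mu>" "(\<integral>\<^sup>+z. ennreal (V (fst z)) \<partial>\<mu>) < \<infinity>" for \<mu>
 proof -
  define v0 where "v0 = enn2real (\<integral>\<^sup>+z. ennreal (V (fst z)) \<partial>\<mu>)"
  have v0: "(\<integral>\<^sup>+z. ennreal (V (fst z)) \<partial>\<mu>) \<le> ennreal v0" "v0 \<ge> 0"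
   using \<mu>(2) by (auto simp: v0_def)
  define B where "B = v0 + drift C MD / (1 - \<gamma>)"
  have D0: "(\<integral>\<^sup>+D. ennreal (norm (D 0)) \<partial>\<D>) \<le> ennreal MD" using D[of 0] by simp
  note V_assms = V_meas less_imp_le[OF V_pos] VF \<gamma> C D0 MD
  have B: "B \<ge> 0" using v0 \<gamma> drift_nonneg[OF V_assms] by (simp add: B_def)
  have "(\<integral>\<^sup>+z. (\<E> w. ennreal (V (fst (chain z w t)))) \<partial>\<mu>) \<le> ennreal B" for t
   unfolding B_def by (rule nn_integral_V_le[OF V_assms \<mu>(1) v0])
  from potential_moment[OF \<mu>(1) V_meas _ \<gamma> less_imp_le[OF C1] this B D MD Z(2,3)]
  have "(\<integral>\<^sup>+z. (\<E> w. ennreal (potential V \<gamma> C1 T (chain z w t))) \<partial>\<mu>)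
   \<le> ennreal ((B + C1 * MD) * Z * real (Suc T) powr (- (\<rho> - 1/2)))" for t T
   using V_pos less_imp_le by blast
  moreover have "(B + C1 * MD) * Z \<ge> 0" using B C1 MD Z(1) by simp
  ultimately show ?thesis by blast
 qed
 \<comment> \<open>After the reset V is the constant \<open>V 0\<close>.\<close>
 have V\<nu>0: "(\<integral>\<^sup>+z. ennreal (V (fst z)) \<partial>origin \<nu>) < \<infinity>"
  unfolding origin_def by (subst nn_integral_distr) (auto simp: \<nu>.emeasure_space_1)
 obtain B1 B2 where B12: "B1 \<ge> 0" "B2 \<ge> 0"
  "\<And>t T. (\<integral>\<^sup>+z. (\<E> w. ennreal (potential V \<gamma> C1 T (chain z w t))) \<partial>\<nu>) \<le> ennreal (B1 * real (Suc T) powr (- (\<rho> - 1/2)))"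
  "\<And>t T. (\<integral>\<^sup>+z. (\<E> w. ennreal (potential V \<gamma> C1 T (chain z w t))) \<partial>origin \<nu>) \<le> ennreal (B2 * real (Suc T) powr (- (\<rho> - 1/2)))"
  using moment[OF \<nu> V\<nu>] moment[OF initial_origin[OF \<nu>] V\<nu>0] by metis
 define B where "B = max B1 B2"
 have B0: "B \<ge> 0" using B12 by (simp add: B_def)
 have B: "(\<integral>\<^sup>+z. (\<E> w. ennreal (potential V \<gamma> C1 T (chain z w t))) \<partial>\<nu>) \<le> ennreal (B * real (Suc T) powr (- (\<rho> - 1/2)))"
  "(\<integral>\<^sup>+z. (\<E> w. ennreal (potential V \<gamma> C1 T (chain z w t))) \<partial>origin \<nu>) \<le> ennreal (B * real (Suc T) powr (- (\<rho> - 1/2)))" for t T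
  by (rule order.trans[OF B12(3)] order.trans[OF B12(4)], intro ennreal_leI mult_right_mono, simp_all add: B_def)+
 let ?T = "\<lambda>n. nat \<lfloor>real n powr \<theta>1\<rfloor>" and ?L = "\<lambda>n. nat \<lfloor>real n powr \<theta>2\<rfloor>" and ?k = "\<lambda>n. nat \<lfloor>real n powr \<theta>3\<rfloor>"
 let ?\<kappa> = "\<lambda>n. Ca * sqrt (real (Suc (?L n)) * (M\<^sup>2 + H)) * real (?T n) powr (- (\<rho> - \<alpha>))"
 \<comment> \<open>The factors of k \<kappa> that are not powers of n: the 2 under the root comes
   from L + 1 \<le> 2 n^\<theta>2, and \<open>2 powr (\<rho> - \<alpha>)\<close> from T \<ge>
   n^\<theta>1 / 2.\<close>
 define Ck where "Ck = Ca * sqrt (2 * (M\<^sup>2 + H)) * 2 powr (\<rho> - \<alpha>)"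
 have ev1: "\<forall>\<^sub>F n in sequentially. 2 * real n powr (\<theta>1 + \<theta>3) \<le> real n powr 1" using par by (intro eventually_powr_le) auto
 have ev2: "\<forall>\<^sub>F n in sequentially. 4 * real n powr (\<theta>2 + \<theta>3) \<le> real n powr 1" using par by (intro eventually_powr_le) auto
 have ev3: "\<forall>\<^sub>F n in sequentially. Ck * real n powr (\<theta>3 + \<theta>2 / 2 - \<theta>1 * (\<rho> - \<alpha>)) \<le> real n powr 0" using par by (intro eventually_powr_le) auto
 have ev4: "\<forall>\<^sub>F n in sequentially. exp (- (\<delta> / 4) * real n powr \<theta>3) \<le> real n powr (- p)" using par \<delta> by (intro eventually_exp_powr_le) auto
 have "\<forall>\<^sub>F n in sequentially. \<forall>A\<in>sets traj_space.
  \<bar>(\<integral>z. path_prob A n z \<partial>\<nu>) - (\<integral>D. path_prob A n (0, D) \<partial>\<D>)\<bar> \<le> (2 * Cc + 1 + 2 * B) * real n powr (- p)"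
  using ev1 ev2 ev3 ev4 eventually_ge_at_top[of 1]
 proof eventually_elim
  case (elim n)
  have n: "n \<ge> 1" by fact
  define T where "T = ?T n"
  define L where "L = ?L n"
  define k where "k = ?k n"
  note Tb = nat_floor_powr[OF n less_imp_le[OF par(7)], folded T_def]
  note Lb = nat_floor_powr[OF n less_imp_le[OF par(8)], folded L_def]
  note kb = nat_floor_powr[OF n less_imp_le[OF par(9)], folded k_def]
  define \<kappa> where "\<kappa> = Ca * sqrt (real (Suc L) * (M\<^sup>2 + H)) * real T powr (- (\<rho> - \<alpha>))"
  have H0: "H \<ge> 0" by (simp add: H_def)
  have \<kappa>0: "\<kappa> \<ge> 0" using Ca H0 by (simp add: \<kappa>_def)
  have time: "k * (T + Suc L) \<le> n"
  proof -
   have "real (k * (T + Suc L)) = real k * (real T + real (Suc L))" by (simp only: of_nat_mult of_nat_add)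
   also have "... \<le> real n powr \<theta>3 * (real n powr \<theta>1 + 2 * real n powr \<theta>2)"
    using kb Tb Lb by (intro mult_mono add_mono) auto
   also have "... = real n powr (\<theta>1 + \<theta>3) + 2 * real n powr (\<theta>2 + \<theta>3)"
    by (simp add: powr_add algebra_simps)
   also have "... \<le> real n" using elim by simp
   finally show ?thesis by (simp only: of_nat_le_iff)
  qed
  have k\<kappa>: "real k * \<kappa> \<le> 1"
  proof -
   have "sqrt (real (Suc L) * (M\<^sup>2 + H)) \<le> sqrt (2 * real n powr \<theta>2 * (M\<^sup>2 + H))"
    using Lb H0 by (intro real_sqrt_le_mono mult_right_mono) auto
   also have "... = sqrt (2 * (M\<^sup>2 + H)) * real n powr (\<theta>2 / 2)"
   proof -
    have "real n powr (\<theta>2 / 2) = sqrt (real n powr \<theta>2)"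
     by (simp add: powr_half_sqrt[symmetric] powr_powr)
    then show ?thesis by (simp only: real_sqrt_mult[symmetric] ac_simps)
   qed
   finally have 1: "sqrt (real (Suc L) * (M\<^sup>2 + H)) \<le> sqrt (2 * (M\<^sup>2 + H)) * real n powr (\<theta>2 / 2)" .
   have "real T powr (- (\<rho> - \<alpha>)) \<le> (real n powr \<theta>1 / 2) powr (- (\<rho> - \<alpha>))"
    using Tb n \<alpha> by (intro powr_mono2') auto
   also have "... = 2 powr (\<rho> - \<alpha>) * real n powr (- (\<theta>1 * (\<rho> - \<alpha>)))"
    by (simp add: powr_divide powr_powr powr_minus powr_diff field_simps)
   finally have 2: "real T powr (- (\<rho> - \<alpha>)) \<le> 2 powr (\<rho> - \<alpha>) * real n powr (- (\<theta>1 * (\<rho> - \<alpha>)))" .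
   have "real k * \<kappa> \<le> real n powr \<theta>3 * (Ca * (sqrt (2 * (M\<^sup>2 + H)) * real n powr (\<theta>2 / 2)) * (2 powr (\<rho> - \<alpha>) * real n powr (- (\<theta>1 * (\<rho> - \<alpha>)))))"
    unfolding \<kappa>_def using kb Ca H0 by (intro mult_mono 1 2 mult_left_mono) auto
   also have "... = Ck * (real n powr \<theta>3 * real n powr (\<theta>2 / 2) * real n powr (- (\<theta>1 * (\<rho> - \<alpha>))))"
    by (simp add: Ck_def)
   also have "... = Ck * real n powr (\<theta>3 + \<theta>2 / 2 - \<theta>1 * (\<rho> - \<alpha>))"
    by (simp only: powr_add[symmetric]) simp
   also have "... \<le> 1" using elim n by simp
   finally show ?thesis .
  qed
  define s where "s = Cc * real (Suc L) powr (- \<theta>)"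
  have s: "0 \<le> s" "s \<le> Cc * real n powr (- p)"
  proof -
   have "real (Suc L) powr (- \<theta>) \<le> (real n powr \<theta>2) powr (- \<theta>)"
    using Lb par n by (intro powr_mono2') auto
   also have "... = real n powr (- (\<theta>2 * \<theta>))" by (simp add: powr_powr)
   also have "... \<le> real n powr (- p)" using par n by (intro powr_mono) auto
   finally show "s \<le> Cc * real n powr (- p)" unfolding s_def using Cc by (intro mult_left_mono) auto
  qed (use Cc in \<open>simp add: s_def\<close>)
  \<comment> \<open>k is a positive power of n, so repeated failure is stretched-exponentially small
    and beats every power.\<close>
  have geo: "(1 - \<delta> / 2) ^ k \<le> real n powr (- p)"
  proof -
   have "(1 - \<delta> / 2) ^ k \<le> exp (- \<delta> / 2) ^ k"
    using \<delta> exp_ge_add_one_self[of "- \<delta> / 2"] by (intro power_mono) auto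
   also have "... = exp (- (\<delta> / 2) * real k)" by (simp add: exp_of_nat_mult[symmetric] mult.commute)
   also have "... \<le> exp (- (\<delta> / 4) * real n powr \<theta>3)"
   proof -
    have "\<delta> / 2 * (real n powr \<theta>3 / 2) \<le> \<delta> / 2 * real k" using kb \<delta> by (intro mult_left_mono) auto
    then show ?thesis by simp
   qed
   also have "... \<le> real n powr (- p)" by fact
   finally show ?thesis .
  qed
  define e where "e = B * real (Suc T) powr (- (\<rho> - 1/2))"
  have e: "0 \<le> e" "real k * e \<le> B * real n powr (- p)"
  proof -
   have "real (Suc T) powr (- (\<rho> - 1/2)) \<le> (real n powr \<theta>1) powr (- (\<rho> - 1/2))"
    using Tb \<rho> n by (intro powr_mono2') auto
   also have "... = real n powr (- (\<theta>1 * (\<rho> - 1/2)))" by (simp only: powr_powr mult_minus_right)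
   finally have "e \<le> B * real n powr (- (\<theta>1 * (\<rho> - 1/2)))" unfolding e_def using B0 by (intro mult_left_mono) auto
   then have "real k * e \<le> real n powr \<theta>3 * (B * real n powr (- (\<theta>1 * (\<rho> - 1/2))))"
    using kb B0 by (intro mult_mono) (auto simp: e_def)
   also have "... = B * real n powr (\<theta>3 - \<theta>1 * (\<rho> - 1/2))"
    by (simp add: powr_add[symmetric] mult.left_commute)
   also have "... \<le> B * real n powr (- p)" using par n B0 by (intro mult_left_mono powr_mono) auto
   finally show "real k * e \<le> B * real n powr (- p)" .
  qed (use B0 in \<open>simp add: e_def\<close>)
  show ?case
  proof
   fix A :: "'d traj set" assume A: "A \<in> sets traj_space"
   let ?Y = "potential V \<gamma> C1 T"
   have "\<bar>(\<integral>z. path_prob A n z \<partial>\<nu>) - (\<integral>D. path_prob A n (0, D) \<partial>\<D>)\<bar> \<le> (2 * s + (1 - \<delta> / 2) ^ k) + 2 * real k * e"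
   proof (rule comparison_with_origin[OF \<nu> A potential_measurable[OF V_meas]])
    fix z :: "'d state"
    \<comment> \<open>The n steps are split into k full trials and a remainder, which becomes part
      of the future event.\<close>
    have "\<bar>path_prob A (k * (T + Suc L) + (n - k * (T + Suc L))) z - path_prob A (k * (T + Suc L) + (n - k * (T + Suc L))) (0, snd z)\<bar>
     \<le> 2 * s + (1 - \<delta> / 2) ^ k + escape ?Y (T + Suc L) k z + escape ?Y (T + Suc L) k (0, snd z)"
     unfolding \<delta>_def
    proof (rule trial_bound[OF \<Lambda>[rule_format] c A potential_measurable[OF V_meas], where \<alpha>=\<alpha> and \<kappa>=\<kappa> and K=K])
     show "norm (\<Sum>j<Suc L. a (m + T + Suc L - j) *\<^sub>R g j) \<le> \<kappa> * real m powr (- \<alpha>)"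
      if "m \<ge> 1" "(\<Sum>j<Suc L. (norm (g j))\<^sup>2) \<le> M\<^sup>2 + H" for m and g :: "'d traj"
      unfolding \<kappa>_def using Ca \<alpha> Tb that by (intro influence_bound) auto
     show "(\<Sum>i<N. (norm (compensation a (\<lambda>j. if j = 0 then v else q j) (Suc L + i)))\<^sup>2) \<le> s\<^sup>2"
      if "\<And>m. m \<ge> 1 \<Longrightarrow> norm (q m) \<le> real m powr (- \<alpha>)" "norm v \<le> M" for q :: "'d traj" and v N
      unfolding s_def by (rule Cc(2)[OF that])
    qed (use H \<alpha> \<kappa>0 H0 s(1) K(2) k\<kappa> in auto)
    then show "\<bar>path_prob A n z - path_prob A n (0, snd z)\<bar>
     \<le> 2 * s + (1 - \<delta> / 2) ^ k + escape ?Y (T + Suc L) k z + escape ?Y (T + Suc L) k (0, snd z)"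
     using time by simp
   qed (use B e in \<open>auto simp: e_def\<close>)
   also have "... \<le> (2 * (Cc * real n powr (- p)) + real n powr (- p)) + 2 * (B * real n powr (- p))"
    using s geo e by linarith
   finally show "\<bar>(\<integral>z. path_prob A n z \<partial>\<nu>) - (\<integral>D. path_prob A n (0, D) \<partial>\<D>)\<bar> \<le> (2 * Cc + 1 + 2 * B) * real n powr (- p)"
    by (simp add: algebra_simps)
  qed
 qed
 then obtain n0 where n0: "\<And>n A. n \<ge> n0 \<Longrightarrow> A \<in> sets traj_space \<Longrightarrow>
  \<bar>(\<integral>z. path_prob A n z \<partial>\<nu>) - (\<integral>D. path_prob A n (0, D) \<partial>\<D>)\<bar> \<le> (2 * Cc + 1 + 2 * B) * real n powr (- p)"
  by (auto simp: eventually_sequentially)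
 \<comment> \<open>The second summand covers the n below \<open>n0\<close>, where only the trivial
   bound 1 is used.\<close>
 define C' where "C' = (2 * Cc + 1 + 2 * B) + real (Suc n0) powr p"
 have C'0: "(2 * Cc + 1 + 2 * B) > 0" using Cc B0 by simp
 show ?thesis
 proof (intro exI[of _ C'] conjI allI impI ballI)
  show "C' > 0" using C'0 by (simp add: C'_def add_pos_nonneg)
  fix n :: nat and A :: "'d traj set" assume n: "n \<ge> 1" and A [measurable]: "A \<in> sets traj_space"
  show "\<bar>(\<integral>z. path_prob A n z \<partial>\<nu>) - (\<integral>D. path_prob A n (0, D) \<partial>\<D>)\<bar> \<le> C' * real n powr (- p)"
  proof (cases "n \<ge> n0")
   case True
   have "(2 * Cc + 1 + 2 * B) * real n powr (- p) \<le> C' * real n powr (- p)" by (intro mult_right_mono) (auto simp: C'_def)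
   with n0[OF True A] show ?thesis by simp
  next
   case False
   interpret D: prob_space \<D> by (rule prob_D)
   have "0 \<le> (\<integral>z. path_prob A n z \<partial>\<nu>)" "(\<integral>z. path_prob A n z \<partial>\<nu>) \<le> 1"
    by (rule \<nu>.bounded_expectation(2)[where K=1] \<nu>.bounded_expectation(3); (rule path_prob_bounds | measurable))+
   moreover have "0 \<le> (\<integral>D. path_prob A n (0, D) \<partial>\<D>)" "(\<integral>D. path_prob A n (0, D) \<partial>\<D>) \<le> 1"
    by (rule D.bounded_expectation(2)[where K=1] D.bounded_expectation(3); (rule path_prob_bounds | measurable))+
   ultimately have "\<bar>(\<integral>z. path_prob A n z \<partial>\<nu>) - (\<integral>D. path_prob A n (0, D) \<partial>\<D>)\<bar> \<le> 1" by linarith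
   also have "1 = real n powr p * real n powr (- p)" using n by (simp add: powr_add[symmetric])
   also have "... \<le> C' * real n powr (- p)"
   proof (rule mult_right_mono)
    have "real n powr p \<le> real (Suc n0) powr p" using False p by (intro powr_mono2) auto
    then show "real n powr p \<le> C'" using C'0 by (simp add: C'_def)
   qed simp
   finally show ?thesis .
  qed
 qed
qed

end

section \<open>The moving average and its past\<close>

text \<open>The squared distances are integrable from some index on, and then tend to 0 in the mean;
  almost sure convergence along a subsequence is that of integrable functions applied to these
  squares.\<close>

lemma (in prob_space) L2_AE_subseq:
 fixes X :: "'a \<Rightarrow> 'v::{real_normed_vector, second_countable_topology}"
 assumes [measurable]: "X \<in> borel_measurable M" "\<And>N. Y N \<in> borel_measurable M"
  and lim: "(\<lambda>N. \<integral>\<^sup>+v. ennreal ((norm (X v - Y N v))\<^sup>2) \<partial>M) \<longlonglongrightarrow> 0"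
 shows "\<exists>r. strict_mono r \<and> (AE v in M. (\<lambda>i. Y (r i) v) \<longlonglongrightarrow> X v)"
proof -
 have "\<forall>\<^sub>F N in sequentially. (\<integral>\<^sup>+v. ennreal ((norm (X v - Y N v))\<^sup>2) \<partial>M) < 1"
  using lim by (rule order_tendstoD) simp
 then obtain N0 where N0: "\<And>N. N \<ge> N0 \<Longrightarrow> (\<integral>\<^sup>+v. ennreal ((norm (X v - Y N v))\<^sup>2) \<partial>M) < 1"
  by (auto simp: eventually_sequentially)
 define u where "u i v = (norm (X v - Y (i + N0) v))\<^sup>2" for i v
 have int: "integrable M (u i)" for i
  unfolding u_def using N0[of "i + N0"]
  by (intro integrableI_nonneg) (auto simp: less_top intro: less_trans)
 have eq: "(\<integral>\<^sup>+v. ennreal (u i v) \<partial>M) = ennreal (\<integral>v. norm (u i v) \<partial>M)" for i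
 proof -
  have n: "norm (u i v) = u i v" for v by (simp add: u_def)
  show ?thesis unfolding n by (intro nn_integral_eq_integral int AE_I2) (simp add: u_def)
 qed
 have "(\<lambda>i. \<integral>\<^sup>+v. ennreal (u i v) \<partial>M) \<longlonglongrightarrow> 0"
  unfolding u_def using LIMSEQ_ignore_initial_segment[OF lim, of N0] by simp
 then have "(\<lambda>i. ennreal (\<integral>v. norm (u i v) \<partial>M)) \<longlonglongrightarrow> ennreal 0"
  unfolding eq by simp
 then have "(\<lambda>i. \<integral>v. norm (u i v) \<partial>M) \<longlonglongrightarrow> 0"
  by (subst (asm) tendsto_ennreal_iff) auto
 from tendsto_L1_AE_subseq[of M u, OF int this] obtain r where r: "strict_mono r" "AE v in M. (\<lambda>n. u (r n) v) \<longlonglongrightarrow> 0"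
  by blast
 show ?thesis
 proof (intro exI[of _ "\<lambda>i. r i + N0"] conjI)
  show "strict_mono (\<lambda>i. r i + N0)" using r(1) by (simp add: strict_mono_def)
  show "AE v in M. (\<lambda>i. Y (r i + N0) v) \<longlonglongrightarrow> X v"
   using r(2)
  proof eventually_elim
   case (elim v)
   then have "(\<lambda>n. sqrt (u (r n) v)) \<longlonglongrightarrow> sqrt 0" by (rule tendsto_real_sqrt)
   then have "(\<lambda>n. norm (X v - Y (r n + N0) v)) \<longlonglongrightarrow> 0" by (simp add: u_def)
   then have "(\<lambda>n. Y (r n + N0) v - X v) \<longlonglongrightarrow> 0" by (subst (asm) norm_minus_commute) (rule tendsto_norm_zero_cancel)
   then show ?case by (simp add: LIM_zero_iff)
  qed
 qed
qed

lemma borel_measurable_vec_component [measurable (raw)]: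
 fixes f :: "'a \<Rightarrow> real ^ 'n"
 assumes "f \<in> borel_measurable M"
 shows "(\<lambda>x. f x $ i) \<in> borel_measurable M"
 by (rule measurable_compose[OF assms]) (auto intro!: borel_measurable_continuous_onI continuous_intros)

context gaussian_noise
begin

lemma \<xi>_measurable [measurable]: "\<xi> k \<in> borel_measurable \<Omega>"
 using distributed_measurable[OF \<xi>_normal[of k]] by simp

lemma \<Delta>_measurable' [measurable]: "\<Delta> k \<in> borel_measurable \<Omega>"
 by (rule \<Delta>_measurable)

lemma past_measurable [measurable (raw)]:
 assumes "\<And>k. X k \<in> borel_measurable \<Omega>"
 shows "past X n \<in> measurable \<Omega> traj_space"
 unfolding past_def by (rule measurable_trajI) (rule assms)

lemma distr_past_\<xi>: "distr \<Omega> traj_space (past \<xi> n) = noise"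
proof -
 have law: "distr \<Omega> borel (\<xi> k) = gauss" for k
  using distributed_distr_eq_density[OF \<xi>_normal[of k]] by (simp add: gauss_def cong: distr_cong)
 have all: "distr \<Omega> (PiM UNIV (\<lambda>_::int. borel)) (\<lambda>x i. \<xi> i x) = PiM UNIV (\<lambda>_::int. gauss)"
  using indep_vars_iff_distr_eq_PiM'[where I=UNIV and M'="\<lambda>_. borel" and X=\<xi>] \<xi>_indep by (simp add: law restrict_UNIV)
 have m: "(\<lambda>v k. v (n - int k)) \<in> measurable (PiM UNIV (\<lambda>_::int. borel)) traj_space"
  by (rule measurable_trajI) measurable
 have m2: "(\<lambda>x i. \<xi> i x) \<in> measurable \<Omega> (PiM UNIV (\<lambda>_::int. borel))"
  by (rule measurable_PiM_single') auto
 have "distr \<Omega> traj_space (past \<xi> n) = distr (distr \<Omega> (PiM UNIV (\<lambda>_::int. borel)) (\<lambda>x i. \<xi> i x)) traj_space (\<lambda>v k. v (n - int k))"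
  by (subst distr_distr[OF m m2]) (simp add: o_def past_def[abs_def])
 also have "... = distr (PiM UNIV (\<lambda>_::int. gauss)) (\<Pi>\<^sub>M k\<in>(UNIV::nat set). gauss) (\<lambda>v. \<lambda>k\<in>UNIV. v (n - int k))"
  unfolding all by (intro distr_cong) (auto simp: sets_noise)
 also have "... = noise"
  using distr_PiM_reindex[of "UNIV :: int set" "\<lambda>_. gauss" "\<lambda>k. n - int k" "UNIV :: nat set"]
  by (simp add: prob_space_gauss inj_on_def)
 finally show ?thesis .
qed

text \<open>The innovations up to time n have the law of the noise for every n, so almost sure facts
  about the noise can be read at any time. In this way facts obtained at time 0 are transported to
  all n.\<close>

lemma AE_past_\<xi>: "(AE v in noise. P v) \<Longrightarrow> (AE x in \<Omega>. P (past \<xi> n x))"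
proof -
 assume "AE v in noise. P v"
 then have "AE v in distr \<Omega> traj_space (past \<xi> n). P v" unfolding distr_past_\<xi> .
 then show ?thesis by (rule AE_distrD[rotated]) (rule past_measurable, rule \<xi>_measurable)
qed

lemma past_Suc: "past X (n + 1) x = case_nat (X (n + 1) x) (past X n x)"
 by (auto simp: past_def fun_eq_iff split: nat.split intro!: arg_cong2[of _ _ _ _ X])

lemma distr_past_\<xi>_Suc: "distr \<Omega> (traj_space \<Otimes>\<^sub>M borel) (\<lambda>x. (past \<xi> n x, \<xi> (n + 1) x)) = noise \<Otimes>\<^sub>M gauss"
proof -
 let ?g = "\<lambda>v :: 'd traj. ((\<lambda>k. v (Suc k)), v 0)"
 have [measurable]: "(\<lambda>v k. v (Suc k)) \<in> measurable traj_space traj_space"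
  by (rule measurable_trajI) measurable
 have g [measurable]: "?g \<in> measurable traj_space (traj_space \<Otimes>\<^sub>M borel)" by measurable
 have "distr \<Omega> (traj_space \<Otimes>\<^sub>M borel) (\<lambda>x. (past \<xi> n x, \<xi> (n + 1) x))
  = distr (distr \<Omega> traj_space (past \<xi> (n + 1))) (traj_space \<Otimes>\<^sub>M borel) ?g"
  by (subst distr_distr[OF g past_measurable[OF \<xi>_measurable]]) (simp add: o_def past_Suc)
 also have "... = distr (distr (gauss \<Otimes>\<^sub>M noise) noise (\<lambda>(s, v). case_nat s v)) (traj_space \<Otimes>\<^sub>M borel) ?g"
  unfolding distr_past_\<xi> noise.PiM_iter ..
 also have "... = distr (gauss \<Otimes>\<^sub>M noise) (traj_space \<Otimes>\<^sub>M borel) (\<lambda>(s, v). (v, s))"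
 proof (subst distr_distr)
  show "?g \<in> measurable noise (traj_space \<Otimes>\<^sub>M borel)"
   using g by (simp cong: measurable_cong_sets[OF sets_noise refl])
  show "(\<lambda>(s, v). case_nat s v) \<in> measurable (gauss \<Otimes>\<^sub>M noise) (noise :: 'd traj measure)"
   by (simp add: split_beta')
 qed (simp add: o_def split_beta')
 also have "... = noise \<Otimes>\<^sub>M gauss"
 proof -
  interpret pair_sigma_finite noise gauss by unfold_locales
  show ?thesis by (subst distr_pair_swap) (intro distr_cong sets_pair_measure_cong, auto simp: sets_noise)
 qed
 finally show ?thesis .
qed

definition partial_sum :: "nat \<Rightarrow> (nat \<Rightarrow> real ^ 'd) \<Rightarrow> real ^ 'd" where
 "partial_sum N v = (\<Sum>k\<le>N. a k *\<^sub>R v k)"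

lemma partial_sum_measurable [measurable]: "partial_sum N \<in> borel_measurable traj_space"
 unfolding partial_sum_def by measurable

text \<open>One subsequence must serve all n, so that one functional of the innovations represents
  all \<Delta> n. It is extracted at time 0; being Cauchy along it is an event of the noise law and
  therefore almost sure at all times, and a further subsequence at time n identifies the
  limit.\<close>

lemma ex_moving_average_subseq:
 "\<exists>r. strict_mono r \<and> (\<forall>n. AE x in \<Omega>. (\<lambda>i. partial_sum (r i) (past \<xi> n x)) \<longlonglongrightarrow> \<Delta> n x)"
proof -
 have L2: "(\<lambda>N. \<integral>\<^sup>+ x. ennreal ((norm (\<Delta> n x - partial_sum N (past \<xi> n x)))\<^sup>2) \<partial>\<Omega>) \<longlonglongrightarrow> 0" for n
  using moving_average[of n] by (simp add: partial_sum_def past_def)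
 have [measurable]: "(\<lambda>x. partial_sum N (past \<xi> n x)) \<in> borel_measurable \<Omega>" for N n
  by (rule measurable_compose[OF _ partial_sum_measurable]) measurable
 obtain r where r: "strict_mono r" "AE x in \<Omega>. (\<lambda>i. partial_sum (r i) (past \<xi> 0 x)) \<longlonglongrightarrow> \<Delta> 0 x"
  using L2_AE_subseq[OF _ _ L2[of 0]] by auto
 have "AE x in \<Omega>. Cauchy (\<lambda>i. partial_sum (r i) (past \<xi> 0 x))"
  using r(2) by eventually_elim (auto intro: convergent_Cauchy convergentI)
 moreover have "{v \<in> space traj_space. Cauchy (\<lambda>i. partial_sum (r i) v)} \<in> sets traj_space"
  by measurable
 ultimately have C: "AE v in noise. Cauchy (\<lambda>i. partial_sum (r i) v)"
  unfolding distr_past_\<xi>[of 0, symmetric] by (subst AE_distr_iff) (auto intro: past_measurable)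
 show ?thesis
 proof (intro exI[of _ r] conjI allI r(1))
  fix n
  have "(\<lambda>i. \<integral>\<^sup>+ x. ennreal ((norm (\<Delta> n x - partial_sum (r i) (past \<xi> n x)))\<^sup>2) \<partial>\<Omega>) \<longlonglongrightarrow> 0"
   using LIMSEQ_subseq_LIMSEQ[OF L2[of n] r(1)] by (simp add: o_def)
  then obtain r' where r': "strict_mono r'" "AE x in \<Omega>. (\<lambda>i. partial_sum (r (r' i)) (past \<xi> n x)) \<longlonglongrightarrow> \<Delta> n x"
   using L2_AE_subseq[of "\<Delta> n" "\<lambda>i x. partial_sum (r i) (past \<xi> n x)"] by auto
  show "AE x in \<Omega>. (\<lambda>i. partial_sum (r i) (past \<xi> n x)) \<longlonglongrightarrow> \<Delta> n x"
   using r'(2) AE_past_\<xi>[OF C, of n]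
  proof eventually_elim
   case (elim x)
   then obtain l where l: "(\<lambda>i. partial_sum (r i) (past \<xi> n x)) \<longlonglongrightarrow> l"
    by (auto simp: Cauchy_convergent_iff convergent_def)
   from LIMSEQ_subseq_LIMSEQ[OF this r'(1)] elim(1) have "l = \<Delta> n x"
    by (auto simp: o_def intro: LIMSEQ_unique)
   with l show ?case by simp
  qed
 qed
qed

text \<open>By \<open>innovation\<close>, finite linear combinations of the past of \<Delta>
  approximate each component of \<xi> 0 in mean square, hence almost surely along a subsequence, and
  the limit of these combinations is a measurable functional.\<close>

lemma ex_innovation_functional:
 "\<exists>\<Xi>. \<Xi> \<in> borel_measurable traj_space \<and> (AE x in \<Omega>. \<xi> 0 x = \<Xi> (past \<Delta> 0 x))"
proof -
 have "\<exists>f. f \<in> borel_measurable traj_space \<and> (AE x in \<Omega>. \<xi> 0 x $ i = f (past \<Delta> 0 x))" for i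
 proof -
  define G where "G j N c \<longleftrightarrow> (\<integral>\<^sup>+ x. ennreal ((\<xi> 0 x $ i - (\<Sum>k\<le>(N::nat). c k * \<Delta> (0 - int k) x $ i))\<^sup>2) \<partial>\<Omega>) < ennreal (1 / real (Suc j))" for j N c
  have "\<forall>j. \<exists>N c. G j N c"
   unfolding G_def by (rule allI, rule innovation) simp
  then obtain N c where "\<And>j. G j (N j) (c j)" by metis
  note Nc = this[unfolded G_def]
  define f where "f j w = (\<Sum>k\<le>N j. c j k * (w k :: real ^ 'd) $ i)" for j w
  have f [measurable]: "f j \<in> borel_measurable traj_space" for j
   unfolding f_def by measurable
  have [measurable]: "(\<lambda>x. f j (past \<Delta> 0 x)) \<in> borel_measurable \<Omega>" for j
   by (rule measurable_compose[OF _ f]) measurable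
  have "(\<lambda>j. \<integral>\<^sup>+ x. ennreal ((norm (\<xi> 0 x $ i - f j (past \<Delta> 0 x)))\<^sup>2) \<partial>\<Omega>) \<longlonglongrightarrow> 0"
  proof (rule tendsto_sandwich[OF _ _ tendsto_const])
   show "(\<lambda>j. ennreal (1 / real (Suc j))) \<longlonglongrightarrow> 0"
    using tendsto_ennrealI[OF LIMSEQ_Suc[OF lim_1_over_n]] by simp
   show "\<forall>\<^sub>F j in sequentially. (\<integral>\<^sup>+ x. ennreal ((norm (\<xi> 0 x $ i - f j (past \<Delta> 0 x)))\<^sup>2) \<partial>\<Omega>) \<le> ennreal (1 / real (Suc j))"
    using Nc by (intro always_eventually allI less_imp_le) (simp add: f_def past_def)
  qed auto
  then obtain r where r: "AE x in \<Omega>. (\<lambda>j. f (r j) (past \<Delta> 0 x)) \<longlonglongrightarrow> \<xi> 0 x $ i"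
   using L2_AE_subseq[of "\<lambda>x. \<xi> 0 x $ i" "\<lambda>j x. f j (past \<Delta> 0 x)"] by auto
  show ?thesis
  proof (intro exI[of _ "\<lambda>w. lim (\<lambda>j. f (r j) w)"] conjI)
   show "AE x in \<Omega>. \<xi> 0 x $ i = lim (\<lambda>j. f (r j) (past \<Delta> 0 x))"
    using r by eventually_elim (simp add: limI)
  qed measurable
 qed
 then obtain f where f: "\<And>i. f i \<in> borel_measurable traj_space" "\<And>i. AE x in \<Omega>. \<xi> 0 x $ i = f i (past \<Delta> 0 x)"
  by metis
 show ?thesis
 proof (intro exI[of _ "\<lambda>w. \<chi> i. f i w"] conjI)
  show "(\<lambda>w. \<chi> i. f i w) \<in> borel_measurable traj_space"
  proof -
   have "(\<lambda>w. \<chi> i. f i w) = (\<lambda>w. \<Sum>i\<in>UNIV. f i w *\<^sub>R axis i 1)"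
    by (auto simp: fun_eq_iff vec_eq_iff axis_def if_distrib cong: if_cong)
   also have "... \<in> borel_measurable traj_space" using f(1) by measurable
   finally show ?thesis .
  qed
  have "AE x in \<Omega>. \<forall>i. \<xi> 0 x $ i = f i (past \<Delta> 0 x)" using f(2) by (simp add: AE_all_countable)
  then show "AE x in \<Omega>. \<xi> 0 x = (\<chi> i. f i (past \<Delta> 0 x))" by eventually_elim (simp add: vec_eq_iff)
 qed
qed

end

text \<open>From 2 s x \<le> s^2 + x^2: a second moment of order s^2 gives a first moment of order
  s.\<close>

lemma (in prob_space) nn_integral_norm_le:
 fixes X :: "'a \<Rightarrow> 'v::{real_normed_vector, second_countable_topology}"
 assumes X: "X \<in> borel_measurable M" and le: "(\<integral>\<^sup>+v. ennreal ((norm (X v))\<^sup>2) \<partial>M) \<le> ennreal (K * s\<^sup>2)"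
  and s: "0 < s" and K: "0 \<le> K"
 shows "(\<integral>\<^sup>+v. ennreal (norm (X v)) \<partial>M) \<le> ennreal ((1 + K) * s)"
proof -
 have "(\<integral>\<^sup>+v. ennreal (norm (X v)) \<partial>M) \<le> (\<integral>\<^sup>+v. ennreal s + ennreal (1 / s) * ennreal ((norm (X v))\<^sup>2) \<partial>M)"
 proof (intro nn_integral_mono)
  fix v
  have "2 * s * norm (X v) \<le> s\<^sup>2 + (norm (X v))\<^sup>2" by (rule sum_squares_bound)
  moreover have "0 \<le> s * norm (X v)" using s by simp
  ultimately have "s * norm (X v) \<le> s\<^sup>2 + (norm (X v))\<^sup>2" by linarith
  then have "norm (X v) \<le> s + (1 / s) * (norm (X v))\<^sup>2" using s by (simp add: field_simps power2_eq_square)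
  then have "ennreal (norm (X v)) \<le> ennreal (s + (1 / s) * (norm (X v))\<^sup>2)" by (rule ennreal_leI)
  also have "... = ennreal s + ennreal (1 / s) * ennreal ((norm (X v))\<^sup>2)"
   using s by (subst ennreal_plus) (auto simp: ennreal_mult[symmetric])
  finally show "ennreal (norm (X v)) \<le> ennreal s + ennreal (1 / s) * ennreal ((norm (X v))\<^sup>2)" .
 qed
 also have "... = ennreal s + ennreal (1 / s) * (\<integral>\<^sup>+v. ennreal ((norm (X v))\<^sup>2) \<partial>M)"
  using X by (simp add: nn_integral_add nn_integral_cmult emeasure_space_1)
 also have "... \<le> ennreal s + ennreal (1 / s) * ennreal (K * s\<^sup>2)"
  by (intro add_left_mono mult_left_mono le) simp
 also have "... = ennreal (s + (1 / s) * (K * s\<^sup>2))"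
  using s K by (subst ennreal_plus) (auto simp: ennreal_mult[symmetric])
 also have "s + (1 / s) * (K * s\<^sup>2) = (1 + K) * s"
  using s by (simp add: power2_eq_square field_simps)
 finally show ?thesis .
qed

context gaussian_noise
begin

text \<open>
 \<open>D (past \<Delta> n) m\<close> is the conditional mean of \<open>\<Delta> (n + m + 1)\<close> given the past up to time \<open>n\<close>. The same
 functional serves for all \<open>n\<close>.
\<close>

theorem ex_memory_functional:
 obtains D where "D \<in> measurable traj_space traj_space"
  "\<And>n. AE x in \<Omega>. \<forall>m. D (past \<Delta> n x) m = \<Delta> (n + int m + 1) x - (\<Sum>k\<le>m. a k *\<^sub>R \<xi> (n + int m + 1 - int k) x)"
  "\<And>n. distr \<Omega> traj_space (past \<Delta> n) = past_law \<Omega> \<Delta>"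
  "distr \<Omega> (traj_space \<Otimes>\<^sub>M borel) (\<lambda>x. (past \<Delta> 0 x, \<xi> 1 x)) = past_law \<Omega> \<Delta> \<Otimes>\<^sub>M gauss"
  "\<And>m s. (\<And>n. (\<Sum>j<n. (a (Suc (m + j)))\<^sup>2) \<le> s\<^sup>2) \<Longrightarrow> s > 0 \<Longrightarrow>
    (\<integral>\<^sup>+w. ennreal (norm (D w m)) \<partial>past_law \<Omega> \<Delta>) \<le> ennreal ((1 + 8 * real CARD('d)) * s)"
proof -
 obtain r where r: "strict_mono r" "\<And>n. AE x in \<Omega>. (\<lambda>i. partial_sum (r i) (past \<xi> n x)) \<longlonglongrightarrow> \<Delta> n x"
  using ex_moving_average_subseq by blast
 obtain \<Xi> where \<Xi> [measurable]: "\<Xi> \<in> borel_measurable traj_space" and \<Xi>0: "AE x in \<Omega>. \<xi> 0 x = \<Xi> (past \<Delta> 0 x)"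
  using ex_innovation_functional by blast
 \<comment> \<open>The present noise as a functional of the innovations up to the present;
   \<open>hh\<close> applies it at all earlier times as well.\<close>
 define h where "h v = lim (\<lambda>i. partial_sum (r i) v)" for v
 have h [measurable]: "h \<in> borel_measurable traj_space" unfolding h_def by measurable
 define hh where "hh v = (\<lambda>j. h (\<lambda>k. v (j + k)))" for v :: "'d traj"
 have shift: "(\<lambda>v k. v (j + k)) \<in> measurable traj_space traj_space" for j
  by (rule measurable_trajI) measurable
 have hh [measurable]: "hh \<in> measurable traj_space traj_space"
  unfolding hh_def by (rule measurable_trajI) (rule measurable_compose[OF shift h])
 have \<Delta>h: "AE x in \<Omega>. \<Delta> n x = h (past \<xi> n x)" for n
  using r(2)[of n] by eventually_elim (simp add: h_def limI)
 have \<Delta>hh: "AE x in \<Omega>. past \<Delta> n x = hh (past \<xi> n x)" for n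
 proof -
  have "AE x in \<Omega>. \<forall>j. \<Delta> (n - int j) x = h (past \<xi> (n - int j) x)" using \<Delta>h by (simp add: AE_all_countable)
  then show ?thesis
   by eventually_elim (auto simp: past_def hh_def fun_eq_iff algebra_simps)
 qed
 have law: "distr \<Omega> traj_space (past \<Delta> n) = distr noise traj_space hh" for n
 proof -
  have "distr \<Omega> traj_space (past \<Delta> n) = distr \<Omega> traj_space (\<lambda>x. hh (past \<xi> n x))"
   by (rule distr_cong_AE) (use \<Delta>hh in \<open>auto intro: measurable_compose[OF _ hh]\<close>)
  also have "... = distr (distr \<Omega> traj_space (past \<xi> n)) traj_space hh"
   by (subst distr_distr) (auto simp: o_def)
  finally show ?thesis by (simp add: distr_past_\<xi>)
 qed
 have Pw: "past_law \<Omega> \<Delta> = distr noise traj_space hh" by (simp add: past_law_def law)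
 \<comment> \<open>Written in terms of the innovations alone, the identity at time 0 is an event of
   full probability for the noise law, so it holds at every n.\<close>
 have \<Xi>n: "AE x in \<Omega>. \<xi> n x = \<Xi> (past \<Delta> n x)" for n
 proof -
  have "AE x in \<Omega>. past \<xi> 0 x 0 = \<Xi> (hh (past \<xi> 0 x))"
   using \<Xi>0 \<Delta>hh[of 0] by eventually_elim (simp add: past_def)
  moreover have "{v \<in> space traj_space. v 0 = \<Xi> (hh v)} \<in> sets traj_space" by measurable
  ultimately have "AE v in noise. v 0 = \<Xi> (hh v)"
   unfolding distr_past_\<xi>[of 0, symmetric] by (subst AE_distr_iff) (auto intro: past_measurable)
  from AE_past_\<xi>[OF this, of n] \<Delta>hh[of n] show ?thesis by eventually_elim (simp add: past_def)
 qed
 \<comment> \<open>The part of the moving average m + 1 steps ahead that involves only innovations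
   already known; its limit is the conditional mean.\<close>
 define t where "t m N v = (\<Sum>j<N - m. a (Suc (m + j)) *\<^sub>R v j)" for m N and v :: "'d traj"
 have t [measurable]: "t m N \<in> borel_measurable traj_space" for m N unfolding t_def by measurable
 define E where "E m v = lim (\<lambda>i. t m (r i) v)" for m v
 have E [measurable]: "E m \<in> borel_measurable traj_space" for m
  unfolding E_def by (rule borel_measurable_lim_metric) (rule t)
 have tsum: "partial_sum N (past \<xi> (n + int m + 1) x) - (\<Sum>k\<le>m. a k *\<^sub>R \<xi> (n + int m + 1 - int k) x) = t m N (past \<xi> n x)"
  if "m \<le> N" for N n m x
 proof -
  have "{..N} = {..m} \<union> (\<lambda>j. Suc (m + j)) ` {..<N - m}"
  proof (intro set_eqI iffI)
   fix k assume "k \<in> {..N}"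
   then show "k \<in> {..m} \<union> (\<lambda>j. Suc (m + j)) ` {..<N - m}"
    by (cases "k \<le> m") (auto intro!: image_eqI[of _ _ "k - Suc m"])
  qed (use that in auto)
  then have "partial_sum N (past \<xi> (n + int m + 1) x) = (\<Sum>k\<le>m. a k *\<^sub>R past \<xi> (n + int m + 1) x k)
    + (\<Sum>k\<in>(\<lambda>j. Suc (m + j)) ` {..<N - m}. a k *\<^sub>R past \<xi> (n + int m + 1) x k)"
   unfolding partial_sum_def by (simp only:) (rule sum.union_disjoint, auto)
  also have "(\<Sum>k\<in>(\<lambda>j. Suc (m + j)) ` {..<N - m}. a k *\<^sub>R past \<xi> (n + int m + 1) x k) = t m N (past \<xi> n x)"
   unfolding t_def by (subst sum.reindex) (auto simp: inj_on_def past_def algebra_simps intro!: sum.cong)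
  finally show ?thesis by (simp add: past_def)
 qed
 have tlim: "AE x in \<Omega>. (\<lambda>i. t m (r i) (past \<xi> n x)) \<longlonglongrightarrow> \<Delta> (n + int m + 1) x - (\<Sum>k\<le>m. a k *\<^sub>R \<xi> (n + int m + 1 - int k) x)" for n m
  using r(2)[of "n + int m + 1"]
 proof eventually_elim
  case (elim x)
  have "(\<lambda>i. partial_sum (r i) (past \<xi> (n + int m + 1) x) - (\<Sum>k\<le>m. a k *\<^sub>R \<xi> (n + int m + 1 - int k) x))
   \<longlonglongrightarrow> \<Delta> (n + int m + 1) x - (\<Sum>k\<le>m. a k *\<^sub>R \<xi> (n + int m + 1 - int k) x)"
   by (intro tendsto_diff elim tendsto_const)
  then show ?case
  proof (rule Lim_transform_eventually)
   have "\<forall>\<^sub>F i in sequentially. r i \<ge> m"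
    using eventually_ge_at_top[of m] by eventually_elim (use seq_suble[OF r(1)] order_trans in blast)
   then show "\<forall>\<^sub>F i in sequentially. partial_sum (r i) (past \<xi> (n + int m + 1) x) - (\<Sum>k\<le>m. a k *\<^sub>R \<xi> (n + int m + 1 - int k) x) = t m (r i) (past \<xi> n x)"
    by eventually_elim (rule tsum)
  qed
 qed
 \<comment> \<open>First the past innovations are recovered from the past noise by \<Xi>, then the
   prediction is computed from them, so that it depends on the observed past only.\<close>
 define D where "D w = (\<lambda>m. E m (\<lambda>j. \<Xi> (\<lambda>i. w (j + i))))" for w
 have D [measurable]: "D \<in> measurable traj_space traj_space"
 proof -
  have B: "(\<lambda>w j. \<Xi> (\<lambda>i. w (j + i))) \<in> measurable traj_space traj_space"
   by (rule measurable_trajI) (rule measurable_compose[OF shift \<Xi>])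
  show ?thesis unfolding D_def by (rule measurable_trajI) (rule measurable_compose[OF B E])
 qed
 have DE: "AE x in \<Omega>. D (past \<Delta> n x) = (\<lambda>m. E m (past \<xi> n x))" for n
 proof -
  have "AE x in \<Omega>. \<forall>j. \<xi> (n - int j) x = \<Xi> (past \<Delta> (n - int j) x)" using \<Xi>n by (simp add: AE_all_countable)
  then show ?thesis
  proof eventually_elim
   case (elim x)
   have "(\<lambda>j. \<Xi> (\<lambda>i. past \<Delta> n x (j + i))) = past \<xi> n x"
    using elim by (simp add: past_def fun_eq_iff algebra_simps)
   then show ?case by (simp add: D_def)
  qed
 qed
 show ?thesis
 proof (rule that[OF D])
  show "AE x in \<Omega>. \<forall>m. D (past \<Delta> n x) m = \<Delta> (n + int m + 1) x - (\<Sum>k\<le>m. a k *\<^sub>R \<xi> (n + int m + 1 - int k) x)" for n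
  proof -
   have "AE x in \<Omega>. \<forall>m. (\<lambda>i. t m (r i) (past \<xi> n x)) \<longlonglongrightarrow> \<Delta> (n + int m + 1) x - (\<Sum>k\<le>m. a k *\<^sub>R \<xi> (n + int m + 1 - int k) x)"
    using tlim by (simp add: AE_all_countable)
   with DE[of n] show ?thesis by eventually_elim (simp add: E_def limI)
  qed
  show "distr \<Omega> traj_space (past \<Delta> n) = past_law \<Omega> \<Delta>" for n by (simp add: Pw law)
  show "distr \<Omega> (traj_space \<Otimes>\<^sub>M borel) (\<lambda>x. (past \<Delta> 0 x, \<xi> 1 x)) = past_law \<Omega> \<Delta> \<Otimes>\<^sub>M gauss"
  proof -
   have hm: "(\<lambda>(v, u). (hh v, u)) \<in> measurable (traj_space \<Otimes>\<^sub>M borel) (traj_space \<Otimes>\<^sub>M borel)" by measurable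
   have "distr \<Omega> (traj_space \<Otimes>\<^sub>M borel) (\<lambda>x. (past \<Delta> 0 x, \<xi> 1 x)) = distr \<Omega> (traj_space \<Otimes>\<^sub>M borel) (\<lambda>x. (hh (past \<xi> 0 x), \<xi> 1 x))"
   proof (rule distr_cong_AE)
    show "AE x in \<Omega>. (past \<Delta> 0 x, \<xi> 1 x) = (hh (past \<xi> 0 x), \<xi> 1 x)" using \<Delta>hh[of 0] by eventually_elim simp
    have "(\<lambda>x. hh (past \<xi> 0 x)) \<in> measurable \<Omega> traj_space" by (rule measurable_compose[OF _ hh]) measurable
    then show "(\<lambda>x. (hh (past \<xi> 0 x), \<xi> 1 x)) \<in> measurable \<Omega> (traj_space \<Otimes>\<^sub>M borel)" by measurable
   qed (auto intro!: measurable_Pair past_measurable)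
   also have "... = distr (distr \<Omega> (traj_space \<Otimes>\<^sub>M borel) (\<lambda>x. (past \<xi> 0 x, \<xi> (0 + 1) x))) (traj_space \<Otimes>\<^sub>M borel) (\<lambda>(v, u). (hh v, u))"
    by (subst distr_distr[OF hm]) (auto simp: o_def intro!: measurable_Pair past_measurable)
   also have "... = distr (noise \<Otimes>\<^sub>M gauss) (traj_space \<Otimes>\<^sub>M gauss) (\<lambda>(v, u). (hh v, u))"
    unfolding distr_past_\<xi>_Suc by (intro distr_cong sets_pair_measure_cong) auto
   also have "... = distr noise traj_space hh \<Otimes>\<^sub>M distr gauss gauss (\<lambda>u. u)"
   proof (rule pair_measure_distr[symmetric])
    have "distr gauss gauss (\<lambda>u :: real ^ 'd. u) = gauss" by (rule distr_id)
    then show "sigma_finite_measure (distr gauss gauss (\<lambda>u :: real ^ 'd. u))" using gauss.sigma_finite_measure_axioms by simp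
   qed auto
   finally show ?thesis by (simp add: Pw distr_id)
  qed
  fix m and s :: real
  assume s: "\<And>n. (\<Sum>j<n. (a (Suc (m + j)))\<^sup>2) \<le> s\<^sup>2" "s > 0"
  have tn: "(\<E> v. ennreal (norm (t m N v))) \<le> ennreal ((1 + 8 * real CARD('d)) * s)" for N
  proof (rule noise.P.nn_integral_norm_le[OF _ _ s(2)])
   show "t m N \<in> borel_measurable noise" by (simp only: measurable_cong_sets[OF sets_noise refl]) (rule t)
   have "(\<E> v. ennreal ((norm (t m N v))\<^sup>2)) \<le> ennreal (8 * real CARD('d) * (\<Sum>j<N - m. (a (Suc (m + j)))\<^sup>2))"
    unfolding t_def by (rule nn_integral_noise_norm_sq_le)
   also have "... \<le> ennreal (8 * real CARD('d) * s\<^sup>2)"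
    by (intro ennreal_leI mult_left_mono s) auto
   finally show "(\<E> v. ennreal ((norm (t m N v))\<^sup>2)) \<le> ennreal (8 * real CARD('d) * s\<^sup>2)" .
  qed simp
  have "(\<integral>\<^sup>+w. ennreal (norm (D w m)) \<partial>past_law \<Omega> \<Delta>) = (\<integral>\<^sup>+x. ennreal (norm (D (past \<Delta> 0 x) m)) \<partial>\<Omega>)"
   unfolding past_law_def by (rule nn_integral_distr) (auto intro: past_measurable)
  \<comment> \<open>Fatou along the subsequence, since the moments of the partial sums are bounded
    uniformly in their length.\<close>
  also have "... = (\<integral>\<^sup>+x. liminf (\<lambda>i. ennreal (norm (t m (r i) (past \<xi> 0 x)))) \<partial>\<Omega>)"
  proof (rule nn_integral_cong_AE)
   show "AE x in \<Omega>. ennreal (norm (D (past \<Delta> 0 x) m)) = liminf (\<lambda>i. ennreal (norm (t m (r i) (past \<xi> 0 x))))"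
    using DE[of 0] tlim[of m 0]
   proof eventually_elim
    case (elim x)
    have "D (past \<Delta> 0 x) m = \<Delta> (0 + int m + 1) x - (\<Sum>k\<le>m. a k *\<^sub>R \<xi> (0 + int m + 1 - int k) x)"
     unfolding elim(1) E_def using elim(2) by (rule limI)
    with elim(2) have "(\<lambda>i. t m (r i) (past \<xi> 0 x)) \<longlonglongrightarrow> D (past \<Delta> 0 x) m" by (simp only:)
    then have "(\<lambda>i. ennreal (norm (t m (r i) (past \<xi> 0 x)))) \<longlonglongrightarrow> ennreal (norm (D (past \<Delta> 0 x) m))"
     by (intro tendsto_ennrealI tendsto_norm)
    from lim_imp_Liminf[OF _ this] show ?case by simp
   qed
  qed
  also have "... \<le> liminf (\<lambda>i. \<integral>\<^sup>+x. ennreal (norm (t m (r i) (past \<xi> 0 x))) \<partial>\<Omega>)"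
  proof (rule nn_integral_liminf)
   show "(\<lambda>x. ennreal (norm (t m (r i) (past \<xi> 0 x)))) \<in> borel_measurable \<Omega>" for i
    by (rule measurable_compose[of _ _ traj_space]) measurable
  qed
  also have "... \<le> ennreal ((1 + 8 * real CARD('d)) * s)"
  proof -
   have "(\<integral>\<^sup>+x. ennreal (norm (t m (r i) (past \<xi> 0 x))) \<partial>\<Omega>) \<le> ennreal ((1 + 8 * real CARD('d)) * s)" for i
   proof -
    have "(\<integral>\<^sup>+x. ennreal (norm (t m (r i) (past \<xi> 0 x))) \<partial>\<Omega>) = (\<integral>\<^sup>+v. ennreal (norm (t m (r i) v)) \<partial>distr \<Omega> traj_space (past \<xi> 0))"
     by (subst nn_integral_distr) auto
    then show ?thesis using tn by (simp add: distr_past_\<xi>)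
   qed
   then have "liminf (\<lambda>i. \<integral>\<^sup>+x. ennreal (norm (t m (r i) (past \<xi> 0 x))) \<partial>\<Omega>) \<le> liminf (\<lambda>i :: nat. ennreal ((1 + 8 * real CARD('d)) * s))"
    by (intro Liminf_mono always_eventually allI)
   also have "... = ennreal ((1 + 8 * real CARD('d)) * s)" by (rule Liminf_const) simp
   finally show ?thesis .
  qed
  finally show "(\<integral>\<^sup>+w. ennreal (norm (D w m)) \<partial>past_law \<Omega> \<Delta>) \<le> ennreal ((1 + 8 * real CARD('d)) * s)" .
 qed
qed

end

section \<open>Path laws\<close>

primrec driven :: "('s \<Rightarrow> real ^ 'd \<Rightarrow> 's) \<Rightarrow> 's \<Rightarrow> (nat \<Rightarrow> real ^ 'd) \<Rightarrow> nat \<Rightarrow> 's" where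
 "driven G y w 0 = y"
| "driven G y w (Suc n) = G (driven G y w n) (w n)"

lemma driven_comb_seq_le: "n \<le> i \<Longrightarrow> driven G y (comb_seq i w w') n = driven G y w n"
 by (induction n) (auto simp: comb_seq_less)

lemma driven_add: "driven G y w (n + k) = driven G (driven G y w n) (\<lambda>i. w (n + i)) k"
 by (induction k) auto

locale driven_system =
 fixes S :: "'s measure" and G :: "'s \<Rightarrow> real ^ 'd \<Rightarrow> 's"
 assumes G_measurable: "(\<lambda>(y, u). G y u) \<in> measurable (S \<Otimes>\<^sub>M borel) S"
begin

lemma G_measurable' [measurable (raw)]:
 assumes [measurable]: "f \<in> measurable M S" "g \<in> measurable M borel"
 shows "(\<lambda>x. G (f x) (g x)) \<in> measurable M S"
proof -
 have "(\<lambda>x. (f x, g x)) \<in> measurable M (S \<Otimes>\<^sub>M borel)" by measurable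
 from measurable_compose[OF this G_measurable] show ?thesis by simp
qed

lemma driven_measurable [measurable (raw)]:
 assumes [measurable]: "f \<in> measurable M S" "g \<in> measurable M traj_space"
 shows "(\<lambda>x. driven G (f x) (g x) n) \<in> measurable M S"
 by (induction n) auto

text \<open>Innovation n is independent of the initial state and of the earlier innovations, on
  which alone \<open>h\<close> depends; splitting the noise at n makes it coordinate 0 of a fresh
  copy.\<close>

lemma nn_integral_driven_next:
 fixes h :: "'s \<Rightarrow> (nat \<Rightarrow> real ^ 'd) \<Rightarrow> real ^ 'd \<Rightarrow> ennreal"
 assumes \<mu>: "prob_space \<mu>" "sets \<mu> = sets S"
  and h: "\<And>y w w' u. (\<And>i. i < n \<Longrightarrow> w i = w' i) \<Longrightarrow> h y w u = h y w' u"
  and [measurable]: "(\<lambda>(y, w, u). h y w u) \<in> borel_measurable (S \<Otimes>\<^sub>M traj_space \<Otimes>\<^sub>M borel)"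
 shows "(\<integral>\<^sup>+x. h (fst x) (snd x) (snd x n) \<partial>(\<mu> \<Otimes>\<^sub>M noise)) = (\<integral>\<^sup>+x. \<integral>\<^sup>+u. h (fst x) (snd x) u \<partial>gauss \<partial>(\<mu> \<Otimes>\<^sub>M noise))"
proof -
 note [measurable_cong] = \<mu>(2)
 have hm: "(\<lambda>x. h (f x) (g x) (k x)) \<in> borel_measurable M"
  if "f \<in> measurable M S" "g \<in> measurable M traj_space" "k \<in> measurable M borel" for f g k and M :: "'q measure"
 proof -
  have "(\<lambda>x. (f x, g x, k x)) \<in> measurable M (S \<Otimes>\<^sub>M traj_space \<Otimes>\<^sub>M borel)" using that by measurable
  from measurable_compose[OF this assms(4)] show ?thesis by simp
 qed
 have m1: "(\<lambda>x. h (fst x) (snd x) (snd x n)) \<in> borel_measurable (\<mu> \<Otimes>\<^sub>M noise)"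
  by (rule hm) measurable
 have "(\<lambda>x. h (fst (fst x)) (snd (fst x)) (snd x)) \<in> borel_measurable ((\<mu> \<Otimes>\<^sub>M noise) \<Otimes>\<^sub>M gauss)"
  by (rule hm) measurable
 from gauss.borel_measurable_nn_integral_fst[OF this]
 have m2: "(\<lambda>x. \<integral>\<^sup>+u. h (fst x) (snd x) u \<partial>gauss) \<in> borel_measurable (\<mu> \<Otimes>\<^sub>M noise)" by simp
 have "(\<integral>\<^sup>+x. h (fst x) (snd x) (snd x n) \<partial>(\<mu> \<Otimes>\<^sub>M noise)) = (\<integral>\<^sup>+y. (\<E> w. h y w (w n)) \<partial>\<mu>)"
  using noise.P.nn_integral_fst[OF m1] by simp
 also have "... = (\<integral>\<^sup>+y. (\<E> w. \<integral>\<^sup>+u. h y w u \<partial>gauss) \<partial>\<mu>)"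
 proof (rule nn_integral_cong)
  fix y assume "y \<in> space \<mu>"
  then have y': "y \<in> space S" using \<open>y \<in> space \<mu>\<close> sets_eq_imp_space_eq[OF \<mu>(2)] by simp
  have "(\<lambda>w. (y, w, w n)) \<in> measurable traj_space (S \<Otimes>\<^sub>M traj_space \<Otimes>\<^sub>M borel)"
   using y' by measurable
  from measurable_compose[OF this assms(4)]
  have "(\<E> w. h y w (w n)) = (\<E> w. (\<E> w'. h y (comb_seq n w w') (comb_seq n w w' n)))"
   by (intro nn_integral_comb_seq_noise) simp
  also have "... = (\<E> w. (\<E> w'. h y w (w' 0)))"
  proof (intro nn_integral_cong)
   fix w w' :: "'d traj"
   have "h y (comb_seq n w w') (w' 0) = h y w (w' 0)" by (rule h) (simp add: comb_seq_less)
   then show "h y (comb_seq n w w') (comb_seq n w w' n) = h y w (w' 0)"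
    using comb_seq_add[of n w w' 0] by simp
  qed
  also have "... = (\<E> w. \<integral>\<^sup>+u. h y w u \<partial>gauss)"
  proof (intro nn_integral_cong)
   fix w :: "'d traj"
   have "(\<lambda>u. (y, w, u)) \<in> measurable borel (S \<Otimes>\<^sub>M traj_space \<Otimes>\<^sub>M borel)"
    using y' by measurable
   from measurable_compose[OF this assms(4)]
   have "(\<E> w'. h y w (w' 0)) = (\<integral>\<^sup>+u. h y w u \<partial>distr noise gauss (\<lambda>w'. w' 0))"
    by (subst nn_integral_distr) auto
   then show "(\<E> w'. h y w (w' 0)) = (\<integral>\<^sup>+u. h y w u \<partial>gauss)"
    by (simp add: noise.PiM_component)
  qed
  finally show "(\<E> w. h y w (w n)) = (\<E> w. \<integral>\<^sup>+u. h y w u \<partial>gauss)" .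
 qed
 also have "... = (\<integral>\<^sup>+x. \<integral>\<^sup>+u. h (fst x) (snd x) u \<partial>gauss \<partial>(\<mu> \<Otimes>\<^sub>M noise))"
  using noise.P.nn_integral_fst[OF m2] by simp
 finally show ?thesis .
qed

text \<open>Markov property with explicit innovations: those from n on are independent of the state
  at time n and form a noise again, so a shifted path is a path started from the law at time
  n.\<close>

lemma distr_driven_shift:
 assumes \<mu>: "prob_space \<mu>" "sets \<mu> = sets S"
 shows "distr (\<mu> \<Otimes>\<^sub>M noise) (S \<Otimes>\<^sub>M noise) (\<lambda>(y, w). (driven G y w n, \<lambda>k. w (n + k)))
  = distr (\<mu> \<Otimes>\<^sub>M noise) S (\<lambda>(y, w). driven G y w n) \<Otimes>\<^sub>M noise"
  (is "?L = ?N \<Otimes>\<^sub>M _")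
proof (rule measure_eqI)
 note [measurable_cong] = \<mu>(2)
 interpret \<mu>: prob_space \<mu> by (rule \<mu>)
 interpret pair_prob_space \<mu> "noise :: 'd traj measure" ..
 have sh [measurable]: "(\<lambda>x k. snd x (n + k)) \<in> measurable (\<mu> \<Otimes>\<^sub>M noise) noise"
  by (subst measurable_cong_sets[OF refl sets_noise], rule measurable_trajI) measurable
 have N: "prob_space ?N" by (rule prob_space_distr) measurable
 show "sets ?L = sets (?N \<Otimes>\<^sub>M noise)" by (simp cong: sets_pair_measure_cong)
 fix A assume "A \<in> sets ?L"
 then have A [measurable]: "A \<in> sets (S \<Otimes>\<^sub>M noise)" by simp
 have A' [measurable]: "A \<in> sets (S \<Otimes>\<^sub>M traj_space)" using A by (simp cong: sets_pair_measure_cong add: sets_noise)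
 have m: "(\<lambda>x. (\<E> w'. indicator A (fst x, w'))) \<in> borel_measurable (S \<Otimes>\<^sub>M traj_space)" by measurable
 have "emeasure ?L A = (\<integral>\<^sup>+z. indicator A z \<partial>?L)" by simp
 also have "... = (\<integral>\<^sup>+x. indicator A (driven G (fst x) (snd x) n, \<lambda>k. snd x (n + k)) \<partial>(\<mu> \<Otimes>\<^sub>M noise))"
  by (subst nn_integral_distr) (auto simp: split_beta')
 also have "... = (\<integral>\<^sup>+y. (\<E> w. indicator A (driven G y w n, \<lambda>k. w (n + k))) \<partial>\<mu>)"
  by (subst noise.P.nn_integral_fst[symmetric]) auto
 also have "... = (\<integral>\<^sup>+y. (\<E> w. (\<E> w'. indicator A (driven G y w n, w'))) \<partial>\<mu>)"
 proof (rule nn_integral_cong)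
  fix y assume "y \<in> space \<mu>"
  then have [measurable]: "y \<in> space S" using sets_eq_imp_space_eq[OF \<mu>(2)] by simp
  have [measurable]: "(\<lambda>w k. w (n + k)) \<in> measurable traj_space traj_space"
   by (rule measurable_trajI) measurable
  have "(\<E> w. indicator A (driven G y w n, \<lambda>k. w (n + k)))
   = (\<E> w. (\<E> w'. indicator A (driven G y (comb_seq n w w') n, \<lambda>k. comb_seq n w w' (n + k))))"
   by (rule nn_integral_comb_seq_noise) measurable
  then show "(\<E> w. indicator A (driven G y w n, \<lambda>k. w (n + k)))
   = (\<E> w. (\<E> w'. indicator A (driven G y w n, w')))"
   by (simp add: driven_comb_seq_le comb_seq_add add.commute[of n])
 qed
 also have "... = (\<integral>\<^sup>+x. (\<E> w'. indicator A (driven G (fst x) (snd x) n, w')) \<partial>(\<mu> \<Otimes>\<^sub>M noise))"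
  by (subst noise.P.nn_integral_fst[symmetric]) auto
 also have "... = (\<integral>\<^sup>+y. (\<E> w'. indicator A (y, w')) \<partial>?N)"
  by (subst nn_integral_distr) (auto simp: split_beta')
 also have "... = (\<integral>\<^sup>+z. indicator A z \<partial>(?N \<Otimes>\<^sub>M noise))"
  by (rule noise.P.nn_integral_fst) measurable
 also have "... = emeasure (?N \<Otimes>\<^sub>M noise) A"
  by (intro nn_integral_indicator) (use A in \<open>simp cong: sets_pair_measure_cong\<close>)
 finally show "emeasure ?L A = emeasure (?N \<Otimes>\<^sub>M noise) A" .
qed

text \<open>The kernel agrees with the driven step only almost surely along the chain, because
  conditional laws are determined up to null sets. Hence the laws of finite histories are compared
  by induction, integrating the kernel identity against the law of the history; these laws determine
  the infinite one.\<close>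

theorem chain_law_driven:
 assumes \<mu>: "prob_space \<mu>" "sets \<mu> = sets S" and Q: "Q \<in> measurable S (prob_algebra S)"
  and step: "\<And>n. AE x in \<mu> \<Otimes>\<^sub>M noise. Q (driven G (fst x) (snd x) n) = distr gauss S (G (driven G (fst x) (snd x) n))"
 shows "chain_law S \<mu> Q = distr (\<mu> \<Otimes>\<^sub>M noise) (PiM UNIV (\<lambda>_. S)) (\<lambda>x. driven G (fst x) (snd x))" (is "_ = ?N")
proof -
 note [measurable_cong] = \<mu>(2)
 interpret \<mu>: prob_space \<mu> by (rule \<mu>)
 interpret pair_prob_space \<mu> "noise :: 'd traj measure" ..
 interpret IT: Ionescu_Tulcea "chain_step \<mu> Q" "\<lambda>_. S" by (rule chain_step_Ionescu_Tulcea[OF \<mu> Q])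
 \<comment> \<open>The history before time n, as a function restricted to its indices, which is the
   form used by the Ionescu-Tulcea construction.\<close>
 define H where "H n x = (\<lambda>i\<in>{0..<n}. driven G (fst x) (snd x) i)" for n and x :: "'s \<times> ('d traj)"
 have H: "(\<lambda>x. H n (f x, g x)) \<in> measurable M (PiM {0..<n} (\<lambda>_. S))"
  if "f \<in> measurable M S" "g \<in> measurable M traj_space" for f g n and M :: "'q measure"
  unfolding H_def using that by (auto intro!: measurable_restrict)
 have H' [measurable]: "H n \<in> measurable (\<mu> \<Otimes>\<^sub>M noise) (PiM {0..<n} (\<lambda>_. S))" for n
  using H[of fst "\<mu> \<Otimes>\<^sub>M noise" snd n] by simp
 let ?L = "\<lambda>n. distr (\<mu> \<Otimes>\<^sub>M noise) (PiM {0..<n} (\<lambda>_. S)) (H n)"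
 have L: "prob_space (?L n)" for n by (rule prob_space_distr) measurable
 have C: "IT.C 0 n (\<lambda>_. undefined) = ?L n" for n
 proof (induction n)
  case 0
  interpret L0: prob_space "?L 0" by (rule L)
  have "emeasure (return (PiM {} (\<lambda>_. S)) (\<lambda>_. undefined)) A = emeasure (?L 0) A" if "A \<in> sets (PiM {} (\<lambda>_. S))" for A
   using that L0.emeasure_space_1 by (auto simp: PiM_empty space_PiM dest!: subset_singletonD)
  then show ?case by (intro measure_eqI) auto
 next
  case (Suc n)
  have eP: "IT.eP n \<in> measurable (?L n) (subprob_algebra (PiM {0..<Suc n} (\<lambda>_. S)))"
   by (simp add: IT.measurable_eP)
  have ne: "space (?L n) \<noteq> {}" using prob_space.not_empty[OF L] .
  show ?case
  proof (rule measure_eqI)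
   have e: "IT.C 0 (Suc n) (\<lambda>_. undefined) = ?L n \<bind> IT.eP n" by (simp add: Suc.IH)
   show "sets (IT.C 0 (Suc n) (\<lambda>_. undefined)) = sets (?L (Suc n))"
    by (subst IT.sets_C) (auto simp: space_PiM)
   fix A assume "A \<in> sets (IT.C 0 (Suc n) (\<lambda>_. undefined))"
   then have A [measurable]: "A \<in> sets (PiM {0..<Suc n} (\<lambda>_. S))"
    by (subst (asm) IT.sets_C) (auto simp: space_PiM)
   have upd: "(\<lambda>x. (H n (f x, g x))(n := h x)) \<in> measurable M (PiM {0..<Suc n} (\<lambda>_. S))"
    if "f \<in> measurable M S" "g \<in> measurable M traj_space" "h \<in> measurable M S" for f g h and M :: "'q measure"
    using that by (intro measurable_fun_upd[where J="{0..<n}"] H) auto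
   have ind: "emeasure (distr \<kappa> S f) {s \<in> space S. (H n x)(n := s) \<in> A} = (\<integral>\<^sup>+u. indicator A ((H n x)(n := f u)) \<partial>\<kappa>)"
    if f: "f \<in> measurable \<kappa> S" and x: "x \<in> space (\<mu> \<Otimes>\<^sub>M noise)" for \<kappa> :: "'q measure" and f x
   proof -
    have [measurable]: "(\<lambda>s. (H n x)(n := s)) \<in> measurable S (PiM {0..<Suc n} (\<lambda>_. S))"
     by (rule measurable_fun_upd[where J="{0..<n}"]) (auto intro: measurable_const measurable_space[OF H' x])
    have "(\<integral>\<^sup>+u. indicator A ((H n x)(n := f u)) \<partial>\<kappa>) = (\<integral>\<^sup>+s. indicator A ((H n x)(n := s)) \<partial>distr \<kappa> S f)"
     by (subst nn_integral_distr[OF f]) auto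
    also have "... = (\<integral>\<^sup>+s. indicator {s \<in> space S. (H n x)(n := s) \<in> A} s \<partial>distr \<kappa> S f)"
     by (intro nn_integral_cong) (auto split: split_indicator)
    also have "... = emeasure (distr \<kappa> S f) {s \<in> space S. (H n x)(n := s) \<in> A}"
     by (intro nn_integral_indicator) simp
    finally show ?thesis ..
   qed
   have "emeasure (IT.C 0 (Suc n) (\<lambda>_. undefined)) A = (\<integral>\<^sup>+w. emeasure (IT.eP n w) A \<partial>?L n)"
    unfolding e by (rule emeasure_bind[OF ne eP A])
   also have "... = (\<integral>\<^sup>+x. emeasure (IT.eP n (H n x)) A \<partial>(\<mu> \<Otimes>\<^sub>M noise))"
    by (subst nn_integral_distr[OF H']) (auto intro!: measurable_emeasure_kernel[OF IT.measurable_eP A])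
   also have "... = (\<integral>\<^sup>+x. emeasure (chain_step \<mu> Q n (H n x)) {s \<in> space S. (H n x)(n := s) \<in> A} \<partial>(\<mu> \<Otimes>\<^sub>M noise))"
    by (intro nn_integral_cong) (auto simp: IT.emeasure_eP[OF measurable_space[OF H']] A vimage_def Int_def conj_commute)
   also have "... = (\<integral>\<^sup>+x. indicator A (H (Suc n) x) \<partial>(\<mu> \<Otimes>\<^sub>M noise))"
   proof (cases n)
    \<comment> \<open>The first step draws the initial state from \<mu>; the history before it is
      empty and carries no randomness.\<close>
    case 0
    have H0: "H 0 x = (\<lambda>_. undefined)" for x by (auto simp: H_def fun_eq_iff)
    have H1: "H (Suc 0) x = (H 0 x)(0 := fst x)" for x by (auto simp: H_def fun_eq_iff)
    let ?A = "{s \<in> space S. (\<lambda>_. undefined)(0 := s) \<in> A}"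
    have "(\<lambda>s. (\<lambda>_. undefined)(0 := s)) \<in> measurable S (PiM {0..<Suc 0} (\<lambda>_. S))"
     by (rule measurable_fun_upd[where J="{0..<0}"]) (auto simp: space_PiM)
    then have A0 [measurable]: "?A \<in> sets S" using A unfolding 0 by measurable
    have "(\<integral>\<^sup>+x. indicator A (H (Suc 0) x) \<partial>(\<mu> \<Otimes>\<^sub>M noise)) = (\<integral>\<^sup>+x. indicator ?A (fst x) \<partial>(\<mu> \<Otimes>\<^sub>M (noise :: 'd traj measure)))"
     unfolding H1 H0
     by (intro nn_integral_cong) (auto simp: space_pair_measure sets_eq_imp_space_eq[OF \<mu>(2)] split: split_indicator)
    also have "... = (\<integral>\<^sup>+y. indicator ?A y \<partial>\<mu>)"
     by (subst noise.P.nn_integral_fst[symmetric]) (auto simp: noise.P.emeasure_space_1[simplified])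
    also have "... = emeasure \<mu> ?A" by (intro nn_integral_indicator) (simp add: \<mu>(2))
    finally show ?thesis unfolding 0 H0 by (simp add: chain_step_def emeasure_space_1)
   next
    case n: (Suc j)
    have HS: "H (Suc n) x = (H n x)(n := G (driven G (fst x) (snd x) j) (snd x j))" for x
     by (auto simp: H_def fun_eq_iff n less_Suc_eq)
    have "(\<integral>\<^sup>+x. indicator A (H (Suc n) x) \<partial>(\<mu> \<Otimes>\<^sub>M noise))
     = (\<integral>\<^sup>+x. (\<lambda>y w u. indicator A ((H n (y, w))(n := G (driven G y w j) u))) (fst x) (snd x) (snd x j) \<partial>(\<mu> \<Otimes>\<^sub>M noise))"
     by (simp add: HS)
    also have "... = (\<integral>\<^sup>+x. \<integral>\<^sup>+u. (\<lambda>y w u. indicator A ((H n (y, w))(n := G (driven G y w j) u))) (fst x) (snd x) u \<partial>gauss \<partial>(\<mu> \<Otimes>\<^sub>M noise))"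
    proof (rule nn_integral_driven_next[OF \<mu>])
     fix y and w w' :: "'d traj" and u :: "real ^ 'd"
     assume w: "\<And>i. i < j \<Longrightarrow> w i = w' i"
     have d: "driven G y w i = driven G y w' i" if "i \<le> j" for i using that w by (induction i) auto
     have "H n (y, w) = H n (y, w')" by (auto simp: H_def n fun_eq_iff d)
     then show "(indicator A ((H n (y, w))(n := G (driven G y w j) u)) :: ennreal) = indicator A ((H n (y, w'))(n := G (driven G y w' j) u))"
      by (simp add: d)
    next
     have "(\<lambda>x. (H n (fst x, fst (snd x)))(n := G (driven G (fst x) (fst (snd x)) j) (snd (snd x))))
       \<in> measurable (S \<Otimes>\<^sub>M traj_space \<Otimes>\<^sub>M borel) (PiM {0..<Suc n} (\<lambda>_. S))"
      by (rule upd) measurable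
     then show "(\<lambda>(y, w, u). indicator A ((H n (y, w))(n := G (driven G y w j) u)))
       \<in> borel_measurable (S \<Otimes>\<^sub>M traj_space \<Otimes>\<^sub>M borel)"
      unfolding split_beta' by measurable
    qed
    also have "... = (\<integral>\<^sup>+x. emeasure (distr gauss S (G (driven G (fst x) (snd x) j))) {s \<in> space S. (H n x)(n := s) \<in> A} \<partial>(\<mu> \<Otimes>\<^sub>M noise))"
    proof (intro nn_integral_cong)
     fix x :: "'s \<times> ('d traj)" assume x: "x \<in> space (\<mu> \<Otimes>\<^sub>M noise)"
     have "(\<lambda>x. driven G (fst x) (snd x) j) \<in> measurable (\<mu> \<Otimes>\<^sub>M noise) S" by measurable
     from measurable_space[OF this x] have "(\<lambda>u. G (driven G (fst x) (snd x) j) u) \<in> measurable gauss S"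
      by (intro G_measurable') (auto intro: measurable_const)
     from ind[OF this x] show "(\<integral>\<^sup>+u. (\<lambda>y w u. indicator A ((H n (y, w))(n := G (driven G y w j) u))) (fst x) (snd x) u \<partial>gauss)
      = emeasure (distr gauss S (G (driven G (fst x) (snd x) j))) {s \<in> space S. (H n x)(n := s) \<in> A}" by simp
    qed
    also have "... = (\<integral>\<^sup>+x. emeasure (chain_step \<mu> Q n (H n x)) {s \<in> space S. (H n x)(n := s) \<in> A} \<partial>(\<mu> \<Otimes>\<^sub>M noise))"
    proof (rule nn_integral_cong_AE)
     show "AE x in \<mu> \<Otimes>\<^sub>M noise. emeasure (distr gauss S (G (driven G (fst x) (snd x) j))) {s \<in> space S. (H n x)(n := s) \<in> A}
      = emeasure (chain_step \<mu> Q n (H n x)) {s \<in> space S. (H n x)(n := s) \<in> A}"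
      using step[of j] by eventually_elim (simp add: chain_step_def n H_def)
    qed
    finally show ?thesis ..
   qed
   also have "... = (\<integral>\<^sup>+z. indicator A z \<partial>?L (Suc n))" by (subst nn_integral_distr[OF H']) auto
   finally show "emeasure (IT.C 0 (Suc n) (\<lambda>_. undefined)) A = emeasure (?L (Suc n)) A" by simp
  qed
 qed
 have N [measurable]: "(\<lambda>x. driven G (fst x) (snd x)) \<in> measurable (\<mu> \<Otimes>\<^sub>M noise) (PiM UNIV (\<lambda>_. S))"
  by (rule measurable_PiM_single') (auto simp: space_pair_measure intro!: measurable_space[of "\<lambda>x. driven G (fst x) (snd x) _" "\<mu> \<Otimes>\<^sub>M noise"])
 have N': "prob_space ?N" by (rule prob_space_distr[OF N])
 \<comment> \<open>It suffices to compare finite-dimensional cylinders, each of which is an event of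
   the history up to a bounded time.\<close>
 have "?N = IT.PF.lim"
 proof (rule measure_eqI_PiM_infinite[where I="UNIV :: nat set" and M="\<lambda>_. S"])
  fix A and J :: "nat set" assume J: "finite J" "J \<subseteq> UNIV" and A: "\<And>i. i \<in> J \<Longrightarrow> A i \<in> sets S"
  define n where "n = IT.up_to J"
  have Jn: "J \<subseteq> {0..<n}" unfolding n_def by (rule IT.up_to[OF J(1)])
  have AJ [measurable]: "Pi\<^sub>E J A \<in> sets (PiM J (\<lambda>_. S))" using J A by (intro sets_PiM_I_finite) auto
  have "emeasure IT.PF.lim (prod_emb UNIV (\<lambda>_. S) J (Pi\<^sub>E J A)) = emeasure (IT.CI J) (Pi\<^sub>E J A)" by (rule IT.lim[OF J(1) AJ])
  also have "... = emeasure (?L n) (prod_emb {0..<n} (\<lambda>_. S) J (Pi\<^sub>E J A))" by (subst IT.emeasure_CI[OF Jn AJ]) (simp add: C)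
  also have "... = emeasure (\<mu> \<Otimes>\<^sub>M noise) (H n -` prod_emb {0..<n} (\<lambda>_. S) J (Pi\<^sub>E J A) \<inter> space (\<mu> \<Otimes>\<^sub>M noise))"
   by (intro emeasure_distr H' measurable_prod_emb AJ Jn)
  also have "... = emeasure ?N (prod_emb UNIV (\<lambda>_. S) J (Pi\<^sub>E J A))"
  proof (subst emeasure_distr[OF N])
   show "prod_emb UNIV (\<lambda>_. S) J (Pi\<^sub>E J A) \<in> sets (PiM UNIV (\<lambda>_. S))" by (intro measurable_prod_emb AJ) simp
   have "H n x \<in> prod_emb {0..<n} (\<lambda>_. S) J (Pi\<^sub>E J A) \<longleftrightarrow> driven G (fst x) (snd x) \<in> prod_emb UNIV (\<lambda>_. S) J (Pi\<^sub>E J A)"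
    if "x \<in> space (\<mu> \<Otimes>\<^sub>M noise)" for x
   proof -
    have "H n x \<in> space (PiM {0..<n} (\<lambda>_. S))" "driven G (fst x) (snd x) \<in> space (PiM UNIV (\<lambda>_. S))"
     using that measurable_space[OF H'] measurable_space[OF N] by blast+
    moreover have "restrict (H n x) J = restrict (driven G (fst x) (snd x)) J" using Jn by (auto simp: H_def fun_eq_iff)
    ultimately show ?thesis by (simp add: prod_emb_iff space_PiM PiE_iff)
   qed
   then show "emeasure (\<mu> \<Otimes>\<^sub>M noise) (H n -` prod_emb {0..<n} (\<lambda>_. S) J (Pi\<^sub>E J A) \<inter> space (\<mu> \<Otimes>\<^sub>M noise))
    = emeasure (\<mu> \<Otimes>\<^sub>M noise) ((\<lambda>x. driven G (fst x) (snd x)) -` prod_emb UNIV (\<lambda>_. S) J (Pi\<^sub>E J A) \<inter> space (\<mu> \<Otimes>\<^sub>M noise))"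
    by (intro arg_cong[where f="emeasure _"]) auto
  qed
  finally show "emeasure ?N (prod_emb UNIV (\<lambda>_. S) J (Pi\<^sub>E J A)) = emeasure IT.PF.lim (prod_emb UNIV (\<lambda>_. S) J (Pi\<^sub>E J A))" ..
 qed (use N' prob_space.finite_measure in auto)
 then show ?thesis by (simp add: chain_law_def)
qed

end

section \<open>One-time laws of driven systems\<close>

context driven_system
begin

definition law where
 "law \<mu> n = distr (\<mu> \<Otimes>\<^sub>M noise) S (\<lambda>x. driven G (fst x) (snd x) n)"

lemma sets_law [simp, measurable_cong]: "sets (law \<mu> n) = sets S"
 by (simp add: law_def)

lemma prob_space_law:
 assumes \<mu>: "prob_space \<mu>" "sets \<mu> = sets S"
 shows "prob_space (law \<mu> n)"
proof -
 note [measurable_cong] = \<mu>(2)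
 interpret \<mu>: prob_space \<mu> by (rule \<mu>)
 interpret pair_prob_space \<mu> "noise :: 'd traj measure" ..
 show ?thesis unfolding law_def by (rule prob_space_distr) measurable
qed

lemma distr_driven_next:
 assumes \<mu>: "prob_space \<mu>" "sets \<mu> = sets S"
 shows "distr (\<mu> \<Otimes>\<^sub>M noise) (S \<Otimes>\<^sub>M gauss) (\<lambda>x. (driven G (fst x) (snd x) n, snd x n)) = law \<mu> n \<Otimes>\<^sub>M gauss"
proof -
 note [measurable_cong] = \<mu>(2)
 have [measurable]: "(\<lambda>x k. snd x (n + k)) \<in> measurable (\<mu> \<Otimes>\<^sub>M noise) noise"
  by (subst measurable_cong_sets[OF refl sets_noise], rule measurable_trajI) measurable
 have "distr (\<mu> \<Otimes>\<^sub>M noise) (S \<Otimes>\<^sub>M noise) (\<lambda>x. (driven G (fst x) (snd x) n, \<lambda>k. snd x (n + k))) = law \<mu> n \<Otimes>\<^sub>M noise"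
  using distr_driven_shift[OF \<mu>, of n] by (simp add: law_def split_beta')
 then have "law \<mu> n \<Otimes>\<^sub>M noise = distr (\<mu> \<Otimes>\<^sub>M noise) (S \<Otimes>\<^sub>M noise) (\<lambda>x. (driven G (fst x) (snd x) n, \<lambda>k. snd x (n + k)))" ..
 then have "distr (law \<mu> n \<Otimes>\<^sub>M noise) (S \<Otimes>\<^sub>M gauss) (\<lambda>(y, w). (y, w 0))
  = distr (\<mu> \<Otimes>\<^sub>M noise) (S \<Otimes>\<^sub>M gauss) (\<lambda>x. (driven G (fst x) (snd x) n, snd x n))"
  by (simp only:) (subst distr_distr, auto simp: o_def split_beta')
 then have "distr (\<mu> \<Otimes>\<^sub>M noise) (S \<Otimes>\<^sub>M gauss) (\<lambda>x. (driven G (fst x) (snd x) n, snd x n))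
  = distr (law \<mu> n \<Otimes>\<^sub>M noise) (law \<mu> n \<Otimes>\<^sub>M gauss) (\<lambda>(y, w). (y, w 0))"
  by (rule trans[OF sym]) (auto intro!: distr_cong sets_pair_measure_cong)
 also have "... = distr (law \<mu> n) (law \<mu> n) (\<lambda>y. y) \<Otimes>\<^sub>M distr noise gauss (\<lambda>w. w 0)"
 proof (rule pair_measure_distr[symmetric])
  show "sigma_finite_measure (distr noise (gauss :: (real ^ 'd) measure) (\<lambda>w. w 0))"
   by (simp add: noise.PiM_component gauss.sigma_finite_measure_axioms)
 qed auto
 finally show ?thesis by (simp add: noise.PiM_component distr_id)
qed

lemma law_0:
 assumes \<mu>: "prob_space \<mu>" "sets \<mu> = sets S"
 shows "law \<mu> 0 = \<mu>"
proof (rule measure_eqI)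
 note [measurable_cong] = \<mu>(2)
 interpret \<mu>: prob_space \<mu> by (rule \<mu>)
 interpret pair_prob_space \<mu> "noise :: 'd traj measure" ..
 fix A assume "A \<in> sets (law \<mu> 0)"
 then have A [measurable]: "A \<in> sets S" by simp
 have "emeasure (law \<mu> 0) A = (\<integral>\<^sup>+x. indicator A (fst x) \<partial>(\<mu> \<Otimes>\<^sub>M (noise :: 'd traj measure)))"
  unfolding law_def by (subst nn_integral_indicator[symmetric]) (auto simp: nn_integral_distr simp del: nn_integral_indicator)
 also have "... = (\<integral>\<^sup>+y. indicator A y \<partial>\<mu>)"
  by (subst noise.P.nn_integral_fst[symmetric]) (auto simp: noise.P.emeasure_space_1[simplified])
 also have "... = emeasure \<mu> A" by (intro nn_integral_indicator) (simp add: \<mu>(2))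
 finally show "emeasure (law \<mu> 0) A = emeasure \<mu> A" .
qed (simp add: \<mu>(2))

lemma law_Suc:
 assumes \<mu>: "prob_space \<mu>" "sets \<mu> = sets S"
 shows "law \<mu> (Suc n) = distr (law \<mu> n \<Otimes>\<^sub>M gauss) S (\<lambda>x. G (fst x) (snd x))"
proof -
 note [measurable_cong] = \<mu>(2)
 have "law \<mu> (Suc n) = distr (distr (\<mu> \<Otimes>\<^sub>M noise) (S \<Otimes>\<^sub>M gauss) (\<lambda>x. (driven G (fst x) (snd x) n, snd x n))) S (\<lambda>x. G (fst x) (snd x))"
  unfolding law_def by (subst distr_distr) (auto simp: o_def)
 then show ?thesis by (simp add: distr_driven_next[OF \<mu>])
qed

lemma AE_driven_next:
 assumes \<mu>: "prob_space \<mu>" "sets \<mu> = sets S" and R: "AE x in law \<mu> n \<Otimes>\<^sub>M gauss. R (fst x) (snd x)"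
 shows "AE x in \<mu> \<Otimes>\<^sub>M noise. R (driven G (fst x) (snd x) n) (snd x n)"
proof -
 note [measurable_cong] = \<mu>(2)
 have "AE x in distr (\<mu> \<Otimes>\<^sub>M noise) (S \<Otimes>\<^sub>M gauss) (\<lambda>x. (driven G (fst x) (snd x) n, snd x n)). R (fst x) (snd x)"
  unfolding distr_driven_next[OF \<mu>] by (rule R)
 from AE_distrD[OF _ this] show ?thesis by simp
qed

lemma AE_driven:
 assumes \<mu>: "prob_space \<mu>" "sets \<mu> = sets S" and R: "AE y in law \<mu> n. R y"
 shows "AE x in \<mu> \<Otimes>\<^sub>M noise. R (driven G (fst x) (snd x) n)"
proof -
 note [measurable_cong] = \<mu>(2)
 show ?thesis using R unfolding law_def by (rule AE_distrD[rotated]) measurable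
qed

lemma bind_kernel_eq:
 assumes \<mu>: "prob_space \<mu>" "sets \<mu> = sets S" and Q: "Q \<in> measurable S (prob_algebra S)"
  and step: "AE y in \<mu>. Q y = distr gauss S (G y)"
 shows "\<mu> \<bind> Q = distr (\<mu> \<Otimes>\<^sub>M gauss) S (\<lambda>x. G (fst x) (snd x))"
proof (rule measure_eqI)
 note [measurable_cong] = \<mu>(2)
 interpret \<mu>: prob_space \<mu> by (rule \<mu>)
 have ne: "space \<mu> \<noteq> {}" by (rule \<mu>.not_empty)
 have Q': "Q \<in> measurable \<mu> (subprob_algebra S)" using measurable_prob_algebraD[OF Q] by measurable
 show s: "sets (\<mu> \<bind> Q) = sets (distr (\<mu> \<Otimes>\<^sub>M gauss) S (\<lambda>x. G (fst x) (snd x)))"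
  using sets_bind[OF sets_kernel[OF Q'] ne] by simp
 fix A assume "A \<in> sets (\<mu> \<bind> Q)"
 then have A [measurable]: "A \<in> sets S" using s by simp
 have "emeasure (\<mu> \<bind> Q) A = (\<integral>\<^sup>+y. emeasure (Q y) A \<partial>\<mu>)" by (rule emeasure_bind[OF ne Q' A])
 also have "... = (\<integral>\<^sup>+y. \<integral>\<^sup>+u. indicator A (G y u) \<partial>gauss \<partial>\<mu>)"
 proof (rule nn_integral_cong_AE)
  show "AE y in \<mu>. emeasure (Q y) A = (\<integral>\<^sup>+u. indicator A (G y u) \<partial>gauss)"
   using step AE_space
  proof eventually_elim
   case (elim y)
   have y: "y \<in> space S" using elim(2) sets_eq_imp_space_eq[OF \<mu>(2)] by simp
   have "(\<lambda>u. G y u) \<in> measurable gauss S" by (intro G_measurable') (auto intro: measurable_const y)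
   then have "(\<integral>\<^sup>+u. indicator A (G y u) \<partial>gauss) = (\<integral>\<^sup>+s. indicator A s \<partial>distr gauss S (G y))"
    by (subst nn_integral_distr) auto
   then show ?case using elim(1) by simp
  qed
 qed
 also have "... = (\<integral>\<^sup>+x. indicator A (G (fst x) (snd x)) \<partial>(\<mu> \<Otimes>\<^sub>M gauss))"
  by (subst gauss.nn_integral_fst[symmetric]) auto
 also have "... = (\<integral>\<^sup>+s. indicator A s \<partial>distr (\<mu> \<Otimes>\<^sub>M gauss) S (\<lambda>x. G (fst x) (snd x)))"
  by (subst nn_integral_distr) auto
 finally show "emeasure (\<mu> \<bind> Q) A = emeasure (distr (\<mu> \<Otimes>\<^sub>M gauss) S (\<lambda>x. G (fst x) (snd x))) A" by simp
qed

end

text \<open>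
 \<open>P\<^sub>w\<close> is a stationary law of pasts and \<open>D w m\<close> the conditional mean, given the past \<open>w\<close>, of the noise
 \<open>m + 1\<close> steps ahead.
\<close>

locale noise_model = memory_dynamics F a
 for F :: "(real ^ 'd) \<times> (real ^ 'd) \<Rightarrow> real ^ 'd" and a :: "nat \<Rightarrow> real" +
 fixes Pw :: "(nat \<Rightarrow> real ^ 'd) measure" and P :: "(nat \<Rightarrow> real ^ 'd) \<Rightarrow> (real ^ 'd) measure"
  and D :: "(nat \<Rightarrow> real ^ 'd) \<Rightarrow> nat \<Rightarrow> real ^ 'd"
 assumes prob_Pw: "prob_space Pw" and sets_Pw [measurable_cong]: "sets Pw = sets traj_space"
  and P_measurable: "P \<in> measurable traj_space (prob_algebra borel)"
  and D_measurable: "D \<in> measurable traj_space traj_space"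
  and invariant_Pw: "distr (Pw \<Otimes>\<^sub>M gauss) traj_space (\<lambda>x. case_nat (D (fst x) 0 + snd x) (fst x)) = Pw"
  and D_next: "AE x in Pw \<Otimes>\<^sub>M gauss. \<forall>m. D (case_nat (D (fst x) 0 + snd x) (fst x)) m = D (fst x) (Suc m) + a (Suc m) *\<^sub>R snd x"
  and P_eq: "AE w in Pw. P w = distr gauss borel (\<lambda>u. D w 0 + u)"
begin

interpretation Pw: prob_space Pw by (rule prob_Pw)

abbreviation Q where "Q \<equiv> transition_kernel F P"
abbreviation init where "init \<equiv> initial_distribution Pw"

text \<open>The transition with explicit innovation: the next noise is its conditional mean plus an
  independent standard Gaussian.\<close>

definition step where
 "step y u = (F (fst y, D (snd y) 0 + u), case_nat (D (snd y) 0 + u) (snd y))"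

lemma step_simps [simp]:
 "fst (step y u) = F (fst y, D (snd y) 0 + u)" "snd (step y u) = case_nat (D (snd y) 0 + u) (snd y)"
 by (simp_all add: step_def)

lemma D_measurable' [measurable (raw)]:
 "f \<in> measurable M traj_space \<Longrightarrow> (\<lambda>x. D (f x)) \<in> measurable M traj_space"
 by (rule measurable_compose[OF _ D_measurable])

lemma D_component_measurable [measurable (raw)]:
 "f \<in> measurable M traj_space \<Longrightarrow> (\<lambda>x. D (f x) m) \<in> borel_measurable M"
 by (drule D_measurable') (erule measurable_compose, measurable)

lemma driven_system_step: "driven_system state_space step"
 by standard (simp add: step_def split_beta', measurable)

sublocale driven_system state_space step by (rule driven_system_step)

lemma Q_measurable: "Q \<in> measurable state_space (prob_algebra state_space)"
 by (rule transition_kernel_measurable[OF F_continuous P_measurable])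

lemma initD:
 assumes "init \<mu>"
 shows "prob_space \<mu>" "sets \<mu> = sets state_space" "distr \<mu> traj_space snd = Pw"
 using assms by (auto simp: initial_distribution_def)

lemma AE_init:
 assumes \<mu>: "init \<mu>" and R: "AE w in Pw. R w"
 shows "AE y in \<mu>. R (snd y)"
proof -
 note [measurable_cong] = initD(2)[OF \<mu>]
 have "AE w in distr \<mu> traj_space snd. R w" unfolding initD(3)[OF \<mu>] by (rule R)
 then show ?thesis by (rule AE_distrD[rotated]) measurable
qed

lemma distr_snd_pair:
 assumes \<mu>: "init \<mu>"
 shows "distr (\<mu> \<Otimes>\<^sub>M gauss) (Pw \<Otimes>\<^sub>M gauss) (\<lambda>x. (snd (fst x), snd x :: real ^ 'd)) = Pw \<Otimes>\<^sub>M gauss"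
proof -
 note [measurable_cong] = initD(2)[OF \<mu>]
 have d: "distr \<mu> Pw snd = Pw" using initD(3)[OF \<mu>] by (simp cong: distr_cong add: sets_Pw)
 have "distr \<mu> Pw snd \<Otimes>\<^sub>M distr gauss gauss (\<lambda>u :: real ^ 'd. u) = distr (\<mu> \<Otimes>\<^sub>M gauss) (Pw \<Otimes>\<^sub>M gauss) (\<lambda>(y, u). (snd y, u))"
 proof (rule pair_measure_distr)
  show "sigma_finite_measure (distr gauss gauss (\<lambda>u :: real ^ 'd. u))"
   unfolding distr_id by (rule gauss.sigma_finite_measure_axioms)
 qed auto
 then show ?thesis unfolding d distr_id split_beta' by (rule sym)
qed

lemma AE_init_pair:
 fixes R :: "(nat \<Rightarrow> real ^ 'd) \<Rightarrow> real ^ 'd \<Rightarrow> bool"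
 assumes \<mu>: "init \<mu>" and R: "AE x in Pw \<Otimes>\<^sub>M gauss. R (fst x) (snd x)"
 shows "AE x in \<mu> \<Otimes>\<^sub>M gauss. R (snd (fst x)) (snd x)"
proof -
 note [measurable_cong] = initD(2)[OF \<mu>]
 have "AE x in distr (\<mu> \<Otimes>\<^sub>M gauss) (Pw \<Otimes>\<^sub>M gauss) (\<lambda>x. (snd (fst x), snd x)). R (fst x) (snd x)"
  unfolding distr_snd_pair[OF \<mu>] by (rule R)
 from AE_distrD[OF _ this] show ?thesis by simp
qed

text \<open>\<open>P\<close> has its Gaussian form for almost every past only, and this passes to
  any law whose second marginal is \<open>Pw\<close>.\<close>

lemma Q_eq:
 assumes \<mu>: "init \<mu>"
 shows "AE y in \<mu>. Q y = distr gauss state_space (step y)"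
 using AE_init[OF \<mu> P_eq]
proof eventually_elim
 case (elim y)
 have [measurable]: "(\<lambda>\<delta>. (F (fst y, \<delta>), case_nat \<delta> (snd y))) \<in> measurable borel state_space" by measurable
 have "Q y = distr (distr gauss borel (\<lambda>u. D (snd y) 0 + u)) state_space (\<lambda>\<delta>. (F (fst y, \<delta>), case_nat \<delta> (snd y)))"
  using elim by (simp add: transition_kernel_def split_beta')
 also have "... = distr gauss state_space (step y)"
  by (subst distr_distr) (auto simp: o_def step_def[abs_def])
 finally show ?case .
qed

text \<open>The kernel identities hold only under laws with second marginal \<open>Pw\<close>;
  stationarity of the noise keeps the chain within this class, so they can be used at every
  time.\<close>

lemma init_law:
 assumes \<mu>: "init \<mu>"
 shows "init (law \<mu> n)"
proof (induction n)
 case 0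
 show ?case using law_0[OF initD(1,2)[OF \<mu>]] \<mu> by simp
next
 case (Suc n)
 have "distr (law \<mu> (Suc n)) traj_space snd
  = distr (law \<mu> n \<Otimes>\<^sub>M gauss) traj_space (\<lambda>x. case_nat (D (snd (fst x)) 0 + snd x) (snd (fst x)))"
  unfolding law_Suc[OF initD(1,2)[OF \<mu>]] by (subst distr_distr) (auto simp: o_def step_def)
 also have "... = distr (distr (law \<mu> n \<Otimes>\<^sub>M gauss) (Pw \<Otimes>\<^sub>M gauss) (\<lambda>x. (snd (fst x), snd x))) traj_space
   (\<lambda>x. case_nat (D (fst x) 0 + snd x) (fst x))"
  using sets_eq_imp_space_eq[OF sets_law]
  by (subst distr_distr) (auto simp: o_def initD(3)[OF Suc.IH, symmetric])
 also have "... = Pw" by (simp add: distr_snd_pair[OF Suc.IH] invariant_Pw)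
 finally show ?case by (simp add: initial_distribution_def prob_space_law[OF initD(1,2)[OF \<mu>]])
qed

lemma bind_law:
 assumes \<mu>: "init \<mu>"
 shows "law \<mu> n \<bind> Q = law \<mu> (Suc n)"
 unfolding law_Suc[OF initD(1,2)[OF \<mu>]]
 by (rule bind_kernel_eq[OF initD(1,2)[OF init_law[OF \<mu>]] Q_measurable Q_eq[OF init_law[OF \<mu>]]])

lemma chain_law_eq:
 assumes \<mu>: "init \<mu>"
 shows "chain_law state_space \<mu> Q = distr (\<mu> \<Otimes>\<^sub>M noise) (PiM UNIV (\<lambda>_. state_space)) (\<lambda>x. driven step (fst x) (snd x))"
 by (rule chain_law_driven[OF initD(1,2)[OF \<mu>] Q_measurable AE_driven[OF initD(1,2)[OF \<mu>] Q_eq[OF init_law[OF \<mu>]]]])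

text \<open>The map from pasts to memories intertwines the chain on states and pasts with
  \<open>memory_chain\<close>, almost surely for all times at once. Questions about X thus become
  questions about dynamics whose memory is affine in the innovations.\<close>

lemma driven_memory:
 assumes \<mu>: "init \<mu>"
 shows "AE x in \<mu> \<Otimes>\<^sub>M noise. \<forall>n.
  chain (fst (fst x), D (snd (fst x))) (snd x) n = (fst (driven step (fst x) (snd x) n), D (snd (driven step (fst x) (snd x) n)))"
proof -
 let ?y = "\<lambda>x n. driven step (fst x) (snd x) n"
 have "AE x in \<mu> \<Otimes>\<^sub>M noise. \<forall>m. D (case_nat (D (snd (?y x n)) 0 + snd x n) (snd (?y x n))) m = D (snd (?y x n)) (Suc m) + a (Suc m) *\<^sub>R snd x n" for n
  by (rule AE_driven_next[OF initD(1,2)[OF \<mu>] AE_init_pair[OF init_law[OF \<mu>] D_next]])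
 then have "AE x in \<mu> \<Otimes>\<^sub>M noise. \<forall>n m. D (case_nat (D (snd (?y x n)) 0 + snd x n) (snd (?y x n))) m = D (snd (?y x n)) (Suc m) + a (Suc m) *\<^sub>R snd x n"
  by (simp add: AE_all_countable)
 then show ?thesis
 proof eventually_elim
  case (elim x)
  show ?case
  proof
   fix n
   show "chain (fst (fst x), D (snd (fst x))) (snd x) n = (fst (?y x n), D (snd (?y x n)))"
    by (induction n) (simp_all add: memory_step_def elim fun_eq_iff)
  qed
 qed
qed

definition memory_law where
 "memory_law \<mu> = distr \<mu> state_space (\<lambda>y. (fst y, D (snd y)))"

lemma path_law_eq:
 assumes \<mu>: "init \<mu>"
 shows "path_law Q \<mu> = distr (\<mu> \<Otimes>\<^sub>M noise) traj_space (\<lambda>x n. fst (driven step (fst x) (snd x) n))"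
proof -
 note [measurable_cong] = initD(2)[OF \<mu>]
 have [measurable]: "(\<lambda>v n. fst (v n)) \<in> measurable (PiM UNIV (\<lambda>_. state_space)) traj_space"
  by (rule measurable_trajI) measurable
 have [measurable]: "(\<lambda>x. driven step (fst x) (snd x)) \<in> measurable (\<mu> \<Otimes>\<^sub>M noise) (PiM UNIV (\<lambda>_. state_space))"
  by (rule measurable_PiM_single') auto
 show ?thesis unfolding path_law_def chain_law_eq[OF \<mu>] by (subst distr_distr) (auto simp: o_def)
qed

lemma shifted_path_law_eq:
 assumes \<mu>: "init \<mu>"
 shows "shifted_path_law Q \<mu> n = distr (\<mu> \<Otimes>\<^sub>M noise) traj_space (\<lambda>x k. fst (driven step (fst x) (snd x) (n + k)))"
proof -
 note [measurable_cong] = initD(2)[OF \<mu>]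
 have [measurable]: "(\<lambda>v k. v (n + k)) \<in> measurable traj_space (traj_space :: 'd traj measure)"
  by (rule measurable_trajI) measurable
 have [measurable]: "(\<lambda>x n. fst (driven step (fst x) (snd x) n)) \<in> measurable (\<mu> \<Otimes>\<^sub>M noise) traj_space"
  by (rule measurable_trajI) measurable
 show ?thesis unfolding shifted_path_law_def path_law_eq[OF \<mu>] by (subst distr_distr) (auto simp: o_def)
qed

text \<open>By Fubini the path law is a mixture of the probabilities \<open>path_prob\<close>, to
  which the pointwise comparison of starting points applies.\<close>

lemma measure_shifted_path_law:
 assumes \<mu>: "init \<mu>" and A [measurable]: "A \<in> sets traj_space"
 shows "measure (shifted_path_law Q \<mu> n) A = (\<integral>z. path_prob A n z \<partial>memory_law \<mu>)"
proof -
 note [measurable_cong] = initD(2)[OF \<mu>]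
 interpret \<mu>: prob_space \<mu> by (rule initD[OF \<mu>])
 interpret pair_prob_space \<mu> "noise :: 'd traj measure" ..
 let ?M = "\<lambda>y. (fst y, D (snd y))"
 have p [measurable]: "(\<lambda>x k. fst (driven step (fst x) (snd x) (n + k))) \<in> measurable (\<mu> \<Otimes>\<^sub>M noise) traj_space"
  by (rule measurable_trajI) measurable
 have M [measurable]: "?M \<in> measurable \<mu> state_space" by measurable
 have I: "integrable (\<mu> \<Otimes>\<^sub>M noise) (\<lambda>x. indicat_real A (\<lambda>k. fst (chain (?M (fst x)) (snd x) (n + k))))"
 proof (rule bounded_expectation(1)[where K=1])
  have "(\<lambda>x k. fst (chain (?M (fst x)) (snd x) (n + k))) \<in> measurable (\<mu> \<Otimes>\<^sub>M noise) traj_space" by measurable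
  from measurable_compose[OF this borel_measurable_indicator[OF A]]
  show "(\<lambda>x. indicat_real A (\<lambda>k. fst (chain (?M (fst x)) (snd x) (n + k)))) \<in> borel_measurable (\<mu> \<Otimes>\<^sub>M noise)" .
 qed (auto split: split_indicator)
 have "measure (shifted_path_law Q \<mu> n) A = (\<integral>x. indicator A (\<lambda>k. fst (driven step (fst x) (snd x) (n + k))) \<partial>(\<mu> \<Otimes>\<^sub>M noise))"
  unfolding shifted_path_law_eq[OF \<mu>] by (subst integral_distr[OF p, symmetric]) auto
 also have "... = (\<integral>x. indicator A (\<lambda>k. fst (chain (?M (fst x)) (snd x) (n + k))) \<partial>(\<mu> \<Otimes>\<^sub>M noise))"
 proof (rule integral_cong_AE)
  show "AE x in \<mu> \<Otimes>\<^sub>M noise. indicat_real A (\<lambda>k. fst (driven step (fst x) (snd x) (n + k)))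
   = indicator A (\<lambda>k. fst (chain (?M (fst x)) (snd x) (n + k)))"
   using driven_memory[OF \<mu>] by eventually_elim simp
 qed measurable
 also have "... = (\<integral>y. (\<EE> v. indicator A (\<lambda>k. fst (chain (?M y) v (n + k)))) \<partial>\<mu>)"
  using integral_fst'[OF I] by simp
 also have "... = (\<integral>y. path_prob A n (?M y) \<partial>\<mu>)"
 proof (rule Bochner_Integration.integral_cong[OF refl])
  fix y
  have "{v. (\<lambda>k. fst (chain (?M y) v (n + k))) \<in> A} \<in> sets noise"
   using path_event_sets[OF A, of "?M y" n] by (simp add: sets_noise)
  then have "path_prob A n (?M y) = (\<EE> v. indicator {v. (\<lambda>k. fst (chain (?M y) v (n + k))) \<in> A} v)"
   by (simp add: path_prob_def)
  also have "... = (\<EE> v. indicator A (\<lambda>k. fst (chain (?M y) v (n + k))))"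
   by (rule Bochner_Integration.integral_cong) (auto split: split_indicator)
  finally show "(\<EE> v. indicator A (\<lambda>k. fst (chain (?M y) v (n + k)))) = path_prob A n (?M y)" ..
 qed
 also have "... = (\<integral>z. path_prob A n z \<partial>memory_law \<mu>)"
  unfolding memory_law_def by (subst integral_distr[OF M]) auto
 finally show ?thesis .
qed

lemma invariant_law:
 assumes "invariant_distribution Pw Q \<mu>"
 shows "init \<mu>" "law \<mu> n = \<mu>"
proof -
 show \<mu>: "init \<mu>" using assms by (simp add: invariant_distribution_def)
 have b: "\<mu> \<bind> Q = \<mu>" using assms by (simp add: invariant_distribution_def)
 show "law \<mu> n = \<mu>"
  by (induction n) (simp_all add: law_0[OF initD(1,2)[OF \<mu>]] bind_law[OF \<mu>, symmetric] b)
qed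

text \<open>The shifted path is a path driven by fresh innovations from the state at time n, and
  invariance makes the law of that state equal to \<mu>.\<close>

lemma shifted_path_law_invariant:
 assumes "invariant_distribution Pw Q \<mu>"
 shows "shifted_path_law Q \<mu> n = path_law Q \<mu>"
proof -
 note \<mu> = invariant_law[OF assms]
 note [measurable_cong] = initD(2)[OF \<mu>(1)]
 have p [measurable]: "(\<lambda>x k. fst (driven step (fst x) (snd x) k)) \<in> measurable (state_space \<Otimes>\<^sub>M noise) traj_space"
  by (rule measurable_trajI) measurable
 have s [measurable]: "(\<lambda>x. (driven step (fst x) (snd x) n, \<lambda>k. snd x (n + k))) \<in> measurable (\<mu> \<Otimes>\<^sub>M noise) (state_space \<Otimes>\<^sub>M noise)"
 proof -
  have [measurable]: "(\<lambda>x k. snd x (n + k)) \<in> measurable (\<mu> \<Otimes>\<^sub>M noise) noise"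
   by (subst measurable_cong_sets[OF refl sets_noise], rule measurable_trajI) measurable
  show ?thesis by measurable
 qed
 have d: "distr (\<mu> \<Otimes>\<^sub>M noise) (state_space \<Otimes>\<^sub>M noise) (\<lambda>x. (driven step (fst x) (snd x) n, \<lambda>k. snd x (n + k))) = \<mu> \<Otimes>\<^sub>M noise"
  using distr_driven_shift[OF initD(1,2)[OF \<mu>(1)], of n] \<mu>(2)[of n] by (simp add: law_def split_beta')
 have "shifted_path_law Q \<mu> n = distr (distr (\<mu> \<Otimes>\<^sub>M noise) (state_space \<Otimes>\<^sub>M noise) (\<lambda>x. (driven step (fst x) (snd x) n, \<lambda>k. snd x (n + k)))) traj_space
   (\<lambda>x k. fst (driven step (fst x) (snd x) k))"
  unfolding shifted_path_law_eq[OF \<mu>(1)] by (subst distr_distr[OF p s]) (simp add: o_def driven_add)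
 then show ?thesis by (simp add: d path_law_eq[OF \<mu>(1)])
qed

lemma stationary_memory_D: "stationary_memory F a (distr Pw traj_space D)"
proof (intro stationary_memory.intro stationary_memory_axioms.intro memory_dynamics_axioms)
 show "prob_space (distr Pw traj_space D)" by (rule Pw.prob_space_distr) measurable
 have m [measurable]: "(\<lambda>x m. fst x (Suc m) + a (Suc m) *\<^sub>R snd x) \<in> measurable (traj_space \<Otimes>\<^sub>M gauss) traj_space"
  by (rule measurable_trajI) measurable
 have "distr (distr Pw traj_space D \<Otimes>\<^sub>M gauss) traj_space (\<lambda>x m. fst x (Suc m) + a (Suc m) *\<^sub>R snd x)
  = distr (distr (Pw \<Otimes>\<^sub>M gauss) (traj_space \<Otimes>\<^sub>M gauss) (\<lambda>x. (D (fst x), snd x))) traj_space (\<lambda>x m. fst x (Suc m) + a (Suc m) *\<^sub>R snd x)"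
 proof -
  have "distr Pw traj_space D \<Otimes>\<^sub>M distr gauss gauss (\<lambda>u :: real ^ 'd. u) = distr (Pw \<Otimes>\<^sub>M gauss) (traj_space \<Otimes>\<^sub>M gauss) (\<lambda>(w, u). (D w, u))"
  proof (rule pair_measure_distr)
   show "sigma_finite_measure (distr gauss gauss (\<lambda>u :: real ^ 'd. u))"
    unfolding distr_id by (rule gauss.sigma_finite_measure_axioms)
  qed auto
  then show ?thesis by (simp add: distr_id split_beta')
 qed
 also have "... = distr (Pw \<Otimes>\<^sub>M gauss) traj_space (\<lambda>x m. D (fst x) (Suc m) + a (Suc m) *\<^sub>R snd x)"
  by (subst distr_distr[OF m]) (auto simp: o_def)
 also have "... = distr (Pw \<Otimes>\<^sub>M gauss) traj_space (\<lambda>x. D (case_nat (D (fst x) 0 + snd x) (fst x)))"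
 proof (rule distr_cong_AE)
  show "AE x in Pw \<Otimes>\<^sub>M gauss. (\<lambda>m. D (fst x) (Suc m) + a (Suc m) *\<^sub>R snd x) = D (case_nat (D (fst x) 0 + snd x) (fst x))"
   using D_next by eventually_elim auto
  show "(\<lambda>x m. D (fst x) (Suc m) + a (Suc m) *\<^sub>R snd x) \<in> measurable (Pw \<Otimes>\<^sub>M gauss) traj_space"
   by (rule measurable_trajI) measurable
 qed auto
 also have "... = distr (distr (Pw \<Otimes>\<^sub>M gauss) traj_space (\<lambda>x. case_nat (D (fst x) 0 + snd x) (fst x))) traj_space D"
  by (subst distr_distr) (auto simp: o_def)
 also have "... = distr Pw traj_space D" by (simp add: invariant_Pw)
 finally show "distr (distr Pw traj_space D \<Otimes>\<^sub>M gauss) traj_space (\<lambda>(D, u) m. D (Suc m) + a (Suc m) *\<^sub>R u) = distr Pw traj_space D"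
  by (simp add: split_beta')
qed simp

sublocale stationary_memory F a "distr Pw traj_space D" by (rule stationary_memory_D)

lemma initial_memory_law:
 assumes \<mu>: "init \<mu>"
 shows "initial (memory_law \<mu>)"
proof -
 note [measurable_cong] = initD(2)[OF \<mu>]
 interpret \<mu>: prob_space \<mu> by (rule initD[OF \<mu>])
 have "prob_space (memory_law \<mu>)" unfolding memory_law_def by (rule \<mu>.prob_space_distr) measurable
 moreover have "distr (memory_law \<mu>) traj_space snd = distr (distr \<mu> traj_space snd) traj_space D"
  unfolding memory_law_def by (subst (1 2) distr_distr) (auto simp: o_def)
 ultimately show ?thesis by (simp add: initial_def initD(3)[OF \<mu>]) (simp add: memory_law_def)
qed

end

section \<open>Existence\<close>

text \<open>Tychonoff's theorem for the cube of functions with values in [0, 1]. Such a cube is not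
  sequentially compact in general, so a filter below \<open>sequentially\<close> takes the place of
  a subsequence and yields a limit for all sets at once.\<close>

lemma ex_setwise_limit:
 fixes m :: "nat \<Rightarrow> 'a \<Rightarrow> real"
 assumes "\<And>k A. 0 \<le> m k A \<and> m k A \<le> 1"
 obtains H :: "nat filter" and L where "H \<noteq> bot" "H \<le> sequentially" "\<And>A. ((\<lambda>k. m k A) \<longlongrightarrow> L A) H"
proof -
 have "compactin (product_topology (\<lambda>_. euclideanreal) UNIV) (PiE (UNIV :: 'a set) (\<lambda>_. {0..1 :: real}))"
  by (subst compactin_PiE) (auto simp: compactin_euclidean_iff)
 then have "compact (PiE (UNIV :: 'a set) (\<lambda>_. {0..1 :: real}))"
  by (simp add: euclidean_product_topology compactin_euclidean_iff)
 moreover have "filtermap m sequentially \<noteq> bot" by (simp add: filtermap_bot_iff)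
 moreover have "eventually (\<lambda>f. f \<in> PiE UNIV (\<lambda>_. {0..1})) (filtermap m sequentially)"
  unfolding eventually_filtermap using assms by (intro always_eventually allI) (auto simp: PiE_UNIV_domain)
 ultimately obtain L where L: "inf (nhds L) (filtermap m sequentially) \<noteq> bot"
  unfolding compact_filter by blast
 \<comment> \<open>The neighbourhoods of the cluster point are pulled back along \<open>m\<close>
   and combined with the tails of the integers.\<close>
 define H where "H = inf (filtercomap m (nhds L)) sequentially"
 have "H \<noteq> bot"
 proof
  assume "H = bot"
  then have "eventually (\<lambda>_. False) (inf (filtercomap m (nhds L)) sequentially)" by (simp add: H_def)
  then obtain Q R where Q: "eventually Q (filtercomap m (nhds L))" and R: "eventually R sequentially"
   and QR: "\<And>k. Q k \<Longrightarrow> R k \<Longrightarrow> False" by (auto simp: eventually_inf)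
  from Q obtain Q' where Q': "eventually Q' (nhds L)" "\<And>k. Q' (m k) \<Longrightarrow> Q k" by (auto simp: eventually_filtercomap)
  have "eventually (\<lambda>f. \<not> Q' f) (filtermap m sequentially)"
   unfolding eventually_filtermap using R by eventually_elim (use Q'(2) QR in blast)
  with Q'(1) have "eventually (\<lambda>_. False) (inf (nhds L) (filtermap m sequentially))"
   unfolding eventually_inf by blast
  with L show False by (simp add: eventually_False)
 qed
 moreover have "H \<le> sequentially" by (simp add: H_def)
 moreover have "((\<lambda>k. m k A) \<longlongrightarrow> L A) H" for A
 proof -
  have "filterlim m (nhds L) H" unfolding H_def filterlim_def
   by (meson filtermap_filtercomap filtermap_mono inf_le1 order_trans)
  then have "((\<lambda>k. m k A) \<longlongrightarrow> L A) H"
   by (rule tendsto_compose[OF _ , rotated]) (use continuous_on_product_coordinates[of A] in \<open>auto simp: continuous_on_def\<close>)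
  then show ?thesis .
 qed
 ultimately show ?thesis by (rule that)
qed

text \<open>A function with values in [0, 1] is uniformly within 1 / N of a finite combination of
  indicators of its level sets, to which setwise convergence applies.\<close>

lemma tendsto_bounded_integral:
 fixes h :: "'a \<Rightarrow> real" and m :: "nat \<Rightarrow> 'a measure"
 assumes m: "\<And>k. prob_space (m k)" "\<And>k. sets (m k) = sets M" and M: "prob_space M"
  and lim: "\<And>A. A \<in> sets M \<Longrightarrow> ((\<lambda>k. measure (m k) A) \<longlongrightarrow> measure M A) H"
  and h [measurable]: "h \<in> borel_measurable M" and h01: "\<And>x. 0 \<le> h x" "\<And>x. h x \<le> 1"
 shows "((\<lambda>k. \<integral>x. h x \<partial>m k) \<longlongrightarrow> (\<integral>x. h x \<partial>M)) H"
proof (rule tendstoI)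
 fix e :: real assume "e > 0"
 then obtain N :: nat where N: "N > 0" "1 / real N < e / 3"
  by (metis ex_inverse_of_nat_less zero_less_divide_iff inverse_eq_divide zero_less_numeral)
 \<comment> \<open>The staircase below h with steps of height 1 / N: each level reached contributes
   1 / N.\<close>
 define g where "g x = (\<Sum>i=1..N. indicat_real {x \<in> space M. real i / real N \<le> h x} x / real N)" for x
 have g: "g x \<le> h x \<and> h x \<le> g x + 1 / real N" if "x \<in> space M" for x
 proof -
  define j where "j = nat \<lfloor>real N * h x\<rfloor>"
  have j: "real j \<le> real N * h x" "real N * h x < real j + 1"
   using h01(1)[of x] by (simp_all add: j_def)
  have "real j \<le> real N" using j(1) h01(2)[of x] mult_left_mono[of "h x" 1 "real N"] by linarith
  then have jN: "j \<le> N" by simp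
  have "(real i / real N \<le> h x) = (i \<le> j)" for i
  proof -
   have "(real i / real N \<le> h x) = (real i \<le> real N * h x)" using N(1) by (simp add: field_simps)
   also have "... = (i \<le> j)" using j by linarith
   finally show ?thesis .
  qed
  then have "g x = (\<Sum>i=1..N. (if i \<le> j then 1 / real N else 0))"
   unfolding g_def using that by (intro sum.cong) (auto simp: indicator_def)
  also have "... = (\<Sum>i\<in>{1..N} \<inter> {i. i \<le> j}. 1 / real N)" by (subst sum.inter_restrict) auto
  also have "{1..N} \<inter> {i. i \<le> j} = {1..j}" using jN by auto
  finally have "g x = real j / real N" by simp
  then show ?thesis using j N(1) by (simp add: divide_le_eq le_divide_eq add_divide_distrib[symmetric] mult.commute)
 qed
 have lev [measurable]: "{x \<in> space M. real i / real N \<le> h x} \<in> sets M" for i by measurable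
 have ig: "(\<integral>x. g x \<partial>M') = (\<Sum>i=1..N. measure M' {x \<in> space M. real i / real N \<le> h x} / real N)"
  and close: "\<bar>(\<integral>x. h x \<partial>M') - (\<integral>x. g x \<partial>M')\<bar> \<le> 1 / real N"
  if "prob_space M'" and s: "sets M' = sets M" for M'
 proof -
  interpret M': prob_space M' by fact
  note [measurable_cong] = s
  have sp: "space M' = space M" using s by (rule sets_eq_imp_space_eq)
  have I: "integrable M' (\<lambda>x. indicat_real {x \<in> space M. real i / real N \<le> h x} x / real N)" for i
   by (rule M'.integrable_const_bound[where B="1 / real N"]) (auto split: split_indicator)
  show "(\<integral>x. g x \<partial>M') = (\<Sum>i=1..N. measure M' {x \<in> space M. real i / real N \<le> h x} / real N)"
   unfolding g_def using I by (subst Bochner_Integration.integral_sum) auto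
  have hI: "integrable M' h" using h01 by (intro M'.integrable_const_bound[where B=1]) auto
  have gI: "integrable M' g" unfolding g_def using I by (intro Bochner_Integration.integrable_sum) auto
  have "(\<integral>x. g x \<partial>M') \<le> (\<integral>x. h x \<partial>M')" using g sp by (intro integral_mono gI hI) auto
  moreover have "(\<integral>x. h x \<partial>M') \<le> (\<integral>x. g x + 1 / real N \<partial>M')"
   using g sp by (intro integral_mono hI Bochner_Integration.integrable_add gI) auto
  moreover have "(\<integral>x. g x + 1 / real N \<partial>M') = (\<integral>x. g x \<partial>M') + 1 / real N"
   using gI by (subst Bochner_Integration.integral_add) (auto simp: M'.prob_space)
  ultimately show "\<bar>(\<integral>x. h x \<partial>M') - (\<integral>x. g x \<partial>M')\<bar> \<le> 1 / real N" by linarith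
 qed
 have "((\<lambda>k. \<integral>x. g x \<partial>m k) \<longlongrightarrow> (\<integral>x. g x \<partial>M)) H"
  unfolding ig[OF m] ig[OF M refl] using N(1) by (intro tendsto_intros lim lev) auto
 then have "\<forall>\<^sub>F k in H. dist (\<integral>x. g x \<partial>m k) (\<integral>x. g x \<partial>M) < e / 3"
  using \<open>e > 0\<close> by (intro tendstoD) auto
 then show "\<forall>\<^sub>F k in H. dist (\<integral>x. h x \<partial>m k) (\<integral>x. h x \<partial>M) < e"
 proof eventually_elim
  case (elim k)
  with close[OF m, of k] close[OF M refl] N(2) show ?case unfolding dist_real_def by linarith
 qed
qed

section \<open>Dyadic cells and limits of couplings\<close>

definition cell :: "nat \<Rightarrow> real ^ 'd \<Rightarrow> real ^ 'd" where
 "cell n x = (\<chi> i. of_int \<lfloor>2 ^ n * x $ i\<rfloor> / 2 ^ n)"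

lemma floor_div_pow2:
 fixes t :: real
 assumes "m \<le> n"
 shows "\<lfloor>(2 :: real) ^ m * (of_int \<lfloor>2 ^ n * t\<rfloor> / 2 ^ n)\<rfloor> = \<lfloor>2 ^ m * t\<rfloor>"
proof -
 define q where "q = (2 :: int) ^ (n - m)"
 have q: "(2 :: real) ^ n = 2 ^ m * of_int q" "q > 0"
  using assms by (simp_all add: q_def flip: power_add)
 have "(2 :: real) ^ m * (of_int \<lfloor>2 ^ n * t\<rfloor> / 2 ^ n) = of_int \<lfloor>2 ^ n * t\<rfloor> / of_int q"
  using q by simp
 moreover have "\<lfloor>real_of_int \<lfloor>2 ^ n * t\<rfloor> / of_int q\<rfloor> = \<lfloor>2 ^ n * t\<rfloor> div q"
  by (rule floor_divide_of_int_eq)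
 moreover have "\<lfloor>2 ^ n * t\<rfloor> div q = \<lfloor>(2 ^ n * t) / of_int q\<rfloor>"
  using q(2) by (metis floor_divide_real_eq_div less_imp_le)
 moreover have "(2 ^ n * t) / of_int q = 2 ^ m * t" using q by simp
 ultimately show ?thesis by metis
qed

text \<open>Rounding down is consistent between levels, so a point is described by a compatible
  sequence of cells and can be recovered from it.\<close>

lemma cell_cell: "m \<le> n \<Longrightarrow> cell m (cell n x) = cell m x"
 using floor_div_pow2 by (simp add: cell_def vec_eq_iff)

lemma norm_cell_le: "norm (x - cell n (x :: real ^ 'd)) \<le> real CARD('d) / 2 ^ n"
proof -
 have "norm (x - cell n x) \<le> (\<Sum>i\<in>UNIV. \<bar>(x - cell n x) $ i\<bar>)" by (rule norm_le_l1_cart)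
 also have "... \<le> (\<Sum>i\<in>(UNIV :: 'd set). 1 / 2 ^ n)"
 proof (rule sum_mono)
  fix i
  have "(x - cell n x) $ i = (2 ^ n * x $ i - of_int \<lfloor>2 ^ n * x $ i\<rfloor>) / 2 ^ n"
   by (simp add: cell_def field_simps)
  moreover have "0 \<le> 2 ^ n * x $ i - of_int \<lfloor>2 ^ n * x $ i\<rfloor>" "2 ^ n * x $ i - of_int \<lfloor>2 ^ n * x $ i\<rfloor> \<le> 1"
   by linarith+
  ultimately show "\<bar>(x - cell n x) $ i\<bar> \<le> 1 / 2 ^ n" by (simp add: divide_right_mono)
 qed
 finally show ?thesis by simp
qed

lemma cell_measurable [measurable]: "cell n \<in> borel_measurable borel"
proof -
 have "cell n = (\<lambda>x. \<Sum>i\<in>UNIV. (of_int \<lfloor>2 ^ n * x $ i\<rfloor> / 2 ^ n) *\<^sub>R axis i (1 :: real))"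
  by (auto simp: fun_eq_iff vec_eq_iff axis_def cell_def if_distrib cong: if_cong)
 also have "... \<in> borel_measurable borel" by measurable
 finally show ?thesis .
qed

lemma finite_cell_cball: "finite (cell n ` cball (0 :: real ^ 'd) K)"
proof -
 define N where "N = \<lceil>2 ^ n * K\<rceil> + 1"
 define B where "B = (\<lambda>z. real_of_int z / 2 ^ n) ` {-N..N}"
 have "cell n ` cball (0 :: real ^ 'd) K \<subseteq> (\<lambda>f. \<chi> i. f i) ` (PiE UNIV (\<lambda>_. B))"
 proof (rule image_subsetI)
  fix x :: "real ^ 'd" assume "x \<in> cball 0 K"
  have "of_int \<lfloor>2 ^ n * x $ i\<rfloor> / 2 ^ n \<in> B" for i
  proof -
   have "\<bar>x $ i\<bar> \<le> K" using component_le_norm_cart[of x i] \<open>x \<in> cball 0 K\<close> by simp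
   then have "\<bar>2 ^ n * x $ i\<bar> \<le> 2 ^ n * K" by (simp add: abs_mult)
   then have "2 ^ n * x $ i \<le> 2 ^ n * K" "- (2 ^ n * K) \<le> 2 ^ n * x $ i" by linarith+
   then have "\<lfloor>2 ^ n * x $ i\<rfloor> \<in> {-N..N}" 
    unfolding N_def atLeastAtMost_iff by (intro conjI) linarith+
   then show ?thesis by (auto simp: B_def)
  qed
  then show "cell n x \<in> (\<lambda>f. \<chi> i. f i) ` (PiE UNIV (\<lambda>_. B))"
   by (auto simp: cell_def intro!: image_eqI[of _ _ "\<lambda>i. of_int \<lfloor>2 ^ n * x $ i\<rfloor> / 2 ^ n"])
 qed
 moreover have "finite (PiE (UNIV :: 'd set) (\<lambda>_. B))" by (rule finite_PiE) (auto simp: B_def)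
 ultimately show ?thesis by (rule finite_subset[OF _ finite_imageI])
qed

text \<open>
 A limit of a tight sequence of couplings with fixed second marginal \<open>\<nu>\<close>. The second coordinate needs
 no topology: the limit along a filter exists for every set, and is countably additive on the sets
 depending on the first coordinate only through its cell, since each compact set meets finitely many
 cells. The Kolmogorov extension theorem glues these measures together. The first coordinate is
 recovered as the limit of its cells.
\<close>

theorem ex_limit_coupling:
 fixes \<mu> :: "nat \<Rightarrow> ((real ^ 'd) \<times> (nat \<Rightarrow> real ^ 'd)) measure"
 assumes \<mu>: "\<And>k. prob_space (\<mu> k)" "\<And>k. sets (\<mu> k) = sets state_space"
  and marg: "\<And>k A. A \<in> sets traj_space \<Longrightarrow> measure (\<mu> k) (UNIV \<times> A) = measure \<nu> A"
  and \<nu>: "prob_space \<nu>" "sets \<nu> = sets traj_space"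
  and tight: "\<And>\<epsilon>. \<epsilon> > 0 \<Longrightarrow> \<exists>K. \<forall>k. measure (\<mu> k) {y. norm (fst y) > K} \<le> \<epsilon>"
 obtains H :: "nat filter" and M where "H \<noteq> bot" "H \<le> sequentially" "prob_space M" "sets M = sets state_space"
  "\<And>\<psi> :: _ \<Rightarrow> real. \<psi> \<in> borel_measurable state_space \<Longrightarrow> (\<And>y. 0 \<le> \<psi> y \<and> \<psi> y \<le> 1) \<Longrightarrow> (\<And>w. continuous_on UNIV (\<lambda>x. \<psi> (x, w))) \<Longrightarrow>
   (\<And>\<epsilon>. \<epsilon> > 0 \<Longrightarrow> \<exists>n0. \<forall>n\<ge>n0. \<forall>k. \<bar>(\<integral>y. \<psi> y \<partial>\<mu> k) - (\<integral>y. \<psi> (cell n (fst y), snd y) \<partial>\<mu> k)\<bar> \<le> \<epsilon>) \<Longrightarrow>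
   ((\<lambda>k. \<integral>y. \<psi> y \<partial>\<mu> k) \<longlongrightarrow> (\<integral>y. \<psi> y \<partial>M)) H"
proof -
 interpret \<mu>: prob_space "\<mu> k" for k by (rule \<mu>)
 interpret \<nu>: prob_space \<nu> by (rule \<nu>)
 note [measurable_cong] = \<mu>(2) \<nu>(2)
 have sp: "space (\<mu> k) = UNIV" for k using sets_eq_imp_space_eq[OF \<mu>(2)] by (simp add: space_pair_measure space_PiM)
 obtain H L where H: "H \<noteq> bot" "H \<le> sequentially" and L: "\<And>A. ((\<lambda>k. measure (\<mu> k) A) \<longlongrightarrow> L A) H"
  using ex_setwise_limit[of "\<lambda>k A. measure (\<mu> k) A"] by auto
 have L_nonneg: "0 \<le> L A" and L_le: "L A \<le> 1" for A
  using H(1) by (auto intro!: tendsto_lowerbound[OF L] tendsto_upperbound[OF L])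
 have L_mono: "L A \<le> L B" if "A \<subseteq> B" "B \<in> sets state_space" for A B
  using that H(1) by (intro tendsto_le[OF _ L L]) (auto intro!: always_eventually \<mu>.finite_measure_mono simp: \<mu>)
 have L_Un: "L (A \<union> B) = L A + L B" if "A \<in> sets state_space" "B \<in> sets state_space" "A \<inter> B = {}" for A B
 proof -
  have "((\<lambda>k. measure (\<mu> k) (A \<union> B)) \<longlongrightarrow> L A + L B) H"
   using tendsto_add[OF L[of A] L[of B]] that by (simp add: \<mu>.finite_measure_Union \<mu>)
  with L[of "A \<union> B"] H(1) show ?thesis by (blast intro: tendsto_unique)
 qed
 have L_le_Un: "L (A \<union> B) \<le> L A + L B" if "A \<in> sets state_space" "B \<in> sets state_space" for A B
  using that H(1) by (intro tendsto_le[OF _ tendsto_add[OF L L] L]) (auto intro!: always_eventually measure_Un_le simp: \<mu>)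
 have L_const: "L A = c" if "\<And>k. measure (\<mu> k) A = c" for A c
  using tendsto_unique[OF H(1) L[of A], of c] that by simp
 have L_UNIV: "L UNIV = 1" using \<mu>.prob_space by (intro L_const) (simp add: sp)
 have L_marg: "L (UNIV \<times> A) = measure \<nu> A" if "A \<in> sets traj_space" for A
  by (rule L_const) (rule marg[OF that])
 define X where "X = (PiM UNIV (\<lambda>_. borel) :: (nat \<Rightarrow> (real ^ 'd) \<times> (real ^ 'd)) measure)"
 have sX: "space X = UNIV" by (simp add: X_def space_PiM)
 \<comment> \<open>State and past are stored in one sequence: coordinate j holds noise entry j and
   the cell of x at level min j n. At a fixed n all the information on x is its cell at level
   n.\<close>
 define \<phi> where "\<phi> n y = (\<lambda>j. (cell (min j n) (fst y), snd y j))" for n and y :: "'d state"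
 have pairm: "(\<lambda>x. (f x, g x)) \<in> borel_measurable M" if "f \<in> borel_measurable M" "g \<in> borel_measurable M"
  for f g :: "'q \<Rightarrow> real ^ 'd" and M by (rule borel_measurable_Pair[OF that])
 have cellm: "(\<lambda>x. cell n (f x)) \<in> borel_measurable M" if "f \<in> borel_measurable M" for f :: "'q \<Rightarrow> real ^ 'd" and M n
  by (rule measurable_compose[OF that cell_measurable])
 have \<phi>: "\<phi> n \<in> measurable state_space X" for n
  unfolding X_def \<phi>_def by (rule measurable_PiM_single') (auto intro!: pairm cellm)
 have \<phi>s: "\<phi> n -` A \<in> sets state_space" if "A \<in> sets X" for n A
  using measurable_sets[OF \<phi> that, of n] by (simp add: space_pair_measure space_PiM)
 define c where "c n A = ennreal (L (\<phi> n -` A))" for n A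
 have ca: "positive (sets X) (c n)" "countably_additive (sets X) (c n)" for n
 proof -
  have "L {} = 0" by (rule L_const) simp
  then show pos: "positive (sets X) (c n)" by (simp add: positive_def c_def)
  have add: "additive (sets X) (c n)"
   unfolding additive_def
  proof (intro ballI impI)
   fix A B assume AB: "A \<in> sets X" "B \<in> sets X" "A \<inter> B = {}"
   then have "L (\<phi> n -` A \<union> \<phi> n -` B) = L (\<phi> n -` A) + L (\<phi> n -` B)" by (intro L_Un \<phi>s) auto
   then show "c n (A \<union> B) = c n A + c n B" by (simp add: c_def ennreal_plus L_nonneg)
  qed
  show "countably_additive (sets X) (c n)"
  proof (rule ring_of_sets.empty_continuous_imp_countably_additive[OF _ pos add])
   show "ring_of_sets (space X) (sets X)" by (rule sets.ring_of_sets_axioms)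
   show "\<forall>A\<in>sets X. c n A \<noteq> \<infinity>" by (simp add: c_def)
   fix A :: "nat \<Rightarrow> (nat \<Rightarrow> (real ^ 'd) \<times> (real ^ 'd)) set" assume A: "range A \<subseteq> sets X" "decseq A" "(\<Inter>i. A i) = {}"
   \<comment> \<open>Up to probability e / 2 the state lies in a ball, which meets finitely many
     cells. For each of these cells the sections of the decreasing sets have empty intersection,
     hence so has their finite union \<open>B\<close>, and the fixed marginal \<nu> is continuous at
     the empty set.\<close>
   have "(\<lambda>i. L (\<phi> n -` A i)) \<longlonglongrightarrow> 0"
   proof (rule LIMSEQ_I)
    fix e :: real assume "e > 0"
    then obtain K where K: "\<And>k. measure (\<mu> k) {y. norm (fst y) > K} \<le> e / 2" using tight[of "e / 2"] by auto
    define C where "C = cell n ` cball (0 :: real ^ 'd) K"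
    have C: "finite C" unfolding C_def by (rule finite_cell_cball)
    define g where "g x w = (\<lambda>j. (cell (min j n) x, w j))" for x :: "real ^ 'd" and w :: "'d traj"
    have gm: "g x \<in> measurable traj_space X" for x
     unfolding X_def g_def by (rule measurable_PiM_single') (auto intro!: pairm)
    have g\<phi>: "\<phi> n (x, w) = g (cell n x) w" for x w by (auto simp: \<phi>_def g_def cell_cell)
    define B where "B i = (\<Union>x\<in>C. g x -` A i)" for i
    have gs: "g x -` A i \<in> sets traj_space" for x i
     using measurable_sets[OF gm, of "A i" x] A(1) by (auto simp: space_PiM)
    have Bs: "B i \<in> sets traj_space" for i unfolding B_def using C gs by (intro sets.finite_UN) auto
    have "decseq B" using A(2) by (auto simp: B_def decseq_def) blast
    moreover have "(\<Inter>i. B i) = {}"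
    proof (rule equals0I)
     fix w assume w: "w \<in> (\<Inter>i. B i)"
     \<comment> \<open>Otherwise each of the finitely many cells drops out at some index, and at the
       largest such index none is left because the sets decrease.\<close>
     have "\<exists>x\<in>C. \<forall>i. g x w \<in> A i"
     proof (rule ccontr)
      assume "\<not> (\<exists>x\<in>C. \<forall>i. g x w \<in> A i)"
      then obtain i where i: "\<And>x. x \<in> C \<Longrightarrow> g x w \<notin> A (i x)" by metis
      define j where "j = Max (i ` C)"
      have "g x w \<notin> A j" if "x \<in> C" for x
      proof -
       have "i x \<le> j" unfolding j_def using C that by (intro Max_ge) auto
       then show ?thesis using i[OF that] A(2) by (auto simp: decseq_def)
      qed
      with w show False by (auto simp: B_def)
     qed
     with A(3) show False by blast
    qed
    ultimately have "(\<lambda>i. measure \<nu> (B i)) \<longlonglongrightarrow> measure \<nu> {}"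
     using \<nu>.finite_Lim_measure_decseq[of B] Bs by (auto simp: \<nu>)
    then have "(\<lambda>i. measure \<nu> (B i)) \<longlonglongrightarrow> 0" by simp
    from LIMSEQ_D[OF this, of "e / 2"] obtain i0 where i0: "\<And>i. i \<ge> i0 \<Longrightarrow> measure \<nu> (B i) < e / 2"
     using \<open>e > 0\<close> by auto
    show "\<exists>no. \<forall>i\<ge>no. norm (L (\<phi> n -` A i) - 0) < e"
    proof (intro exI allI impI)
     fix i assume "i \<ge> i0"
     have s1: "{y. norm (fst y) > K} \<in> sets (state_space :: 'd state measure)"
     proof -
      have "{y \<in> space (state_space :: 'd state measure). norm (fst y) > K} \<in> sets state_space" by measurable
      then show ?thesis by (simp add: space_pair_measure space_PiM)
     qed
     have s2: "UNIV \<times> B i \<in> sets (state_space :: 'd state measure)" using Bs by simp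
     have "\<phi> n -` A i \<subseteq> {y. norm (fst y) > K} \<union> (UNIV \<times> B i)"
     proof
      fix y assume "y \<in> \<phi> n -` A i"
      then show "y \<in> {y. norm (fst y) > K} \<union> (UNIV \<times> B i)"
       by (cases y) (auto simp: B_def C_def g\<phi> not_less)
     qed
     then have "L (\<phi> n -` A i) \<le> L ({y. norm (fst y) > K} \<union> (UNIV \<times> B i))" by (intro L_mono sets.Un s1 s2)
     also have "... \<le> L {y. norm (fst y) > K} + L (UNIV \<times> B i)" by (rule L_le_Un[OF s1 s2])
     also have "L {y. norm (fst y) > K} \<le> e / 2" by (rule tendsto_upperbound[OF L]) (use K H in auto)
     also have "L (UNIV \<times> B i) < e / 2" unfolding L_marg[OF Bs] using i0 \<open>i \<ge> i0\<close> by simp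
     finally show "norm (L (\<phi> n -` A i) - 0) < e" using L_nonneg by simp
    qed
   qed
   then show "(\<lambda>i. c n (A i)) \<longlonglongrightarrow> 0" unfolding c_def using tendsto_ennrealI by fastforce
  qed
 qed
 define Mn where "Mn n = measure_of (space X) (sets X) (c n)" for n
 have sMn [simp]: "sets (Mn n) = sets X" for n by (simp add: Mn_def)
 have eMn: "emeasure (Mn n) A = ennreal (L (\<phi> n -` A))" if "A \<in> sets X" for n A
 proof -
  have "emeasure (Mn n) A = c n A" unfolding Mn_def
   by (rule emeasure_measure_of_sigma[OF sets.sigma_algebra_axioms ca that])
  then show ?thesis by (simp add: c_def)
 qed
 have UX: "UNIV \<in> sets X" using sets.top[of X] by (simp add: sX)
 have spMn: "space (Mn n) = UNIV" for n using sets_eq_imp_space_eq[OF sMn] by (simp add: sX)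
 have pMn: "prob_space (Mn n)" for n by (rule prob_spaceI) (simp add: spMn eMn[OF UX] L_UNIV)
 define \<pi> where "\<pi> y = (\<lambda>j. (cell j (fst y), snd y j))" for y :: "'d state"
 \<comment> \<open>A level at which all coordinates in J show their own cells, min j n being j
   there; the inserted 0 gives a value for empty J.\<close>
 define lev where "lev J = Max (insert 0 J)" for J :: "nat set"
 have \<phi>\<pi>: "restrict (\<phi> (lev J) y) J = restrict (\<pi> y) J" if "finite J" for J y
 proof -
  have "min j (lev J) = j" if "j \<in> J" for j
   using Max_ge[of "insert 0 J" j] that \<open>finite J\<close> by (simp add: lev_def min_def)
  then show ?thesis by (auto simp: \<phi>_def \<pi>_def fun_eq_iff)
 qed
 define P where "P J = distr (Mn (lev J)) (PiM J (\<lambda>_. borel)) (\<lambda>v. restrict v J)" for J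
 have rX: "(\<lambda>v. restrict v J) \<in> measurable X (PiM J (\<lambda>_. borel))" for J
  unfolding X_def by (rule measurable_restrict_subset) simp
 have eP: "emeasure (P J) A = ennreal (L {y. restrict (\<pi> y) J \<in> A})" if J: "finite J" and A: "A \<in> sets (PiM J (\<lambda>_. borel))" for J A
 proof -
  have r: "(\<lambda>v. restrict v J) \<in> measurable (Mn (lev J)) (PiM J (\<lambda>_. borel))" using rX by (simp cong: measurable_cong_sets)
  have "(\<lambda>v. restrict v J) -` A \<in> sets X" using measurable_sets[OF rX A] by (simp add: sX)
  then have "emeasure (P J) A = ennreal (L (\<phi> (lev J) -` ((\<lambda>v. restrict v J) -` A)))"
   unfolding P_def by (simp add: emeasure_distr[OF r A] spMn eMn)
  then show ?thesis by (simp add: vimage_def \<phi>\<pi>[OF J])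
 qed
 have sP: "sets (P J) = sets (PiM J (\<lambda>_. borel))" for J by (simp add: P_def)
 have "projective_family UNIV P (\<lambda>_. borel)"
 proof (rule projective_family.intro)
  fix J H :: "nat set" assume JH: "J \<subseteq> H" "finite H"
  have J: "finite J" using JH by (rule finite_subset)
  have r: "(\<lambda>v. restrict v J) \<in> measurable (PiM H (\<lambda>_. borel)) (PiM J (\<lambda>_. borel :: ((real ^ 'd) \<times> (real ^ 'd)) measure))"
   by (rule measurable_restrict_subset) (rule JH)
  show "P J = distr (P H) (PiM J (\<lambda>_. borel)) (\<lambda>f. restrict f J)"
  proof (rule measure_eqI)
   fix A assume "A \<in> sets (P J)"
   then have A: "A \<in> sets (PiM J (\<lambda>_. borel))" by (simp add: sP)
   have r': "(\<lambda>v. restrict v J) \<in> measurable (P H) (PiM J (\<lambda>_. borel :: ((real ^ 'd) \<times> (real ^ 'd)) measure))"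
    using r by (simp cong: measurable_cong_sets add: sP)
   have s: "(\<lambda>v. restrict v J) -` A \<inter> space (P H) \<in> sets (PiM H (\<lambda>_. borel))"
    using measurable_sets[OF r' A] by (simp add: sP)
   have "space (P H) = PiE H (\<lambda>_. UNIV)" by (simp add: P_def space_PiM)
   then have "restrict (\<pi> y) H \<in> (\<lambda>v. restrict v J) -` A \<inter> space (P H) \<longleftrightarrow> restrict (\<pi> y) J \<in> A" for y
    using JH by (auto simp: restrict_restrict Int_absorb1)
   then show "emeasure (P J) A = emeasure (distr (P H) (PiM J (\<lambda>_. borel)) (\<lambda>f. restrict f J)) A"
    by (simp only: emeasure_distr[OF r' A] eP[OF J A] eP[OF JH(2) s])
  qed (simp add: sP)
 next
  fix J :: "nat set" assume J: "finite J"
  show "prob_space (P J)" unfolding P_def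
   by (rule prob_space.prob_space_distr[OF pMn]) (use rX in \<open>simp cong: measurable_cong_sets\<close>)
 qed
 then interpret PP: polish_projective UNIV P by (simp add: polish_projective_def)
 define \<Lambda> where "\<Lambda> = PP.lim"
 have s\<Lambda> [measurable_cong]: "sets \<Lambda> = sets X" by (simp add: \<Lambda>_def X_def)
 have sp\<Lambda>: "space \<Lambda> = UNIV" using sets_eq_imp_space_eq[OF s\<Lambda>] by (simp add: sX)
 have \<Lambda>: "emeasure \<Lambda> {v. restrict v J \<in> A} = ennreal (L {y. restrict (\<pi> y) J \<in> A})"
  if J: "finite J" and A: "A \<in> sets (PiM J (\<lambda>_. borel))" for J A
 proof -
  have "{v. restrict v J \<in> A} = prod_emb UNIV (\<lambda>_. borel) J A" by (auto simp: prod_emb_def)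
  then show ?thesis using PP.emeasure_lim_emb[OF subset_UNIV J A] by (simp add: \<Lambda>_def eP[OF J A])
 qed
 interpret \<Lambda>: prob_space \<Lambda>
 proof (rule prob_spaceI)
  have "emeasure \<Lambda> {v. restrict v {} \<in> {\<lambda>_. undefined}} = ennreal (L {y. restrict (\<pi> y) {} \<in> {\<lambda>_. undefined}})"
   by (rule \<Lambda>) (simp_all add: PiM_empty)
  then show "emeasure \<Lambda> (space \<Lambda>) = 1" by (simp add: sp\<Lambda> L_UNIV restrict_def)
 qed
 \<comment> \<open>Compatibility of the cells survives in the limit because each instance is an
   event of two coordinates on which L is 1.\<close>
 have rel: "AE v in \<Lambda>. \<forall>m n. m \<le> n \<longrightarrow> fst (v m) = cell m (fst (v n))"
 proof -
  have "AE v in \<Lambda>. fst (v m) = cell m (fst (v n))" if "m \<le> n" for m n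
  proof -
   let ?M = "PiM {m, n} (\<lambda>_. borel :: ((real ^ 'd) \<times> (real ^ 'd)) measure)"
   let ?A = "{f \<in> space ?M. fst (f m) = cell m (fst (f n))}"
   have comp: "(\<lambda>f. fst (f j)) \<in> borel_measurable ?M" if "j \<in> {m, n}" for j
    using measurable_component_singleton[OF that, of "\<lambda>_. borel :: ((real ^ 'd) \<times> (real ^ 'd)) measure"]
    by (rule measurable_compose) (simp add: borel_prod[symmetric])
   have A: "?A \<in> sets ?M"
    by (intro measurable_equality_set comp cellm) auto
   have "{y. restrict (\<pi> y) {m, n} \<in> ?A} = UNIV"
    using that by (auto simp: space_PiM \<pi>_def cell_cell)
   then have "emeasure \<Lambda> {v. restrict v {m, n} \<in> ?A} = 1"
    using \<Lambda>[OF _ A] by (simp add: L_UNIV)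
   then have "AE v in \<Lambda>. v \<in> {v. restrict v {m, n} \<in> ?A}"
    by (intro \<Lambda>.AE_prob_1) (simp add: measure_def)
   then show ?thesis by eventually_elim auto
  qed
  then show ?thesis by (simp add: AE_all_countable)
 qed
 have fstm: "(\<lambda>v. fst (v j)) \<in> borel_measurable X" and sndm: "(\<lambda>v. snd (v j)) \<in> borel_measurable X" for j
 proof -
  have "(\<lambda>v. v j) \<in> measurable X (borel \<Otimes>\<^sub>M borel)"
   unfolding X_def borel_prod by (rule measurable_component_singleton) simp
  then show "(\<lambda>v. fst (v j)) \<in> borel_measurable X" "(\<lambda>v. snd (v j)) \<in> borel_measurable X"
   by measurable
 qed
 define \<sigma> where "\<sigma> v = (\<lambda>j. snd (v j))" for v :: "nat \<Rightarrow> (real ^ 'd) \<times> (real ^ 'd)"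
 define x where "x v = lim (\<lambda>n. fst (v n))" for v :: "nat \<Rightarrow> (real ^ 'd) \<times> (real ^ 'd)"
 have xm: "x \<in> borel_measurable X" unfolding x_def by (rule borel_measurable_lim_metric) (rule fstm)
 have \<sigma>m: "\<sigma> \<in> measurable X traj_space" unfolding \<sigma>_def by (rule measurable_trajI) (rule sndm)
 have conv: "AE v in \<Lambda>. (\<lambda>n. fst (v n)) \<longlonglongrightarrow> x v"
  using rel
 proof eventually_elim
  case (elim v)
  have "Cauchy (\<lambda>n. fst (v n))"
  proof (rule CauchyI')
   fix e :: real assume "e > 0"
   have "(\<lambda>m. real CARD('d) / 2 ^ m) \<longlonglongrightarrow> 0" by real_asymp
   from LIMSEQ_D[OF this \<open>e > 0\<close>] obtain m0 where m0: "\<And>m. m \<ge> m0 \<Longrightarrow> real CARD('d) / 2 ^ m < e" by auto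
   show "\<exists>M. \<forall>m\<ge>M. \<forall>n>m. dist (fst (v m)) (fst (v n)) < e"
   proof (intro exI allI impI)
    fix m n assume "m0 \<le> m" "m < n"
    then have "fst (v m) = cell m (fst (v n))" using elim by simp
    then have "norm (fst (v m) - fst (v n)) \<le> real CARD('d) / 2 ^ m"
     using norm_cell_le[of "fst (v n)" m] by (subst norm_minus_commute) simp
    with m0 \<open>m0 \<le> m\<close> show "dist (fst (v m)) (fst (v n)) < e" unfolding dist_norm by force
   qed
  qed
  then show ?case unfolding x_def by (simp add: Cauchy_convergent_iff convergent_LIMSEQ_iff)
 qed
 \<comment> \<open>Capping the cells of the extension at level n gives back the countably additive
   measure of that level, so integrals of functions of finitely fine cells are limits along
   H.\<close>
 have proj: "distr \<Lambda> X (\<lambda>v j. (fst (v (min j n)), snd (v j))) = Mn n" (is "distr _ _ ?f = _") for n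
 proof (rule measure_eqI_PiM_infinite[where I="UNIV :: nat set" and M="\<lambda>_. borel"])
  have f: "?f \<in> measurable X X"
   unfolding X_def by (rule measurable_PiM_single') (auto intro!: pairm fstm[unfolded X_def] sndm[unfolded X_def])
  then have f': "?f \<in> measurable \<Lambda> X" by (simp cong: measurable_cong_sets add: s\<Lambda>)
  show "finite_measure (distr \<Lambda> X ?f)" using \<Lambda>.prob_space_distr[OF f'] by (rule prob_space.finite_measure)
  show "sets (distr \<Lambda> X ?f) = sets (PiM UNIV (\<lambda>_. borel))" "sets (Mn n) = sets (PiM UNIV (\<lambda>_. borel))"
   by (simp_all add: X_def)
  fix A and J :: "nat set" assume J: "finite J" and A: "\<And>i. i \<in> J \<Longrightarrow> A i \<in> sets (borel :: ((real ^ 'd) \<times> (real ^ 'd)) measure)"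
  define E where "E = prod_emb UNIV (\<lambda>_. borel :: ((real ^ 'd) \<times> (real ^ 'd)) measure) J (Pi\<^sub>E J A)"
  have E: "E \<in> sets X" unfolding E_def X_def using J A by (intro measurable_prod_emb sets_PiM_I_finite) auto
  have E_iff: "v \<in> E \<longleftrightarrow> (\<forall>j\<in>J. v j \<in> A j)" for v by (auto simp: E_def prod_emb_def PiE_iff)
  define J' where "J' = J \<union> (\<lambda>j. min j n) ` J"
  let ?M = "PiM J' (\<lambda>_. borel :: ((real ^ 'd) \<times> (real ^ 'd)) measure)"
  have J': "finite J'" using J by (simp add: J'_def)
  define A' where "A' = {v \<in> space ?M. \<forall>j\<in>J. (fst (v (min j n)), snd (v j)) \<in> A j}"
  have comp: "(\<lambda>v. v j) \<in> measurable ?M (borel \<Otimes>\<^sub>M borel)" if "j \<in> J'" for j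
   unfolding borel_prod by (rule measurable_component_singleton) (rule that)
  have A': "A' \<in> sets ?M"
  proof -
   have "{v \<in> space ?M. (fst (v (min j n)), snd (v j)) \<in> A j} \<in> sets ?M" if "j \<in> J" for j
   proof -
    have "(\<lambda>v. (fst (v (min j n)), snd (v j))) \<in> measurable ?M borel"
     using that comp[of j] comp[of "min j n"] by (intro pairm) (auto simp: J'_def intro: measurable_fst'' measurable_snd'')
    from measurable_sets[OF this A[OF that]] show ?thesis by (simp add: vimage_def Int_def conj_commute)
   qed
   moreover have "A' = space ?M \<inter> (\<Inter>j\<in>J. {v \<in> space ?M. (fst (v (min j n)), snd (v j)) \<in> A j})" by (auto simp: A'_def)
   ultimately show ?thesis using J by (cases "J = {}") (auto intro!: sets.Int sets.finite_INT)
  qed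
  have "emeasure (distr \<Lambda> X ?f) E = emeasure \<Lambda> {v. restrict v J' \<in> A'}"
  proof -
   have "?f -` E \<inter> space \<Lambda> = {v. restrict v J' \<in> A'}"
    by (auto simp: sp\<Lambda> E_iff A'_def J'_def space_PiM)
   then show ?thesis by (simp add: emeasure_distr[OF f' E])
  qed
  also have "... = ennreal (L {y. restrict (\<pi> y) J' \<in> A'})" by (rule \<Lambda>[OF J' A'])
  also have "{y. restrict (\<pi> y) J' \<in> A'} = \<phi> n -` E"
   by (auto simp: E_iff A'_def J'_def space_PiM \<pi>_def \<phi>_def)
  also have "ennreal (L (\<phi> n -` E)) = emeasure (Mn n) E" by (rule eMn[OF E, symmetric])
  finally show "emeasure (distr \<Lambda> X ?f) (prod_emb UNIV (\<lambda>_. borel) J (Pi\<^sub>E J A)) = emeasure (Mn n) (prod_emb UNIV (\<lambda>_. borel) J (Pi\<^sub>E J A))"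
   by (simp add: E_def)
 qed
 define M where "M = distr \<Lambda> state_space (\<lambda>v. (x v, \<sigma> v))"
 have stm: "(\<lambda>v. (x v, \<sigma> v)) \<in> measurable \<Lambda> state_space"
  using xm \<sigma>m by (simp cong: measurable_cong_sets add: s\<Lambda>)
 show ?thesis
 proof (rule that[of H M, OF H])
  show "prob_space M" unfolding M_def by (rule \<Lambda>.prob_space_distr[OF stm])
  show "sets M = sets state_space" by (simp add: M_def)
  fix \<psi> :: "'d state \<Rightarrow> real"
  assume \<psi>: "\<psi> \<in> borel_measurable state_space" "\<And>y. 0 \<le> \<psi> y \<and> \<psi> y \<le> 1" "\<And>w. continuous_on UNIV (\<lambda>x. \<psi> (x, w))"
   and unif: "\<And>\<epsilon>. \<epsilon> > 0 \<Longrightarrow> \<exists>n0. \<forall>n\<ge>n0. \<forall>k. \<bar>(\<integral>y. \<psi> y \<partial>\<mu> k) - (\<integral>y. \<psi> (cell n (fst y), snd y) \<partial>\<mu> k)\<bar> \<le> \<epsilon>"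
  define h where "h n v = \<psi> (fst (v n), \<sigma> v)" for n v
  have hm: "h n \<in> borel_measurable X" for n
   unfolding h_def by (rule measurable_compose[OF _ \<psi>(1)]) (intro measurable_Pair fstm \<sigma>m)
  have A: "((\<lambda>k. \<integral>y. \<psi> (cell n (fst y), snd y) \<partial>\<mu> k) \<longlongrightarrow> (\<integral>v. h n v \<partial>\<Lambda>)) H" for n
  proof -
   have \<phi>': "\<phi> n \<in> measurable (\<mu> k) X" for k using \<phi> by (simp cong: measurable_cong_sets add: \<mu>)
   have "((\<lambda>k. \<integral>v. h n v \<partial>distr (\<mu> k) X (\<phi> n)) \<longlongrightarrow> (\<integral>v. h n v \<partial>Mn n)) H"
   proof (rule tendsto_bounded_integral)
    show "prob_space (distr (\<mu> k) X (\<phi> n))" for k by (rule \<mu>.prob_space_distr[OF \<phi>'])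
    fix A assume "A \<in> sets (Mn n)"
    then have A: "A \<in> sets X" by simp
    have "measure (distr (\<mu> k) X (\<phi> n)) A = measure (\<mu> k) (\<phi> n -` A)" for k
     by (simp add: measure_distr[OF \<phi>' A] sp)
    moreover have "measure (Mn n) A = L (\<phi> n -` A)" by (simp add: measure_def eMn[OF A] L_nonneg)
    ultimately show "((\<lambda>k. measure (distr (\<mu> k) X (\<phi> n)) A) \<longlongrightarrow> measure (Mn n) A) H" using L by simp
   qed (use hm \<psi>(2) pMn in \<open>auto simp: h_def[symmetric] cong: measurable_cong_sets\<close>, auto simp: h_def \<psi>(2))
   also have "(\<lambda>k. \<integral>v. h n v \<partial>distr (\<mu> k) X (\<phi> n)) = (\<lambda>k. \<integral>y. \<psi> (cell n (fst y), snd y) \<partial>\<mu> k)"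
    by (subst integral_distr[OF \<phi>' hm]) (simp add: h_def \<phi>_def \<sigma>_def)
   also have "(\<integral>v. h n v \<partial>Mn n) = (\<integral>v. h n v \<partial>\<Lambda>)"
   proof -
    have "(\<lambda>v j. (fst (v (min j n)), snd (v j))) \<in> measurable X X"
     by (subst (2) X_def, rule measurable_PiM_single') (auto intro!: pairm fstm sndm)
    then have f: "(\<lambda>v j. (fst (v (min j n)), snd (v j))) \<in> measurable \<Lambda> X" by (simp cong: measurable_cong_sets add: s\<Lambda>)
    show ?thesis unfolding proj[symmetric] by (subst integral_distr[OF f hm]) (simp add: h_def[abs_def] \<sigma>_def)
   qed
   finally show ?thesis .
  qed
  have B: "(\<lambda>n. \<integral>v. h n v \<partial>\<Lambda>) \<longlonglongrightarrow> (\<integral>y. \<psi> y \<partial>M)"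
  proof -
   have "(\<lambda>n. \<integral>v. h n v \<partial>\<Lambda>) \<longlonglongrightarrow> (\<integral>v. \<psi> (x v, \<sigma> v) \<partial>\<Lambda>)"
   proof (rule integral_dominated_convergence[where w="\<lambda>_. 1"])
    show "(\<lambda>v. \<psi> (x v, \<sigma> v)) \<in> borel_measurable \<Lambda>" by (rule measurable_compose[OF stm \<psi>(1)])
    show "h n \<in> borel_measurable \<Lambda>" for n using hm by (simp cong: measurable_cong_sets add: s\<Lambda>)
    show "AE v in \<Lambda>. (\<lambda>n. h n v) \<longlonglongrightarrow> \<psi> (x v, \<sigma> v)"
     using conv
    proof eventually_elim
     case (elim v)
     have "isCont (\<lambda>x. \<psi> (x, \<sigma> v)) (x v)" using \<psi>(3) by (simp add: continuous_on_eq_continuous_at)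
     then show ?case unfolding h_def by (rule isCont_tendsto_compose) (rule elim)
    qed
   qed (use \<psi>(2) in \<open>auto simp: h_def\<close>)
   also have "(\<integral>v. \<psi> (x v, \<sigma> v) \<partial>\<Lambda>) = (\<integral>y. \<psi> y \<partial>M)" unfolding M_def by (rule integral_distr[OF stm \<psi>(1), symmetric])
   finally show ?thesis .
  qed
  \<comment> \<open>Three approximations: the state is replaced by a fine cell with error uniform in
    k, the limit in k is taken at that level, and the level is sent to infinity in the limit
    measure.\<close>
  show "((\<lambda>k. \<integral>y. \<psi> y \<partial>\<mu> k) \<longlongrightarrow> (\<integral>y. \<psi> y \<partial>M)) H"
  proof (rule tendstoI)
   fix e :: real assume "e > 0"
   from unif[of "e / 4"] \<open>e > 0\<close> obtain n0 where n0: "\<And>n k. n \<ge> n0 \<Longrightarrow> \<bar>(\<integral>y. \<psi> y \<partial>\<mu> k) - (\<integral>y. \<psi> (cell n (fst y), snd y) \<partial>\<mu> k)\<bar> \<le> e / 4" by auto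
   from LIMSEQ_D[OF B, of "e / 4"] \<open>e > 0\<close> obtain n1 where n1: "\<And>n. n \<ge> n1 \<Longrightarrow> \<bar>(\<integral>v. h n v \<partial>\<Lambda>) - (\<integral>y. \<psi> y \<partial>M)\<bar> < e / 4" by auto
   define n where "n = max n0 n1"
   have n: "n \<ge> n0" "n \<ge> n1" by (auto simp: n_def)
   have "\<forall>\<^sub>F k in H. dist (\<integral>y. \<psi> (cell n (fst y), snd y) \<partial>\<mu> k) (\<integral>v. h n v \<partial>\<Lambda>) < e / 4"
    using A[of n] \<open>e > 0\<close> by (intro tendstoD) auto
   then show "\<forall>\<^sub>F k in H. dist (\<integral>y. \<psi> y \<partial>\<mu> k) (\<integral>y. \<psi> y \<partial>M) < e"
   proof eventually_elim
    case (elim k)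
    with n0[OF n(1), of k] n1[OF n(2)] \<open>e > 0\<close> show ?case unfolding dist_real_def by linarith
   qed
  qed
 qed
qed

text \<open>The Cesaro mean of the laws, realised as the mixture over a uniformly distributed
  index.\<close>

lemma ex_average:
 assumes N: "\<And>i. prob_space (N i)" "\<And>i. sets (N i) = sets M"
 obtains \<nu> where "prob_space \<nu>" "sets \<nu> = sets M"
  "\<And>f :: 'a \<Rightarrow> real. f \<in> borel_measurable M \<Longrightarrow> (\<And>x. 0 \<le> f x \<and> f x \<le> 1) \<Longrightarrow>
   (\<integral>x. f x \<partial>\<nu>) = (\<Sum>i\<le>k. \<integral>x. f x \<partial>N i) / real (Suc k)"
proof -
 interpret N: prob_space "N i" for i by (rule N)
 define p where "p = measure_pmf (pmf_of_set {..k})"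
 have Nm: "N \<in> measurable p (prob_algebra M)"
  by (auto simp: p_def space_prob_algebra N)
 note Nm' = measurable_prob_algebraD[OF Nm]
 have ne: "space p \<noteq> {}" by (simp add: p_def)
 define \<nu> where "\<nu> = p \<bind> N"
 have s: "sets \<nu> = sets M" unfolding \<nu>_def by (rule sets_bind[OF sets_kernel[OF Nm'] ne])
 have pr: "prob_space \<nu>" unfolding \<nu>_def
  by (rule prob_space.prob_space_bind[OF _ _ Nm']) (auto simp: p_def N measure_pmf.prob_space_axioms)
 interpret \<nu>: prob_space \<nu> by (rule pr)
 show ?thesis
 proof (rule that[OF pr s])
  fix f :: "'a \<Rightarrow> real" assume f: "f \<in> borel_measurable M" and f01: "\<And>x. 0 \<le> f x \<and> f x \<le> 1"
  note [measurable_cong] = s N(2)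
  note [measurable] = f
  have i: "(\<integral>\<^sup>+x. ennreal (f x) \<partial>N i) = ennreal (\<integral>x. f x \<partial>N i)" for i
   using f01 by (intro nn_integral_eq_integral N.integrable_const_bound[where B=1]) auto
  have n: "0 \<le> (\<integral>x. f x \<partial>N i)" for i using f01 by (intro integral_nonneg_AE) auto
  have "ennreal (\<integral>x. f x \<partial>\<nu>) = (\<integral>\<^sup>+x. ennreal (f x) \<partial>\<nu>)"
   using f01 by (intro nn_integral_eq_integral[symmetric] \<nu>.integrable_const_bound[where B=1]) auto
  also have "... = (\<integral>\<^sup>+i. ennreal (\<integral>x. f x \<partial>N i) \<partial>p)"
   unfolding \<nu>_def by (subst nn_integral_bind[OF _ Nm']) (auto simp: i)
  also have "... = ennreal (\<integral>i. (\<integral>x. f x \<partial>N i) \<partial>p)"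
  proof (rule nn_integral_eq_integral)
   show "integrable p (\<lambda>i. \<integral>x. f x \<partial>N i)" unfolding p_def
    by (rule integrable_measure_pmf_finite) simp
  qed (use n in auto)
  also have "(\<integral>i. (\<integral>x. f x \<partial>N i) \<partial>p) = (\<Sum>i\<le>k. \<integral>x. f x \<partial>N i) / real (Suc k)"
   unfolding p_def by (subst integral_pmf_of_set) auto
  finally show "(\<integral>x. f x \<partial>\<nu>) = (\<Sum>i\<le>k. \<integral>x. f x \<partial>N i) / real (Suc k)"
   using n f01 by (subst (asm) ennreal_inj) (auto intro!: integral_nonneg_AE sum_nonneg divide_nonneg_nonneg)
 qed
qed

section \<open>Lyapunov moments of one-time and invariant laws\<close>

context noise_model
begin

lemma nn_integral_law:
 assumes \<mu>: "init \<mu>" and [measurable]: "g \<in> borel_measurable borel"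
 shows "(\<integral>\<^sup>+y. g (fst y) \<partial>law \<mu> n) = (\<integral>\<^sup>+z. \<integral>\<^sup>+\<omega>. g (fst (chain z \<omega> n)) \<partial>noise \<partial>memory_law \<mu>)"
proof -
 note [measurable_cong] = initD(2)[OF \<mu>]
 let ?M = "\<lambda>y. (fst y, D (snd y))"
 have [measurable]: "?M \<in> measurable \<mu> state_space" by measurable
 have "(\<integral>\<^sup>+y. g (fst y) \<partial>law \<mu> n) = (\<integral>\<^sup>+x. g (fst (driven step (fst x) (snd x) n)) \<partial>(\<mu> \<Otimes>\<^sub>M noise))"
  unfolding law_def by (subst nn_integral_distr) auto
 also have "... = (\<integral>\<^sup>+x. g (fst (chain (?M (fst x)) (snd x) n)) \<partial>(\<mu> \<Otimes>\<^sub>M noise))"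
 proof (rule nn_integral_cong_AE)
  show "AE x in \<mu> \<Otimes>\<^sub>M noise. g (fst (driven step (fst x) (snd x) n)) = g (fst (chain (?M (fst x)) (snd x) n))"
   using driven_memory[OF \<mu>] by eventually_elim simp
 qed
 also have "... = (\<integral>\<^sup>+y. \<integral>\<^sup>+\<omega>. g (fst (chain (?M y) \<omega> n)) \<partial>noise \<partial>\<mu>)"
  by (subst noise.P.nn_integral_fst[symmetric]) auto
 also have "... = (\<integral>\<^sup>+z. \<integral>\<^sup>+\<omega>. g (fst (chain z \<omega> n)) \<partial>noise \<partial>memory_law \<mu>)"
  unfolding memory_law_def by (subst nn_integral_distr) auto
 finally show ?thesis .
qed

lemma nn_integral_memory_law_fst:
 assumes \<mu>: "init \<mu>" and [measurable]: "g \<in> borel_measurable borel"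
 shows "(\<integral>\<^sup>+z. g (fst z) \<partial>memory_law \<mu>) = (\<integral>\<^sup>+y. g (fst y) \<partial>\<mu>)"
proof -
 note [measurable_cong] = initD(2)[OF \<mu>]
 show ?thesis unfolding memory_law_def by (subst nn_integral_distr) auto
qed

lemma nn_integral_norm_memory:
 "(\<integral>\<^sup>+D'. ennreal (norm (D' m)) \<partial>distr Pw traj_space D) = (\<integral>\<^sup>+w. ennreal (norm (D w m)) \<partial>Pw)"
 by (subst nn_integral_distr) auto

context
 fixes V :: "real ^ 'd \<Rightarrow> real" and \<gamma> C m1 :: real
 assumes V_measurable [measurable]: "V \<in> borel_measurable borel" and V_nonneg: "\<And>x. V x \<ge> 0"
  and V_step: "\<And>x w. V (F (x, w)) \<le> \<gamma> * V x + C * (1 + norm w)" and \<gamma>: "0 < \<gamma>" "\<gamma> < 1" and C: "C > 0"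
  and m1: "(\<integral>\<^sup>+w. ennreal (norm (D w 0)) \<partial>Pw) \<le> ennreal m1" "m1 \<ge> 0"
begin

lemmas V_assms = V_measurable V_nonneg V_step \<gamma> C m1(1)[folded nn_integral_norm_memory] m1(2)

lemma nn_integral_V_law_le:
 assumes \<mu>: "init \<mu>" and v: "(\<integral>\<^sup>+y. ennreal (V (fst y)) \<partial>\<mu>) \<le> ennreal v" "v \<ge> 0"
 shows "(\<integral>\<^sup>+y. ennreal (V (fst y)) \<partial>law \<mu> n) \<le> ennreal (v + drift C m1 / (1 - \<gamma>))"
 unfolding nn_integral_law[OF \<mu>, of "\<lambda>x. ennreal (V x)", simplified]
 by (rule nn_integral_V_le[OF V_assms initial_memory_law[OF \<mu>]])
  (simp_all add: nn_integral_memory_law_fst[OF \<mu>, of "\<lambda>x. ennreal (V x)"] v)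

text \<open>V is truncated before invariance is used, as its integral might be infinite. Iterating
  the drift n times under the truncation bounds \<open>f 1\<close> by
  \<open>f (\<gamma> ^ n)\<close> plus a geometric sum; the former tends to 0 by dominated
  convergence, and Fatou's lemma removes the truncation.\<close>

lemma nn_integral_V_invariant:
 assumes "invariant_distribution Pw Q \<mu>"
 shows "(\<integral>\<^sup>+y. ennreal (V (fst y)) \<partial>\<mu>) \<le> ennreal (drift C m1 / (1 - \<gamma>))"
proof -
 note \<mu> = invariant_law[OF assms]
 note [measurable_cong] = initD(2)[OF \<mu>(1)]
 interpret \<mu>: prob_space \<mu> by (rule initD[OF \<mu>(1)])
 have trunc: "(\<integral>\<^sup>+y. min (ennreal (V (fst y))) (ennreal (real N)) \<partial>\<mu>) \<le> ennreal (drift C m1 / (1 - \<gamma>))" for N :: nat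
 proof -
  define f where "f s = (\<integral>\<^sup>+y. min (ennreal (s * V (fst y))) (ennreal (real N)) \<partial>\<mu>)" for s
  have chain_f: "(\<integral>\<^sup>+z. \<integral>\<^sup>+\<omega>. min (ennreal (s * V (fst (chain z \<omega> t)))) (ennreal (real N)) \<partial>noise \<partial>memory_law \<mu>) = f s" for s t
   using nn_integral_law[OF \<mu>(1), of "\<lambda>x. min (ennreal (s * V x)) (ennreal (real N))" t] by (simp add: f_def \<mu>(2))
  have it: "f 1 \<le> f (\<gamma> ^ n) + ennreal ((\<Sum>k<n. \<gamma> ^ k) * drift C m1)" for n
  proof (induction n)
   case (Suc n)
   have "f (\<gamma> ^ n) \<le> f (\<gamma> ^ n * \<gamma>) + ennreal (\<gamma> ^ n * drift C m1)"
    using nn_integral_V_Suc[OF V_assms initial_memory_law[OF \<mu>(1)], where s="\<gamma> ^ n" and R="ennreal (real N)" and t=0] \<gamma>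
    by (simp only: chain_f) simp
   then have "f 1 \<le> f (\<gamma> ^ n * \<gamma>) + ennreal (\<gamma> ^ n * drift C m1) + ennreal ((\<Sum>k<n. \<gamma> ^ k) * drift C m1)"
    using Suc.IH by (meson add_right_mono order_trans)
   also have "... = f (\<gamma> ^ n * \<gamma>) + (ennreal (\<gamma> ^ n * drift C m1) + ennreal ((\<Sum>k<n. \<gamma> ^ k) * drift C m1))" by (rule add.assoc)
   also have "ennreal (\<gamma> ^ n * drift C m1) + ennreal ((\<Sum>k<n. \<gamma> ^ k) * drift C m1) = ennreal (\<gamma> ^ n * drift C m1 + (\<Sum>k<n. \<gamma> ^ k) * drift C m1)"
    using \<gamma> drift_nonneg[OF V_assms] by (intro ennreal_plus[symmetric]) (auto intro!: mult_nonneg_nonneg sum_nonneg)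
   also have "\<gamma> ^ n * drift C m1 + (\<Sum>k<n. \<gamma> ^ k) * drift C m1 = (\<Sum>k<Suc n. \<gamma> ^ k) * drift C m1"
    by (simp add: distrib_right)
   also have "\<gamma> ^ n * \<gamma> = \<gamma> ^ Suc n" by simp
   finally show ?case .
  qed simp
  have "(\<lambda>n. f (\<gamma> ^ n)) \<longlonglongrightarrow> (\<integral>\<^sup>+y. 0 \<partial>\<mu>)"
   unfolding f_def
  proof (rule nn_integral_dominated_convergence[where w="\<lambda>_. ennreal (real N)"])
   show "AE y in \<mu>. (\<lambda>n. min (ennreal (\<gamma> ^ n * V (fst y))) (ennreal (real N))) \<longlonglongrightarrow> 0"
   proof (intro AE_I2)
    fix y :: "'d state"
    have "(\<lambda>n. \<gamma> ^ n * V (fst y)) \<longlonglongrightarrow> 0 * V (fst y)"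
     using \<gamma> by (intro tendsto_intros LIMSEQ_power_zero) auto
    then have "(\<lambda>n. min (ennreal (\<gamma> ^ n * V (fst y))) (ennreal (real N))) \<longlonglongrightarrow> min (ennreal (0 * V (fst y))) (ennreal (real N))"
     by (intro tendsto_min tendsto_ennrealI tendsto_const)
    then show "(\<lambda>n. min (ennreal (\<gamma> ^ n * V (fst y))) (ennreal (real N))) \<longlonglongrightarrow> 0" by simp
   qed
  qed (auto simp: \<mu>.emeasure_space_1 ennreal_mult_less_top)
  then have "(\<lambda>n. f (\<gamma> ^ n) + ennreal (drift C m1 / (1 - \<gamma>))) \<longlonglongrightarrow> 0 + ennreal (drift C m1 / (1 - \<gamma>))"
   by (intro tendsto_add tendsto_const) simp
  moreover have "f 1 \<le> f (\<gamma> ^ n) + ennreal (drift C m1 / (1 - \<gamma>))" for n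
  proof (rule order_trans[OF it[of n]], rule add_left_mono, rule ennreal_leI)
   have "(\<Sum>k<n. \<gamma> ^ k) \<le> 1 / (1 - \<gamma>)"
    using \<gamma> by (subst sum_gp_strict) (auto simp: field_simps)
   from mult_right_mono[OF this drift_nonneg[OF V_assms]] show "(\<Sum>k<n. \<gamma> ^ k) * drift C m1 \<le> drift C m1 / (1 - \<gamma>)" by simp
  qed
  ultimately have "f 1 \<le> 0 + ennreal (drift C m1 / (1 - \<gamma>))"
   by (intro tendsto_lowerbound[of _ _ sequentially]) auto
  then show ?thesis by (simp add: f_def)
 qed
 have "(\<integral>\<^sup>+y. ennreal (V (fst y)) \<partial>\<mu>) = (\<integral>\<^sup>+y. liminf (\<lambda>N. min (ennreal (V (fst y))) (ennreal (real N))) \<partial>\<mu>)"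
 proof (rule nn_integral_cong)
  fix y :: "'d state"
  have "\<forall>\<^sub>F N in sequentially. ennreal (V (fst y)) = min (ennreal (V (fst y))) (ennreal (real N))"
  proof (rule eventually_sequentiallyI)
   fix N assume "nat \<lceil>V (fst y)\<rceil> \<le> N"
   then have "V (fst y) \<le> real N" by linarith
   then show "ennreal (V (fst y)) = min (ennreal (V (fst y))) (ennreal (real N))"
    by (simp add: min_def ennreal_leI)
  qed
  then have "(\<lambda>N. min (ennreal (V (fst y))) (ennreal (real N))) \<longlonglongrightarrow> ennreal (V (fst y))"
   by (rule Lim_transform_eventually[OF tendsto_const])
  from lim_imp_Liminf[OF _ this] show "ennreal (V (fst y)) = liminf (\<lambda>N. min (ennreal (V (fst y))) (ennreal (real N)))" by simp
 qed
 also have "... \<le> liminf (\<lambda>N. \<integral>\<^sup>+y. min (ennreal (V (fst y))) (ennreal (real N)) \<partial>\<mu>)"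
  by (rule nn_integral_liminf) measurable
 also have "... \<le> liminf (\<lambda>N :: nat. ennreal (drift C m1 / (1 - \<gamma>)))"
  by (intro Liminf_mono always_eventually allI trunc)
 finally show ?thesis by (simp add: Liminf_const)
qed

end

end

text \<open>Products of closed sets with measurable sets form a generator of the product
  sigma-algebra that is stable under intersection, so uniqueness of measures applies.\<close>

lemma measure_eq_closed_times:
 fixes M N :: "('a::metric_space \<times> 'b) measure"
 assumes M: "prob_space M" "sets M = sets (borel \<Otimes>\<^sub>M L)" and N: "prob_space N" "sets N = sets (borel \<Otimes>\<^sub>M L)"
  and eq: "\<And>E A. closed E \<Longrightarrow> A \<in> sets L \<Longrightarrow> emeasure M (E \<times> A) = emeasure N (E \<times> A)"
 shows "M = N"
proof -
 interpret M: prob_space M by (rule M)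
 define G where "G = {E \<times> A | E A. closed (E :: 'a set) \<and> A \<in> sets L}"
 have sp: "space (borel \<Otimes>\<^sub>M L) = UNIV \<times> space L" by (simp add: space_pair_measure)
 have gen: "sets (borel \<Otimes>\<^sub>M L) = sigma_sets (UNIV \<times> space L) G"
 proof -
  have "sets (borel \<Otimes>\<^sub>M L) = sets (sigma (space (borel :: 'a measure) \<times> space L) {a \<times> b | a b. a \<in> Collect closed \<and> b \<in> sets L})"
   by (rule sets_pair_eq[where Ca="{UNIV}" and Cb="{space L}"])
    (auto simp: borel_eq_closed sets.sigma_sets_eq dest: sets.sets_into_space[THEN subsetD])
  also have "... = sigma_sets (UNIV \<times> space L) G"
   by (subst sets_measure_of) (auto simp: G_def dest: sets.sets_into_space)
  finally show ?thesis .
 qed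
 show ?thesis
 proof (rule measure_eqI_generator_eq[where E=G and \<Omega>="UNIV \<times> space L" and A="\<lambda>_. UNIV \<times> space L"])
  show "Int_stable G"
   unfolding Int_stable_def G_def by (auto simp: Times_Int_Times) (blast intro: closed_Int)
  show "G \<subseteq> Pow (UNIV \<times> space L)" by (auto simp: G_def dest: sets.sets_into_space)
  show "sets M = sigma_sets (UNIV \<times> space L) G" "sets N = sigma_sets (UNIV \<times> space L) G" by (simp_all add: M N gen)
  show "range (\<lambda>_ :: nat. UNIV \<times> space L) \<subseteq> G" by (auto simp: G_def)
  show "emeasure M X = emeasure N X" if "X \<in> G" for X using that eq by (auto simp: G_def)
 qed auto
qed

context noise_model
begin

lemma integral_step_measurable:
 fixes f :: "_ \<Rightarrow> real"
 assumes [measurable]: "f \<in> borel_measurable state_space"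
 shows "(\<lambda>y. \<integral>u. f (step y u) \<partial>gauss) \<in> borel_measurable state_space"
 by measurable

lemma integral_step_eq:
 fixes f :: "_ \<Rightarrow> real"
 assumes \<mu>: "init \<mu>" and f [measurable]: "f \<in> borel_measurable state_space" and f01: "\<And>y. 0 \<le> f y \<and> f y \<le> 1"
  and g [measurable]: "g \<in> measurable state_space state_space"
 shows "(\<integral>y. (\<integral>u. f (step (g y) u) \<partial>gauss) \<partial>\<mu>) = (\<integral>x. f (step (g (fst x)) (snd x)) \<partial>(\<mu> \<Otimes>\<^sub>M gauss))"
proof -
 note [measurable_cong] = initD(2)[OF \<mu>]
 interpret \<mu>: prob_space \<mu> by (rule initD[OF \<mu>])
 interpret pair_prob_space \<mu> "gauss :: (real ^ 'd) measure" ..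
 have "integrable (\<mu> \<Otimes>\<^sub>M gauss) (\<lambda>x. f (step (g (fst x)) (snd x)))"
  using f01 by (intro integrable_const_bound[where B=1]) auto
 from integral_fst'[OF this] show ?thesis by simp
qed

lemma integral_law_Suc:
 fixes f :: "_ \<Rightarrow> real"
 assumes \<mu>: "init \<mu>" and f [measurable]: "f \<in> borel_measurable state_space" and f01: "\<And>y. 0 \<le> f y \<and> f y \<le> 1"
 shows "(\<integral>y. f y \<partial>law \<mu> (Suc n)) = (\<integral>y. (\<integral>u. f (step y u) \<partial>gauss) \<partial>law \<mu> n)"
proof -
 have "(\<integral>y. f y \<partial>law \<mu> (Suc n)) = (\<integral>x. f (step (fst x) (snd x)) \<partial>(law \<mu> n \<Otimes>\<^sub>M gauss))"
  unfolding law_Suc[OF initD(1,2)[OF \<mu>]] by (rule integral_distr) measurable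
 with integral_step_eq[OF init_law[OF \<mu>] f f01, of "\<lambda>y. y" n] show ?thesis by simp
qed

lemma measure_next_noise:
 assumes \<mu>: "init \<mu>" and A [measurable]: "A \<in> sets traj_space"
 shows "measure (\<mu> \<Otimes>\<^sub>M gauss) {x \<in> space (\<mu> \<Otimes>\<^sub>M gauss). snd (step (fst x) (snd x)) \<in> A} = measure Pw A"
proof -
 note [measurable_cong] = initD(2)[OF \<mu>]
 have "measure Pw A = measure (distr (distr (\<mu> \<Otimes>\<^sub>M gauss) (Pw \<Otimes>\<^sub>M gauss) (\<lambda>x. (snd (fst x), snd x))) traj_space
   (\<lambda>x. case_nat (D (fst x) 0 + snd x) (fst x))) A"
  by (simp add: distr_snd_pair[OF \<mu>] invariant_Pw)
 also have "... = measure (distr (\<mu> \<Otimes>\<^sub>M gauss) traj_space (\<lambda>x. snd (step (fst x) (snd x)))) A"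
  by (subst distr_distr) (auto simp: o_def initD(3)[OF \<mu>, symmetric])
 also have "... = measure (\<mu> \<Otimes>\<^sub>M gauss) {x \<in> space (\<mu> \<Otimes>\<^sub>M gauss). snd (step (fst x) (snd x)) \<in> A}"
  by (subst measure_distr) (auto simp: vimage_def Int_def conj_commute)
 finally show ?thesis ..
qed

text \<open>
 The error of replacing \<open>x\<close> by its cell is small uniformly over the initial laws with a tight first
 marginal: \<open>F\<close> is uniformly continuous on compact sets, and the next noise variable has a fixed law.
\<close>

lemma cell_error:
 fixes g :: "real ^ 'd \<Rightarrow> real"
 assumes g: "uniformly_continuous_on UNIV g" "\<And>x. 0 \<le> g x \<and> g x \<le> 1" and A [measurable]: "A \<in> sets traj_space"
  and init: "\<And>k. init (\<nu> k)"
  and tight: "\<And>\<epsilon>. \<epsilon> > 0 \<Longrightarrow> \<exists>K. \<forall>k. measure (\<nu> k) {y. norm (fst y) > K} \<le> \<epsilon>" and \<epsilon>: "\<epsilon> > 0"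
 defines "f \<equiv> \<lambda>y. g (fst y) * indicator A (snd y)"
 shows "\<exists>n0. \<forall>n\<ge>n0. \<forall>k. \<bar>(\<integral>y. (\<integral>u. f (step y u) \<partial>gauss) \<partial>\<nu> k) - (\<integral>y. (\<integral>u. f (step (cell n (fst y), snd y) u) \<partial>gauss) \<partial>\<nu> k)\<bar> \<le> \<epsilon>"
proof -
 have gm [measurable]: "g \<in> borel_measurable borel"
  using uniformly_continuous_imp_continuous[OF g(1)] by (rule borel_measurable_continuous_onI)
 have f [measurable]: "f \<in> borel_measurable state_space" unfolding f_def by measurable
 have f01: "0 \<le> f y \<and> f y \<le> 1" for y using g(2) by (auto simp: f_def split: split_indicator)
 have fn: "\<bar>f y\<bar> \<le> 1" for y using f01[of y] by linarith
 obtain K where K: "\<And>k. measure (\<nu> k) {y. norm (fst y) > K} \<le> \<epsilon> / 3" using tight[of "\<epsilon> / 3"] \<epsilon> by auto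
 obtain R where R: "measure Pw {w. norm (w 0) > R} \<le> \<epsilon> / 3"
 proof -
  define B where "B i = {w :: 'd traj. norm (w 0) > real i}" for i
  have Bs: "B i \<in> sets Pw" for i
  proof -
   have "{w \<in> space (traj_space :: 'd traj measure). norm (w 0) > real i} \<in> sets traj_space" by measurable
   then show ?thesis by (simp add: B_def sets_Pw)
  qed
  interpret Pw: prob_space Pw by (rule prob_Pw)
  have "decseq B" by (auto simp: B_def decseq_def)
  moreover have "(\<Inter>i. B i) = {}"
  proof (rule equals0I)
   fix w assume w: "w \<in> (\<Inter>i. B i)"
   obtain i where "norm (w 0) < real i" using reals_Archimedean2 by blast
   moreover have "w \<in> B i" using w by blast
   ultimately show False by (simp add: B_def)
  qed
  ultimately have "(\<lambda>i. measure Pw (B i)) \<longlonglongrightarrow> 0"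
   using Pw.finite_Lim_measure_decseq[of B] Bs by auto
  from LIMSEQ_D[OF this, of "\<epsilon> / 3"] \<epsilon> obtain i where "measure Pw (B i) < \<epsilon> / 3" by auto
  then show ?thesis by (intro that[of "real i"]) (simp add: B_def)
 qed
 \<comment> \<open>Cells displace points by at most \<open>CARD('d)\<close>, so with the enlarged
   radius a point of the ball and its cell lie in the same compact set.\<close>
 let ?C = "cball (0 :: real ^ 'd) (K + real CARD('d)) \<times> cball (0 :: real ^ 'd) R"
 have "uniformly_continuous_on ?C (\<lambda>x. g (F x))"
 proof (rule compact_uniformly_continuous)
  show "continuous_on ?C (\<lambda>x. g (F x))"
   by (rule continuous_on_compose2[OF uniformly_continuous_imp_continuous[OF g(1)] continuous_on_subset[OF F_continuous]]) auto
  show "compact ?C" by (intro compact_Times compact_cball)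
 qed
 then obtain \<delta> where \<delta>: "\<delta> > 0" "\<And>p q. p \<in> ?C \<Longrightarrow> q \<in> ?C \<Longrightarrow> dist q p < \<delta> \<Longrightarrow> dist (g (F q)) (g (F p)) < \<epsilon> / 3"
  unfolding uniformly_continuous_on_def using \<epsilon> by (metis divide_pos_pos zero_less_numeral)
 have "(\<lambda>n. real CARD('d) / 2 ^ n) \<longlonglongrightarrow> 0" by real_asymp
 from LIMSEQ_D[OF this \<delta>(1)] obtain n0 where n0: "\<And>n. n \<ge> n0 \<Longrightarrow> real CARD('d) / 2 ^ n < \<delta>" by auto
 show ?thesis
 proof (intro exI allI impI)
  fix n k assume n: "n \<ge> n0"
  define \<mu> where "\<mu> = \<nu> k"
  have \<mu>: "init \<mu>" unfolding \<mu>_def by (rule init)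
  note [measurable_cong] = initD(2)[OF \<mu>]
  interpret \<mu>: prob_space \<mu> by (rule initD[OF \<mu>])
  interpret \<mu>g: pair_prob_space \<mu> "gauss :: (real ^ 'd) measure" ..
  have sp\<mu>: "space \<mu> = UNIV" using sets_eq_imp_space_eq[OF initD(2)[OF \<mu>]] by simp
  let ?c = "\<lambda>y :: 'd state. (cell n (fst y), snd y)"
  define B1 where "B1 = {x \<in> space (\<mu> \<Otimes>\<^sub>M (gauss :: (real ^ 'd) measure)). norm (fst (fst x)) > K}"
  \<comment> \<open>An event of the next noise variable, whose law is the same under every
    admissible initial law; its probability is therefore small uniformly in k.\<close>
  define B2 where "B2 = {x \<in> space (\<mu> \<Otimes>\<^sub>M gauss). snd (step (fst x) (snd x)) \<in> {w \<in> space traj_space. norm (w 0) > R}}"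
  have [measurable]: "B1 \<in> sets (\<mu> \<Otimes>\<^sub>M gauss)" unfolding B1_def by measurable
  have [measurable]: "B2 \<in> sets (\<mu> \<Otimes>\<^sub>M gauss)" unfolding B2_def by measurable
  have B1: "measure (\<mu> \<Otimes>\<^sub>M gauss) B1 \<le> \<epsilon> / 3"
  proof -
   have s: "{y \<in> space \<mu>. norm (fst y) > K} \<in> sets \<mu>" by measurable
   have "B1 = {y \<in> space \<mu>. norm (fst y) > K} \<times> space (gauss :: (real ^ 'd) measure)" by (auto simp: B1_def space_pair_measure)
   then have "measure (\<mu> \<Otimes>\<^sub>M gauss) B1 = measure \<mu> {y \<in> space \<mu>. norm (fst y) > K}"
    using s by (simp add: measure_def gauss.emeasure_pair_measure_Times gauss.emeasure_space_1[simplified])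
   then show ?thesis using K[of k] by (simp add: sp\<mu>[unfolded \<mu>_def] \<mu>_def)
  qed
  have B2: "measure (\<mu> \<Otimes>\<^sub>M gauss) B2 \<le> \<epsilon> / 3"
  proof -
   have "{w \<in> space traj_space. norm (w 0 :: real ^ 'd) > R} \<in> sets traj_space" by measurable
   from measure_next_noise[OF \<mu> this] show ?thesis unfolding B2_def using R by simp
  qed
  have bound: "\<bar>f (step (fst x) (snd x)) - f (step (?c (fst x)) (snd x))\<bar> \<le> \<epsilon> / 3 + indicator B1 x + indicator B2 x"
   if "x \<in> space (\<mu> \<Otimes>\<^sub>M gauss)" for x
  proof (cases "x \<in> B1 \<or> x \<in> B2")
   case True
   have "\<bar>f (step (fst x) (snd x)) - f (step (?c (fst x)) (snd x))\<bar> \<le> 1"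
    using f01[of "step (fst x) (snd x)"] f01[of "step (?c (fst x)) (snd x)"] by linarith
   then show ?thesis using True \<epsilon> by (auto split: split_indicator)
  next
   case False
   define z where "z = D (snd (fst x)) 0 + snd x"
   have nx: "norm (fst (fst x)) \<le> K" using False that by (auto simp: B1_def)
   have nz: "norm z \<le> R" using False that by (auto simp: B2_def z_def)
   have c: "norm (fst (fst x) - cell n (fst (fst x))) \<le> real CARD('d) / 2 ^ n" by (rule norm_cell_le)
   also have "... \<le> real CARD('d)" by (simp add: divide_le_eq mult_le_cancel_left1)
   finally have "norm (cell n (fst (fst x))) \<le> K + real CARD('d)"
    using nx norm_triangle_ineq4[of "fst (fst x)" "fst (fst x) - cell n (fst (fst x))"] by simp
   then have "dist (g (F (fst (fst x), z))) (g (F (cell n (fst (fst x)), z))) < \<epsilon> / 3"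
    using nx nz c n0[OF n] by (intro \<delta>(2)) (auto simp: dist_Pair_Pair dist_norm)
   then have "\<bar>g (F (fst (fst x), z)) - g (F (cell n (fst (fst x)), z))\<bar> \<le> \<epsilon> / 3" by (simp add: dist_real_def)
   then show ?thesis using \<epsilon> by (auto simp: f_def z_def left_diff_distrib[symmetric] abs_mult split: split_indicator)
  qed
  have cm [measurable]: "?c \<in> measurable state_space state_space" by measurable
  have I: "integrable (\<mu> \<Otimes>\<^sub>M gauss) (\<lambda>x. f (step (fst x) (snd x)))" "integrable (\<mu> \<Otimes>\<^sub>M gauss) (\<lambda>x. f (step (?c (fst x)) (snd x)))"
   by (intro \<mu>g.integrable_const_bound[where B=1] AE_I2; simp add: fn)+
  have J: "integrable (\<mu> \<Otimes>\<^sub>M gauss) (indicat_real B1)" "integrable (\<mu> \<Otimes>\<^sub>M gauss) (indicat_real B2)"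
   by (intro \<mu>g.integrable_const_bound[where B=1] AE_I2; simp)+
  have "\<bar>(\<integral>y. (\<integral>u. f (step y u) \<partial>gauss) \<partial>\<mu>) - (\<integral>y. (\<integral>u. f (step (?c y) u) \<partial>gauss) \<partial>\<mu>)\<bar>
   = \<bar>\<integral>x. f (step (fst x) (snd x)) - f (step (?c (fst x)) (snd x)) \<partial>(\<mu> \<Otimes>\<^sub>M gauss)\<bar>"
   using integral_step_eq[OF \<mu> f f01, of "\<lambda>y. y"] integral_step_eq[OF \<mu> f f01 cm] I by simp
  also have "... \<le> (\<integral>x. \<bar>f (step (fst x) (snd x)) - f (step (?c (fst x)) (snd x))\<bar> \<partial>(\<mu> \<Otimes>\<^sub>M gauss))"
   by (rule integral_abs_bound)
  also have "... \<le> (\<integral>x. \<epsilon> / 3 + indicator B1 x + indicator B2 x \<partial>(\<mu> \<Otimes>\<^sub>M gauss))"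
   by (intro integral_mono integrable_abs Bochner_Integration.integrable_diff I Bochner_Integration.integrable_add bound)
    (auto simp: J)
  also have "... = \<epsilon> / 3 + measure (\<mu> \<Otimes>\<^sub>M gauss) B1 + measure (\<mu> \<Otimes>\<^sub>M gauss) B2"
  proof -
   have "B1 \<inter> space (\<mu> \<Otimes>\<^sub>M gauss) = B1" "B2 \<inter> space (\<mu> \<Otimes>\<^sub>M gauss) = B2" by (auto simp: B1_def B2_def)
   then show ?thesis by (simp add: J \<mu>g.prob_space)
  qed
  also have "... \<le> \<epsilon>" using B1 B2 by linarith
  finally show "\<bar>(\<integral>y. (\<integral>u. f (step y u) \<partial>gauss) \<partial>\<nu> k) - (\<integral>y. (\<integral>u. f (step (cell n (fst y), snd y) u) \<partial>gauss) \<partial>\<nu> k)\<bar> \<le> \<epsilon>"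
   by (simp add: \<mu>_def)
 qed
qed

end

section \<open>Krylov-Bogoliubov averages and their limit\<close>

context noise_model
begin

theorem ex_invariant_distribution:
 fixes V :: "real ^ 'd \<Rightarrow> real"
 assumes V_measurable [measurable]: "V \<in> borel_measurable borel" and V_nonneg: "\<And>x. V x \<ge> 0"
  and V_step: "\<And>x w. V (F (x, w)) \<le> \<gamma> * V x + C * (1 + norm w)" and \<gamma>: "0 < \<gamma>" "\<gamma> < 1" and C: "C > 0"
  and coercive: "filterlim V at_top at_infinity"
  and m1: "(\<integral>\<^sup>+w. ennreal (norm (D w 0)) \<partial>Pw) \<le> ennreal m1" "m1 \<ge> 0"
 shows "\<exists>\<mu>. invariant_distribution Pw Q \<mu>"
proof -
 interpret Pw: prob_space Pw by (rule prob_Pw)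
 \<comment> \<open>Starting X at 0 gives V a finite initial moment, which the drift then propagates
   to all times.\<close>
 define \<mu>0 where "\<mu>0 = distr Pw state_space (\<lambda>w. (0 :: real ^ 'd, w))"
 have "distr \<mu>0 traj_space snd = Pw"
  unfolding \<mu>0_def by (subst distr_distr) (auto simp: o_def sets_Pw intro: distr_id2)
 then have \<mu>0: "init \<mu>0" by (auto simp: initial_distribution_def \<mu>0_def intro!: Pw.prob_space_distr)
 define N where "N = law \<mu>0"
 have N: "init (N i)" for i unfolding N_def by (rule init_law[OF \<mu>0])
 note N' = initD[OF N]
 interpret N: prob_space "N i" for i by (rule N')
 note [measurable_cong] = N'(2)
 obtain B where B: "B > 0" "\<And>i. (\<integral>\<^sup>+y. ennreal (V (fst y)) \<partial>N i) \<le> ennreal B"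
 proof -
  have "(\<integral>\<^sup>+y. ennreal (V (fst y)) \<partial>\<mu>0) = (\<integral>\<^sup>+w. ennreal (V 0) \<partial>Pw)"
   unfolding \<mu>0_def by (subst nn_integral_distr) auto
  then have v: "(\<integral>\<^sup>+y. ennreal (V (fst y)) \<partial>\<mu>0) \<le> ennreal (V 0)" by (simp add: Pw.emeasure_space_1)
  let ?B = "V 0 + drift C m1 / (1 - \<gamma>)"
  have le: "(\<integral>\<^sup>+y. ennreal (V (fst y)) \<partial>N i) \<le> ennreal ?B" for i
   unfolding N_def
   by (rule nn_integral_V_law_le[OF V_measurable V_nonneg V_step \<gamma> C m1 \<mu>0 v V_nonneg])
  have "?B \<le> max 1 ?B" by simp
  show ?thesis by (rule that[of "max 1 ?B"]) (auto intro: order_trans[OF le ennreal_leI])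
 qed
 have "\<exists>\<nu>. prob_space \<nu> \<and> sets \<nu> = sets state_space \<and> (\<forall>f :: _ \<Rightarrow> real. f \<in> borel_measurable state_space \<longrightarrow> (\<forall>x. 0 \<le> f x \<and> f x \<le> 1) \<longrightarrow>
   (\<integral>x. f x \<partial>\<nu>) = (\<Sum>i\<le>k. \<integral>x. f x \<partial>N i) / real (Suc k))" for k
  using ex_average[of N state_space k, OF N'(1,2)] by metis
 then obtain \<nu> where \<nu>: "\<And>k. prob_space (\<nu> k)" "\<And>k. sets (\<nu> k) = sets state_space"
  and avg: "\<And>k (f :: _ \<Rightarrow> real). f \<in> borel_measurable state_space \<Longrightarrow> (\<And>x. 0 \<le> f x \<and> f x \<le> 1) \<Longrightarrow> (\<integral>x. f x \<partial>\<nu> k) = (\<Sum>i\<le>k. \<integral>x. f x \<partial>N i) / real (Suc k)"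
  by metis
 interpret \<nu>: prob_space "\<nu> k" for k by (rule \<nu>)
 note [measurable_cong] = \<nu>(2)
 have avg_measure: "measure (\<nu> k) A = (\<Sum>i\<le>k. measure (N i) A) / real (Suc k)" if A: "A \<in> sets state_space" for k A
  using avg[of "indicat_real A" k] A \<nu>(2) N'(2) by (auto split: split_indicator)
 have times: "UNIV \<times> A \<in> sets (state_space :: 'd state measure)" if "A \<in> sets traj_space" for A using that by simp
 have marg: "measure M (UNIV \<times> A) = measure (distr M traj_space snd) A"
  if "sets M = sets state_space" and A: "A \<in> sets traj_space" for M :: "'d state measure" and A
 proof -
  note [measurable_cong] = that(1)
  have "space M = UNIV" using sets_eq_imp_space_eq[OF that(1)] by simp
  then have "snd -` A \<inter> space M = UNIV \<times> A" by auto
  then show ?thesis using A by (subst measure_distr) auto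
 qed
 have \<nu>_marg: "measure (\<nu> k) (UNIV \<times> A) = measure Pw A" if A: "A \<in> sets traj_space" for k A
  unfolding avg_measure[OF times[OF A]] by (simp add: marg[OF N'(2) A] N'(3))
 have init_of: "init M" if "prob_space M" and s: "sets M = sets state_space"
  and m: "\<And>A. A \<in> sets traj_space \<Longrightarrow> measure M (UNIV \<times> A) = measure Pw A" for M
 proof -
  note [measurable_cong] = s
  interpret M: prob_space M by fact
  interpret M': prob_space "distr M traj_space snd" by (rule M.prob_space_distr) measurable
  have "distr M traj_space snd = Pw"
  proof (rule measure_eqI)
   fix A assume "A \<in> sets (distr M traj_space snd)"
   then have A: "A \<in> sets traj_space" by simp
   show "emeasure (distr M traj_space snd) A = emeasure Pw A"
    using m[OF A] marg[OF s A] by (simp add: M'.emeasure_eq_measure Pw.emeasure_eq_measure)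
  qed (simp add: sets_Pw)
  then show ?thesis using that by (simp add: initial_distribution_def)
 qed
 have init_\<nu>: "init (\<nu> k)" for k by (rule init_of[OF \<nu> \<nu>_marg])
 have tight: "\<exists>K. \<forall>k. measure (\<nu> k) {y. norm (fst y) > K} \<le> \<epsilon>" if \<epsilon>: "\<epsilon> > 0" for \<epsilon>
 proof -
  obtain K where K: "\<And>x. K \<le> norm x \<Longrightarrow> B / \<epsilon> < V x"
   using coercive[unfolded filterlim_at_top_dense, rule_format, of "B / \<epsilon>"] by (auto simp: eventually_at_infinity)
  let ?E = "{y :: 'd state. norm (fst y) > K}"
  have E [measurable]: "?E \<in> sets state_space"
  proof -
   have "{y \<in> space (state_space :: 'd state measure). norm (fst y) > K} \<in> sets state_space" by measurable
   then show ?thesis by simp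
  qed
  have "measure (N i) ?E \<le> \<epsilon>" for i
  proof -
   have "ennreal (B / \<epsilon> * measure (N i) ?E) = (\<integral>\<^sup>+y. ennreal (B / \<epsilon>) * indicator ?E y \<partial>N i)"
    using B \<epsilon> by (subst nn_integral_cmult_indicator) (auto simp: N.emeasure_eq_measure ennreal_mult[symmetric] N'(2))
   also have "... \<le> (\<integral>\<^sup>+y. ennreal (V (fst y)) \<partial>N i)"
    using K by (intro nn_integral_mono) (auto split: split_indicator intro!: ennreal_leI intro: less_imp_le)
   also have "... \<le> ennreal B" by (rule B)
   finally have "B / \<epsilon> * measure (N i) ?E \<le> B" using B(1) by simp
   then show ?thesis using B(1) \<epsilon> by (simp add: field_simps)
  qed
  then have "(\<Sum>i\<le>k. measure (N i) ?E) \<le> (\<Sum>i\<le>k. \<epsilon>)" for k by (intro sum_mono)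
  then have "measure (\<nu> k) ?E \<le> \<epsilon>" for k by (simp add: avg_measure[OF E] field_simps)
  then show ?thesis by blast
 qed
 show ?thesis
 proof (rule ex_limit_coupling[OF \<nu> \<nu>_marg prob_Pw sets_Pw tight], assumption, assumption)
 fix H M assume H: "H \<noteq> bot" "H \<le> sequentially" and M: "prob_space M" "sets M = sets state_space"
  and lim: "\<And>\<psi> :: _ \<Rightarrow> real. \<psi> \<in> borel_measurable state_space \<Longrightarrow> (\<And>y. 0 \<le> \<psi> y \<and> \<psi> y \<le> 1) \<Longrightarrow> (\<And>w. continuous_on UNIV (\<lambda>x. \<psi> (x, w))) \<Longrightarrow>
   (\<And>\<epsilon>. \<epsilon> > 0 \<Longrightarrow> \<exists>n0. \<forall>n\<ge>n0. \<forall>k. \<bar>(\<integral>y. \<psi> y \<partial>\<nu> k) - (\<integral>y. \<psi> (cell n (fst y), snd y) \<partial>\<nu> k)\<bar> \<le> \<epsilon>) \<Longrightarrow>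
   ((\<lambda>k. \<integral>y. \<psi> y \<partial>\<nu> k) \<longlongrightarrow> (\<integral>y. \<psi> y \<partial>M)) H"
 note [measurable_cong] = M(2)
 \<comment> \<open>The marginal on the noise is constant along the averages, so it passes to the
   limit.\<close>
 have "measure M (UNIV \<times> A) = measure Pw A" if A: "A \<in> sets traj_space" for A
 proof -
  let ?\<psi> = "indicat_real (UNIV \<times> A) :: 'd state \<Rightarrow> real"
  have e1: "?\<psi> (cell n (fst y), snd y) = ?\<psi> y" for n y by (cases y) (auto split: split_indicator)
  have e2: "(\<lambda>x. ?\<psi> (x, w)) = (\<lambda>x. indicator A w)" for w by (auto split: split_indicator)
  have "((\<lambda>k. \<integral>y. ?\<psi> y \<partial>\<nu> k) \<longlongrightarrow> (\<integral>y. ?\<psi> y \<partial>M)) H"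
  proof (rule lim)
   show "?\<psi> \<in> borel_measurable state_space" using times[OF A] by simp
   show "0 \<le> ?\<psi> y \<and> ?\<psi> y \<le> 1" for y by (simp split: split_indicator)
   show "continuous_on UNIV (\<lambda>x. ?\<psi> (x, w))" for w unfolding e2 by simp
   show "\<exists>n0. \<forall>n\<ge>n0. \<forall>k. \<bar>(\<integral>y. ?\<psi> y \<partial>\<nu> k) - (\<integral>y. ?\<psi> (cell n (fst y), snd y) \<partial>\<nu> k)\<bar> \<le> \<epsilon>" if "\<epsilon> > 0" for \<epsilon> :: real
    using that by (simp add: e1)
  qed
  then have "((\<lambda>k. measure Pw A) \<longlongrightarrow> measure M (UNIV \<times> A)) H"
   using times[OF A] by (simp add: \<nu>_marg[OF A] \<nu>(2) M(2))
  then show ?thesis by (rule tendsto_unique[OF H(1)]) (rule tendsto_const)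
 qed
 then have init_M: "init M" by (rule init_of[OF M])
 \<comment> \<open>Invariance is tested on closed sets times measurable sets of pasts. The indicator
   of the closed factor is a limit of the Lipschitz functions \<open>g j\<close>, for which the test
   functions are continuous in x and the limit along H applies.\<close>
 have "law M 1 = M"
 proof (rule measure_eq_closed_times)
  show "prob_space (law M 1)" "prob_space M" by (rule initD[OF init_law[OF init_M]], rule M)
  show "sets (law M 1) = sets (borel \<Otimes>\<^sub>M traj_space)" "sets M = sets (borel \<Otimes>\<^sub>M traj_space)" by (simp_all add: M)
  fix E :: "(real ^ 'd) set" and A :: "'d traj set" assume E: "closed E" and A [measurable]: "A \<in> sets traj_space"
  interpret L: prob_space "law M 1" by (rule initD[OF init_law[OF init_M]])
  interpret M: prob_space M by (rule M)
  show "emeasure (law M 1) (E \<times> A) = emeasure M (E \<times> A)"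
  proof (cases "E = {}")
   case False
   define g where "g j x = max 0 (1 - real j * infdist x E)" for j :: nat and x
   have g01: "0 \<le> g j x \<and> g j x \<le> 1" for j x by (auto simp: g_def infdist_nonneg)
   have gu: "uniformly_continuous_on UNIV (g j)" for j
   proof -
    have "(real j)-lipschitz_on UNIV (g j)"
    proof (rule lipschitz_onI)
     fix x y :: "real ^ 'd"
     have "\<bar>infdist x E - infdist y E\<bar> \<le> dist x y" using infdist_triangle_abs[of x E y] by (simp add: dist_commute)
     then have "real j * \<bar>infdist x E - infdist y E\<bar> \<le> real j * dist x y" by (rule mult_left_mono) simp
     then have "\<bar>real j * infdist x E - real j * infdist y E\<bar> \<le> real j * dist x y" by (simp add: abs_mult right_diff_distrib[symmetric])
     then show "dist (g j x) (g j y) \<le> real j * dist x y" unfolding g_def dist_real_def by linarith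
    qed simp
    then show ?thesis by (rule lipschitz_on_uniformly_continuous)
   qed
   have gm [measurable]: "g j \<in> borel_measurable borel" for j
    using uniformly_continuous_imp_continuous[OF gu] by (rule borel_measurable_continuous_onI)
   define f where "f j y = g j (fst y) * indicat_real A (snd y)" for j and y :: "'d state"
   have fm [measurable]: "f j \<in> borel_measurable state_space" for j unfolding f_def by measurable
   have f01: "0 \<le> f j y \<and> f j y \<le> 1" for j y using g01 by (auto simp: f_def split: split_indicator)
   have fn: "\<bar>f j y\<bar> \<le> 1" for j y using f01[of j y] by linarith
   let ?T = "\<lambda>j y. \<integral>u. f j (step y u) \<partial>gauss"
   have T01: "0 \<le> ?T j y \<and> ?T j y \<le> 1" for j y
   proof
    show "0 \<le> ?T j y" using f01 by (intro integral_nonneg_AE) auto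
    have "y \<in> space state_space" by simp
    then have [measurable]: "(\<lambda>u. f j (step y u)) \<in> borel_measurable gauss" by measurable
    have "?T j y \<le> (\<integral>u. 1 \<partial>(gauss :: (real ^ 'd) measure))"
     using f01 by (intro integral_mono gauss.integrable_const_bound[where B=1] AE_I2) (auto simp: fn)
    then show "?T j y \<le> 1" by (simp add: gauss.prob_space[simplified])
   qed
   have eq: "(\<integral>y. f j y \<partial>law M 1) = (\<integral>y. f j y \<partial>M)" for j
   proof -
    have l1: "((\<lambda>k. \<integral>y. f j y \<partial>\<nu> k) \<longlongrightarrow> (\<integral>y. f j y \<partial>M)) H"
    proof (rule lim[OF fm f01])
     show "continuous_on UNIV (\<lambda>x. f j (x, w))" for w
      unfolding f_def using uniformly_continuous_imp_continuous[OF gu] by (auto intro!: continuous_intros)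
     fix \<epsilon> :: real assume "\<epsilon> > 0"
     then obtain \<delta> where \<delta>: "\<delta> > 0" "\<And>x x'. dist x' x < \<delta> \<Longrightarrow> dist (g j x') (g j x) < \<epsilon>"
      using gu[of j] unfolding uniformly_continuous_on_def by blast
     have "(\<lambda>n. real CARD('d) / 2 ^ n) \<longlonglongrightarrow> 0" by real_asymp
     from LIMSEQ_D[OF this \<delta>(1)] obtain n0 where n0: "\<And>n. n \<ge> n0 \<Longrightarrow> real CARD('d) / 2 ^ n < \<delta>" by auto
     show "\<exists>n0. \<forall>n\<ge>n0. \<forall>k. \<bar>(\<integral>y. f j y \<partial>\<nu> k) - (\<integral>y. f j (cell n (fst y), snd y) \<partial>\<nu> k)\<bar> \<le> \<epsilon>"
     proof (intro exI allI impI)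
      fix n k assume n: "n \<ge> n0"
      have I: "integrable (\<nu> k) (f j)" "integrable (\<nu> k) (\<lambda>y. f j (cell n (fst y), snd y))"
       by (intro \<nu>.integrable_const_bound[where B=1] AE_I2; simp add: fn)+
      have b: "\<bar>f j y - f j (cell n (fst y), snd y)\<bar> \<le> \<epsilon>" for y
      proof -
       have "dist (fst y) (cell n (fst y)) < \<delta>"
        using norm_cell_le[of "fst y" n] n0[OF n] by (simp add: dist_norm)
       from \<delta>(2)[OF this] show ?thesis using \<open>\<epsilon> > 0\<close>
        by (auto simp: f_def dist_real_def split: split_indicator)
      qed
      have "\<bar>(\<integral>y. f j y \<partial>\<nu> k) - (\<integral>y. f j (cell n (fst y), snd y) \<partial>\<nu> k)\<bar> = \<bar>\<integral>y. f j y - f j (cell n (fst y), snd y) \<partial>\<nu> k\<bar>"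
       using I by simp
      also have "... \<le> (\<integral>y. \<bar>f j y - f j (cell n (fst y), snd y)\<bar> \<partial>\<nu> k)" by (rule integral_abs_bound)
      also have "... \<le> (\<integral>y. \<epsilon> \<partial>\<nu> k)"
       using b by (intro integral_mono integrable_abs Bochner_Integration.integrable_diff I) auto
      finally show "\<bar>(\<integral>y. f j y \<partial>\<nu> k) - (\<integral>y. f j (cell n (fst y), snd y) \<partial>\<nu> k)\<bar> \<le> \<epsilon>"
       by (simp add: \<nu>.prob_space)
     qed
    qed
    \<comment> \<open>After one step the test function is still continuous in x, by continuity of F
      and dominated convergence, and its discretisation error is uniform by
      \<open>cell_error\<close>.\<close>
    have l2: "((\<lambda>k. \<integral>y. ?T j y \<partial>\<nu> k) \<longlongrightarrow> (\<integral>y. ?T j y \<partial>M)) H"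
    proof (rule lim[OF integral_step_measurable[OF fm] T01])
     show "continuous_on UNIV (\<lambda>x. ?T j (x, w))" for w
      unfolding continuous_on_sequentially
     proof (intro ballI allI impI, elim conjE)
      fix x :: "real ^ 'd" and xs assume xs: "xs \<longlonglongrightarrow> x"
      have "((\<lambda>i. \<integral>u. f j (step (xs i, w) u) \<partial>gauss) \<longlonglongrightarrow> (\<integral>u. f j (step (x, w) u) \<partial>gauss))"
      proof (rule integral_dominated_convergence[where w="\<lambda>_. 1"])
       have m: "(\<lambda>u. f j (step y u)) \<in> borel_measurable gauss" for y
       proof -
        have "y \<in> space state_space" by simp
        then show ?thesis by measurable
       qed
       show "(\<lambda>u. f j (step (x, w) u)) \<in> borel_measurable gauss" "\<And>i. (\<lambda>u. f j (step (xs i, w) u)) \<in> borel_measurable gauss" by (rule m)+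
       show "AE u in gauss. (\<lambda>i. f j (step (xs i, w) u)) \<longlonglongrightarrow> f j (step (x, w) u)"
       proof (rule AE_I2)
        fix u :: "real ^ 'd"
        have "(\<lambda>i. F (xs i, D w 0 + u)) \<longlonglongrightarrow> F (x, D w 0 + u)"
         using F_continuous xs by (intro continuous_on_tendsto_compose[OF F_continuous] tendsto_intros) auto
        then have "(\<lambda>i. g j (F (xs i, D w 0 + u))) \<longlonglongrightarrow> g j (F (x, D w 0 + u))"
         by (rule continuous_on_tendsto_compose[OF uniformly_continuous_imp_continuous[OF gu]]) auto
        then show "(\<lambda>i. f j (step (xs i, w) u)) \<longlonglongrightarrow> f j (step (x, w) u)"
         unfolding f_def by (auto intro!: tendsto_intros)
       qed
      qed (auto simp: fn)
      then show "((\<lambda>x. ?T j (x, w)) \<circ> xs) \<longlonglongrightarrow> ?T j (x, w)" by (simp add: o_def)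
     qed
     fix \<epsilon> :: real assume "\<epsilon> > 0"
     from cell_error[OF gu[of j] g01 A init_\<nu> tight this]
     show "\<exists>n0. \<forall>n\<ge>n0. \<forall>k. \<bar>(\<integral>y. ?T j y \<partial>\<nu> k) - (\<integral>y. ?T j (cell n (fst y), snd y) \<partial>\<nu> k)\<bar> \<le> \<epsilon>"
      by (simp add: f_def)
    qed
    \<comment> \<open>One transition changes the average by a telescoping sum divided by k + 1,
      hence by at most 1 / (k + 1).\<close>
    have "((\<lambda>k. (\<integral>y. f j y \<partial>\<nu> k) - (\<integral>y. ?T j y \<partial>\<nu> k)) \<longlongrightarrow> 0) H"
    proof (rule tendsto_mono[OF H(2)], rule Lim_null_comparison)
     show "(\<lambda>k. 1 / real (Suc k)) \<longlonglongrightarrow> 0" using LIMSEQ_Suc[OF lim_1_over_n] .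
     show "\<forall>\<^sub>F k in sequentially. norm ((\<integral>y. f j y \<partial>\<nu> k) - (\<integral>y. ?T j y \<partial>\<nu> k)) \<le> 1 / real (Suc k)"
     proof (intro always_eventually allI)
      fix k
      have "(\<integral>y. ?T j y \<partial>\<nu> k) = (\<Sum>i\<le>k. \<integral>y. f j y \<partial>N (Suc i)) / real (Suc k)"
       unfolding avg[OF integral_step_measurable[OF fm] T01] N_def
       by (simp add: integral_law_Suc[OF \<mu>0 fm f01])
      then have "(\<integral>y. f j y \<partial>\<nu> k) - (\<integral>y. ?T j y \<partial>\<nu> k) = (\<Sum>i\<le>k. (\<integral>y. f j y \<partial>N i) - (\<integral>y. f j y \<partial>N (Suc i))) / real (Suc k)"
       unfolding avg[OF fm f01] by (simp only: sum_subtractf diff_divide_distrib)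
      also have "(\<Sum>i\<le>k. (\<integral>y. f j y \<partial>N i) - (\<integral>y. f j y \<partial>N (Suc i))) = (\<integral>y. f j y \<partial>N 0) - (\<integral>y. f j y \<partial>N (Suc k))"
       by (rule sum_telescope)
      finally have e: "(\<integral>y. f j y \<partial>\<nu> k) - (\<integral>y. ?T j y \<partial>\<nu> k) = ((\<integral>y. f j y \<partial>N 0) - (\<integral>y. f j y \<partial>N (Suc k))) / real (Suc k)" .
      have b: "0 \<le> (\<integral>y. f j y \<partial>N i) \<and> (\<integral>y. f j y \<partial>N i) \<le> 1" for i
       using f01 by (intro conjI integral_nonneg_AE N.integral_le_const N.integrable_const_bound[where B=1] AE_I2) (auto simp: fn)
      have "\<bar>(\<integral>y. f j y \<partial>N 0) - (\<integral>y. f j y \<partial>N (Suc k))\<bar> \<le> 1" using b[of 0] b[of "Suc k"] by linarith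
      then show "norm ((\<integral>y. f j y \<partial>\<nu> k) - (\<integral>y. ?T j y \<partial>\<nu> k)) \<le> 1 / real (Suc k)"
       unfolding e by (simp add: divide_right_mono)
     qed
    qed
    moreover have lTf: "((\<lambda>k. (\<integral>y. f j y \<partial>\<nu> k) - (\<integral>y. ?T j y \<partial>\<nu> k)) \<longlongrightarrow> (\<integral>y. f j y \<partial>M) - (\<integral>y. ?T j y \<partial>M)) H"
     by (intro tendsto_diff l1 l2)
    ultimately have "(\<integral>y. f j y \<partial>M) - (\<integral>y. ?T j y \<partial>M) = 0" by (intro tendsto_unique[OF H(1) lTf])
    then show ?thesis using integral_law_Suc[OF init_M fm f01, of 0 j] by (simp add: law_0[OF M])
   qed
   have conv: "(\<lambda>j. \<integral>y. f j y \<partial>M') \<longlonglongrightarrow> measure M' (E \<times> A)"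
    if "prob_space M'" and s: "sets M' = sets state_space" for M'
   proof -
    interpret M': prob_space M' by fact
    note [measurable_cong] = s
    have EA [measurable]: "E \<times> A \<in> sets state_space" using E by (intro pair_measureI) auto
    have "(\<lambda>j. \<integral>y. f j y \<partial>M') \<longlonglongrightarrow> (\<integral>y. indicator (E \<times> A) y \<partial>M')"
    proof (rule integral_dominated_convergence[where w="\<lambda>_. 1"])
     show "AE y in M'. (\<lambda>j. f j y) \<longlonglongrightarrow> indicator (E \<times> A) y"
     proof (rule AE_I2)
      fix y :: "'d state"
      have "(\<lambda>j. g j (fst y)) \<longlonglongrightarrow> indicator E (fst y)"
      proof (cases "fst y \<in> E")
       case True
       then show ?thesis by (simp add: g_def)
      next
       case nE: False
       then have p: "infdist (fst y) E > 0"
        using E False in_closed_iff_infdist_zero[OF E False] infdist_nonneg[of "fst y" E] by (auto simp: less_le)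
       obtain j0 :: nat where j0: "1 / infdist (fst y) E < real j0" using reals_Archimedean2 by blast
       have "g j (fst y) = 0" if "j \<ge> j0" for j
       proof -
        have "1 / infdist (fst y) E < real j" using j0 that by simp
        then show ?thesis using p by (simp add: g_def field_simps)
       qed
       then have "\<forall>\<^sub>F j in sequentially. g j (fst y) = 0" by (auto simp: eventually_sequentially)
       with nE show ?thesis by (simp add: tendsto_eventually)
      qed
      then have "(\<lambda>j. f j y) \<longlonglongrightarrow> indicator E (fst y) * indicator A (snd y)"
       unfolding f_def by (intro tendsto_mult tendsto_const)
      then show "(\<lambda>j. f j y) \<longlonglongrightarrow> indicator (E \<times> A) y" by (simp add: indicator_times)
     qed
    qed (auto simp: fn)
    then show ?thesis using EA s by simp
   qed
   have "measure (law M 1) (E \<times> A) = measure M (E \<times> A)"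
    using LIMSEQ_unique[OF conv[OF M] conv[OF initD(1,2)[OF init_law[OF init_M, of 1]], unfolded eq]] by simp
   then show ?thesis unfolding L.emeasure_eq_measure M.emeasure_eq_measure by (rule arg_cong)
  qed simp
 qed
 moreover have "M \<bind> Q = law M 1" using bind_law[OF init_M, of 0] by (simp add: law_0[OF M])
 ultimately show ?thesis using init_M by (auto simp: invariant_distribution_def)
 qed
qed

end

text \<open>For one Borel set, equality of the integrals over all A gives almost sure equality. A
  countable intersection-stable generator makes one null set sufficient for all Borel sets.\<close>

lemma AE_kernel_eq:
 fixes P K :: "'a \<Rightarrow> 'b::second_countable_topology measure"
 assumes M: "finite_measure M" and P: "P \<in> measurable M (prob_algebra borel)" and K: "K \<in> measurable M (prob_algebra borel)"
  and eq: "\<And>A B. A \<in> sets M \<Longrightarrow> B \<in> sets borel \<Longrightarrow>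
   (\<integral>\<^sup>+y. emeasure (P y) B * indicator A y \<partial>M) = (\<integral>\<^sup>+y. emeasure (K y) B * indicator A y \<partial>M)"
 shows "AE y in M. P y = K y"
proof -
 interpret finite_measure M by (rule M)
 obtain B0 :: "'b set set" where B0: "countable B0" "topological_basis B0" using ex_countable_basis by blast
 \<comment> \<open>Finite intersections of basic open sets. The empty intersection supplies
   \<open>UNIV\<close>, the exhausting set in the uniqueness theorem.\<close>
 define G where "G = Inter ` {F. finite F \<and> F \<subseteq> B0}"
 have G: "countable G" unfolding G_def using B0(1) by (intro countable_image countable_Collect_finite_subset)
 have Gb: "G \<subseteq> sets borel"
 proof
  fix X assume "X \<in> G"
  then obtain F where F: "finite F" "F \<subseteq> B0" "X = \<Inter>F" by (auto simp: G_def)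
  then have "open X" using topological_basis_open[OF B0(2)] by (auto intro!: open_Inter)
  then show "X \<in> sets borel" by simp
 qed
 have B0G: "B0 \<subseteq> G"
 proof
  fix X assume "X \<in> B0"
  then show "X \<in> G" unfolding G_def by (intro image_eqI[of _ _ "{X}"]) auto
 qed
 have gen: "sets borel = sigma_sets UNIV G"
 proof
  have "sets borel = sets (sigma UNIV B0)" by (rule arg_cong[OF borel_eq_countable_basis[OF B0]])
  then have "sets borel = sigma_sets UNIV B0" by simp
  also have "... \<subseteq> sigma_sets UNIV G" using B0G by (rule sigma_sets_mono')
  finally show "sets borel \<subseteq> sigma_sets UNIV G" .
  show "sigma_sets UNIV G \<subseteq> sets borel" using Gb sets.sigma_sets_subset[of G borel] by simp
 qed
 have "AE y in M. emeasure (P y) B = emeasure (K y) B" if "B \<in> G" for B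
 proof (rule density_unique_finite_measure)
  have B: "B \<in> sets borel" using that Gb by blast
  show "(\<lambda>y. emeasure (P y) B) \<in> borel_measurable M" "(\<lambda>y. emeasure (K y) B) \<in> borel_measurable M"
   using B P K by (auto intro: measurable_emeasure_kernel measurable_prob_algebraD)
  show "\<And>A. A \<in> sets M \<Longrightarrow> (\<integral>\<^sup>+y. emeasure (P y) B * indicator A y \<partial>M) = (\<integral>\<^sup>+y. emeasure (K y) B * indicator A y \<partial>M)"
   using eq B by blast
 qed auto
 then have "AE y in M. \<forall>B\<in>G. emeasure (P y) B = emeasure (K y) B" using G by (subst AE_ball_countable) auto
 then show ?thesis using AE_space
 proof eventually_elim
  case (elim y)
  have P': "prob_space (P y)" "sets (P y) = sets borel" and K': "prob_space (K y)" "sets (K y) = sets borel"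
   using measurable_space[OF P elim(2)] measurable_space[OF K elim(2)] by (auto simp: space_prob_algebra)
  interpret Py: prob_space "P y" by (rule P')
  show "P y = K y"
  proof (rule measure_eqI_generator_eq[where E=G and \<Omega>=UNIV and A="\<lambda>_. UNIV"])
   show "Int_stable G"
   proof (rule Int_stableI)
    fix X Y assume "X \<in> G" "Y \<in> G"
    then obtain F F' where "finite F" "F \<subseteq> B0" "X = \<Inter>F" "finite F'" "F' \<subseteq> B0" "Y = \<Inter>F'" by (auto simp: G_def)
    then show "X \<inter> Y \<in> G" unfolding G_def by (intro image_eqI[of _ _ "F \<union> F'"]) auto
   qed
   show "range (\<lambda>_ :: nat. UNIV) \<subseteq> G" unfolding G_def by (auto intro: image_eqI[of _ _ "{}"])
   show "emeasure (P y) X = emeasure (K y) X" if "X \<in> G" for X using elim(1) that by blast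
  qed (auto simp: P' K' gen)
 qed
qed

text \<open>Telescoping of x^(-q): each decrement is at least the absolute derivative at the right
  end point, obtained from ln t \<le> t - 1 and 1 + t \<le> exp t.\<close>

lemma sum_tail_powr_le:
 fixes q :: real
 assumes q: "q > 0"
 shows "(\<Sum>j<n. (real (m + j) + 2) powr (- q - 1)) \<le> (real m + 1) powr (- q) / q"
proof -
 have step: "q * (x + 1) powr (- q - 1) \<le> x powr (- q) - (x + 1) powr (- q)" if "x > 0" for x :: real
 proof -
  have "ln (x / (x + 1)) \<le> x / (x + 1) - 1" using that by (intro ln_le_minus_one) auto
  also have "x / (x + 1) - 1 = - 1 / (x + 1)" using that by (simp add: field_simps)
  finally have l: "ln x - ln (x + 1) \<le> - 1 / (x + 1)" using that by (simp add: ln_div)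
  have "(x + 1) powr (- q) * (1 + q / (x + 1)) \<le> (x + 1) powr (- q) * exp (q / (x + 1))"
   by (intro mult_left_mono exp_ge_add_one_self) auto
  also have "... = exp (- q * ln (x + 1) + q / (x + 1))" using that by (simp add: powr_def flip: exp_add)
  also have "... \<le> exp (- q * ln x)"
  proof (subst exp_le_cancel_iff)
   have "q * (ln x - ln (x + 1)) \<le> q * (- 1 / (x + 1))" using q by (intro mult_left_mono l) auto
   then show "- q * ln (x + 1) + q / (x + 1) \<le> - q * ln x" by (simp add: algebra_simps)
  qed
  also have "... = x powr (- q)" using that by (simp add: powr_def)
  finally have "(x + 1) powr (- q) + q * ((x + 1) powr (- q) / (x + 1)) \<le> x powr (- q)" by (simp add: distrib_left mult.commute)
  moreover have "(x + 1) powr (- q) / (x + 1) = (x + 1) powr (- q - 1)" using that by (simp add: powr_diff)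
  ultimately show ?thesis by simp
 qed
 have "q * (\<Sum>j<n. (real (m + j) + 2) powr (- q - 1)) \<le> (real m + 1) powr (- q) - (real (m + n) + 1) powr (- q)"
 proof (induction n)
  case (Suc n)
  have "q * (real (m + n) + 2) powr (- q - 1) \<le> (real (m + n) + 1) powr (- q) - (real (m + Suc n) + 1) powr (- q)"
   using step[of "real (m + n) + 1"] by (simp add: add.commute add.left_commute)
  with Suc.IH show ?case by (simp add: distrib_left)
 qed simp
 also have "... \<le> (real m + 1) powr (- q)" by simp
 finally show ?thesis using q by (simp add: field_simps)
qed

section \<open>From the Gaussian noise to the abstract model\<close>

context gaussian_noise
begin

text \<open>Everything is read off the joint law of the past and the next innovation, which is a
  product. It shows that the explicit Gaussian kernel is a version of the conditional law, so the
  given kernel equals it for almost every past.\<close>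

lemma ex_noise_model:
 fixes F :: "(real ^ 'd) \<times> (real ^ 'd) \<Rightarrow> real ^ 'd"
 assumes F: "continuous_on UNIV F" and P: "noise_kernel \<Omega> \<Delta> P"
 obtains D where "noise_model F a (past_law \<Omega> \<Delta>) P D"
  "\<And>m s. (\<And>n. (\<Sum>j<n. (a (Suc (m + j)))\<^sup>2) \<le> s\<^sup>2) \<Longrightarrow> s > 0 \<Longrightarrow>
    (\<integral>\<^sup>+w. ennreal (norm (D w m)) \<partial>past_law \<Omega> \<Delta>) \<le> ennreal ((1 + 8 * real CARD('d)) * s)"
proof -
 obtain D where D: "D \<in> measurable traj_space traj_space"
  and D_eq: "\<And>n. AE x in \<Omega>. \<forall>m. D (past \<Delta> n x) m = \<Delta> (n + int m + 1) x - (\<Sum>k\<le>m. a k *\<^sub>R \<xi> (n + int m + 1 - int k) x)"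
  and law: "\<And>n. distr \<Omega> traj_space (past \<Delta> n) = past_law \<Omega> \<Delta>"
  and joint: "distr \<Omega> (traj_space \<Otimes>\<^sub>M borel) (\<lambda>x. (past \<Delta> 0 x, \<xi> 1 x)) = past_law \<Omega> \<Delta> \<Otimes>\<^sub>M gauss"
  and mom: "\<And>m s. (\<And>n. (\<Sum>j<n. (a (Suc (m + j)))\<^sup>2) \<le> s\<^sup>2) \<Longrightarrow> s > 0 \<Longrightarrow>
    (\<integral>\<^sup>+w. ennreal (norm (D w m)) \<partial>past_law \<Omega> \<Delta>) \<le> ennreal ((1 + 8 * real CARD('d)) * s)"
  by (rule ex_memory_functional) blast
 let ?Pw = "past_law \<Omega> \<Delta>"
 have Dm [measurable (raw)]: "(\<lambda>x. D (f x)) \<in> measurable M traj_space" if "f \<in> measurable M traj_space" for f and M :: "'q measure"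
  using that by (rule measurable_compose[OF _ D])
 have Dc [measurable (raw)]: "(\<lambda>x. D (f x) m) \<in> borel_measurable M" if "f \<in> measurable M traj_space" for f m and M :: "'q measure"
  using Dm[OF that] by (rule measurable_compose) measurable
 have pm [measurable]: "past \<Delta> n \<in> measurable \<Omega> traj_space" for n by (rule past_measurable[OF \<Delta>_measurable])
 have pj [measurable]: "(\<lambda>x. (past \<Delta> 0 x, \<xi> 1 x)) \<in> measurable \<Omega> (traj_space \<Otimes>\<^sub>M borel)" by measurable
 have sPw [measurable_cong]: "sets ?Pw = sets traj_space" by (simp add: past_law_def)
 have pPw: "prob_space ?Pw" unfolding past_law_def by (rule prob_space_distr) measurable
 interpret Pw: prob_space ?Pw by (rule pPw)
 \<comment> \<open>The memory formula with m = 0, where only the innovation with coefficient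
   \<open>a 0\<close> has been removed.\<close>
 have next0: "AE x in \<Omega>. \<Delta> 1 x = D (past \<Delta> 0 x) 0 + \<xi> 1 x"
  using D_eq[of 0] by eventually_elim (auto dest!: spec[of _ 0] simp: a_0)
 have P_meas: "P \<in> measurable traj_space (prob_algebra borel)"
  and P_law: "\<And>A B. A \<in> sets traj_space \<Longrightarrow> B \<in> sets borel \<Longrightarrow>
   emeasure \<Omega> {v\<in>space \<Omega>. past \<Delta> 0 v \<in> A \<and> \<Delta> 1 v \<in> B} = (\<integral>\<^sup>+ y\<in>A. emeasure (P y) B \<partial>?Pw)"
  using P[unfolded noise_kernel_def cond_law_def, rule_format, of 0] by (auto simp: past_law_def)
 have "noise_model F a ?Pw P D"
 proof (intro noise_model.intro memory_dynamics.intro noise_model_axioms.intro F a_0 pPw sPw P_meas D)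
  let ?g = "\<lambda>x. case_nat (D (fst x) 0 + snd x) (fst x)"
  have gm: "?g \<in> measurable (traj_space \<Otimes>\<^sub>M borel) traj_space" by measurable
  have "distr (?Pw \<Otimes>\<^sub>M gauss) traj_space ?g = distr \<Omega> traj_space (\<lambda>x. case_nat (D (past \<Delta> 0 x) 0 + \<xi> 1 x) (past \<Delta> 0 x))"
   unfolding joint[symmetric] by (subst distr_distr[OF gm pj]) (simp add: o_def)
  also have "... = distr \<Omega> traj_space (past \<Delta> (0 + 1))"
  proof (rule distr_cong_AE)
   show "AE x in \<Omega>. case_nat (D (past \<Delta> 0 x) 0 + \<xi> 1 x) (past \<Delta> 0 x) = past \<Delta> (0 + 1) x"
    using next0 unfolding past_Suc by eventually_elim simp
  qed auto
  finally show "distr (?Pw \<Otimes>\<^sub>M gauss) traj_space ?g = ?Pw" by (simp only: law)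
 next
  have "AE x in \<Omega>. \<forall>m. D (case_nat (D (past \<Delta> 0 x) 0 + \<xi> 1 x) (past \<Delta> 0 x)) m = D (past \<Delta> 0 x) (Suc m) + a (Suc m) *\<^sub>R \<xi> 1 x"
   using D_eq[of 0] D_eq[of 1] next0
  proof eventually_elim
   case (elim x)
   show ?case
   proof
    fix m
    have "case_nat (D (past \<Delta> 0 x) 0 + \<xi> 1 x) (past \<Delta> 0 x) = past \<Delta> 1 x"
     using past_Suc[of \<Delta> 0 x] elim(3) by simp
    then have "D (case_nat (D (past \<Delta> 0 x) 0 + \<xi> 1 x) (past \<Delta> 0 x)) m
     = \<Delta> (1 + int m + 1) x - (\<Sum>k\<le>m. a k *\<^sub>R \<xi> (1 + int m + 1 - int k) x)"
     using elim(2) by simp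
    also have "... = D (past \<Delta> 0 x) (Suc m) + a (Suc m) *\<^sub>R \<xi> 1 x"
     using elim(1)[rule_format, of "Suc m"] by (simp add: algebra_simps)
    finally show "D (case_nat (D (past \<Delta> 0 x) 0 + \<xi> 1 x) (past \<Delta> 0 x)) m = D (past \<Delta> 0 x) (Suc m) + a (Suc m) *\<^sub>R \<xi> 1 x" .
   qed
  qed
  moreover have "{x \<in> space (traj_space \<Otimes>\<^sub>M borel). \<forall>m. D (case_nat (D (fst x) 0 + snd x) (fst x)) m = D (fst x) (Suc m) + a (Suc m) *\<^sub>R snd x}
    \<in> sets (traj_space \<Otimes>\<^sub>M (borel :: (real ^ 'd) measure))" by measurable
  ultimately show "AE x in ?Pw \<Otimes>\<^sub>M gauss. \<forall>m. D (case_nat (D (fst x) 0 + snd x) (fst x)) m = D (fst x) (Suc m) + a (Suc m) *\<^sub>R snd x"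
   unfolding joint[symmetric] by (subst AE_distr_iff[OF pj]) simp_all
 next
  let ?K = "\<lambda>w. distr gauss borel (\<lambda>u. D w 0 + u)"
  show "AE w in ?Pw. P w = ?K w"
  proof (rule AE_kernel_eq)
   show "finite_measure ?Pw" by (rule Pw.finite_measure_axioms)
   show "P \<in> measurable ?Pw (prob_algebra borel)" using P_meas by measurable
   show "?K \<in> measurable ?Pw (prob_algebra borel)"
   proof (rule measurable_distr_prob_space2[where M=gauss])
    show "(\<lambda>_. gauss) \<in> measurable ?Pw (prob_algebra (gauss :: (real ^ 'd) measure))"
     by (rule measurable_const) (simp add: space_prob_algebra prob_space_gauss)
    show "(\<lambda>(w, u). D w 0 + u) \<in> measurable (?Pw \<Otimes>\<^sub>M gauss) borel" unfolding split_beta' by measurable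
   qed
   fix A :: "'d traj set" and B :: "(real ^ 'd) set" assume "A \<in> sets ?Pw" and B [measurable]: "B \<in> sets borel"
   then have A [measurable]: "A \<in> sets traj_space" by (simp add: sPw)
   have "(\<integral>\<^sup>+ y\<in>A. emeasure (P y) B \<partial>?Pw) = emeasure \<Omega> {v\<in>space \<Omega>. past \<Delta> 0 v \<in> A \<and> \<Delta> 1 v \<in> B}"
    by (rule P_law[OF A B, symmetric])
   also have "... = emeasure \<Omega> {v\<in>space \<Omega>. past \<Delta> 0 v \<in> A \<and> D (past \<Delta> 0 v) 0 + \<xi> 1 v \<in> B}"
   proof (rule emeasure_eq_AE)
    show "AE v in \<Omega>. v \<in> {v\<in>space \<Omega>. past \<Delta> 0 v \<in> A \<and> \<Delta> 1 v \<in> B} \<longleftrightarrow> v \<in> {v\<in>space \<Omega>. past \<Delta> 0 v \<in> A \<and> D (past \<Delta> 0 v) 0 + \<xi> 1 v \<in> B}"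
     using next0 by eventually_elim auto
   qed measurable
   also have "... = (\<integral>\<^sup>+v. indicator A (past \<Delta> 0 v) * indicator B (D (past \<Delta> 0 v) 0 + \<xi> 1 v) \<partial>\<Omega>)"
   proof -
    let ?S = "{v\<in>space \<Omega>. past \<Delta> 0 v \<in> A \<and> D (past \<Delta> 0 v) 0 + \<xi> 1 v \<in> B}"
    have "?S \<in> sets \<Omega>" by measurable
    then have "emeasure \<Omega> ?S = (\<integral>\<^sup>+v. indicator ?S v \<partial>\<Omega>)" by simp
    also have "... = (\<integral>\<^sup>+v. indicator A (past \<Delta> 0 v) * indicator B (D (past \<Delta> 0 v) 0 + \<xi> 1 v) \<partial>\<Omega>)"
     by (intro nn_integral_cong) (auto split: split_indicator)
    finally show ?thesis .
   qed
   also have "... = (\<integral>\<^sup>+x. indicator A (fst x) * indicator B (D (fst x) 0 + snd x) \<partial>distr \<Omega> (traj_space \<Otimes>\<^sub>M borel) (\<lambda>x. (past \<Delta> 0 x, \<xi> 1 x)))"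
    by (subst nn_integral_distr[OF pj]) auto
   also have "... = (\<integral>\<^sup>+w. \<integral>\<^sup>+u. indicator A w * indicator B (D w 0 + u) \<partial>gauss \<partial>?Pw)"
    unfolding joint by (subst gauss.nn_integral_fst[symmetric]) auto
   also have "... = (\<integral>\<^sup>+w\<in>A. emeasure (?K w) B \<partial>?Pw)"
   proof (rule nn_integral_cong)
    fix w
    have m: "(\<lambda>u. D w 0 + u) \<in> measurable gauss borel" by measurable
    have "emeasure (?K w) B = (\<integral>\<^sup>+u. indicator B u \<partial>?K w)" by simp
    also have "... = (\<integral>\<^sup>+u. indicator B (D w 0 + u) \<partial>gauss)" by (subst nn_integral_distr[OF m]) auto
    finally show "(\<integral>\<^sup>+u. indicator A w * indicator B (D w 0 + u) \<partial>gauss) = emeasure (?K w) B * indicator A w"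
     by (auto split: split_indicator)
   qed
   finally show "(\<integral>\<^sup>+y. emeasure (P y) B * indicator A y \<partial>?Pw) = (\<integral>\<^sup>+y. emeasure (?K y) B * indicator A y \<partial>?Pw)" .
  qed
 qed
 from that[OF this mom] show ?thesis by blast
qed

end

context noise_model
begin

lemma nn_integral_V_invariant_finite:
 assumes H1: "H1 F V" and M: "(\<integral>\<^sup>+w. ennreal (norm (D w 0)) \<partial>Pw) \<le> ennreal M" and inv: "invariant_distribution Pw Q \<mu>"
 shows "(\<integral>\<^sup>+y. ennreal (V (fst y)) \<partial>\<mu>) < \<infinity>"
proof -
 have cont: "continuous_on UNIV V" and pos: "\<And>x. V x > 0" using H1 by (auto simp: H1_def)
 obtain \<gamma> C where \<gamma>: "0 < \<gamma>" "\<gamma> < 1" and C: "C > 0" and step: "\<And>x w. V (F (x, w)) \<le> \<gamma> * V x + C * (1 + norm w)"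
  using H1 by (auto simp: H1_def)
 have M': "(\<integral>\<^sup>+w. ennreal (norm (D w 0)) \<partial>Pw) \<le> ennreal (max 0 M)" by (rule order_trans[OF M]) (simp add: ennreal_leI)
 from nn_integral_V_invariant[OF borel_measurable_continuous_onI[OF cont] less_imp_le[OF pos] step \<gamma> C M' _ inv]
 show ?thesis by (auto intro: le_less_trans)
qed

text \<open>Triangle inequality through the reference started at X = 0: both laws converge to it at
  the same rate, and the path law of an invariant distribution is unchanged by the shift.\<close>

lemma convergence_to_invariant:
 assumes H1: "H1 F V" and H2: "H2 F"
  and Ca: "Ca > 0" "\<And>k. \<bar>a k\<bar> \<le> Ca * (real k + 1) powr (- \<rho>)"
  and Cb: "Cb > 0" "\<And>k. \<bar>inverse_coeffs a k\<bar> \<le> Cb * (real k + 1) powr (- \<beta>)"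
  and \<beta>: "\<beta> > 1/2" and \<alpha>: "max (1/2) (3/2 - \<beta>) < \<alpha>" "\<alpha> < \<rho>" and p: "0 < p"
   "p < min 1 (2 * (\<rho> - \<alpha>)) * (min (min \<alpha> \<beta>) (\<alpha> + \<beta> - 1) - 1/2)"
  and MD: "\<And>m. (\<integral>\<^sup>+w. ennreal (norm (D w m)) \<partial>Pw) \<le> ennreal (MD * real (Suc m) powr (- (\<rho> - 1/2)))" "MD \<ge> 0"
  and inv: "invariant_distribution Pw Q \<mu>" and \<nu>: "init \<nu>" and V\<nu>: "(\<integral>\<^sup>+y. ennreal (V (fst y)) \<partial>\<nu>) < \<infinity>"
 shows "\<exists>C>0. \<forall>n\<ge>1. \<forall>A\<in>sets traj_space.
  \<bar>measure (shifted_path_law Q \<nu> n) A - measure (path_law Q \<mu>) A\<bar> \<le> C * real n powr (- p)"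
proof -
 have cont: "continuous_on UNIV V" using H1 by (simp add: H1_def)
 then have Vm [measurable]: "V \<in> borel_measurable borel" by (rule borel_measurable_continuous_onI)
 have V\<mu>: "(\<integral>\<^sup>+y. ennreal (V (fst y)) \<partial>\<mu>) < \<infinity>" by (rule nn_integral_V_invariant_finite[OF H1 MD(1)[of 0] inv])
 note \<mu> = invariant_law(1)[OF inv]
 have *: "\<exists>C>0. \<forall>n\<ge>1. \<forall>A\<in>sets traj_space.
   \<bar>measure (shifted_path_law Q \<nu> n) A - (\<integral>D'. path_prob A n (0, D') \<partial>distr Pw traj_space D)\<bar> \<le> C * real n powr (- p)"
  if \<nu>: "init \<nu>" and V\<nu>: "(\<integral>\<^sup>+y. ennreal (V (fst y)) \<partial>\<nu>) < \<infinity>" for \<nu>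
 proof -
  have "\<exists>C>0. \<forall>n\<ge>1. \<forall>A\<in>sets traj_space.
   \<bar>(\<integral>z. path_prob A n z \<partial>memory_law \<nu>) - (\<integral>D'. path_prob A n (0, D') \<partial>distr Pw traj_space D)\<bar> \<le> C * real n powr (- p)"
   by (rule memory_convergence[OF H1 H2 Ca Cb \<beta> \<alpha> p MD(1)[folded nn_integral_norm_memory] MD(2) initial_memory_law[OF \<nu>]])
    (use V\<nu> nn_integral_memory_law_fst[OF \<nu>, of "\<lambda>x. ennreal (V x)"] in simp)
  then show ?thesis by (simp add: measure_shifted_path_law[OF \<nu>])
 qed
 obtain C1 where C1: "C1 > 0" "\<And>n A. n \<ge> 1 \<Longrightarrow> A \<in> sets traj_space \<Longrightarrow>
   \<bar>measure (shifted_path_law Q \<nu> n) A - (\<integral>D'. path_prob A n (0, D') \<partial>distr Pw traj_space D)\<bar> \<le> C1 * real n powr (- p)"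
  using *[OF \<nu> V\<nu>] by blast
 obtain C2 where C2: "C2 > 0" "\<And>n A. n \<ge> 1 \<Longrightarrow> A \<in> sets traj_space \<Longrightarrow>
   \<bar>measure (shifted_path_law Q \<mu> n) A - (\<integral>D'. path_prob A n (0, D') \<partial>distr Pw traj_space D)\<bar> \<le> C2 * real n powr (- p)"
  using *[OF \<mu> V\<mu>] by blast
 show ?thesis
 proof (intro exI[of _ "C1 + C2"] conjI allI impI ballI)
  fix n :: nat and A :: "'d traj set" assume "n \<ge> 1" "A \<in> sets traj_space"
  from C1(2)[OF this] C2(2)[OF this]
  show "\<bar>measure (shifted_path_law Q \<nu> n) A - measure (path_law Q \<mu>) A\<bar> \<le> (C1 + C2) * real n powr (- p)"
   unfolding shifted_path_law_invariant[OF inv] distrib_right by linarith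
 qed (use C1 C2 in simp)
qed

text \<open>The distance between the path laws of two invariant distributions does not depend on n
  and tends to 0. The bound \<rho> + \<beta> > 3/2 makes the interval of admissible \<alpha>
  nonempty, and V is integrable under every invariant distribution.\<close>

lemma unique_invariantI:
 assumes H1: "H1 F V" and H2: "H2 F"
  and Ca: "Ca > 0" "\<And>k. \<bar>a k\<bar> \<le> Ca * (real k + 1) powr (- \<rho>)"
  and Cb: "Cb > 0" "\<And>k. \<bar>inverse_coeffs a k\<bar> \<le> Cb * (real k + 1) powr (- \<beta>)"
  and \<beta>: "\<beta> > 1/2" and \<rho>: "\<rho> > 1/2" "\<rho> + \<beta> > 3/2"
  and MD: "\<And>m. (\<integral>\<^sup>+w. ennreal (norm (D w m)) \<partial>Pw) \<le> ennreal (MD * real (Suc m) powr (- (\<rho> - 1/2)))" "MD \<ge> 0"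
 shows "unique_invariant Pw Q"
 unfolding unique_invariant_def
proof (intro allI impI)
 fix \<mu> \<nu> assume inv: "invariant_distribution Pw Q \<mu>" "invariant_distribution Pw Q \<nu>"
 note \<mu> = invariant_law(1)[OF inv(1)] and \<nu> = invariant_law(1)[OF inv(2)]
 have V\<nu>: "(\<integral>\<^sup>+y. ennreal (V (fst y)) \<partial>\<nu>) < \<infinity>" by (rule nn_integral_V_invariant_finite[OF H1 MD(1)[of 0] inv(2)])
 obtain \<alpha> where \<alpha>: "max (1/2) (3/2 - \<beta>) < \<alpha>" "\<alpha> < \<rho>" using dense[of "max (1/2) (3/2 - \<beta>)" \<rho>] \<rho> by auto
 have "0 < min 1 (2 * (\<rho> - \<alpha>)) * (min (min \<alpha> \<beta>) (\<alpha> + \<beta> - 1) - 1/2)"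
  using \<alpha> \<beta> by (intro mult_pos_pos) auto
 then obtain p where p: "0 < p" "p < min 1 (2 * (\<rho> - \<alpha>)) * (min (min \<alpha> \<beta>) (\<alpha> + \<beta> - 1) - 1/2)" using dense by blast
 obtain C where C: "C > 0" "\<And>n A. n \<ge> 1 \<Longrightarrow> A \<in> sets traj_space \<Longrightarrow>
   \<bar>measure (shifted_path_law Q \<nu> n) A - measure (path_law Q \<mu>) A\<bar> \<le> C * real n powr (- p)"
  using convergence_to_invariant[OF H1 H2 Ca Cb \<beta> \<alpha> p MD inv(1) \<nu> V\<nu>] by blast
 have lim: "(\<lambda>n. C * real n powr (- p)) \<longlonglongrightarrow> C * 0"
  by (intro tendsto_mult tendsto_const tendsto_neg_powr[OF _ filterlim_real_sequentially]) (use p in simp)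
 have pr: "prob_space (path_law Q \<mu>)" if "init \<mu>" for \<mu>
 proof -
  note [measurable_cong] = initD(2)[OF that]
  interpret \<mu>: prob_space \<mu> by (rule initD[OF that])
  interpret pair_prob_space \<mu> "noise :: 'd traj measure" ..
  show ?thesis unfolding path_law_eq[OF that] by (intro prob_space_distr measurable_trajI) measurable
 qed
 interpret P\<mu>: prob_space "path_law Q \<mu>" by (rule pr[OF \<mu>])
 interpret P\<nu>: prob_space "path_law Q \<nu>" by (rule pr[OF \<nu>])
 show "path_law Q \<mu> = path_law Q \<nu>"
 proof (rule measure_eqI)
  show "sets (path_law Q \<mu>) = sets (path_law Q \<nu>)" by (simp add: path_law_def)
  fix A assume "A \<in> sets (path_law Q \<mu>)"
  then have A: "A \<in> sets traj_space" by (simp add: path_law_def)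
  have "\<bar>measure (path_law Q \<nu>) A - measure (path_law Q \<mu>) A\<bar> \<le> C * 0"
  proof (rule tendsto_lowerbound[OF lim])
   show "\<forall>\<^sub>F n in sequentially. \<bar>measure (path_law Q \<nu>) A - measure (path_law Q \<mu>) A\<bar> \<le> C * real n powr (- p)"
    using eventually_ge_at_top[of 1]
    by eventually_elim (use C(2)[OF _ A] in \<open>simp add: shifted_path_law_invariant[OF inv(2)]\<close>)
  qed simp
  then show "emeasure (path_law Q \<mu>) A = emeasure (path_law Q \<nu>) A"
   by (simp add: P\<mu>.emeasure_eq_measure P\<nu>.emeasure_eq_measure)
 qed
qed

end

section \<open>Total variation bounds in the polynomial and exponential regimes\<close>

lemma tv_dist_le:
 assumes "\<And>A. A \<in> sets \<mu> \<Longrightarrow> \<bar>measure \<mu> A - measure \<nu> A\<bar> \<le> c"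
 shows "tv_dist \<mu> \<nu> \<le> c"
 unfolding tv_dist_def using assms by (intro cSUP_least) auto

lemma exp_le_powr:
 fixes l r :: real
 assumes "l > 0"
 obtains C where "C > 0" "\<And>k :: nat. exp (- l * real k) \<le> C * (real k + 1) powr (- r)"
proof -
 have "(\<lambda>k :: nat. exp (- l * real k) * (real k + 1) powr r) \<longlonglongrightarrow> 0" using assms by real_asymp
 then have "Bseq (\<lambda>k :: nat. exp (- l * real k) * (real k + 1) powr r)" by (intro convergent_imp_Bseq convergentI)
 then obtain C where C: "C > 0" "\<And>k :: nat. norm (exp (- l * real k) * (real k + 1) powr r) \<le> C" by (auto elim: BseqE)
 show ?thesis
 proof (rule that[OF C(1)])
  fix k :: nat
  have "exp (- l * real k) = exp (- l * real k) * (real k + 1) powr r * (real k + 1) powr (- r)"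
   by (simp add: mult.assoc powr_add[symmetric])
  also have "... \<le> C * (real k + 1) powr (- r)" using C(2)[of k] by (intro mult_right_mono) (auto simp: abs_mult)
  finally show "exp (- l * real k) \<le> C * (real k + 1) powr (- r)" .
 qed
qed

theorem theorem2p1:
  fixes F :: "(real ^ 'd) \<times> (real ^ 'd) \<Rightarrow> real ^ 'd"
    and V :: "real ^ 'd \<Rightarrow> real"
    and \<Omega> :: "'w measure"
    and a :: "nat \<Rightarrow> real"
    and \<xi> \<Delta> :: "int \<Rightarrow> 'w \<Rightarrow> real ^ 'd"
    and P :: "(nat \<Rightarrow> real ^ 'd) \<Rightarrow> (real ^ 'd) measure"
  assumes F_continuous: "continuous_on UNIV F"
    and H1: "H1 F V"
    and H2: "H2 F"
    and noise: "gaussian_noise \<Omega> a \<xi> \<Delta>"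
    and kernel: "noise_kernel \<Omega> \<Delta> P"
  defines "Pw \<equiv> past_law \<Omega> \<Delta>"
    and "Q \<equiv> transition_kernel F P"
  shows
    "(\<exists>\<mu>. invariant_distribution Pw Q \<mu>) \<and>
     (\<forall>\<rho> \<beta>. H_poly a \<rho> \<beta> \<and> \<rho> + \<beta> > 3/2 \<longrightarrow>
        unique_invariant Pw Q \<and>
        (\<forall>\<mu>star \<mu>0. invariant_distribution Pw Q \<mu>star \<longrightarrow>
           initial_distribution Pw \<mu>0 \<longrightarrow>
           (\<integral>\<^sup>+ x. ennreal (V x) \<partial>distr \<mu>0 borel fst) < \<infinity> \<longrightarrow>
           (\<forall>\<epsilon>>0. \<exists>C>0. \<forall>n\<ge>1.
              tv_dist (shifted_path_law Q \<mu>0 n) (path_law Q \<mu>star)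
                \<le> C * real n powr (- (rate \<beta> \<rho> - \<epsilon>))))) \<and>
     (H_exp a \<longrightarrow>
        unique_invariant Pw Q \<and>
        (\<forall>\<mu>star \<mu>0. invariant_distribution Pw Q \<mu>star \<longrightarrow>
           initial_distribution Pw \<mu>0 \<longrightarrow>
           (\<integral>\<^sup>+ x. ennreal (V x) \<partial>distr \<mu>0 borel fst) < \<infinity> \<longrightarrow>
           (\<forall>p>0. \<exists>C>0. \<forall>n\<ge>1.
              tv_dist (shifted_path_law Q \<mu>0 n) (path_law Q \<mu>star)
                \<le> C * real n powr (- p))))"
proof -
 interpret gaussian_noise \<Omega> a \<xi> \<Delta> by (rule noise)
 obtain D where model: "noise_model F a Pw P D"
  and mom: "\<And>m s. (\<And>n. (\<Sum>j<n. (a (Suc (m + j)))\<^sup>2) \<le> s\<^sup>2) \<Longrightarrow> s > 0 \<Longrightarrow>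
    (\<integral>\<^sup>+w. ennreal (norm (D w m)) \<partial>Pw) \<le> ennreal ((1 + 8 * real CARD('d)) * s)"
  unfolding Pw_def by (rule ex_noise_model[OF F_continuous kernel]) blast
 interpret N: noise_model F a Pw P D by (rule model)
 have cont: "continuous_on UNIV V" and pos: "\<And>x. V x > 0" and coercive: "filterlim V at_top at_infinity"
  using H1 by (auto simp: H1_def)
 obtain \<gamma> C where \<gamma>: "0 < \<gamma>" "\<gamma> < 1" and C: "C > 0" and step: "\<And>x w. V (F (x, w)) \<le> \<gamma> * V x + C * (1 + norm w)"
  using H1 by (auto simp: H1_def)
 have Vm [measurable]: "V \<in> borel_measurable borel" by (rule borel_measurable_continuous_onI[OF cont])
 have existence: "\<exists>\<mu>. invariant_distribution Pw Q \<mu>"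
 proof -
  \<comment> \<open>The total square sum bounds the first memory entry; adding 1 keeps s
    positive.\<close>
  define s where "s = sqrt (\<Sum>k. (a k)\<^sup>2) + 1"
  have s0: "0 \<le> (\<Sum>k. (a k)\<^sup>2)" by (rule suminf_nonneg[OF a_square_summable]) simp
  then have s: "s > 0" by (simp add: s_def add_nonneg_pos)
  have "(\<Sum>j<n. (a (Suc (0 + j)))\<^sup>2) \<le> s\<^sup>2" for n
  proof -
   have "(\<Sum>j<n. (a (Suc (0 + j)))\<^sup>2) = (\<Sum>k\<in>Suc ` {..<n}. (a k)\<^sup>2)" by (subst sum.reindex) auto
   also have "... \<le> (\<Sum>k. (a k)\<^sup>2)" by (rule sum_le_suminf[OF a_square_summable]) auto
   also have "... = (sqrt (\<Sum>k. (a k)\<^sup>2))\<^sup>2" using s0 by simp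
   also have "... \<le> s\<^sup>2" unfolding s_def using s0 by (intro power_mono) auto
   finally show ?thesis .
  qed
  from mom[OF this s]
  have "(\<integral>\<^sup>+w. ennreal (norm (D w 0)) \<partial>Pw) \<le> ennreal ((1 + 8 * real CARD('d)) * s)" .
  from N.ex_invariant_distribution[OF Vm less_imp_le[OF pos] step \<gamma> C coercive this] s
  show ?thesis by (simp add: Q_def)
 qed
 \<comment> \<open>The squares of a beyond m sum to order m^(-(2 \<rho> - 1)), and entry m of the
   memory has first moment of the order of the root of this.\<close>
 have moments: "\<exists>MD\<ge>0. \<forall>m. (\<integral>\<^sup>+w. ennreal (norm (D w m)) \<partial>Pw) \<le> ennreal (MD * real (Suc m) powr (- (\<rho> - 1/2)))"
  if \<rho>: "\<rho> > 1/2" and Ca: "Ca > 0" "\<And>k. \<bar>a k\<bar> \<le> Ca * (real k + 1) powr (- \<rho>)" for \<rho> Ca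
 proof -
  define q where "q = 2 * \<rho> - 1"
  have q: "q > 0" using \<rho> by (simp add: q_def)
  define MD where "MD = (1 + 8 * real CARD('d)) * (Ca / sqrt q)"
  have "(\<integral>\<^sup>+w. ennreal (norm (D w m)) \<partial>Pw) \<le> ennreal (MD * real (Suc m) powr (- (\<rho> - 1/2)))" for m
  proof -
   define s where "s = Ca / sqrt q * real (Suc m) powr (- (\<rho> - 1/2))"
   have s: "s > 0" using Ca q by (simp add: s_def)
   have s2: "s\<^sup>2 = Ca\<^sup>2 * ((real m + 1) powr (- q) / q)"
   proof -
    have "(real (Suc m) powr (- (\<rho> - 1/2)))\<^sup>2 = (real m + 1) powr (- q)"
     by (simp add: power2_eq_square powr_add[symmetric] q_def add.commute)
    then show ?thesis using q by (simp add: s_def power_mult_distrib power_divide)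
   qed
   have "(\<Sum>j<n. (a (Suc (m + j)))\<^sup>2) \<le> s\<^sup>2" for n
   proof -
    have "(a (Suc (m + j)))\<^sup>2 \<le> Ca\<^sup>2 * (real (m + j) + 2) powr (- q - 1)" for j
    proof -
     have "(a (Suc (m + j)))\<^sup>2 = \<bar>a (Suc (m + j))\<bar>\<^sup>2" by simp
     also have "... \<le> (Ca * (real (Suc (m + j)) + 1) powr (- \<rho>))\<^sup>2" by (intro power_mono Ca) auto
     also have "real (Suc (m + j)) + 1 = real (m + j) + 2" by simp
     also have "(Ca * (real (m + j) + 2) powr (- \<rho>))\<^sup>2 = Ca\<^sup>2 * (real (m + j) + 2) powr (- q - 1)"
      by (simp add: power_mult_distrib power2_eq_square powr_add[symmetric] q_def)
     finally show ?thesis .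
    qed
    then have "(\<Sum>j<n. (a (Suc (m + j)))\<^sup>2) \<le> (\<Sum>j<n. Ca\<^sup>2 * (real (m + j) + 2) powr (- q - 1))" by (intro sum_mono)
    also have "... = Ca\<^sup>2 * (\<Sum>j<n. (real (m + j) + 2) powr (- q - 1))" by (rule sum_distrib_left[symmetric])
    also have "... \<le> s\<^sup>2" unfolding s2 by (intro mult_left_mono sum_tail_powr_le q) simp
    finally show ?thesis .
   qed
   from mom[OF this s] show ?thesis by (simp add: s_def MD_def mult.assoc)
  qed
  moreover have "MD \<ge> 0" using Ca q by (simp add: MD_def)
  ultimately show ?thesis by blast
 qed
 have V_fst: "(\<integral>\<^sup>+y. ennreal (V (fst y)) \<partial>\<mu>0) < \<infinity>"
  if "initial_distribution Pw \<mu>0" "(\<integral>\<^sup>+ x. ennreal (V x) \<partial>distr \<mu>0 borel fst) < \<infinity>" for \<mu>0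
 proof -
  note [measurable_cong] = N.initD(2)[OF that(1)]
  have "(\<integral>\<^sup>+ x. ennreal (V x) \<partial>distr \<mu>0 borel fst) = (\<integral>\<^sup>+y. ennreal (V (fst y)) \<partial>\<mu>0)"
   by (subst nn_integral_distr) auto
  with that(2) show ?thesis by simp
 qed
 have sets_shifted: "sets (shifted_path_law Q \<mu>0 n) = sets traj_space" for \<mu>0 n by (simp add: shifted_path_law_def)
 have tv: "\<exists>C>0. \<forall>n\<ge>1. tv_dist (shifted_path_law Q \<mu>0 n) (path_law Q \<mu>star) \<le> C * real n powr (- p)"
  if Ca: "Ca > 0" "\<And>k. \<bar>a k\<bar> \<le> Ca * (real k + 1) powr (- \<rho>)"
   and Cb: "Cb > 0" "\<And>k. \<bar>inverse_coeffs a k\<bar> \<le> Cb * (real k + 1) powr (- \<beta>)"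
   and \<beta>: "\<beta> > 1/2" and \<alpha>: "max (1/2) (3/2 - \<beta>) < \<alpha>" "\<alpha> < \<rho>" and p: "0 < p"
    "p < min 1 (2 * (\<rho> - \<alpha>)) * (min (min \<alpha> \<beta>) (\<alpha> + \<beta> - 1) - 1/2)"
   and inv: "invariant_distribution Pw Q \<mu>star" and \<mu>0: "initial_distribution Pw \<mu>0"
   and V0: "(\<integral>\<^sup>+ x. ennreal (V x) \<partial>distr \<mu>0 borel fst) < \<infinity>" for Ca Cb \<rho> \<beta> \<alpha> p \<mu>star \<mu>0
 proof -
  have "\<rho> > 1/2" using \<alpha> by simp
  from moments[OF this Ca] obtain MD where MD: "MD \<ge> 0"
   "\<And>m. (\<integral>\<^sup>+w. ennreal (norm (D w m)) \<partial>Pw) \<le> ennreal (MD * real (Suc m) powr (- (\<rho> - 1/2)))" by blast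
  from N.convergence_to_invariant[OF H1 H2 Ca Cb \<beta> \<alpha> p MD(2,1) inv[unfolded Q_def] \<mu>0 V_fst[OF \<mu>0 V0]]
  obtain C where "C > 0" "\<And>n A. n \<ge> 1 \<Longrightarrow> A \<in> sets traj_space \<Longrightarrow>
   \<bar>measure (shifted_path_law Q \<mu>0 n) A - measure (path_law Q \<mu>star) A\<bar> \<le> C * real n powr (- p)"
   unfolding Q_def by blast
  then show ?thesis by (intro exI[of _ C] conjI allI impI tv_dist_le) (auto simp: sets_shifted)
 qed
 have tv_le_1: "tv_dist (shifted_path_law Q \<mu>0 n) (path_law Q \<mu>star) \<le> 1"
  if inv: "invariant_distribution Pw Q \<mu>star" and \<mu>0: "initial_distribution Pw \<mu>0" for \<mu>star \<mu>0 n
 proof (rule tv_dist_le)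
  fix A
  have pr: "prob_space (shifted_path_law Q \<mu> n)" if \<mu>: "initial_distribution Pw \<mu>" for \<mu> n
  proof -
   note [measurable_cong] = N.initD(2)[OF \<mu>]
   interpret \<mu>: prob_space \<mu> by (rule N.initD[OF \<mu>])
   interpret pair_prob_space \<mu> "noise :: 'd traj measure" ..
   show ?thesis unfolding Q_def N.shifted_path_law_eq[OF \<mu>] by (intro prob_space_distr measurable_trajI) measurable
  qed
  note b = prob_space.prob_le_1[OF pr] measure_nonneg
  have e: "path_law Q \<mu>star = shifted_path_law Q \<mu>star 0"
   unfolding Q_def by (rule N.shifted_path_law_invariant[symmetric]) (rule inv[unfolded Q_def])
  show "\<bar>measure (shifted_path_law Q \<mu>0 n) A - measure (path_law Q \<mu>star) A\<bar> \<le> 1"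
   unfolding e abs_le_iff using b(1)[OF \<mu>0, of n A] b(1)[OF N.invariant_law(1)[OF inv[unfolded Q_def]], of 0 A]
    b(2)[of "shifted_path_law Q \<mu>0 n" A] b(2)[of "shifted_path_law Q \<mu>star 0" A] by linarith
 qed
 have unique: "unique_invariant Pw Q"
  if Ca: "Ca > 0" "\<And>k. \<bar>a k\<bar> \<le> Ca * (real k + 1) powr (- \<rho>)"
   and Cb: "Cb > 0" "\<And>k. \<bar>inverse_coeffs a k\<bar> \<le> Cb * (real k + 1) powr (- \<beta>)"
   and \<rho>: "\<rho> > 1/2" and \<beta>: "\<beta> > 1/2" and \<rho>\<beta>: "\<rho> + \<beta> > 3/2" for Ca Cb \<rho> \<beta>
 proof -
  from moments[OF \<rho> Ca] obtain MD where MD: "MD \<ge> 0"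
   "\<And>m. (\<integral>\<^sup>+w. ennreal (norm (D w m)) \<partial>Pw) \<le> ennreal (MD * real (Suc m) powr (- (\<rho> - 1/2)))" by blast
  show ?thesis unfolding Q_def by (rule N.unique_invariantI[OF H1 H2 Ca Cb \<beta> \<rho> \<rho>\<beta> MD(2,1)])
 qed
 show ?thesis
 proof (intro conjI allI impI existence)
  fix \<rho> \<beta> assume "H_poly a \<rho> \<beta> \<and> \<rho> + \<beta> > 3/2"
  then obtain Ca Cb where \<rho>: "\<rho> > 1/2" and \<beta>: "\<beta> > 1/2" and \<rho>\<beta>: "\<rho> + \<beta> > 3/2"
   and Ca: "Ca > 0" "\<And>k. \<bar>a k\<bar> \<le> Ca * (real k + 1) powr (- \<rho>)"
   and Cb: "Cb > 0" "\<And>k. \<bar>inverse_coeffs a k\<bar> \<le> Cb * (real k + 1) powr (- \<beta>)"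
   unfolding H_poly_def by blast
  show "unique_invariant Pw Q" by (rule unique[OF Ca Cb \<rho> \<beta> \<rho>\<beta>])
  fix \<mu>star \<mu>0 and \<epsilon> :: real
  assume inv: "invariant_distribution Pw Q \<mu>star" and \<mu>0: "initial_distribution Pw \<mu>0"
   and V0: "(\<integral>\<^sup>+ x. ennreal (V x) \<partial>distr \<mu>0 borel fst) < \<infinity>" and \<epsilon>: "\<epsilon> > 0"
  define p where "p = rate \<beta> \<rho> - \<epsilon>"
  show "\<exists>C>0. \<forall>n\<ge>1. tv_dist (shifted_path_law Q \<mu>0 n) (path_law Q \<mu>star) \<le> C * real n powr (- (rate \<beta> \<rho> - \<epsilon>))"
  proof (cases "p > 0")
   case True
   let ?I = "{max (1/2) (3/2 - \<beta>)<..<\<rho>}"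
   let ?v = "\<lambda>\<alpha>. min 1 (2 * (\<rho> - \<alpha>)) * (min (min \<alpha> \<beta>) (\<alpha> + \<beta> - 1) - 1/2)"
   have ne: "?I \<noteq> {}" using \<rho> \<rho>\<beta> by (simp add: max_def)
   \<comment> \<open>The set under the supremum must be bounded above; \<rho> is a bound since the
     first factor is at most 1 and \<alpha> < \<rho>.\<close>
   have "?v \<alpha> \<le> \<rho>" if "\<alpha> \<in> ?I" for \<alpha>
   proof -
    have "?v \<alpha> \<le> 1 * (min (min \<alpha> \<beta>) (\<alpha> + \<beta> - 1) - 1/2)" using that \<beta> by (intro mult_right_mono) auto
    also have "... \<le> \<rho>" using that by (simp add: min_def)
    finally show ?thesis .
   qed
   then have bdd: "bdd_above (?v ` ?I)" by (intro bdd_aboveI2[where M=\<rho>])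
   have "p < rate \<beta> \<rho>" using \<epsilon> by (simp add: p_def)
   \<comment> \<open>Being strictly below the supremum, p is below the value at some admissible
     \<alpha>.\<close>
   then obtain \<alpha> where \<alpha>: "\<alpha> \<in> ?I" "p < ?v \<alpha>" unfolding rate_def less_cSUP_iff[OF ne bdd] by blast
   from \<alpha>(1) have "max (1/2) (3/2 - \<beta>) < \<alpha>" "\<alpha> < \<rho>" by auto
   from tv[OF Ca Cb \<beta> this True \<alpha>(2) inv \<mu>0 V0] show ?thesis by (simp add: p_def)
  next
   \<comment> \<open>If the claimed exponent is not positive, the trivial bound 1 on the total
     variation is enough.\<close>
   case False
   have "tv_dist (shifted_path_law Q \<mu>0 n) (path_law Q \<mu>star) \<le> 1 * real n powr (- (rate \<beta> \<rho> - \<epsilon>))" if "n \<ge> 1" for n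
   proof -
    have "1 \<le> real n powr (- (rate \<beta> \<rho> - \<epsilon>))" using False that by (intro ge_one_powr_ge_zero) (auto simp: p_def)
    with tv_le_1[OF inv \<mu>0, of n] show ?thesis by linarith
   qed
   then show ?thesis by (intro exI[of _ 1]) auto
  qed
 next
  assume "H_exp a"
  then obtain l Cl z Cz where l: "l > 0" "Cl > 0" "\<And>k. \<bar>a k\<bar> \<le> Cl * exp (- l * real k)"
   and z: "z > 0" "Cz > 0" "\<And>k. \<bar>inverse_coeffs a k\<bar> \<le> Cz * exp (- z * real k)"
   unfolding H_exp_def by blast
  have poly: "\<exists>Ca>0. \<forall>k. \<bar>f k\<bar> \<le> Ca * (real k + 1) powr (- r)"
   if f: "l > 0" "Cl > 0" "\<And>k. \<bar>f k\<bar> \<le> Cl * exp (- l * real k)" for f l Cl r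
  proof -
   obtain C where C: "C > 0" "\<And>k :: nat. exp (- l * real k) \<le> C * (real k + 1) powr (- r)" by (rule exp_le_powr[OF f(1), of r]) blast
   have "\<bar>f k\<bar> \<le> Cl * C * (real k + 1) powr (- r)" for k
    using order_trans[OF f(3) mult_left_mono[OF C(2)]] f(2) by (simp add: mult.assoc)
   then show ?thesis using C(1) f(2) by (intro exI[of _ "Cl * C"]) auto
  qed
  have ab: "\<exists>Ca>0. \<exists>Cb>0. (\<forall>k. \<bar>a k\<bar> \<le> Ca * (real k + 1) powr (- r)) \<and> (\<forall>k. \<bar>inverse_coeffs a k\<bar> \<le> Cb * (real k + 1) powr (- r))" for r
   using poly[OF l, of r] poly[OF z, of r] by blast
  show "unique_invariant Pw Q"
  proof -
   \<comment> \<open>Both exponents equal to 1 satisfy the conditions for uniqueness, as 1 + 1 >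
     3/2.\<close>
   from ab[of 1] obtain Ca Cb where "Ca > 0" "\<And>k. \<bar>a k\<bar> \<le> Ca * (real k + 1) powr (- 1)"
    "Cb > 0" "\<And>k. \<bar>inverse_coeffs a k\<bar> \<le> Cb * (real k + 1) powr (- 1)" by blast
   from unique[OF this] show ?thesis by simp
  qed
  fix \<mu>star \<mu>0 and p :: real
  assume inv: "invariant_distribution Pw Q \<mu>star" and \<mu>0: "initial_distribution Pw \<mu>0"
   and V0: "(\<integral>\<^sup>+ x. ennreal (V x) \<partial>distr \<mu>0 borel fst) < \<infinity>" and p: "p > 0"
  \<comment> \<open>With \<rho> = \<beta> = p + 2 and \<alpha> = p + 3/2 the first factor of the
    rate is 1 and the second is p + 1, which exceeds p.\<close>
  from ab[of "p + 2"] obtain Ca Cb where Ca: "Ca > 0" "\<And>k. \<bar>a k\<bar> \<le> Ca * (real k + 1) powr (- (p + 2))"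
   and Cb: "Cb > 0" "\<And>k. \<bar>inverse_coeffs a k\<bar> \<le> Cb * (real k + 1) powr (- (p + 2))" by blast
  show "\<exists>C>0. \<forall>n\<ge>1. tv_dist (shifted_path_law Q \<mu>0 n) (path_law Q \<mu>star) \<le> C * real n powr (- p)"
   by (rule tv[of Ca "p + 2" Cb "p + 2" "p + 3/2", OF Ca Cb _ _ _ p _ inv \<mu>0 V0]) (use p in auto)
 qed
qed

end
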